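(* Let $\Bbbk$ be a field and let $\mathscr{S}$ be a $\Bbbk$-linear triangulated category with a full and strong exceptional sequence $(A,B,C)$ such that $\mathscr{S}(A,B)=\Bbbk f$, $\mathscr{S}(B,C)=\Bbbk g$, $\mathscr{S}(A,C)=\Bbbk h$ are one-dimensional, where $h:=g\circ f\neq0$. Let $\mathscr{T}$ be a (small, $\Bbbk$-linear) triangulated category. Then there is a natural bijection between the set $\mathbf{Ht}(\mathscr{S},\mathscr{T})$ of isomorphism classes of exact functors $\mathscr{S}\to\mathscr{T}$ and the set of isomorphism classes of good octahedra in $\mathscr{T}$.
   Context: All categories and functors are $\Bbbk$-linear. A sequence $(E_1,\dots,E_n)$ in a triangulated category $\mathscr{S}$ is a full and strong exceptional sequence if, for all $i,j$ and $m\in\mathbb{Z}$: $\mathscr{S}(E_i,E_i)\cong\Bbbk$; $\mathscr{S}(E_i,E_j[m])\neq0$ implies $m=0$ and $i\le j$; and $\mathscr{S}$ is the triangulated envelope of $\{E_1,\dots,E_n\}$. An exact functor is a pair $(\mathsf F,\alpha)$ with $\mathsf F$ a functor and $\alpha\colon\mathsf F\circ[1]\to[1]\circ\mathsf F$ a natural isomorphism, preserving distinguished triangles; an isomorphism $(\mathsf F,\alpha)\to(\mathsf F',\alpha')$ is an isomorphism of functors $\gamma\colon\mathsf F\to\mathsf F'$ with $\alpha'_X\circ\gamma_{X[1]}=\gamma_X[1]\circ\alpha_X$ for all $X$. Octahedra. An octahedron in a triangulated category $\mathscr{T}$ consists of objects $A,B,C,D,E,F$ and morphisms $f\colon A\to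 B$, $f'\colon B\to D$, $f''\colon D\to A[1]$, $g\colon B\to C$, $g'\colon C\to F$, $g''\colon F\to B[1]$, $h\colon A\to C$, $h'\colon C\to E$, $h''\colon E\to A[1]$, $k\colon D\to E$, $k'\colon E\to F$, $k''\colon F\to D[1]$, $l\colon B\to E$, $l'\colon E\to B[1]$ such that $h=g\circ f$, $k''=f'[1]\circ g''$, $f''=h''\circ k$, $g'=k'\circ h'$, $l=h'\circ g=k\circ f'$, $l'=f[1]\circ h''=g''\circ k'$, and the triangles $A\xrightarrow{f}B\xrightarrow{f'}D\xrightarrow{f''}A[1]$, $A\xrightarrow{h}C\xrightarrow{h'}E\xrightarrow{h''}A[1]$, $B\xrightarrow{g}C\xrightarrow{g'}F\xrightarrow{g''}B[1]$, $D\xrightarrow{k}E\xrightarrow{k'}F\xrightarrow{k''}D[1]$ are distinguished. (Here the letters $A,B,C,f,g,h$ denote arbitrary objects and morphisms of $\mathscr{T}$, not those of $\mathscr{S}$.) It is good if moreover the triangles $$B\xrightarrow{l}E\xrightarrow{\left(\begin{smallmatrix} k' \\ -h'' \end{smallmatrix}\right)}F\oplus A[1]\xrightarrow{(g''\ \ f[1])}B[1],\qquad B\xrightarrow{\left(\begin{smallmatrix} g \\ f' \end{smallmatrix}\right)}C\oplus D\xrightarrow{(h'\ \ -k)}E\xrightarrow{l'}B[1]$$ are distinguished. Two octahedra (the second written with tildes) are isomorphic if there are isomorphisms $\phi_X\colon X\to\tilde X$ for $X\in\{A,B,C,D,E,F\}$ such that $\tilde x\circ\phi_Y=\phi_Z\circ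 x$ for each of the fourteen morphisms $x\colon Y\to Z$, where $\phi_{X[1]}:=\phi_X[1]$. *)

theory Defs
  imports Main
begin

section \<open>Linear categories\<close>

text \<open>
  Categories are given by carrier sets, so they are small.  Hom-sets are required to be
  pairwise disjoint, hence composition, addition, scalar multiplication and the action of a
  functor on morphisms need no object annotations; only the zero morphism does.
\<close>

record ('o, 'a, 'k) lin_cat =
  ob :: "'o set"
  hom :: "'o \<Rightarrow> 'o \<Rightarrow> 'a set"
  ide :: "'o \<Rightarrow> 'a"
  cmp :: "'a \<Rightarrow> 'a \<Rightarrow> 'a" (infixl "\<cdot>\<index>" 70)
  add :: "'a \<Rightarrow> 'a \<Rightarrow> 'a" (infixl "\<oplus>\<index>" 65)
  zer :: "'o \<Rightarrow> 'o \<Rightarrow> 'a"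
  smul :: "'k \<Rightarrow> 'a \<Rightarrow> 'a" (infixr "\<odot>\<index>" 75)

locale linear_category =
  fixes C :: "('o, 'a, 'k :: field, 'more) lin_cat_scheme" (structure)
  assumes hom_ob: "u \<in> hom C X Y \<Longrightarrow> X \<in> ob C \<and> Y \<in> ob C"
    and hom_disjoint: "u \<in> hom C X Y \<Longrightarrow> u \<in> hom C X' Y' \<Longrightarrow> X = X' \<and> Y = Y'"
    and ide_in_hom: "X \<in> ob C \<Longrightarrow> ide C X \<in> hom C X X"
    and cmp_in_hom: "u \<in> hom C X Y \<Longrightarrow> v \<in> hom C Y Z \<Longrightarrow> v \<cdot> u \<in> hom C X Z"
    and cmp_ide_right: "u \<in> hom C X Y \<Longrightarrow> u \<cdot> ide C X = u"
    and cmp_ide_left: "u \<in> hom C X Y \<Longrightarrow> ide C Y \<cdot> u = u"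
    and cmp_assoc: "u \<in> hom C X Y \<Longrightarrow> v \<in> hom C Y Z \<Longrightarrow> w \<in> hom C Z W
                      \<Longrightarrow> (w \<cdot> v) \<cdot> u = w \<cdot> (v \<cdot> u)"
    and zer_in_hom: "X \<in> ob C \<Longrightarrow> Y \<in> ob C \<Longrightarrow> zer C X Y \<in> hom C X Y"
    and add_in_hom: "u \<in> hom C X Y \<Longrightarrow> v \<in> hom C X Y \<Longrightarrow> u \<oplus> v \<in> hom C X Y"
    and add_assoc: "u \<in> hom C X Y \<Longrightarrow> v \<in> hom C X Y \<Longrightarrow> w \<in> hom C X Y
                      \<Longrightarrow> (u \<oplus> v) \<oplus> w = u \<oplus> (v \<oplus> w)"
    and add_commute: "u \<in> hom C X Y \<Longrightarrow> v \<in> hom C X Y \<Longrightarrow> u \<oplus> v = v \<oplus> u"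
    and add_zer: "u \<in> hom C X Y \<Longrightarrow> u \<oplus> zer C X Y = u"
    and add_inverse: "u \<in> hom C X Y \<Longrightarrow> \<exists>v \<in> hom C X Y. u \<oplus> v = zer C X Y"
    and smul_in_hom: "u \<in> hom C X Y \<Longrightarrow> c \<odot> u \<in> hom C X Y"
    and smul_one: "u \<in> hom C X Y \<Longrightarrow> 1 \<odot> u = u"
    and smul_smul: "u \<in> hom C X Y \<Longrightarrow> c \<odot> d \<odot> u = (c * d) \<odot> u"
    and smul_add_left: "u \<in> hom C X Y \<Longrightarrow> (c + d) \<odot> u = (c \<odot> u) \<oplus> (d \<odot> u)"
    and smul_add_right: "u \<in> hom C X Y \<Longrightarrow> v \<in> hom C X Y
                      \<Longrightarrow> c \<odot> (u \<oplus> v) = (c \<odot> u) \<oplus> (c \<odot> v)"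
    and cmp_add_right: "u \<in> hom C X Y \<Longrightarrow> u' \<in> hom C X Y \<Longrightarrow> v \<in> hom C Y Z
                      \<Longrightarrow> v \<cdot> (u \<oplus> u') = (v \<cdot> u) \<oplus> (v \<cdot> u')"
    and cmp_add_left: "u \<in> hom C X Y \<Longrightarrow> v \<in> hom C Y Z \<Longrightarrow> v' \<in> hom C Y Z
                      \<Longrightarrow> (v \<oplus> v') \<cdot> u = (v \<cdot> u) \<oplus> (v' \<cdot> u)"
    and cmp_smul_right: "u \<in> hom C X Y \<Longrightarrow> v \<in> hom C Y Z \<Longrightarrow> v \<cdot> (c \<odot> u) = c \<odot> (v \<cdot> u)"
    and cmp_smul_left: "u \<in> hom C X Y \<Longrightarrow> v \<in> hom C Y Z \<Longrightarrow> (c \<odot> v) \<cdot> u = c \<odot> (v \<cdot> u)"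

definition neg :: "('o, 'a, 'k :: field, 'more) lin_cat_scheme \<Rightarrow> 'a \<Rightarrow> 'a" where
  "neg C u = (- 1) \<odot>\<^bsub>C\<^esub> u"

definition isom :: "('o, 'a, 'k, 'more) lin_cat_scheme \<Rightarrow> 'o \<Rightarrow> 'o \<Rightarrow> 'a \<Rightarrow> bool" where
  "isom C X Y u \<longleftrightarrow> u \<in> hom C X Y \<and>
     (\<exists>v \<in> hom C Y X. v \<cdot>\<^bsub>C\<^esub> u = ide C X \<and> u \<cdot>\<^bsub>C\<^esub> v = ide C Y)"

definition zero_object :: "('o, 'a, 'k, 'more) lin_cat_scheme \<Rightarrow> 'o \<Rightarrow> bool" where
  "zero_object C Z \<longleftrightarrow> Z \<in> ob C \<and> (\<forall>X \<in> ob C. (\<exists>!u. u \<in> hom C X Z) \<and> (\<exists>!u. u \<in> hom C Z X))"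

definition biproduct ::
    "('o, 'a, 'k, 'more) lin_cat_scheme \<Rightarrow> 'o \<Rightarrow> 'o \<Rightarrow> 'o \<Rightarrow> 'a \<Rightarrow> 'a \<Rightarrow> 'a \<Rightarrow> 'a \<Rightarrow> bool" where
  "biproduct C X Y P i\<^sub>1 i\<^sub>2 p\<^sub>1 p\<^sub>2 \<longleftrightarrow>
     i\<^sub>1 \<in> hom C X P \<and> i\<^sub>2 \<in> hom C Y P \<and> p\<^sub>1 \<in> hom C P X \<and> p\<^sub>2 \<in> hom C P Y \<and>
     p\<^sub>1 \<cdot>\<^bsub>C\<^esub> i\<^sub>1 = ide C X \<and> p\<^sub>2 \<cdot>\<^bsub>C\<^esub> i\<^sub>2 = ide C Y \<and>
     p\<^sub>1 \<cdot>\<^bsub>C\<^esub> i\<^sub>2 = zer C Y X \<and> p\<^sub>2 \<cdot>\<^bsub>C\<^esub> i\<^sub>1 = zer C X Y \<and>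
     (i\<^sub>1 \<cdot>\<^bsub>C\<^esub> p\<^sub>1) \<oplus>\<^bsub>C\<^esub> (i\<^sub>2 \<cdot>\<^bsub>C\<^esub> p\<^sub>2) = ide C P"

locale additive_category = linear_category +
  assumes ex_zero_object: "\<exists>Z. zero_object C Z"
    and ex_biproduct: "X \<in> ob C \<Longrightarrow> Y \<in> ob C \<Longrightarrow> \<exists>P i\<^sub>1 i\<^sub>2 p\<^sub>1 p\<^sub>2. biproduct C X Y P i\<^sub>1 i\<^sub>2 p\<^sub>1 p\<^sub>2"

definition linear_functor ::
    "('o, 'a, 'k, 'm) lin_cat_scheme \<Rightarrow> ('p, 'b, 'k, 'n) lin_cat_scheme
      \<Rightarrow> ('o \<Rightarrow> 'p) \<Rightarrow> ('a \<Rightarrow> 'b) \<Rightarrow> bool" where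
  "linear_functor C D Fo Fm \<longleftrightarrow>
     (\<forall>X \<in> ob C. Fo X \<in> ob D \<and> Fm (ide C X) = ide D (Fo X)) \<and>
     (\<forall>X Y. \<forall>u \<in> hom C X Y. Fm u \<in> hom D (Fo X) (Fo Y)) \<and>
     (\<forall>X Y Z. \<forall>u \<in> hom C X Y. \<forall>v \<in> hom C Y Z. Fm (v \<cdot>\<^bsub>C\<^esub> u) = Fm v \<cdot>\<^bsub>D\<^esub> Fm u) \<and>
     (\<forall>X Y. \<forall>u \<in> hom C X Y. \<forall>v \<in> hom C X Y. Fm (u \<oplus>\<^bsub>C\<^esub> v) = Fm u \<oplus>\<^bsub>D\<^esub> Fm v) \<and>
     (\<forall>X Y. \<forall>u \<in> hom C X Y. \<forall>c. Fm (c \<odot>\<^bsub>C\<^esub> u) = c \<odot>\<^bsub>D\<^esub> Fm u)"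


section \<open>Triangulated categories\<close>

text \<open>
  The shift \<open>[1]\<close> acts by \<open>sho\<close> on objects and by \<open>shm\<close> on morphisms.  A distinguished
  triangle \<open>X \<rightarrow> Y \<rightarrow> Z \<rightarrow> X[1]\<close> is recorded by its three morphisms, which determine the objects.
\<close>

record ('o, 'a, 'k) tri_cat = "('o, 'a, 'k) lin_cat" +
  sho :: "'o \<Rightarrow> 'o"
  shm :: "'a \<Rightarrow> 'a"
  dtri :: "('a \<times> 'a \<times> 'a) set"

definition triangle ::
    "('o, 'a, 'k) tri_cat \<Rightarrow> 'o \<Rightarrow> 'o \<Rightarrow> 'o \<Rightarrow> 'a \<Rightarrow> 'a \<Rightarrow> 'a \<Rightarrow> bool" where
  "triangle T X Y Z u v w \<longleftrightarrow> u \<in> hom T X Y \<and> v \<in> hom T Y Z \<and> w \<in> hom T Z (sho T X)"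

definition dist_triangle ::
    "('o, 'a, 'k) tri_cat \<Rightarrow> 'o \<Rightarrow> 'o \<Rightarrow> 'o \<Rightarrow> 'a \<Rightarrow> 'a \<Rightarrow> 'a \<Rightarrow> bool" where
  "dist_triangle T X Y Z u v w \<longleftrightarrow> triangle T X Y Z u v w \<and> (u, v, w) \<in> dtri T"

text \<open>\<open>X'\<close> is written \<open>X1\<close> and \<open>X''\<close> is written \<open>X2\<close>.\<close>

record ('o, 'a) octa =
  oA :: 'o  oB :: 'o  oC :: 'o  oD :: 'o  oE :: 'o  oF :: 'o
  mf :: 'a  mf1 :: 'a  mf2 :: 'a
  mg :: 'a  mg1 :: 'a  mg2 :: 'a
  mh :: 'a  mh1 :: 'a  mh2 :: 'a
  mk :: 'a  mk1 :: 'a  mk2 :: 'a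
  ml :: 'a  ml1 :: 'a

definition octahedron :: "('o, 'a, 'k) tri_cat \<Rightarrow> ('o, 'a) octa \<Rightarrow> bool" where
  "octahedron T X \<longleftrightarrow>
     dist_triangle T (oA X) (oB X) (oD X) (mf X) (mf1 X) (mf2 X) \<and>
     dist_triangle T (oA X) (oC X) (oE X) (mh X) (mh1 X) (mh2 X) \<and>
     dist_triangle T (oB X) (oC X) (oF X) (mg X) (mg1 X) (mg2 X) \<and>
     dist_triangle T (oD X) (oE X) (oF X) (mk X) (mk1 X) (mk2 X) \<and>
     ml X \<in> hom T (oB X) (oE X) \<and> ml1 X \<in> hom T (oE X) (sho T (oB X)) \<and>
     mh X = mg X \<cdot>\<^bsub>T\<^esub> mf X \<and> mk2 X = shm T (mf1 X) \<cdot>\<^bsub>T\<^esub> mg2 X \<and>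
     mf2 X = mh2 X \<cdot>\<^bsub>T\<^esub> mk X \<and> mg1 X = mk1 X \<cdot>\<^bsub>T\<^esub> mh1 X \<and>
     ml X = mh1 X \<cdot>\<^bsub>T\<^esub> mg X \<and> ml X = mk X \<cdot>\<^bsub>T\<^esub> mf1 X \<and>
     ml1 X = shm T (mf X) \<cdot>\<^bsub>T\<^esub> mh2 X \<and> ml1 X = mg2 X \<cdot>\<^bsub>T\<^esub> mk1 X"

text \<open>Verdier's axioms, with the shift an automorphism of the category.\<close>

locale triangulated_category = additive_category T
  for T :: "('o, 'a, 'k :: field) tri_cat" (structure) +
  assumes shift_functor: "linear_functor T T (sho T) (shm T)"
    and shift_bij_ob: "bij_betw (sho T) (ob T) (ob T)"
    and shift_bij_hom: "X \<in> ob T \<Longrightarrow> Y \<in> ob T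
          \<Longrightarrow> bij_betw (shm T) (hom T X Y) (hom T (sho T X) (sho T Y))"
    and dtri_triangle: "(u, v, w) \<in> dtri T \<Longrightarrow> \<exists>X Y Z. triangle T X Y Z u v w"
    and TR1_iso: "dist_triangle T X Y Z u v w \<Longrightarrow> triangle T X' Y' Z' u' v' w'
          \<Longrightarrow> isom T X X' a \<Longrightarrow> isom T Y Y' b \<Longrightarrow> isom T Z Z' c
          \<Longrightarrow> u' \<cdot> a = b \<cdot> u \<Longrightarrow> v' \<cdot> b = c \<cdot> v \<Longrightarrow> w' \<cdot> c = shm T a \<cdot> w
          \<Longrightarrow> dist_triangle T X' Y' Z' u' v' w'"
    and TR1_ide: "X \<in> ob T \<Longrightarrow> zero_object T Z
          \<Longrightarrow> dist_triangle T X X Z (ide T X) (zer T X Z) (zer T Z (sho T X))"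
    and TR1_cone: "u \<in> hom T X Y \<Longrightarrow> \<exists>Z v w. dist_triangle T X Y Z u v w"
    and TR2: "triangle T X Y Z u v w
          \<Longrightarrow> dist_triangle T X Y Z u v w \<longleftrightarrow> dist_triangle T Y Z (sho T X) v w (neg T (shm T u))"
    and TR3: "dist_triangle T X Y Z u v w \<Longrightarrow> dist_triangle T X' Y' Z' u' v' w'
          \<Longrightarrow> a \<in> hom T X X' \<Longrightarrow> b \<in> hom T Y Y' \<Longrightarrow> u' \<cdot> a = b \<cdot> u
          \<Longrightarrow> \<exists>c \<in> hom T Z Z'. v' \<cdot> b = c \<cdot> v \<and> w' \<cdot> c = shm T a \<cdot> w"
    and TR4: "dist_triangle T A B D f f' f'' \<Longrightarrow> dist_triangle T B C F g g' g''
          \<Longrightarrow> dist_triangle T A C E (g \<cdot> f) h' h''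
          \<Longrightarrow> \<exists>k k' k'' l l'. octahedron T
                \<lparr>oA = A, oB = B, oC = C, oD = D, oE = E, oF = F,
                 mf = f, mf1 = f', mf2 = f'', mg = g, mg1 = g', mg2 = g'',
                 mh = g \<cdot> f, mh1 = h', mh2 = h'', mk = k, mk1 = k', mk2 = k'',
                 ml = l, ml1 = l'\<rparr>"


section \<open>Exceptional sequences\<close>

definition shift_ob :: "('o, 'a, 'k) tri_cat \<Rightarrow> int \<Rightarrow> 'o \<Rightarrow> 'o" where
  "shift_ob T m X = (if 0 \<le> m then (sho T ^^ nat m) X
                     else (inv_into (ob T) (sho T) ^^ nat (- m)) X)"

text \<open>The object set of a strictly full triangulated subcategory.\<close>

definition tri_subcat :: "('o, 'a, 'k) tri_cat \<Rightarrow> 'o set \<Rightarrow> bool" where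
  "tri_subcat T P \<longleftrightarrow> P \<subseteq> ob T \<and> (\<exists>Z \<in> P. zero_object T Z) \<and>
     (\<forall>X \<in> P. \<forall>Y u. isom T X Y u \<longrightarrow> Y \<in> P) \<and>
     (\<forall>X \<in> P. \<forall>m. shift_ob T m X \<in> P) \<and>
     (\<forall>X Y Z u v w. dist_triangle T X Y Z u v w \<longrightarrow> X \<in> P \<longrightarrow> Y \<in> P \<longrightarrow> Z \<in> P)"

definition tri_envelope :: "('o, 'a, 'k) tri_cat \<Rightarrow> 'o set \<Rightarrow> 'o set" where
  "tri_envelope T M = \<Inter> {P. tri_subcat T P \<and> M \<subseteq> P}"

text \<open>
  The linear maps from the ground field to \<open>hom X Y\<close> are exactly the maps \<open>c \<mapsto> c u\<close>, so this says
  that \<open>u\<close> defines an isomorphism between them.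
\<close>

definition hom_line :: "('o, 'a, 'k :: field, 'm) lin_cat_scheme \<Rightarrow> 'o \<Rightarrow> 'o \<Rightarrow> 'a \<Rightarrow> bool" where
  "hom_line C X Y u \<longleftrightarrow> u \<in> hom C X Y \<and> bij_betw (\<lambda>c. c \<odot>\<^bsub>C\<^esub> u) UNIV (hom C X Y)"

definition full_strong_exceptional :: "('o, 'a, 'k :: field) tri_cat \<Rightarrow> 'o list \<Rightarrow> bool" where
  "full_strong_exceptional T Es \<longleftrightarrow>
     set Es \<subseteq> ob T \<and>
     (\<forall>i < length Es. \<exists>u. hom_line T (Es ! i) (Es ! i) u) \<and>
     (\<forall>i < length Es. \<forall>j < length Es. \<forall>m.
        hom T (Es ! i) (shift_ob T m (Es ! j)) \<noteq> {zer T (Es ! i) (shift_ob T m (Es ! j))}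
          \<longrightarrow> m = 0 \<and> i \<le> j) \<and>
     ob T = tri_envelope T (set Es)"


section \<open>Exact functors\<close>

text \<open>\<open>fal F X\<close> is the component \<open>F (X[1]) \<rightarrow> (F X)[1]\<close> of the comparison isomorphism.\<close>

record ('o, 'a, 'p, 'b) ex_fun =
  fob :: "'o \<Rightarrow> 'p"
  fmor :: "'a \<Rightarrow> 'b"
  fal :: "'o \<Rightarrow> 'b"

definition exact_functor ::
    "('o, 'a, 'k) tri_cat \<Rightarrow> ('p, 'b, 'k) tri_cat \<Rightarrow> ('o, 'a, 'p, 'b) ex_fun \<Rightarrow> bool" where
  "exact_functor S T F \<longleftrightarrow>
     linear_functor S T (fob F) (fmor F) \<and>
     (\<forall>X \<in> ob S. isom T (fob F (sho S X)) (sho T (fob F X)) (fal F X)) \<and>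
     (\<forall>X Y. \<forall>u \<in> hom S X Y.
        fal F Y \<cdot>\<^bsub>T\<^esub> fmor F (shm S u) = shm T (fmor F u) \<cdot>\<^bsub>T\<^esub> fal F X) \<and>
     (\<forall>X Y Z u v w. dist_triangle S X Y Z u v w \<longrightarrow>
        dist_triangle T (fob F X) (fob F Y) (fob F Z) (fmor F u) (fmor F v) (fal F X \<cdot>\<^bsub>T\<^esub> fmor F w))"

definition exact_functor_iso ::
    "('o, 'a, 'k) tri_cat \<Rightarrow> ('p, 'b, 'k) tri_cat
      \<Rightarrow> ('o, 'a, 'p, 'b) ex_fun \<Rightarrow> ('o, 'a, 'p, 'b) ex_fun \<Rightarrow> bool" where
  "exact_functor_iso S T F F' \<longleftrightarrow> (\<exists>\<gamma>.
     (\<forall>X \<in> ob S. isom T (fob F X) (fob F' X) (\<gamma> X)) \<and>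
     (\<forall>X Y. \<forall>u \<in> hom S X Y. \<gamma> Y \<cdot>\<^bsub>T\<^esub> fmor F u = fmor F' u \<cdot>\<^bsub>T\<^esub> \<gamma> X) \<and>
     (\<forall>X \<in> ob S. fal F' X \<cdot>\<^bsub>T\<^esub> \<gamma> (sho S X) = shm T (\<gamma> X) \<cdot>\<^bsub>T\<^esub> fal F X))"

definition Ht ::
    "('o, 'a, 'k) tri_cat \<Rightarrow> ('p, 'b, 'k) tri_cat \<Rightarrow> ('o, 'a, 'p, 'b) ex_fun set set" where
  "Ht S T = {F. exact_functor S T F} //
     {(F, F'). exact_functor S T F \<and> exact_functor S T F' \<and> exact_functor_iso S T F F'}"


section \<open>Good octahedra\<close>

text \<open>
  The column \<open>(a, b)\<close> into a direct sum is \<open>i\<^sub>1 a + i\<^sub>2 b\<close>, the row \<open>(a b)\<close> out of it is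
  \<open>a p\<^sub>1 + b p\<^sub>2\<close>.  Distinguished triangles being closed under isomorphism, the condition does not
  depend on the choice of the direct sums.
\<close>

definition good_octahedron :: "('o, 'a, 'k :: field) tri_cat \<Rightarrow> ('o, 'a) octa \<Rightarrow> bool" where
  "good_octahedron T X \<longleftrightarrow> octahedron T X \<and>
     (\<exists>P i\<^sub>1 i\<^sub>2 p\<^sub>1 p\<^sub>2. biproduct T (oF X) (sho T (oA X)) P i\<^sub>1 i\<^sub>2 p\<^sub>1 p\<^sub>2 \<and>
        dist_triangle T (oB X) (oE X) P
          (ml X)
          ((i\<^sub>1 \<cdot>\<^bsub>T\<^esub> mk1 X) \<oplus>\<^bsub>T\<^esub> (i\<^sub>2 \<cdot>\<^bsub>T\<^esub> neg T (mh2 X)))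
          ((mg2 X \<cdot>\<^bsub>T\<^esub> p\<^sub>1) \<oplus>\<^bsub>T\<^esub> (shm T (mf X) \<cdot>\<^bsub>T\<^esub> p\<^sub>2))) \<and>
     (\<exists>P i\<^sub>1 i\<^sub>2 p\<^sub>1 p\<^sub>2. biproduct T (oC X) (oD X) P i\<^sub>1 i\<^sub>2 p\<^sub>1 p\<^sub>2 \<and>
        dist_triangle T (oB X) P (oE X)
          ((i\<^sub>1 \<cdot>\<^bsub>T\<^esub> mg X) \<oplus>\<^bsub>T\<^esub> (i\<^sub>2 \<cdot>\<^bsub>T\<^esub> mf1 X))
          ((mh1 X \<cdot>\<^bsub>T\<^esub> p\<^sub>1) \<oplus>\<^bsub>T\<^esub> (neg T (mk X) \<cdot>\<^bsub>T\<^esub> p\<^sub>2))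
          (ml1 X))"

definition octa_iso :: "('o, 'a, 'k) tri_cat \<Rightarrow> ('o, 'a) octa \<Rightarrow> ('o, 'a) octa \<Rightarrow> bool" where
  "octa_iso T X Y \<longleftrightarrow> (\<exists>a b c d e r.
     isom T (oA X) (oA Y) a \<and> isom T (oB X) (oB Y) b \<and> isom T (oC X) (oC Y) c \<and>
     isom T (oD X) (oD Y) d \<and> isom T (oE X) (oE Y) e \<and> isom T (oF X) (oF Y) r \<and>
     mf Y \<cdot>\<^bsub>T\<^esub> a = b \<cdot>\<^bsub>T\<^esub> mf X \<and> mf1 Y \<cdot>\<^bsub>T\<^esub> b = d \<cdot>\<^bsub>T\<^esub> mf1 X \<and> mf2 Y \<cdot>\<^bsub>T\<^esub> d = shm T a \<cdot>\<^bsub>T\<^esub> mf2 X \<and>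
     mg Y \<cdot>\<^bsub>T\<^esub> b = c \<cdot>\<^bsub>T\<^esub> mg X \<and> mg1 Y \<cdot>\<^bsub>T\<^esub> c = r \<cdot>\<^bsub>T\<^esub> mg1 X \<and> mg2 Y \<cdot>\<^bsub>T\<^esub> r = shm T b \<cdot>\<^bsub>T\<^esub> mg2 X \<and>
     mh Y \<cdot>\<^bsub>T\<^esub> a = c \<cdot>\<^bsub>T\<^esub> mh X \<and> mh1 Y \<cdot>\<^bsub>T\<^esub> c = e \<cdot>\<^bsub>T\<^esub> mh1 X \<and> mh2 Y \<cdot>\<^bsub>T\<^esub> e = shm T a \<cdot>\<^bsub>T\<^esub> mh2 X \<and>
     mk Y \<cdot>\<^bsub>T\<^esub> d = e \<cdot>\<^bsub>T\<^esub> mk X \<and> mk1 Y \<cdot>\<^bsub>T\<^esub> e = r \<cdot>\<^bsub>T\<^esub> mk1 X \<and> mk2 Y \<cdot>\<^bsub>T\<^esub> r = shm T d \<cdot>\<^bsub>T\<^esub> mk2 X \<and>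
     ml Y \<cdot>\<^bsub>T\<^esub> b = e \<cdot>\<^bsub>T\<^esub> ml X \<and> ml1 Y \<cdot>\<^bsub>T\<^esub> e = shm T b \<cdot>\<^bsub>T\<^esub> ml1 X)"

definition good_octa_rel :: "('o, 'a, 'k :: field) tri_cat \<Rightarrow> (('o, 'a) octa \<times> ('o, 'a) octa) set" where
  "good_octa_rel T = {(X, Y). good_octahedron T X \<and> good_octahedron T Y \<and> octa_iso T X Y}"

definition good_octa_classes :: "('o, 'a, 'k :: field) tri_cat \<Rightarrow> ('o, 'a) octa set set" where
  "good_octa_classes T = {X. good_octahedron T X} // good_octa_rel T"

text \<open>
  The image of an octahedron under an exact functor: morphisms into a shifted object have to be
  composed with the comparison isomorphism.
\<close>

definition map_octa ::
    "('p, 'b, 'k) tri_cat \<Rightarrow> ('o, 'a, 'p, 'b) ex_fun \<Rightarrow> ('o, 'a) octa \<Rightarrow> ('p, 'b) octa" where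
  "map_octa T F X =
     \<lparr>oA = fob F (oA X), oB = fob F (oB X), oC = fob F (oC X),
      oD = fob F (oD X), oE = fob F (oE X), oF = fob F (oF X),
      mf = fmor F (mf X), mf1 = fmor F (mf1 X), mf2 = fal F (oA X) \<cdot>\<^bsub>T\<^esub> fmor F (mf2 X),
      mg = fmor F (mg X), mg1 = fmor F (mg1 X), mg2 = fal F (oB X) \<cdot>\<^bsub>T\<^esub> fmor F (mg2 X),
      mh = fmor F (mh X), mh1 = fmor F (mh1 X), mh2 = fal F (oA X) \<cdot>\<^bsub>T\<^esub> fmor F (mh2 X),
      mk = fmor F (mk X), mk1 = fmor F (mk1 X), mk2 = fal F (oD X) \<cdot>\<^bsub>T\<^esub> fmor F (mk2 X),
      ml = fmor F (ml X), ml1 = fal F (oB X) \<cdot>\<^bsub>T\<^esub> fmor F (ml1 X)\<rparr>"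

text \<open>
  The map on isomorphism classes induced by \<open>F \<mapsto> F(X)\<close>.  If its value on a class is again an
  isomorphism class of good octahedra, then it is independent of the representative \<open>F\<close>.
\<close>

definition eval_octa ::
    "('p, 'b, 'k :: field) tri_cat \<Rightarrow> ('o, 'a) octa
      \<Rightarrow> ('o, 'a, 'p, 'b) ex_fun set \<Rightarrow> ('p, 'b) octa set" where
  "eval_octa T X \<F> = (\<Union>F \<in> \<F>. good_octa_rel T `` {map_octa T F X})"

end

theory Submission
  imports Defs
begin

text \<open>
  The faces of the octahedron \<open>X\<close> on \<open>(A, B, C)\<close> determine all morphism spaces between shifts of its six
  objects: they have dimension at most one and are spanned by composites of edges.  In a finite direct
  sum of such objects a further component of a morphism can be cleared against an already decomposed
  morphism by row and column operations, so every morphism is a finite direct sum of zero maps, edges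
  and the maps of the two squares \<open>h' g = k f'\<close> and \<open>f[1] h'' = g'' k'\<close>.  The cones of these are given
  by the four faces and the two additional triangles of a good octahedron.  Hence finite direct sums of
  the six objects form a triangulated subcategory, which is all of \<open>S\<close>, and a functor that commutes
  with the shift is exact as soon as it maps \<open>X\<close> to a good octahedron.

  Given a good octahedron \<open>Y\<close> in \<open>T\<close>, the functor is the left Kan extension of the diagram formed by the
  shifts of \<open>Y\<close> along the diagram formed by the shifts of \<open>X\<close>; the universal property of its values
  provides the compatibility with the shift and shows that the exact functor is determined by \<open>Y\<close> up
  to isomorphism.
\<close>

section \<open>Linear categories\<close>

text \<open>Cones are not functorial, so a functor cannot be obtained from an octahedron in
  \<open>T\<close> by choosing cones of the images of morphisms. The Kan extension involves no such
  choice: on shifts of the six objects a cocone is read off from coefficients with respect to edges,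
  and the only composition rules used are those valid in every octahedron. Goodness enters in two
  ways. In \<open>S\<close> it is automatic: the vanishing of all morphisms \<open>C -> D\<close>
  and \<open>F -> A[1]\<close> forces the two additional triangles to be distinguished in any
  octahedron that \<open>TR4\<close> provides. In \<open>T\<close> no such vanishing is available,
  and goodness is what controls the images of \<open>l\<close>, \<open>l'\<close> and of the two
  squares, which are not morphisms of the faces. Triangles are never classified directly. A triangle
  is determined up to isomorphism by its first morphism, so closure under cones and exactness are
  both tested on normal forms of morphisms. A component can be cleared only along morphisms that
  exist, so the summands of a target have to be added in the order of increasing weight.\<close>

definition arr :: "('o, 'a, 'k, 'm) lin_cat_scheme \<Rightarrow> 'a \<Rightarrow> bool" where
  "arr C u \<longleftrightarrow> (\<exists>X Y. u \<in> hom C X Y)"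

definition dm :: "('o, 'a, 'k, 'm) lin_cat_scheme \<Rightarrow> 'a \<Rightarrow> 'o" where
  "dm C u = (SOME X. \<exists>Y. u \<in> hom C X Y)"

definition cd :: "('o, 'a, 'k, 'm) lin_cat_scheme \<Rightarrow> 'a \<Rightarrow> 'o" where
  "cd C u = (SOME Y. \<exists>X. u \<in> hom C X Y)"

context linear_category
begin

text \<open>Typing becomes a set of equations for \<open>dm\<close> and \<open>cd\<close>, from
  which the simplifier infers the ends of composites. The choices made in \<open>dm\<close> and
  \<open>cd\<close> are harmless because hom-sets are disjoint.\<close>

lemma hom_iff [simp]: "u \<in> hom C X Y \<longleftrightarrow> arr C u \<and> dm C u = X \<and> cd C u = Y"
proof
  assume u: "u \<in> hom C X Y"
  have "\<exists>Y. u \<in> hom C (dm C u) Y" unfolding dm_def using u by (rule someI2_ex[OF exI[of _ X], OF exI]) blast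
  moreover have "\<exists>X. u \<in> hom C X (cd C u)" unfolding cd_def using u by (rule someI2_ex[OF exI[of _ Y],
      OF exI]) blast
  ultimately show "arr C u \<and> dm C u = X \<and> cd C u = Y"
    using u hom_disjoint unfolding arr_def by metis
next
  assume a: "arr C u \<and> dm C u = X \<and> cd C u = Y"
  then obtain X' Y' where u: "u \<in> hom C X' Y'" unfolding arr_def by blast
  have "\<exists>Y. u \<in> hom C (dm C u) Y" unfolding dm_def using u by (rule someI2_ex[OF exI[of _ X'], OF exI]) blast
  moreover have "\<exists>X. u \<in> hom C X (cd C u)" unfolding cd_def using u by (rule someI2_ex[OF exI[of _ Y'],
      OF exI]) blast
  ultimately show "u \<in> hom C X Y"
    using u a hom_disjoint by metis
qed

lemma dm_ob [simp]: "arr C u \<Longrightarrow> dm C u \<in> ob C"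
  and cd_ob [simp]: "arr C u \<Longrightarrow> cd C u \<in> ob C"
  using hom_ob[of u "dm C u" "cd C u"] by simp_all

lemma ide_simps [simp]:
  assumes "X \<in> ob C"
  shows "arr C (ide C X)" "dm C (ide C X) = X" "cd C (ide C X) = X"
  using ide_in_hom[OF assms] by simp_all

lemma zer_simps [simp]:
  assumes "X \<in> ob C" "Y \<in> ob C"
  shows "arr C (zer C X Y)" "dm C (zer C X Y) = X" "cd C (zer C X Y) = Y"
  using zer_in_hom[OF assms] by simp_all

lemma cmp_simps [simp]:
  assumes "arr C u" "arr C v" "cd C u = dm C v"
  shows "arr C (v \<cdot> u)" "dm C (v \<cdot> u) = dm C u" "cd C (v \<cdot> u) = cd C v"
  using cmp_in_hom[of u "dm C u" "dm C v" v "cd C v"] assms by simp_all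

lemma add_simps [simp]:
  assumes "arr C u" "arr C v" "dm C u = dm C v" "cd C u = cd C v"
  shows "arr C (u \<oplus> v)" "dm C (u \<oplus> v) = dm C v" "cd C (u \<oplus> v) = cd C v"
  using add_in_hom[of u "dm C v" "cd C v" v] assms by simp_all

lemma smul_simps [simp]:
  assumes "arr C u"
  shows "arr C (c \<odot> u)" "dm C (c \<odot> u) = dm C u" "cd C (c \<odot> u) = cd C u"
  using smul_in_hom[of u "dm C u" "cd C u" c] assms by simp_all

lemma ide_cmp [simp]: "arr C u \<Longrightarrow> cd C u = Y \<Longrightarrow> ide C Y \<cdot> u = u"
  using cmp_ide_left[of u "dm C u" Y] by simp

lemma cmp_ide [simp]: "arr C u \<Longrightarrow> dm C u = X \<Longrightarrow> u \<cdot> ide C X = u"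
  using cmp_ide_right[of u X "cd C u"] by simp

lemma assoc [simp]:
  "arr C u \<Longrightarrow> arr C v \<Longrightarrow> arr C w \<Longrightarrow> cd C u = dm C v \<Longrightarrow> cd C v = dm C w
    \<Longrightarrow> (w \<cdot> v) \<cdot> u = w \<cdot> (v \<cdot> u)"
  using cmp_assoc[of u "dm C u" "dm C v" v "dm C w" w "cd C w"] by simp

lemma add_assoc' [simp]:
  assumes "arr C u" "arr C v" "arr C w" "dm C u = dm C v" "dm C v = dm C w"
    "cd C u = cd C v" "cd C v = cd C w"
  shows "(u \<oplus> v) \<oplus> w = u \<oplus> (v \<oplus> w)"
  using add_assoc[of u "dm C w" "cd C w" v w] assms by simp

lemma add_com: "arr C u \<Longrightarrow> arr C v \<Longrightarrow> dm C u = dm C v \<Longrightarrow> cd C u = cd C v \<Longrightarrow> u \<oplus> v = v \<oplus> u"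
  using add_commute[of u "dm C v" "cd C v" v] by simp

lemma add_left_com:
  assumes "arr C u" "arr C v" "arr C w" "dm C u = dm C v" "dm C v = dm C w"
    "cd C u = cd C v" "cd C v = cd C w"
  shows "u \<oplus> (v \<oplus> w) = v \<oplus> (u \<oplus> w)"
proof -
  have "(u \<oplus> v) \<oplus> w = (v \<oplus> u) \<oplus> w" using assms by (simp only: add_com[of u v])
  then show ?thesis using assms by simp
qed

lemmas add_ac = add_com add_left_com

lemma add_zer_right [simp]: "arr C u \<Longrightarrow> dm C u = X \<Longrightarrow> cd C u = Y \<Longrightarrow> u \<oplus> zer C X Y = u"
  using add_zer[of u X Y] by simp

lemma add_zer_left [simp]: "arr C u \<Longrightarrow> dm C u = X \<Longrightarrow> cd C u = Y \<Longrightarrow> zer C X Y \<oplus> u = u"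
  using add_zer_right[of u X Y] add_com[of "zer C X Y" u] dm_ob cd_ob by fastforce

lemma add_cancel:
  assumes "arr C u" "arr C v" "arr C w" "dm C u = dm C v" "dm C v = dm C w"
    "cd C u = cd C v" "cd C v = cd C w" and e: "u \<oplus> v = u \<oplus> w"
  shows "v = w"
proof -
  obtain n where n: "arr C n" "dm C n = dm C u" "cd C n = cd C u" "u \<oplus> n = zer C (dm C u) (cd C u)"
    using add_inverse[of u "dm C u" "cd C u"] assms by auto
  have nu: "n \<oplus> u = zer C (dm C u) (cd C u)" using n assms by (simp add: add_com)
  have "(n \<oplus> u) \<oplus> v = (n \<oplus> u) \<oplus> w" using n e assms by (simp only: add_assoc')
  then show ?thesis unfolding nu using assms by simp
qed

lemma smul_simps2 [simp]:
  assumes "arr C u"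
  shows "1 \<odot> u = u" "c \<odot> d \<odot> u = (c * d) \<odot> u" "0 \<odot> u = zer C (dm C u) (cd C u)"
proof -
  show "1 \<odot> u = u" "c \<odot> d \<odot> u = (c * d) \<odot> u"
    using smul_one[of u "dm C u" "cd C u"] smul_smul[of u "dm C u" "cd C u" c d] assms by simp_all
  have "(0 + 0) \<odot> u = 0 \<odot> u \<oplus> 0 \<odot> u"
    by (rule smul_add_left[of u "dm C u" "cd C u"]) (use assms in simp)
  then have "0 \<odot> u \<oplus> 0 \<odot> u = 0 \<odot> u" by (simp only: add_0)
  also have "\<dots> = 0 \<odot> u \<oplus> zer C (dm C u) (cd C u)" using assms by simp
  finally have e: "0 \<odot> u \<oplus> 0 \<odot> u = 0 \<odot> u \<oplus> zer C (dm C u) (cd C u)" .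
  show "0 \<odot> u = zer C (dm C u) (cd C u)"
    by (rule add_cancel[OF _ _ _ _ _ _ _ e]) (use assms in simp_all)
qed

lemma smul_left: "arr C u \<Longrightarrow> (c \<odot> u) \<oplus> (d \<odot> u) = (c + d) \<odot> u"
  using smul_add_left[of u "dm C u" "cd C u" c d] by simp

lemma smul_left1 [simp]: "arr C u \<Longrightarrow> u \<oplus> (d \<odot> u) = (1 + d) \<odot> u"
  "arr C u \<Longrightarrow> (d \<odot> u) \<oplus> u = (d + 1) \<odot> u"
  using smul_left[of u 1 d] smul_left[of u d 1] by simp_all

lemma smul_left2:
  assumes "arr C u" "arr C w" "dm C u = dm C w" "cd C u = cd C w"
  shows "c \<odot> u \<oplus> (d \<odot> u \<oplus> w) = (c + d) \<odot> u \<oplus> w"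
proof -
  have "c \<odot> u \<oplus> (d \<odot> u \<oplus> w) = (c \<odot> u \<oplus> d \<odot> u) \<oplus> w"
    using assms by (simp del: smul_left1)
  then show ?thesis using assms by (simp add: smul_left)
qed


lemma smul_zer [simp]: "X \<in> ob C \<Longrightarrow> Y \<in> ob C \<Longrightarrow> c \<odot> zer C X Y = zer C X Y"
  using smul_simps2(2)[of "zer C X Y" c 0] smul_simps2(3)[of "zer C X Y"] by simp

lemma smul_add [simp]:
  "arr C u \<Longrightarrow> arr C v \<Longrightarrow> dm C u = dm C v \<Longrightarrow> cd C u = cd C v
    \<Longrightarrow> c \<odot> (u \<oplus> v) = (c \<odot> u) \<oplus> (c \<odot> v)"
  using smul_add_right[of u "dm C v" "cd C v" v c] by simp

lemma neg_eq [simp]: "neg C u = (- 1) \<odot> u"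
  by (simp add: neg_def)

lemma cmp_add [simp]:
  "arr C u \<Longrightarrow> arr C u' \<Longrightarrow> arr C v \<Longrightarrow> dm C u = dm C u' \<Longrightarrow> cd C u = dm C v \<Longrightarrow> cd C u' = dm C v
    \<Longrightarrow> v \<cdot> (u \<oplus> u') = (v \<cdot> u) \<oplus> (v \<cdot> u')"
  using cmp_add_right[of u "dm C u'" "dm C v" u' v "cd C v"] by simp

lemma add_cmp [simp]:
  "arr C u \<Longrightarrow> arr C v \<Longrightarrow> arr C v' \<Longrightarrow> dm C v = dm C v' \<Longrightarrow> cd C v = cd C v' \<Longrightarrow> cd C u = dm C v'
    \<Longrightarrow> (v \<oplus> v') \<cdot> u = (v \<cdot> u) \<oplus> (v' \<cdot> u)"
  using cmp_add_left[of u "dm C u" "dm C v'" v "cd C v'" v'] by simp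

lemma smul_cmp [simp]:
  "arr C u \<Longrightarrow> arr C v \<Longrightarrow> cd C u = dm C v \<Longrightarrow> (c \<odot> v) \<cdot> u = c \<odot> (v \<cdot> u)"
  using cmp_smul_left[of u "dm C u" "dm C v" v "cd C v" c] by simp

lemma cmp_smul [simp]:
  "arr C u \<Longrightarrow> arr C v \<Longrightarrow> cd C u = dm C v \<Longrightarrow> v \<cdot> (c \<odot> u) = c \<odot> (v \<cdot> u)"
  using cmp_smul_right[of u "dm C u" "dm C v" v "cd C v" c] by simp

lemma cmp_zer [simp]: "arr C v \<Longrightarrow> dm C v = Y \<Longrightarrow> X \<in> ob C \<Longrightarrow> v \<cdot> zer C X Y = zer C X (cd C v)"
  using cmp_smul[of "zer C X Y" v 0] dm_ob[of v] by auto

lemma zer_cmp [simp]: "arr C u \<Longrightarrow> cd C u = Y \<Longrightarrow> Z \<in> ob C \<Longrightarrow> zer C Y Z \<cdot> u = zer C (dm C u) Z"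
  using smul_cmp[of u "zer C Y Z" 0] cd_ob[of u] by auto

lemma add_neg_eq_zer:
  assumes "arr C u" "arr C v" "dm C u = dm C v" "cd C u = cd C v"
  shows "u \<oplus> (- 1) \<odot> v = zer C (dm C v) (cd C v) \<longleftrightarrow> u = v"
proof
  assume a: "u \<oplus> (- 1) \<odot> v = zer C (dm C v) (cd C v)"
  show "u = v"
    by (rule add_cancel[of "(- 1) \<odot> v"]) (use a assms in \<open>auto simp: add_com[of _ u]\<close>)
qed (use assms in simp)

lemma smul_eq_zer:
  assumes "arr C u" "c \<noteq> 0" "c \<odot> u = zer C (dm C u) (cd C u)"
  shows "u = zer C (dm C u) (cd C u)"
proof -
  have "u = inverse c \<odot> c \<odot> u" using assms(1,2) by simp
  also have "\<dots> = zer C (dm C u) (cd C u)" unfolding assms(3) using assms by simp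
  finally show ?thesis .
qed

text \<open>Composites are kept bracketed to the right, so an equation for
  \<open>v \<cdot> u\<close> can rewrite inside a longer composite only after a trailing factor has
  been added to both sides.\<close>

lemma cmp_eq: "v \<cdot> u = w \<Longrightarrow> arr C u \<Longrightarrow> arr C v \<Longrightarrow> arr C x \<Longrightarrow> cd C u = dm C v \<Longrightarrow> cd C x = dm C u
    \<Longrightarrow> v \<cdot> (u \<cdot> x) = w \<cdot> x"
  using assoc[of x u v] by auto

subsection \<open>Isomorphisms and zero objects\<close>

lemma isomD:
  assumes "isom C X Y u"
  shows "arr C u" "dm C u = X" "cd C u = Y" "X \<in> ob C" "Y \<in> ob C"
  using assms dm_ob[of u] cd_ob[of u] unfolding isom_def by auto

lemma isomE:
  assumes "isom C X Y u"
  obtains v where "isom C Y X v" "arr C v" "dm C v = Y" "cd C v = X" "v \<cdot> u = ide C X" "u \<cdot> v = ide C Y"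
    "\<And>x. arr C x \<Longrightarrow> cd C x = X \<Longrightarrow> v \<cdot> (u \<cdot> x) = x"
    "\<And>x. arr C x \<Longrightarrow> cd C x = Y \<Longrightarrow> u \<cdot> (v \<cdot> x) = x"
proof -
  obtain v where v: "arr C v" "dm C v = Y" "cd C v = X" "v \<cdot> u = ide C X" "u \<cdot> v = ide C Y"
    using assms unfolding isom_def by auto
  note u = isomD[OF assms]
  show thesis
    by (rule that[of v]) (use u v in \<open>auto simp: isom_def cmp_eq[of v u] cmp_eq[of u v] simp del: assoc\<close>)
qed

lemma isomI:
  assumes "arr C u" "arr C v" "dm C u = X" "cd C u = Y" "dm C v = Y" "cd C v = X"
    "v \<cdot> u = ide C X" "u \<cdot> v = ide C Y"
  shows "isom C X Y u"
  using assms unfolding isom_def by auto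

lemma isom_ide [simp]: "X \<in> ob C \<Longrightarrow> isom C X X (ide C X)"
  by (rule isomI[of _ "ide C X"]) auto

lemma isom_smul:
  assumes "isom C X Y u" "c \<noteq> 0" shows "isom C X Y (c \<odot> u)"
proof -
  obtain v where v: "arr C v" "dm C v = Y" "cd C v = X" "v \<cdot> u = ide C X" "u \<cdot> v = ide C Y"
    by (rule isomE[OF assms(1)])
  show ?thesis by (rule isomI[of _ "inverse c \<odot> v"]) (use assms v isomD[OF assms(1)] in auto)
qed

lemma isom_cmp:
  assumes "isom C X Y u" "isom C Y Z v" shows "isom C X Z (v \<cdot> u)"
proof -
  obtain u' where u': "arr C u'" "dm C u' = Y" "cd C u' = X" "u' \<cdot> u = ide C X" "u \<cdot> u' = ide C Y"
    "\<And>x. arr C x \<Longrightarrow> cd C x = Y \<Longrightarrow> u \<cdot> (u' \<cdot> x) = x"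
    using isomE[OF assms(1)] by metis
  obtain v' where v': "arr C v'" "dm C v' = Z" "cd C v' = Y" "v' \<cdot> v = ide C Y" "v \<cdot> v' = ide C Z"
    "\<And>x. arr C x \<Longrightarrow> cd C x = Y \<Longrightarrow> v' \<cdot> (v \<cdot> x) = x"
    using isomE[OF assms(2)] by metis
  show ?thesis
    by (rule isomI[of _ "u' \<cdot> v'"]) (use u' v' isomD[OF assms(1)] isomD[OF assms(2)] in auto)
qed

lemma isom_cancel_left:
  assumes "isom C Y Z v" "arr C x" "arr C y" "cd C x = Y" "cd C y = Y" "v \<cdot> x = v \<cdot> y"
  shows "x = y"
proof -
  obtain v' where v': "\<And>x. arr C x \<Longrightarrow> cd C x = Y \<Longrightarrow> v' \<cdot> (v \<cdot> x) = x"
    by (rule isomE[OF assms(1)]) blast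
  show ?thesis using v'[of x] v'[of y] assms by metis
qed

lemma isom_cancel_right:
  assumes "isom C X Y u" "arr C x" "arr C y" "dm C x = Y" "dm C y = Y" "x \<cdot> u = y \<cdot> u"
  shows "x = y"
proof -
  obtain u' where u': "arr C u'" "dm C u' = Y" "cd C u' = X" "u \<cdot> u' = ide C Y"
    by (rule isomE[OF assms(1)])
  have "(x \<cdot> u) \<cdot> u' = (y \<cdot> u) \<cdot> u'" using assms(6) by (rule arg_cong)
  then show ?thesis using u' assms(2-5) isomD[OF assms(1)] by simp
qed

lemma zero_objectD:
  assumes "zero_object C Z"
  shows "Z \<in> ob C" "arr C u \<Longrightarrow> cd C u = Z \<Longrightarrow> u = zer C (dm C u) Z"
    "arr C u \<Longrightarrow> dm C u = Z \<Longrightarrow> u = zer C Z (cd C u)"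
proof -
  have Z: "Z \<in> ob C" and ex: "\<And>X. X \<in> ob C \<Longrightarrow> \<exists>!u. u \<in> hom C X Z" "\<And>X. X \<in> ob C \<Longrightarrow> \<exists>!u. u \<in> hom C Z X"
    using assms unfolding zero_object_def by blast+
  show "Z \<in> ob C" by fact
  { assume "arr C u" "cd C u = Z" then show "u = zer C (dm C u) Z" using ex(1)[of "dm C u"] Z by auto }
  { assume "arr C u" "dm C u = Z" then show "u = zer C Z (cd C u)" using ex(2)[of "cd C u"] Z by auto }
qed

lemma zero_object_iff: "zero_object C Z \<longleftrightarrow> Z \<in> ob C \<and> ide C Z = zer C Z Z"
proof
  assume "zero_object C Z"
  then show "Z \<in> ob C \<and> ide C Z = zer C Z Z" using zero_objectD(1,2)[of Z] ide_simps[of Z] by metis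
next
  assume a: "Z \<in> ob C \<and> ide C Z = zer C Z Z"
  have 1: "u = zer C (dm C u) Z" if "arr C u" "cd C u = Z" for u
    using ide_cmp[OF that] a that by auto
  have 2: "u = zer C Z (cd C u)" if "arr C u" "dm C u = Z" for u
    using cmp_ide[OF that] a that by auto
  show "zero_object C Z" unfolding zero_object_def
  proof (intro conjI ballI)
    fix X assume X: "X \<in> ob C"
    show "\<exists>!u. u \<in> hom C X Z"
      by (rule ex1I[of _ "zer C X Z"]) (use 1 a X in auto)
    show "\<exists>!u. u \<in> hom C Z X"
      by (rule ex1I[of _ "zer C Z X"]) (use 2 a X in auto)
  qed (use a in blast)
qed

lemma zero_object_isom:
  assumes "zero_object C Z" "isom C Z Z' u" shows "zero_object C Z'"
proof -
  obtain v where v: "arr C v" "dm C v = Z'" "cd C v = Z" "u \<cdot> v = ide C Z'"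
    by (rule isomE[OF assms(2)])
  note u = isomD[OF assms(2)]
  have "u \<cdot> v = zer C Z' Z'" using zero_objectD(2)[OF assms(1), of v] v u by simp
  then show ?thesis unfolding zero_object_iff using u v by auto
qed

lemma isom_zero:
  assumes "zero_object C Z" "zero_object C Z'" shows "isom C Z Z' (zer C Z Z')"
  by (rule isomI[of _ "zer C Z' Z"]) (use assms in \<open>auto simp: zero_object_iff\<close>)

subsection \<open>Biproducts\<close>

lemma biproductD:
  assumes "biproduct C X Y P i j p q"
  shows "arr C i" "arr C j" "arr C p" "arr C q" "dm C i = X" "dm C j = Y" "cd C i = P" "cd C j = P"
    "dm C p = P" "dm C q = P" "cd C p = X" "cd C q = Y" "X \<in> ob C" "Y \<in> ob C" "P \<in> ob C"
    "p \<cdot> i = ide C X" "q \<cdot> j = ide C Y" "p \<cdot> j = zer C Y X" "q \<cdot> i = zer C X Y"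
    "i \<cdot> p \<oplus> j \<cdot> q = ide C P"
    "\<And>x. arr C x \<Longrightarrow> cd C x = X \<Longrightarrow> p \<cdot> (i \<cdot> x) = x"
    "\<And>x. arr C x \<Longrightarrow> cd C x = Y \<Longrightarrow> q \<cdot> (j \<cdot> x) = x"
    "\<And>x. arr C x \<Longrightarrow> cd C x = Y \<Longrightarrow> p \<cdot> (j \<cdot> x) = zer C (dm C x) X"
    "\<And>x. arr C x \<Longrightarrow> cd C x = X \<Longrightarrow> q \<cdot> (i \<cdot> x) = zer C (dm C x) Y"
proof -
  show s: "arr C i" "arr C j" "arr C p" "arr C q" "dm C i = X" "dm C j = Y" "cd C i = P" "cd C j = P"
    "dm C p = P" "dm C q = P" "cd C p = X" "cd C q = Y"
    "p \<cdot> i = ide C X" "q \<cdot> j = ide C Y" "p \<cdot> j = zer C Y X" "q \<cdot> i = zer C X Y"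
    "i \<cdot> p \<oplus> j \<cdot> q = ide C P"
    using assms unfolding biproduct_def by auto
  show o: "X \<in> ob C" "Y \<in> ob C" "P \<in> ob C" using dm_ob[of i] dm_ob[of j] cd_ob[of i] s by auto
  fix x assume x: "arr C x"
  show "cd C x = X \<Longrightarrow> p \<cdot> (i \<cdot> x) = x" "cd C x = Y \<Longrightarrow> q \<cdot> (j \<cdot> x) = x"
    "cd C x = Y \<Longrightarrow> p \<cdot> (j \<cdot> x) = zer C (dm C x) X" "cd C x = X \<Longrightarrow> q \<cdot> (i \<cdot> x) = zer C (dm C x) Y"
    using s o x cmp_eq[OF s(13)] cmp_eq[OF s(14)] cmp_eq[OF s(15)] cmp_eq[OF s(16)] by auto
qed

lemma biproductI:
  assumes "arr C i" "arr C j" "arr C p" "arr C q" "dm C i = X" "dm C j = Y" "cd C i = P" "cd C j = P"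
    "dm C p = P" "dm C q = P" "cd C p = X" "cd C q = Y"
    "p \<cdot> i = ide C X" "q \<cdot> j = ide C Y" "p \<cdot> j = zer C Y X" "q \<cdot> i = zer C X Y"
    "i \<cdot> p \<oplus> j \<cdot> q = ide C P"
  shows "biproduct C X Y P i j p q"
  using assms unfolding biproduct_def by simp

lemma biproduct_swap: "biproduct C X Y P i j p q \<Longrightarrow> biproduct C Y X P j i q p"
  by (frule biproductD(20)) (auto simp: biproduct_def add_com)

lemma biproduct_into:
  assumes "biproduct C X Y P i j p q" "arr C x" "cd C x = P"
  shows "i \<cdot> (p \<cdot> x) \<oplus> j \<cdot> (q \<cdot> x) = x"
proof -
  note b = biproductD[OF assms(1)]
  have "i \<cdot> (p \<cdot> x) \<oplus> j \<cdot> (q \<cdot> x) = (i \<cdot> p \<oplus> j \<cdot> q) \<cdot> x" using assms(2,3) b(1-15) by simp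
  also have "\<dots> = x" unfolding b(20) using assms(2,3) by simp
  finally show ?thesis .
qed

lemma biproduct_out:
  assumes "biproduct C X Y P i j p q" "arr C x" "dm C x = P"
  shows "x \<cdot> (i \<cdot> p) \<oplus> x \<cdot> (j \<cdot> q) = x"
proof -
  note b = biproductD[OF assms(1)]
  have "x \<cdot> (i \<cdot> p) \<oplus> x \<cdot> (j \<cdot> q) = x \<cdot> (i \<cdot> p \<oplus> j \<cdot> q)" using assms(2,3) b(1-15) by simp
  also have "\<dots> = x" unfolding b(20) using assms(2,3) by simp
  finally show ?thesis .
qed


lemma biproduct_eq_out:
  assumes "biproduct C X Y P i j p q" "arr C x" "dm C x = P" "arr C y" "dm C y = P"
    "x \<cdot> i = y \<cdot> i" "x \<cdot> j = y \<cdot> j"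
  shows "x = y"
proof -
  note b = biproductD[OF assms(1)]
  have "x = (x \<cdot> i) \<cdot> p \<oplus> (x \<cdot> j) \<cdot> q" using assms(2,3) b(1-15) by (simp add: biproduct_out[OF assms(1-3)])
  also have "\<dots> = (y \<cdot> i) \<cdot> p \<oplus> (y \<cdot> j) \<cdot> q" using assms by simp
  also have "\<dots> = y" using assms(4,5) b(1-15) by (simp add: biproduct_out[OF assms(1,4,5)])
  finally show ?thesis .
qed

text \<open>An isomorphism is a degenerate biproduct, with a zero object as the other summand.
  Closure under direct sums then yields closure under isomorphism, as in
  \<open>decomposed_isom\<close>.\<close>

lemma biproduct_zero_left:
  assumes "zero_object C Z" "isom C X P u"
  obtains v where "biproduct C Z X P (zer C Z P) u (zer C P Z) v"
    "v \<cdot> u = ide C X" "u \<cdot> v = ide C P" "arr C v" "dm C v = P" "cd C v = X"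
proof -
  obtain v where v: "arr C v" "dm C v = P" "cd C v = X" "v \<cdot> u = ide C X" "u \<cdot> v = ide C P"
    by (rule isomE[OF assms(2)])
  note u = isomD[OF assms(2)]
  have "biproduct C Z X P (zer C Z P) u (zer C P Z) v"
    by (rule biproductI) (use u v assms(1) in \<open>auto simp: zero_object_iff\<close>)
  then show thesis by (rule that) (use v in auto)
qed

lemma biproduct_isom:
  assumes "biproduct C X Y P i j p q" "isom C P P' u"
  obtains v where "biproduct C X Y P' (u \<cdot> i) (u \<cdot> j) (p \<cdot> v) (q \<cdot> v)"
     "v \<cdot> u = ide C P" "u \<cdot> v = ide C P'" "isom C P' P v"
proof -
  obtain v where v: "isom C P' P v" "arr C v" "dm C v = P'" "cd C v = P" "v \<cdot> u = ide C P" "u \<cdot> v = ide C P'"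
      "\<And>x. arr C x \<Longrightarrow> cd C x = P \<Longrightarrow> v \<cdot> (u \<cdot> x) = x" "\<And>x. arr C x \<Longrightarrow> cd C x = P' \<Longrightarrow> u \<cdot> (v \<cdot> x) = x"
    using isomE[OF assms(2)] by metis
  note u = isomD[OF assms(2)] and b = biproductD[OF assms(1)]
  have "u \<cdot> (i \<cdot> (p \<cdot> v)) \<oplus> u \<cdot> (j \<cdot> (q \<cdot> v)) = u \<cdot> ((i \<cdot> p \<oplus> j \<cdot> q) \<cdot> v)"
    using u v b(1-19) by simp
  also have "\<dots> = ide C P'" unfolding b(20) using u v b by simp
  finally have "biproduct C X Y P' (u \<cdot> i) (u \<cdot> j) (p \<cdot> v) (q \<cdot> v)"
    by (intro biproductI) (use u v b in auto)
  then show thesis by (rule that) (use v in auto)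
qed

lemma biproduct_isom_summands:
  assumes "biproduct C X Y P i j p q" "isom C X' X u" "isom C Y' Y w"
  obtains u' w' where "biproduct C X' Y' P (i \<cdot> u) (j \<cdot> w) (u' \<cdot> p) (w' \<cdot> q)"
    "isom C X X' u'" "isom C Y Y' w'" "u' \<cdot> u = ide C X'" "u \<cdot> u' = ide C X" "w' \<cdot> w = ide C Y'" "w \<cdot> w' = ide C Y"
proof -
  obtain u' where u': "isom C X X' u'" "arr C u'" "dm C u' = X" "cd C u' = X'" "u' \<cdot> u = ide C X'"
      "u \<cdot> u' = ide C X"
    "\<And>x. arr C x \<Longrightarrow> cd C x = X \<Longrightarrow> u \<cdot> (u' \<cdot> x) = x"
    using isomE[OF assms(2)] by metis
  obtain w' where w': "isom C Y Y' w'" "arr C w'" "dm C w' = Y" "cd C w' = Y'" "w' \<cdot> w = ide C Y'"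
      "w \<cdot> w' = ide C Y"
    "\<And>x. arr C x \<Longrightarrow> cd C x = Y \<Longrightarrow> w \<cdot> (w' \<cdot> x) = x"
    using isomE[OF assms(3)] by metis
  note b = biproductD[OF assms(1)] and u = isomD[OF assms(2)] isomD[OF assms(3)]
  have "biproduct C X' Y' P (i \<cdot> u) (j \<cdot> w) (u' \<cdot> p) (w' \<cdot> q)"
    by (rule biproductI) (use b u u' w' in auto)
  then show thesis by (rule that) (use u' w' in auto)
qed

lemma biproduct_unique:
  assumes "biproduct C X Y P i j p q" "biproduct C X Y P' i' j' p' q'"
  shows "isom C P P' (i' \<cdot> p \<oplus> j' \<cdot> q)"
  by (rule isomI[of _ "i \<cdot> p' \<oplus> j \<cdot> q'"])
    (use biproductD[OF assms(1)] biproductD[OF assms(2)] in simp_all)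

text \<open>\<open>Y\<close> is embedded along the graph of \<open>- s\<close>.\<close>

lemma biproduct_shear:
  assumes "biproduct C X Y P i j p q" "arr C s" "dm C s = Y" "cd C s = X"
  shows "biproduct C X Y P i (j \<oplus> (- 1) \<odot> (i \<cdot> s)) (p \<oplus> s \<cdot> q) q"
proof (rule biproductI)
  note b = biproductD[OF assms(1)]
  have "i \<cdot> (s \<cdot> q) \<oplus> (- 1) \<odot> (i \<cdot> (s \<cdot> q)) = zer C P P"
    using b assms by simp
  then show "i \<cdot> (p \<oplus> s \<cdot> q) \<oplus> (j \<oplus> (- 1) \<odot> (i \<cdot> s)) \<cdot> q = ide C P"
    using b assms add_left_com[of "i \<cdot> (s \<cdot> q)" "j \<cdot> q" "(- 1) \<odot> (i \<cdot> (s \<cdot> q))"] by (simp del: smul_left1)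
qed (use biproductD[OF assms(1)] assms in \<open>auto simp: add_neg_eq_zer\<close>)

end


section \<open>Integer iterates of a bijection\<close>

text \<open>The formula of \<open>shift_ob\<close>, freed from objects, so that one set of laws
  serves for the shift of objects and for the shift of arrows.\<close>

definition zpw :: "('x \<Rightarrow> 'x) \<Rightarrow> 'x set \<Rightarrow> int \<Rightarrow> 'x \<Rightarrow> 'x" where
  "zpw f A m x = (if 0 \<le> m then (f ^^ nat m) x else (inv_into A f ^^ nat (- m)) x)"

lemma zpw_simps [simp]: "zpw f A 0 x = x" "zpw f A 1 x = f x"
  by (simp_all add: zpw_def)

context
  fixes f :: "'x \<Rightarrow> 'x" and A
  assumes f: "bij_betw f A A"
begin

lemma zpw_in [simp]: "x \<in> A \<Longrightarrow> zpw f A m x \<in> A"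
proof -
  assume x: "x \<in> A"
  have "(f ^^ n) x \<in> A \<and> (inv_into A f ^^ n) x \<in> A" for n
    by (induct n) (use x bij_betwE[OF f] bij_betwE[OF bij_betw_inv_into[OF f]] in auto)
  then show ?thesis by (simp add: zpw_def)
qed

lemma zpw_succ: "x \<in> A \<Longrightarrow> zpw f A (m + 1) x = f (zpw f A m x)"
proof (cases "0 \<le> m")
  case True
  then have "nat (m + 1) = Suc (nat m)" by simp
  then show ?thesis using True by (simp add: zpw_def)
next
  case False
  assume x: "x \<in> A"
  have e: "nat (- m) = Suc (nat (- (m + 1)))" using False by simp
  have "zpw f A m x = inv_into A f ((inv_into A f ^^ nat (- (m + 1))) x)"
    using False unfolding zpw_def e by simp
  moreover have "zpw f A (m + 1) x = (inv_into A f ^^ nat (- (m + 1))) x"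
    using False by (auto simp: zpw_def)
  ultimately show ?thesis using x zpw_in[of x "m + 1"] f by (simp add: bij_betw_inv_into_right[OF f])
qed

lemma zpw_pred: "x \<in> A \<Longrightarrow> zpw f A (m - 1) x = inv_into A f (zpw f A m x)"
  using zpw_succ[of x "m - 1"] zpw_in[of x "m - 1"] bij_betw_inv_into_left[OF f] by simp

lemma zpw_add: "x \<in> A \<Longrightarrow> zpw f A (m + n) x = zpw f A m (zpw f A n x)"
proof (induct m rule: int_induct[of _ 0])
  case (step1 i)
  then show ?case using zpw_succ[of x "i + n"] zpw_succ[of "zpw f A n x" i] by (simp add: algebra_simps)
next
  case (step2 i)
  then show ?case using zpw_pred[of x "i + n"] zpw_pred[of "zpw f A n x" i] by (simp add: algebra_simps)
qed simp

end

section \<open>Triangulated categories\<close>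

definition sh :: "('o, 'a, 'k) tri_cat \<Rightarrow> int \<Rightarrow> 'a \<Rightarrow> 'a" where
  "sh T m = zpw (shm T) {u. arr T u} m"

lemma shift_ob_zpw: "shift_ob T m X = zpw (sho T) (ob T) m X"
  by (simp add: shift_ob_def zpw_def)

lemma shift_ob_simps [simp]: "shift_ob T 0 X = X" "shift_ob T 1 X = sho T X"
  and sh_simps [simp]: "sh T 0 u = u" "sh T 1 u = shm T u"
  by (simp_all add: shift_ob_zpw sh_def)

context triangulated_category
begin

subsection \<open>The shift\<close>

lemma sho_ob [simp]: "X \<in> ob T \<Longrightarrow> sho T X \<in> ob T"
  using shift_functor unfolding linear_functor_def by blast

lemma shm_simps [simp]:
  assumes "arr T u" shows "arr T (shm T u)" "dm T (shm T u) = sho T (dm T u)" "cd T (shm T u) = sho T (cd T u)"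
proof -
  have "\<And>X Y u. u \<in> hom T X Y \<Longrightarrow> shm T u \<in> hom T (sho T X) (sho T Y)"
    using shift_functor unfolding linear_functor_def by blast
  from this[of u "dm T u" "cd T u"] show "arr T (shm T u)" "dm T (shm T u) = sho T (dm T u)" "cd T (shm T u)
      = sho T (cd T u)"
    using assms by auto
qed

lemma shm_ide [simp]: "X \<in> ob T \<Longrightarrow> shm T (ide T X) = ide T (sho T X)"
  using shift_functor unfolding linear_functor_def by blast

lemma shm_cmp [simp]: "arr T u \<Longrightarrow> arr T v \<Longrightarrow> cd T u = dm T v \<Longrightarrow> shm T (v \<cdot> u) = shm T v \<cdot> shm T u"
proof -
  have "\<And>X Y Z u v. u \<in> hom T X Y \<Longrightarrow> v \<in> hom T Y Z \<Longrightarrow> shm T (v \<cdot> u) = shm T v \<cdot> shm T u"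
    using shift_functor unfolding linear_functor_def by blast
  from this[of u "dm T u" "cd T u" v "cd T v"] show "arr T u \<Longrightarrow> arr T v \<Longrightarrow> cd T u = dm T v \<Longrightarrow> ?thesis" by simp
qed

lemma shm_add [simp]: "arr T u \<Longrightarrow> arr T v \<Longrightarrow> dm T u = dm T v \<Longrightarrow> cd T u = cd T v \<Longrightarrow> shm T (u \<oplus> v) = shm T u \<oplus> shm T v"
proof -
  have "\<And>X Y u v. u \<in> hom T X Y \<Longrightarrow> v \<in> hom T X Y \<Longrightarrow> shm T (u \<oplus> v) = shm T u \<oplus> shm T v"
    using shift_functor unfolding linear_functor_def by blast
  from this[of u "dm T u" "cd T u" v] show "arr T u \<Longrightarrow> arr T v \<Longrightarrow> dm T u = dm T v \<Longrightarrow> cd T u = cd T v \<Longrightarrow> ?thesis" by simp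
qed

lemma shm_smul [simp]: "arr T u \<Longrightarrow> shm T (c \<odot> u) = c \<odot> shm T u"
proof -
  have "\<And>X Y u. u \<in> hom T X Y \<Longrightarrow> shm T (c \<odot> u) = c \<odot> shm T u"
    using shift_functor unfolding linear_functor_def by blast
  from this[of u "dm T u" "cd T u"] show "arr T u \<Longrightarrow> ?thesis" by simp
qed

lemma shm_zer [simp]: "X \<in> ob T \<Longrightarrow> Y \<in> ob T \<Longrightarrow> shm T (zer T X Y) = zer T (sho T X) (sho T Y)"
  using shm_smul[of "zer T X Y" 0] by (simp del: shm_smul)

lemma sho_inj: "X \<in> ob T \<Longrightarrow> Y \<in> ob T \<Longrightarrow> sho T X = sho T Y \<Longrightarrow> X = Y"
  using shift_bij_ob unfolding bij_betw_def inj_on_def by blast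

lemma sho_surj:
  assumes "X \<in> ob T" obtains Y where "Y \<in> ob T" "X = sho T Y"
  using shift_bij_ob assms unfolding bij_betw_def by (metis imageE)

lemma shm_inj:
  assumes "arr T u" "arr T v" "shm T u = shm T v" shows "u = v"
proof -
  have "sho T (dm T u) = sho T (dm T v)" "sho T (cd T u) = sho T (cd T v)"
    using shm_simps[of u] shm_simps[of v] assms by auto
  then have e: "dm T u = dm T v" "cd T u = cd T v" using sho_inj assms by auto
  have "inj_on (shm T) (hom T (dm T u) (cd T u))" using shift_bij_hom[of "dm T u" "cd T u"] assms
      unfolding bij_betw_def by simp
  then show ?thesis using assms e unfolding inj_on_def by simp
qed

lemma shm_surj:
  assumes "arr T w" "dm T w = sho T X" "cd T w = sho T Y" "X \<in> ob T" "Y \<in> ob T"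
  obtains u where "arr T u" "dm T u = X" "cd T u = Y" "w = shm T u"
proof -
  have "w \<in> shm T ` hom T X Y" using shift_bij_hom[of X Y] assms unfolding bij_betw_def by simp
  then show thesis using that by auto
qed

text \<open>The bijections between hom-sets glue: the shift is bijective on objects, so the ends of
  an arrow have unique preimages, and these determine the hom-set to look in.\<close>

lemma bij_shm: "bij_betw (shm T) {u. arr T u} {u. arr T u}"
  unfolding bij_betw_def
proof
  show "inj_on (shm T) {u. arr T u}" using shm_inj by (auto intro: inj_onI)
  have "w \<in> shm T ` {u. arr T u}" if w: "arr T w" for w
  proof -
    obtain X where X: "X \<in> ob T" "dm T w = sho T X" using sho_surj[of "dm T w"] dm_ob[OF w] by metis
    obtain Y where Y: "Y \<in> ob T" "cd T w = sho T Y" using sho_surj[of "cd T w"] cd_ob[OF w] by metis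
    show ?thesis using shm_surj[OF w X(2) Y(2) X(1) Y(1)] by blast
  qed
  then show "shm T ` {u. arr T u} = {u. arr T u}" by auto
qed

lemma shift_ob_ob [simp]: "X \<in> ob T \<Longrightarrow> shift_ob T m X \<in> ob T"
  unfolding shift_ob_zpw by (rule zpw_in[OF shift_bij_ob])

lemma shift_ob_add: "X \<in> ob T \<Longrightarrow> shift_ob T (m + n) X = shift_ob T m (shift_ob T n X)"
  unfolding shift_ob_zpw by (rule zpw_add[OF shift_bij_ob])

lemma shift_ob_succ: "X \<in> ob T \<Longrightarrow> shift_ob T (m + 1) X = sho T (shift_ob T m X)"
  unfolding shift_ob_zpw by (rule zpw_succ[OF shift_bij_ob])

lemma shift_ob_sho: "X \<in> ob T \<Longrightarrow> shift_ob T m (sho T X) = shift_ob T (m + 1) X"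
  using shift_ob_add[of X m 1] by simp

lemma sh_add: "arr T u \<Longrightarrow> sh T (m + n) u = sh T m (sh T n u)"
  unfolding sh_def by (rule zpw_add[OF bij_shm]) simp

lemma sh_succ: "arr T u \<Longrightarrow> sh T (m + 1) u = shm T (sh T m u)"
  unfolding sh_def by (rule zpw_succ[OF bij_shm]) simp

lemma sh_arr [simp]: "arr T u \<Longrightarrow> arr T (sh T m u)"
  unfolding sh_def using zpw_in[OF bij_shm, of u m] by simp

lemma sh_shm: "arr T u \<Longrightarrow> sh T m (shm T u) = sh T (m + 1) u"
  using sh_add[of u m 1] by simp

text \<open>Serves the downward steps of inductions over integers: an equation for the shift by
  \<open>m - 1\<close> may be checked after one more shift, by injectivity.\<close>

lemma sh_pred_unique: "arr T u \<Longrightarrow> arr T w \<Longrightarrow> shm T w = sh T m u \<Longrightarrow> sh T (m - 1) u = w"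
  using sh_succ[of u "m - 1"] shm_inj[of "sh T (m - 1) u" w] by simp

lemma sh_dm_cd: assumes u: "arr T u"
  shows "dm T (sh T m u) = shift_ob T m (dm T u) \<and> cd T (sh T m u) = shift_ob T m (cd T u)"
proof (induct m rule: int_induct[of _ 0])
  case (step1 i)
  then show ?case using u by (simp add: sh_succ shift_ob_succ)
next
  case (step2 i)
  have e: "sho T (dm T (sh T (i - 1) u)) = sho T (shift_ob T (i - 1) (dm T u))"
     "sho T (cd T (sh T (i - 1) u)) = sho T (shift_ob T (i - 1) (cd T u))"
    using step2(2) u shm_simps(2,3)[of "sh T (i - 1) u", folded sh_succ[OF u]] shift_ob_succ[of "dm T u" "i - 1"]
        shift_ob_succ[of "cd T u" "i - 1"]
    by simp_all
  then show ?case using u sho_inj by simp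
qed simp

lemma sh_dm [simp]: "arr T u \<Longrightarrow> dm T (sh T m u) = shift_ob T m (dm T u)"
  and sh_cd [simp]: "arr T u \<Longrightarrow> cd T (sh T m u) = shift_ob T m (cd T u)"
  using sh_dm_cd by blast+

lemma sh_inj: "arr T u \<Longrightarrow> arr T v \<Longrightarrow> sh T m u = sh T m v \<Longrightarrow> u = v"
  using sh_add[of u "- m" m] sh_add[of v "- m" m] by simp


lemma sh_surj:
  assumes "arr T w" "dm T w = shift_ob T m X" "cd T w = shift_ob T m Y" "X \<in> ob T" "Y \<in> ob T"
  obtains u where "arr T u" "dm T u = X" "cd T u = Y" "w = sh T m u"
proof (rule that[of "sh T (- m) w"])
  show "w = sh T m (sh T (- m) w)" using sh_add[of w m "- m"] assms by simp
  show "dm T (sh T (- m) w) = X" "cd T (sh T (- m) w) = Y" "arr T (sh T (- m) w)"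
    using assms shift_ob_add[of _ "- m" m] by (simp_all flip: shift_ob_add)
qed

lemma sh_cmp [simp]: assumes "arr T u" "arr T v" "cd T u = dm T v"
  shows "sh T m (v \<cdot> u) = sh T m v \<cdot> sh T m u"
proof (induct m rule: int_induct[of _ 0])
  case (step1 i) then show ?case using assms by (simp add: sh_succ)
next
  case (step2 i) then show ?case
    using assms sh_succ[of u "i - 1"] sh_succ[of v "i - 1"] by (intro sh_pred_unique) auto
qed simp

lemma sh_ide [simp]: assumes "X \<in> ob T" shows "sh T m (ide T X) = ide T (shift_ob T m X)"
proof (induct m rule: int_induct[of _ 0])
  case (step1 i) then show ?case using assms by (simp add: sh_succ shift_ob_succ)
next
  case (step2 i) then show ?case
    using assms shift_ob_succ[of X "i - 1"] by (intro sh_pred_unique) auto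
qed simp

lemma sh_add_mor [simp]: assumes "arr T u" "arr T v" "dm T u = dm T v" "cd T u = cd T v"
  shows "sh T m (u \<oplus> v) = sh T m u \<oplus> sh T m v"
proof (induct m rule: int_induct[of _ 0])
  case (step1 i) then show ?case using assms by (simp add: sh_succ)
next
  case (step2 i) then show ?case
    using assms sh_succ[of u "i - 1"] sh_succ[of v "i - 1"] by (intro sh_pred_unique) auto
qed simp

lemma sh_smul [simp]: assumes "arr T u" shows "sh T m (c \<odot> u) = c \<odot> sh T m u"
proof (induct m rule: int_induct[of _ 0])
  case (step1 i) then show ?case using assms by (simp add: sh_succ)
next
  case (step2 i) then show ?case
    using assms sh_succ[of u "i - 1"] by (intro sh_pred_unique) auto
qed simp

lemma sh_zer [simp]: "X \<in> ob T \<Longrightarrow> Y \<in> ob T \<Longrightarrow> sh T m (zer T X Y) = zer T (shift_ob T m X) (shift_ob T m Y)"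
  using sh_smul[of "zer T X Y" m 0] by (simp del: sh_smul)

lemma isom_sh:
  assumes "isom T X Y u" shows "isom T (shift_ob T m X) (shift_ob T m Y) (sh T m u)"
proof -
  obtain v where v: "arr T v" "dm T v = Y" "cd T v = X" "v \<cdot> u = ide T X" "u \<cdot> v = ide T Y"
    by (rule isomE[OF assms(1)])
  show ?thesis
    by (rule isomI[of _ "sh T m v"]) (use v isomD[OF assms] in \<open>simp_all flip: sh_cmp\<close>)
qed

lemma isom_shm: "isom T X Y u \<Longrightarrow> isom T (sho T X) (sho T Y) (shm T u)"
  using isom_sh[of X Y u 1] by simp

lemma biproduct_sh:
  assumes "biproduct T X Y P i j p q"
  shows "biproduct T (shift_ob T m X) (shift_ob T m Y) (shift_ob T m P) (sh T m i) (sh T m j) (sh T m p) (sh T m q)"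
  using biproductD[OF assms] by (intro biproductI) (simp_all flip: sh_cmp sh_add_mor)

lemma biproduct_shm:
  "biproduct T X Y P i j p q \<Longrightarrow> biproduct T (sho T X) (sho T Y) (sho T P) (shm T i) (shm T j) (shm T p) (shm T q)"
  using biproduct_sh[of X Y P i j p q 1] by simp

lemma zero_object_sh: "zero_object T Z \<Longrightarrow> zero_object T (shift_ob T m Z)"
  using sh_ide[of Z m] by (simp add: zero_object_iff del: sh_ide)

lemma zero_object_shm: "zero_object T Z \<Longrightarrow> zero_object T (sho T Z)"
  using zero_object_sh[of Z 1] by simp

subsection \<open>Rotation and signs\<close>

abbreviation "dt \<equiv> dist_triangle T"

lemma triangle_iff: "triangle T X Y Z u v w \<longleftrightarrow> arr T u \<and> dm T u = X \<and> cd T u = Y \<and> arr T v \<and> dm T v = Y \<and> cd T v = Z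
    \<and> arr T w \<and> dm T w = Z \<and> cd T w = sho T X"
  by (simp add: triangle_def)

lemma dtD:
  assumes "dt X Y Z u v w"
  shows "arr T u" "dm T u = X" "cd T u = Y" "arr T v" "dm T v = Y" "cd T v = Z" "arr T w" "dm T w = Z"
      "cd T w = sho T X"
    "X \<in> ob T" "Y \<in> ob T" "Z \<in> ob T"
proof -
  show "arr T u" "dm T u = X" "cd T u = Y" "arr T v" "dm T v = Y" "cd T v = Z" "arr T w" "dm T w = Z"
      "cd T w = sho T X"
    using assms unfolding dist_triangle_def triangle_iff by auto
  then show "X \<in> ob T" "Y \<in> ob T" "Z \<in> ob T" using dm_ob cd_ob by metis+
qed

lemma dt_rot: "dt X Y Z u v w \<Longrightarrow> dt Y Z (sho T X) v w ((- 1) \<odot> shm T u)"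
  using TR2[of X Y Z u v w] unfolding dist_triangle_def by simp

lemma dt_unrot:
  assumes "dt Y Z (sho T X) v w u'" "u' = (- 1) \<odot> shm T u" "arr T u" "dm T u = X" "cd T u = Y"
  shows "dt X Y Z u v w"
proof -
  have "triangle T X Y Z u v w" using dtD[OF assms(1)] assms(3-5) by (simp add: triangle_iff)
  then show ?thesis using TR2[of X Y Z u v w] assms(1,2) by simp
qed

text \<open>The shift is bijective on objects and on arrows, so the vertex and the arrow that
  precede a triangle can always be found.\<close>

lemma dt_unrot_ex:
  assumes "dt X Y Z u v w"
  obtains Z' w' where "arr T w'" "dm T w' = Z'" "cd T w' = X" "Z' \<in> ob T" "sho T Z' = Z" "w = (- 1) \<odot> shm T w'"
      "dt Z' X Y w' u v"
proof -
  note d = dtD[OF assms]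
  obtain Z' where Z': "Z' \<in> ob T" "Z = sho T Z'" using sho_surj d by metis
  obtain w' where w': "arr T w'" "dm T w' = Z'" "cd T w' = X" "(- 1) \<odot> w = shm T w'"
    using shm_surj[of "(- 1) \<odot> w" Z' X] d Z' by auto
  then have "w = (- 1) \<odot> shm T w'" using d(7) smul_simps2(2)[of w "- 1" "- 1"] by simp
  then show thesis using that[of w' Z'] w' Z' dt_unrot[of X Y Z' u v w w'] assms by simp
qed

text \<open>The scalars 1, \<open>a\<close> and \<open>a * b\<close> on the three objects form an
  isomorphism of triangles exactly because the product of all three factors is 1.\<close>

lemma dt_signs:
  assumes d: "dt X Y Z u v w" and abc: "a * b * c = 1"
  shows "dt X Y Z (a \<odot> u) (b \<odot> v) (c \<odot> w)"
proof -
  note D = dtD[OF d]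
  have "a \<noteq> 0" "b \<noteq> 0" "c * (a * b) = 1" using abc by (auto simp: mult_ac)
  then show ?thesis
    using D by (intro TR1_iso[OF d, where a="ide T X" and b="a \<odot> ide T Y" and c="(a * b) \<odot> ide T Z"])
      (simp_all add: triangle_iff isom_smul mult.commute)
qed

text \<open>Three rotations shift the triangle and negate all three morphisms;
  \<open>dt_signs\<close> removes two of the signs and leaves one.\<close>

lemma dt_shm_iff:
  assumes "triangle T X Y Z u v w"
  shows "dt X Y Z u v w \<longleftrightarrow> dt (sho T X) (sho T Y) (sho T Z) (shm T u) (shm T v) ((- 1) \<odot> shm T w)"
proof -
  have t: "arr T u" "dm T u = X" "cd T u = Y" "arr T v" "dm T v = Y" "cd T v = Z" "arr T w" "dm T w = Z"
      "cd T w = sho T X"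
    using assms by (simp_all add: triangle_iff)
  then have o: "X \<in> ob T" "Y \<in> ob T" "Z \<in> ob T" using dm_ob cd_ob by metis+
  have "dt X Y Z u v w \<longleftrightarrow> dt (sho T X) (sho T Y) (sho T Z) ((- 1) \<odot> shm T u) ((- 1) \<odot> shm T v) ((- 1) \<odot> shm T w)"
    using t o TR2[of X Y Z u v w] TR2[of Y Z "sho T X" v w "(- 1) \<odot> shm T u"]
     TR2[of Z "sho T X" "sho T Y" w "(- 1) \<odot> shm T u" "(- 1) \<odot> shm T v"]
    by (simp add: triangle_iff)
  also have "\<dots> \<longleftrightarrow> dt (sho T X) (sho T Y) (sho T Z) (shm T u) (shm T v) ((- 1) \<odot> shm T w)"
    using dt_signs[of "sho T X" "sho T Y" "sho T Z" "(- 1) \<odot> shm T u" "(- 1) \<odot> shm T v" "(- 1) \<odot> shm T w" "-1"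
        "-1" 1]
      dt_signs[of "sho T X" "sho T Y" "sho T Z" "shm T u" "shm T v" "(- 1) \<odot> shm T w" "-1" "-1" 1] t by auto
  finally show ?thesis .
qed

text \<open>Each shift of a triangle leaves one sign on its third morphism, so the sign after
  \<open>m\<close> shifts is the parity of \<open>m\<close>.\<close>

definition shsgn :: "int \<Rightarrow> 'k" where "shsgn m = (if even m then 1 else - 1)"

lemma dt_sh:
  assumes d: "dt X Y Z u v w"
  shows "dt (shift_ob T m X) (shift_ob T m Y) (shift_ob T m Z) (sh T m u) (sh T m v) (shsgn m \<odot> sh T m w)"
proof -
  note D = dtD[OF d]
  have t: "triangle T (shift_ob T m X) (shift_ob T m Y) (shift_ob T m Z) (sh T m u) (sh T m v) (c \<odot> sh T m w)"
      for m c
    using D by (simp add: triangle_iff shift_ob_sho shift_ob_succ)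
  show ?thesis
  proof (induct m rule: int_induct[of _ 0])
    case base show ?case using d D by (simp add: shsgn_def)
  next
    case (step1 i)
    have "dt (sho T (shift_ob T i X)) (sho T (shift_ob T i Y)) (sho T (shift_ob T i Z)) (shm T (sh T i u)) (shm T (sh T i v))
       ((- 1) \<odot> shm T (shsgn i \<odot> sh T i w))"
      using step1(2) dt_shm_iff[OF t[of i "shsgn i"]] by blast
    then show ?case using D by (cases "even i") (simp_all add: sh_succ shift_ob_succ shsgn_def)
  next
    case (step2 i)
    have "dt (shift_ob T (i - 1) X) (shift_ob T (i - 1) Y) (shift_ob T (i - 1) Z) (sh T (i - 1) u) (sh T (i - 1) v) (shsgn (i - 1) \<odot> sh T (i - 1) w)"
      unfolding dt_shm_iff[OF t[of "i - 1" "shsgn (i - 1)"]]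
      using step2(2) D by (cases "even i") (simp_all add: sh_succ[symmetric] shift_ob_succ[symmetric] shsgn_def)
    then show ?case .
  qed
qed

subsection \<open>Exactness\<close>

lemma dt_id: assumes "zero_object T Z" "X \<in> ob T" shows "dt X X Z (ide T X) (zer T X Z) (zer T Z (sho T X))"
  using TR1_ide assms by blast

lemma dt_zero_source:
  assumes "zero_object T Z" "X \<in> ob T" shows "dt Z X X (zer T Z X) (ide T X) (zer T X (sho T Z))"
  by (rule dt_unrot[OF dt_id[OF zero_object_shm[OF assms(1)] assms(2)]])
    (use assms zero_object_iff[of Z] zero_objectD(3)[OF zero_object_shm[OF assms(1)],
        of "zer T (sho T Z) (sho T X)"] in auto)

lemma dt_zero_target:
  assumes "zero_object T Z" "X \<in> ob T"
      shows "dt X Z (sho T X) (zer T X Z) (zer T Z (sho T X)) ((- 1) \<odot> ide T (sho T X))"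
  using dt_rot[OF dt_id[OF assms]] assms by simp

text \<open>By \<open>TR3\<close> the triangle of the identity of \<open>X\<close> maps to the given
  one, and this factors \<open>v \<cdot> u\<close> through a zero object.\<close>

lemma dt_comp_zero:
  assumes d: "dt X Y Z u v w"
  shows "v \<cdot> u = zer T X Z"
proof -
  note D = dtD[OF d]
  obtain O' where O': "zero_object T O'" using ex_zero_object by blast
  obtain c where c: "arr T c" "dm T c = O'" "cd T c = Z" "v \<cdot> u = c \<cdot> zer T X O'"
    using TR3[OF dt_id[OF O' D(10)] d, of "ide T X" u] D by auto
  show ?thesis using c D zero_objectD(1)[OF O'] by simp
qed

lemma dt_comp_zero2: "dt X Y Z u v w \<Longrightarrow> w \<cdot> v = zer T Y (sho T X)"
  using dt_comp_zero[OF dt_rot] by blast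

lemma dt_comp_zero3: assumes "dt X Y Z u v w" shows "shm T u \<cdot> w = zer T Z (sho T Y)"
  using dt_comp_zero2[OF dt_rot[OF assms]] dtD[OF assms] smul_eq_zer[of "shm T u \<cdot> w" "- 1"] by simp

text \<open>Exactness of morphisms out of a fixed object \<open>W\<close>, the domain of
  \<open>y\<close>: \<open>TR3\<close> maps the triangle on \<open>W -> 0 -> W[1]\<close> to the
  rotated triangle, and the resulting arrow \<open>W[1] -> X[1]\<close> is the shift of the
  lift.\<close>

lemma dt_lift:
  assumes d: "dt X Y Z u v w" and y: "arr T y" "cd T y = Y" "v \<cdot> y = zer T (dm T y) Z"
  obtains x where "arr T x" "dm T x = dm T y" "cd T x = X" "u \<cdot> x = y"
proof -
  note D = dtD[OF d]
  obtain O' where O': "zero_object T O'" using ex_zero_object by blast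
  have O'o: "O' \<in> ob T" using zero_objectD(1)[OF O'] .
  obtain c where c: "arr T c" "dm T c = sho T (dm T y)" "cd T c = sho T X"
    "((- 1) \<odot> shm T u) \<cdot> c = shm T y \<cdot> ((- 1) \<odot> ide T (sho T (dm T y)))"
    using TR3[OF dt_zero_target[OF O', of "dm T y"] dt_rot[OF d], of y "zer T O' Z"] D y O'o by auto
  obtain x where x: "arr T x" "dm T x = dm T y" "cd T x = X" "c = shm T x"
    using shm_surj[OF c(1-3)] y D by auto
  have "(- 1) \<odot> (- 1) \<odot> shm T (u \<cdot> x) = (- 1) \<odot> (- 1) \<odot> shm T y"
    using c(4) x y D by simp
  then have "shm T (u \<cdot> x) = shm T y"
    using x y D by (simp del: shm_cmp)
  then show thesis using that[of x] x y D shm_inj[of "u \<cdot> x" y] by auto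
qed

lemma dt_lift2:
  assumes d: "dt X Y Z u v w" and y: "arr T y" "cd T y = Z" "w \<cdot> y = zer T (dm T y) (sho T X)"
  obtains x where "arr T x" "dm T x = dm T y" "cd T x = Y" "v \<cdot> x = y"
  using dt_lift[OF dt_rot[OF d] y] by blast

lemma dt_lift3:
  assumes d: "dt X Y Z u v w" and y: "arr T y" "cd T y = sho T X" "shm T u \<cdot> y = zer T (dm T y) (sho T Y)"
  obtains x where "arr T x" "dm T x = dm T y" "cd T x = Z" "w \<cdot> x = y"
  using dt_lift2[OF dt_rot[OF d] y(1,2)] y dtD[OF d] by auto

text \<open>Dual to \<open>dt_lift\<close>; here the given triangle is mapped by \<open>TR3\<close>
  to the one on \<open>0 -> W = W\<close>, where \<open>W\<close> is the codomain of
  \<open>y\<close>.\<close>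

lemma dt_extend:
  assumes d: "dt X Y Z u v w" and y: "arr T y" "dm T y = Y" "y \<cdot> u = zer T X (cd T y)"
  obtains x where "arr T x" "dm T x = Z" "cd T x = cd T y" "x \<cdot> v = y"
proof -
  note D = dtD[OF d]
  obtain O' where O': "zero_object T O'" using ex_zero_object by blast
  have O'o: "O' \<in> ob T" using zero_objectD(1)[OF O'] .
  have "\<exists>c\<in>hom T Z (cd T y). ide T (cd T y) \<cdot> y = c \<cdot> v \<and> zer T (cd T y) (sho T O') \<cdot> c = shm T (zer T X O') \<cdot> w"
    by (rule TR3[OF d dt_zero_source[OF O', of "cd T y"], of "zer T X O'" y]) (use D y O'o in simp_all)
  then obtain c where c: "arr T c" "dm T c = Z" "cd T c = cd T y" "ide T (cd T y) \<cdot> y = c \<cdot> v"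
    by (auto simp del: ide_cmp)
  show thesis by (rule that[OF c(1-3)]) (use c(4) y in simp)
qed

lemma dt_extend2:
  assumes d: "dt X Y Z u v w" and y: "arr T y" "dm T y = Z" "y \<cdot> v = zer T Y (cd T y)"
  obtains x where "arr T x" "dm T x = sho T X" "cd T x = cd T y" "x \<cdot> w = y"
  using dt_extend[OF dt_rot[OF d] y] by blast

lemma dt_lift_ex:
  assumes "dt X Y Z u v w" "arr T y" "dm T y = W"
  shows "cd T y = Y \<Longrightarrow> v \<cdot> y = zer T W Z \<Longrightarrow> \<exists>x. arr T x \<and> dm T x = W \<and> cd T x = X \<and> u \<cdot> x = y"
    "cd T y = Z \<Longrightarrow> w \<cdot> y = zer T W (sho T X) \<Longrightarrow> \<exists>x. arr T x \<and> dm T x = W \<and> cd T x = Y \<and> v \<cdot> x = y"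
    "cd T y = sho T X \<Longrightarrow> shm T u \<cdot> y = zer T W (sho T Y) \<Longrightarrow> \<exists>x. arr T x \<and> dm T x = W \<and> cd T x = Z \<and> w \<cdot> x = y"
  using dt_lift[OF assms(1,2)] dt_lift2[OF assms(1,2)] dt_lift3[OF assms(1,2)] assms(3) by metis+

text \<open>The part of the long exact sequence that the five lemma consumes. It is separated from
  distinguished triangles because a direct sum of two triangles is at first only known to be exact
  in this sense.\<close>

definition hom_exact where
  "hom_exact X Y Z u v w \<longleftrightarrow> triangle T X Y Z u v w \<and> v \<cdot> u = zer T X Z \<and> shm T u \<cdot> w = zer T Z (sho T Y) \<and>
     (\<forall>y. arr T y \<and> cd T y = Y \<and> v \<cdot> y = zer T (dm T y) Z \<longrightarrow> (\<exists>x. arr T x \<and> dm T x = dm T y \<and> cd T x = X \<and>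
         u \<cdot> x = y)) \<and>
     (\<forall>y. arr T y \<and> cd T y = Z \<and> w \<cdot> y = zer T (dm T y) (sho T X) \<longrightarrow> (\<exists>x. arr T x \<and> dm T x = dm T y \<and> cd T x = Y \<and>
         v \<cdot> x = y)) \<and>
     (\<forall>y. arr T y \<and> cd T y = sho T X \<and> shm T u \<cdot> y = zer T (dm T y) (sho T Y) \<longrightarrow> (\<exists>x. arr T x \<and> dm T x = dm T y \<and>
         cd T x = Z \<and> w \<cdot> x = y))"

lemma dt_hom_exact: assumes "dt X Y Z u v w" shows "hom_exact X Y Z u v w"
  unfolding hom_exact_def
proof (intro conjI allI impI; (elim conjE)?)
  show "triangle T X Y Z u v w" using assms by (simp add: dist_triangle_def)
qed (use dt_comp_zero[OF assms] dt_comp_zero3[OF assms]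
    dt_lift[OF assms] dt_lift2[OF assms] dt_lift3[OF assms] in metis)+

lemma hom_exactD:
  assumes "hom_exact X Y Z u v w"
  shows "arr T u" "dm T u = X" "cd T u = Y" "arr T v" "dm T v = Y" "cd T v = Z" "arr T w" "dm T w = Z"
      "cd T w = sho T X"
    "v \<cdot> u = zer T X Z" "shm T u \<cdot> w = zer T Z (sho T Y)" "X \<in> ob T" "Y \<in> ob T" "Z \<in> ob T"
proof -
  show "arr T u" "dm T u = X" "cd T u = Y" "arr T v" "dm T v = Y" "cd T v = Z" "arr T w" "dm T w = Z"
      "cd T w = sho T X"
    "v \<cdot> u = zer T X Z" "shm T u \<cdot> w = zer T Z (sho T Y)"
    using assms unfolding hom_exact_def triangle_iff by auto
  then show "X \<in> ob T" "Y \<in> ob T" "Z \<in> ob T" using dm_ob cd_ob by metis+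
qed

text \<open>The two halves of the usual diagram chase, carried out on arbitrary arrows into
  \<open>Z\<close> and \<open>Z'\<close>: the chase replaces elements by arrows from a common
  domain.\<close>

lemma five_lemma:
  assumes E: "hom_exact X Y Z u v w" and E': "hom_exact X' Y' Z' u' v' w'"
    and a: "isom T X X' a" and b: "isom T Y Y' b" and c: "arr T c" "dm T c = Z" "cd T c = Z'"
    and e: "u' \<cdot> a = b \<cdot> u" "v' \<cdot> b = c \<cdot> v" "w' \<cdot> c = shm T a \<cdot> w"
  shows "isom T Z Z' c"
proof -
  note D = hom_exactD[OF E] and D' = hom_exactD[OF E']
  note A = isomD[OF a] and B = isomD[OF b]
  obtain a' where a': "arr T a'" "dm T a' = X'" "cd T a' = X" "\<And>x. arr T x \<Longrightarrow> cd T x = X' \<Longrightarrow> a \<cdot> (a' \<cdot> x) = x"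
    using isomE[OF a] by metis
  obtain a1 where a1: "arr T a1" "dm T a1 = sho T X'" "cd T a1 = sho T X" "\<And>x. arr T x \<Longrightarrow> cd T x = sho T X'
      \<Longrightarrow> shm T a \<cdot> (a1 \<cdot> x) = x"
    using isomE[OF isom_shm[OF a]] by metis
  obtain b' where b': "arr T b'" "dm T b' = Y'" "cd T b' = Y" "\<And>x. arr T x \<Longrightarrow> cd T x = Y' \<Longrightarrow> b \<cdot> (b' \<cdot> x) = x"
    using isomE[OF b] by metis
  have e1: "u' \<cdot> (a \<cdot> x) = b \<cdot> (u \<cdot> x)" if "arr T x" "cd T x = X" for x
    using that arg_cong[OF e(1), of "\<lambda>y. y \<cdot> x"] D D' A B by simp
  have e2: "v' \<cdot> (b \<cdot> x) = c \<cdot> (v \<cdot> x)" if "arr T x" "cd T x = Y" for x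
    using that arg_cong[OF e(2), of "\<lambda>y. y \<cdot> x"] D D' A B c by simp
  have e3: "w' \<cdot> (c \<cdot> x) = shm T a \<cdot> (w \<cdot> x)" if "arr T x" "cd T x = Z" for x
    using that arg_cong[OF e(3), of "\<lambda>y. y \<cdot> x"] D D' A B c by simp
  have e4: "shm T u' \<cdot> (shm T a \<cdot> x) = shm T b \<cdot> (shm T u \<cdot> x)" if "arr T x" "cd T x = sho T X" for x
    using that arg_cong[OF e(1), of "\<lambda>y. shm T y \<cdot> x"] D D' A B by simp
  have inj: "x = zer T (dm T x) Z" if x: "arr T x" "cd T x = Z" "c \<cdot> x = zer T (dm T x) Z'" for x
  proof -
    have "shm T a \<cdot> (w \<cdot> x) = shm T a \<cdot> zer T (dm T x) (sho T X)"
      using e3[OF x(1,2)] x D D' A by simp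
    then have "w \<cdot> x = zer T (dm T x) (sho T X)"
      using isom_cancel_left[OF isom_shm[OF a], of "w \<cdot> x" "zer T (dm T x) (sho T X)"] x D by simp
    then obtain y where y: "arr T y" "dm T y = dm T x" "cd T y = Y" "v \<cdot> y = x"
      using E x unfolding hom_exact_def by metis
    have "v' \<cdot> (b \<cdot> y) = zer T (dm T x) Z'" using e2[OF y(1,3)] y x by simp
    then obtain t where t: "arr T t" "dm T t = dm T x" "cd T t = X'" "u' \<cdot> t = b \<cdot> y"
      using E' y B unfolding hom_exact_def by (metis cmp_simps)
    have "b \<cdot> (u \<cdot> (a' \<cdot> t)) = b \<cdot> y" using e1[of "a' \<cdot> t"] t a' by simp
    then have "u \<cdot> (a' \<cdot> t) = y" using isom_cancel_left[OF b, of "u \<cdot> (a' \<cdot> t)" y] t a' y D by simp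
    then have "x = (v \<cdot> u) \<cdot> (a' \<cdot> t)" using y(4) t a' D(1-9) by simp
    also have "\<dots> = zer T (dm T x) Z" unfolding D(10) using t a' D(12-14) by simp
    finally show ?thesis .
  qed
  have surj: "\<exists>z. arr T z \<and> dm T z = dm T z' \<and> cd T z = Z \<and> c \<cdot> z = z'" if z': "arr T z'" "cd T z' = Z'" for z'
  proof -
    define t where "t = a1 \<cdot> (w' \<cdot> z')"
    have t: "arr T t" "dm T t = dm T z'" "cd T t = sho T X" "shm T a \<cdot> t = w' \<cdot> z'" unfolding t_def using a1 D' z'
        by simp_all
    have "shm T b \<cdot> (shm T u \<cdot> t) = (shm T u' \<cdot> w') \<cdot> z'" using e4[of t] t D'(1-9) z' by simp
    also have "\<dots> = shm T b \<cdot> zer T (dm T z') (sho T Y)" unfolding D'(11) using z' D' B by simp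
    finally have "shm T u \<cdot> t = zer T (dm T z') (sho T Y)"
      using isom_cancel_left[OF isom_shm[OF b], of "shm T u \<cdot> t" "zer T (dm T z') (sho T Y)"] t D z' by simp
    then obtain z where z: "arr T z" "dm T z = dm T z'" "cd T z = Z" "w \<cdot> z = t"
      using E t unfolding hom_exact_def by metis
    have "w' \<cdot> (c \<cdot> z) = w' \<cdot> z'" using e3[OF z(1,3)] z t by simp
    then have wz: "w' \<cdot> (z' \<oplus> (- 1) \<odot> (c \<cdot> z)) = zer T (dm T z') (sho T X')" using z z' c D' by simp
    define d where "d = z' \<oplus> (- 1) \<odot> (c \<cdot> z)"
    have d: "arr T d" "dm T d = dm T z'" "cd T d = Z'" "w' \<cdot> d = zer T (dm T d) (sho T X')"
      using wz z z' c unfolding d_def by simp_all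
    obtain y' where y': "arr T y'" "dm T y' = dm T z'" "cd T y' = Y'" "v' \<cdot> y' = z' \<oplus> (- 1) \<odot> (c \<cdot> z)"
      using E' d unfolding hom_exact_def d_def[symmetric] by metis
    have "c \<cdot> (v \<cdot> (b' \<cdot> y')) = z' \<oplus> (- 1) \<odot> (c \<cdot> z)" using e2[of "b' \<cdot> y'"] y' b' by simp
    then have "c \<cdot> (v \<cdot> (b' \<cdot> y') \<oplus> z) = (z' \<oplus> (- 1) \<odot> (c \<cdot> z)) \<oplus> c \<cdot> z" using y' b' z D c by simp
    also have "\<dots> = z'" using z z' c by simp
    finally show ?thesis using y' b' z D by (intro exI[of _ "v \<cdot> (b' \<cdot> y') \<oplus> z"]) simp
  qed
  obtain z where z: "arr T z" "dm T z = Z'" "cd T z = Z" "c \<cdot> z = ide T Z'"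
    using surj[of "ide T Z'"] D' by auto
  \<comment> \<open>A right inverse \<open>z\<close> of \<open>c\<close> comes from surjectivity. It
    is also a left inverse, since \<open>c\<close> kills \<open>z c - 1\<close> and is injective on
    arrows.\<close>
  have "c \<cdot> (z \<cdot> c \<oplus> (- 1) \<odot> ide T Z) = (c \<cdot> z) \<cdot> c \<oplus> (- 1) \<odot> c" using z(1-3) c D by simp
  also have "\<dots> = zer T Z Z'" unfolding z(4) using c D' by simp
  finally have "z \<cdot> c \<oplus> (- 1) \<odot> ide T Z = zer T Z Z"
    using inj[of "z \<cdot> c \<oplus> (- 1) \<odot> ide T Z"] z c D by simp
  then have "z \<cdot> c = ide T Z" using add_neg_eq_zer[of "z \<cdot> c" "ide T Z"] z c D by simp
  then show ?thesis using z c by (intro isomI[of _ z]) auto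
qed

lemma dt_iso_extend:
  assumes d: "dt X Y Z u v w" "dt X' Y' Z' u' v' w'" and a: "isom T X X' a" and b: "isom T Y Y' b"
      and e: "u' \<cdot> a = b \<cdot> u"
  obtains c where "isom T Z Z' c" "v' \<cdot> b = c \<cdot> v" "w' \<cdot> c = shm T a \<cdot> w"
proof -
  have "\<exists>c\<in>hom T Z Z'. v' \<cdot> b = c \<cdot> v \<and> w' \<cdot> c = shm T a \<cdot> w"
    by (rule TR3[OF d _ _ e]) (use isomD[OF a] isomD[OF b] in simp_all)
  then obtain c where c: "arr T c" "dm T c = Z" "cd T c = Z'" "v' \<cdot> b = c \<cdot> v" "w' \<cdot> c = shm T a \<cdot> w"
    by auto
  show thesis using that[OF five_lemma[OF dt_hom_exact[OF d(1)] dt_hom_exact[OF d(2)] a b c(1-3) e c(4,5)] c(4,5)] .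
qed

lemma dt_unique:
  assumes d: "dt X Y Z u v w" "dt X Y Z' u v' w'"
  obtains c where "isom T Z Z' c" "c \<cdot> v = v'" "w' \<cdot> c = w"
  using dt_iso_extend[OF d isom_ide isom_ide] dtD[OF d(1)] dtD[OF d(2)] by simp metis

subsection \<open>Direct sums of triangles\<close>

text \<open>The componentwise sum is exact because both summands are. The cone of its first map
  receives \<open>Z1\<close> and \<open>Z2\<close> by \<open>TR3\<close>, and the map from
  \<open>Z\<close> assembled from these two is invertible by the five lemma.\<close>

lemma dt_sum:
  assumes d1: "dt X1 Y1 Z1 u1 v1 w1" and d2: "dt X2 Y2 Z2 u2 v2 w2"
    and bX: "biproduct T X1 X2 X i1 i2 p1 p2" and bY: "biproduct T Y1 Y2 Y j1 j2 q1 q2"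
        and bZ: "biproduct T Z1 Z2 Z k1 k2 r1 r2"
  shows "dt X Y Z (j1 \<cdot> (u1 \<cdot> p1) \<oplus> j2 \<cdot> (u2 \<cdot> p2)) (k1 \<cdot> (v1 \<cdot> q1) \<oplus> k2 \<cdot> (v2 \<cdot> q2))
     (shm T i1 \<cdot> (w1 \<cdot> r1) \<oplus> shm T i2 \<cdot> (w2 \<cdot> r2))" (is "dt X Y Z ?u ?v ?w")
proof -
  note D1 = dtD[OF d1] and D2 = dtD[OF d2] and B1 = biproductD[OF bX] and B2 = biproductD[OF bY]
      and B3 = biproductD[OF bZ]
    and B4 = biproductD[OF biproduct_shm[OF bX]] and B5 = biproductD[OF biproduct_shm[OF bY]]
  note C1 = dt_comp_zero[OF d1] dt_comp_zero[OF d2] dt_comp_zero3[OF d1] dt_comp_zero3[OF d2]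
  have z1: "v1 \<cdot> (u1 \<cdot> x) = zer T (dm T x) Z1" if "arr T x" "cd T x = X1" for x
    using cmp_eq[OF C1(1)] that D1 by simp
  have z2: "v2 \<cdot> (u2 \<cdot> x) = zer T (dm T x) Z2" if "arr T x" "cd T x = X2" for x
    using cmp_eq[OF C1(2)] that D2 by simp
  have z3: "shm T u1 \<cdot> (w1 \<cdot> x) = zer T (dm T x) (sho T Y1)" if "arr T x" "cd T x = Z1" for x
    using cmp_eq[OF C1(3)] that D1 by simp
  have z4: "shm T u2 \<cdot> (w2 \<cdot> x) = zer T (dm T x) (sho T Y2)" if "arr T x" "cd T x = Z2" for x
    using cmp_eq[OF C1(4)] that D2 by simp
  note [simp] = D1 D2 B1 B2 B3 B4 B5
  have Eq: "hom_exact X Y Z ?u ?v ?w" unfolding hom_exact_def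
  proof (intro conjI allI impI; (elim conjE)?)
    show "triangle T X Y Z ?u ?v ?w" by (simp add: triangle_iff)
    show "?v \<cdot> ?u = zer T X Z" using z1 z2 by simp
    show "shm T ?u \<cdot> ?w = zer T Z (sho T Y)" using z3 z4 by simp
  next
    fix y assume y: "arr T y" "cd T y = Y" "?v \<cdot> y = zer T (dm T y) Z"
    have "v1 \<cdot> (q1 \<cdot> y) = r1 \<cdot> (?v \<cdot> y)" "v2 \<cdot> (q2 \<cdot> y) = r2 \<cdot> (?v \<cdot> y)" using y(1,2) by simp_all
    then have v: "v1 \<cdot> (q1 \<cdot> y) = zer T (dm T y) Z1" "v2 \<cdot> (q2 \<cdot> y) = zer T (dm T y) Z2" unfolding y(3) using y(1,2)
        by simp_all
    have "arr T (q1 \<cdot> y)" "dm T (q1 \<cdot> y) = dm T y" "cd T (q1 \<cdot> y) = Y1" using y(1,2) by simp_all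
    then obtain x1 where x1: "arr T x1" "dm T x1 = dm T y" "cd T x1 = X1" "u1 \<cdot> x1 = q1 \<cdot> y"
      using dt_lift_ex(1)[OF d1 _ _ _ v(1)] by blast
    have "arr T (q2 \<cdot> y)" "dm T (q2 \<cdot> y) = dm T y" "cd T (q2 \<cdot> y) = Y2" using y(1,2) by simp_all
    then obtain x2 where x2: "arr T x2" "dm T x2 = dm T y" "cd T x2 = X2" "u2 \<cdot> x2 = q2 \<cdot> y"
      using dt_lift_ex(1)[OF d2 _ _ _ v(2)] by blast
    have x: "arr T (i1 \<cdot> x1 \<oplus> i2 \<cdot> x2)" "dm T (i1 \<cdot> x1 \<oplus> i2 \<cdot> x2) = dm T y" "cd T (i1 \<cdot> x1 \<oplus> i2 \<cdot> x2) = X"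
        using x1(1-3) x2(1-3) by simp_all
    have "?u \<cdot> (i1 \<cdot> x1 \<oplus> i2 \<cdot> x2) = j1 \<cdot> (q1 \<cdot> y) \<oplus> j2 \<cdot> (q2 \<cdot> y)" using x1 x2 y(1,2) by simp
    also have "\<dots> = y" using biproduct_into[OF bY y(1,2)] .
    finally show "\<exists>x. arr T x \<and> dm T x = dm T y \<and> cd T x = X \<and> ?u \<cdot> x = y" using x by blast
  next
    fix y assume y: "arr T y" "cd T y = Z" "?w \<cdot> y = zer T (dm T y) (sho T X)"
    have "w1 \<cdot> (r1 \<cdot> y) = shm T p1 \<cdot> (?w \<cdot> y)" "w2 \<cdot> (r2 \<cdot> y) = shm T p2 \<cdot> (?w \<cdot> y)" using y(1,2) by simp_all
    then have v: "w1 \<cdot> (r1 \<cdot> y) = zer T (dm T y) (sho T X1)" "w2 \<cdot> (r2 \<cdot> y) = zer T (dm T y) (sho T X2)"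
        unfolding y(3) using y(1,2) by simp_all
    have "arr T (r1 \<cdot> y)" "dm T (r1 \<cdot> y) = dm T y" "cd T (r1 \<cdot> y) = Z1" using y(1,2) by simp_all
    then obtain x1 where x1: "arr T x1" "dm T x1 = dm T y" "cd T x1 = Y1" "v1 \<cdot> x1 = r1 \<cdot> y"
      using dt_lift_ex(2)[OF d1 _ _ _ v(1)] by blast
    have "arr T (r2 \<cdot> y)" "dm T (r2 \<cdot> y) = dm T y" "cd T (r2 \<cdot> y) = Z2" using y(1,2) by simp_all
    then obtain x2 where x2: "arr T x2" "dm T x2 = dm T y" "cd T x2 = Y2" "v2 \<cdot> x2 = r2 \<cdot> y"
      using dt_lift_ex(2)[OF d2 _ _ _ v(2)] by blast
    have x: "arr T (j1 \<cdot> x1 \<oplus> j2 \<cdot> x2)" "dm T (j1 \<cdot> x1 \<oplus> j2 \<cdot> x2) = dm T y" "cd T (j1 \<cdot> x1 \<oplus> j2 \<cdot> x2) = Y"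
        using x1(1-3) x2(1-3) by simp_all
    have "?v \<cdot> (j1 \<cdot> x1 \<oplus> j2 \<cdot> x2) = k1 \<cdot> (r1 \<cdot> y) \<oplus> k2 \<cdot> (r2 \<cdot> y)" using x1 x2 y(1,2) by simp
    also have "\<dots> = y" using biproduct_into[OF bZ y(1,2)] .
    finally show "\<exists>x. arr T x \<and> dm T x = dm T y \<and> cd T x = Y \<and> ?v \<cdot> x = y" using x by blast
  next
    fix y assume y: "arr T y" "cd T y = sho T X" "shm T ?u \<cdot> y = zer T (dm T y) (sho T Y)"
    have "shm T u1 \<cdot> (shm T p1 \<cdot> y) = shm T q1 \<cdot> (shm T ?u \<cdot> y)" "shm T u2 \<cdot> (shm T p2 \<cdot> y)
        = shm T q2 \<cdot> (shm T ?u \<cdot> y)" using y(1,2) by simp_all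
    then have v: "shm T u1 \<cdot> (shm T p1 \<cdot> y) = zer T (dm T y) (sho T Y1)" "shm T u2 \<cdot> (shm T p2 \<cdot> y)
        = zer T (dm T y) (sho T Y2)" unfolding y(3) using y(1,2) by simp_all
    have "arr T (shm T p1 \<cdot> y)" "dm T (shm T p1 \<cdot> y) = dm T y" "cd T (shm T p1 \<cdot> y) = sho T X1" using y(1,2)
        by simp_all
    then obtain x1 where x1: "arr T x1" "dm T x1 = dm T y" "cd T x1 = Z1" "w1 \<cdot> x1 = shm T p1 \<cdot> y"
      using dt_lift_ex(3)[OF d1 _ _ _ v(1)] by blast
    have "arr T (shm T p2 \<cdot> y)" "dm T (shm T p2 \<cdot> y) = dm T y" "cd T (shm T p2 \<cdot> y) = sho T X2" using y(1,2)
        by simp_all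
    then obtain x2 where x2: "arr T x2" "dm T x2 = dm T y" "cd T x2 = Z2" "w2 \<cdot> x2 = shm T p2 \<cdot> y"
      using dt_lift_ex(3)[OF d2 _ _ _ v(2)] by blast
    have x: "arr T (k1 \<cdot> x1 \<oplus> k2 \<cdot> x2)" "dm T (k1 \<cdot> x1 \<oplus> k2 \<cdot> x2) = dm T y" "cd T (k1 \<cdot> x1 \<oplus> k2 \<cdot> x2) = Z"
        using x1(1-3) x2(1-3) by simp_all
    have "?w \<cdot> (k1 \<cdot> x1 \<oplus> k2 \<cdot> x2) = shm T i1 \<cdot> (shm T p1 \<cdot> y) \<oplus> shm T i2 \<cdot> (shm T p2 \<cdot> y)" using x1 x2 y(1,2)
        by simp
    also have "\<dots> = y" using biproduct_into[OF biproduct_shm[OF bX] y(1,2)] .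
    finally show "\<exists>x. arr T x \<and> dm T x = dm T y \<and> cd T x = Z \<and> ?w \<cdot> x = y" using x by blast
  qed
  have "?u \<in> hom T X Y" by simp
  then obtain Z' v' w' where d: "dt X Y Z' ?u v' w'" using TR1_cone by blast
  note D = dtD[OF d]
  have "\<exists>c\<in>hom T Z1 Z'. v' \<cdot> j1 = c \<cdot> v1 \<and> w' \<cdot> c = shm T i1 \<cdot> w1"
    by (rule TR3[OF d1 d]) simp_all
  then obtain c1 where c1: "arr T c1" "dm T c1 = Z1" "cd T c1 = Z'" "v' \<cdot> j1 = c1 \<cdot> v1" "w' \<cdot> c1 = shm T i1 \<cdot> w1"
    by auto
  have "\<exists>c\<in>hom T Z2 Z'. v' \<cdot> j2 = c \<cdot> v2 \<and> w' \<cdot> c = shm T i2 \<cdot> w2"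
    by (rule TR3[OF d2 d]) simp_all
  then obtain c2 where c2: "arr T c2" "dm T c2 = Z2" "cd T c2 = Z'" "v' \<cdot> j2 = c2 \<cdot> v2" "w' \<cdot> c2 = shm T i2 \<cdot> w2"
    by auto
  let ?c = "c1 \<cdot> r1 \<oplus> c2 \<cdot> r2"
  have "(?c \<cdot> ?v) \<cdot> j1 = v' \<cdot> j1" "(?c \<cdot> ?v) \<cdot> j2 = v' \<cdot> j2" unfolding c1(4) c2(4) using c1(1-3) c2(1-3) D(1-12)
      by simp_all
  then have cv: "?c \<cdot> ?v = v'" using biproduct_eq_out[OF bY, of "?c \<cdot> ?v" v'] c1(1-3) c2(1-3) D(1-12) by simp
  have "(w' \<cdot> ?c) = (w' \<cdot> c1) \<cdot> r1 \<oplus> (w' \<cdot> c2) \<cdot> r2" using c1(1-3) c2(1-3) D(1-12) by simp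
  then have wc: "w' \<cdot> ?c = ?w" unfolding c1(5) c2(5) by simp
  define c where "c = ?c"
  have c [simp]: "arr T c" "dm T c = Z" "cd T c = Z'" unfolding c_def using c1(1-3) c2(1-3) D(1-12) by simp_all
  have ci: "isom T Z Z' c"
    by (rule five_lemma[OF Eq dt_hom_exact[OF d], of "ide T X" "ide T Y"]) (use cv wc D in \<open>simp_all add:
        c_def[symmetric]\<close>)
  obtain c' where c': "isom T Z' Z c'" "arr T c'" "dm T c' = Z'" "cd T c' = Z" "c \<cdot> c' = ide T Z'"
     "\<And>x. arr T x \<Longrightarrow> cd T x = Z \<Longrightarrow> c' \<cdot> (c \<cdot> x) = x"
    using isomE[OF ci] by metis
  have cv': "c' \<cdot> v' = ?v" using c'(6)[of ?v] unfolding cv[folded c_def] by simp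
  have "?w \<cdot> c' = w' \<cdot> (c \<cdot> c')" unfolding wc[folded c_def, symmetric] using c' D(1-12) by simp
  then have wc': "?w \<cdot> c' = w'" unfolding c'(5) using D by simp
  have ids: "isom T X X (ide T X)" "isom T Y Y (ide T Y)" by auto
  show ?thesis
    by (rule TR1_iso[OF d _ ids c'(1)]) (use cv' wc' D in \<open>simp_all add: triangle_iff\<close>)
qed

text \<open>The split triangle is the direct sum of the triangles on \<open>X = X -> 0\<close> and
  \<open>0 -> Y = Y\<close>.\<close>

lemma dt_split:
  assumes b: "biproduct T X Y P i j p q"
  shows "dt X P Y i q (zer T Y (sho T X))"
proof -
  note B = biproductD[OF b]
  obtain Z where Z: "zero_object T Z" using ex_zero_object by blast
  note Zo = zero_objectD(1)[OF Z]
  obtain p1 where p1: "biproduct T Z X X (zer T Z X) (ide T X) (zer T X Z) p1" "p1 \<cdot> ide T X = ide T X" "arr T p1"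
      "dm T p1 = X"
    using biproduct_zero_left[OF Z isom_ide[OF B(13)]] by metis
  obtain p2 where p2: "biproduct T Z Y Y (zer T Z Y) (ide T Y) (zer T Y Z) p2" "p2 \<cdot> ide T Y = ide T Y" "arr T p2"
      "dm T p2 = Y"
    using biproduct_zero_left[OF Z isom_ide[OF B(14)]] by metis
  have e: "p1 = ide T X" "p2 = ide T Y" using p1 p2 by simp_all
  show ?thesis
    using dt_sum[OF dt_id[OF Z B(13)] dt_zero_source[OF Z B(14)]
        biproduct_swap[OF p1(1)] b p2(1)] B Zo zero_objectD(1)[OF zero_object_shm[OF Z]]
    by (simp add: e)
qed

end


section \<open>The mesh category of an octahedron\<close>

text \<open>
  The six objects of an octahedron and their shifts are indexed by \<open>vertex \<times> int\<close>.  Between two of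
  them there is at most one composite of edges that is not forced to vanish; \<open>deg v w\<close> is the
  degree of the one from \<open>v\<close> to \<open>w\<close>.
\<close>

datatype vertex = VA | VB | VC | VD | VE | VF

fun deg :: "vertex \<Rightarrow> vertex \<Rightarrow> int option" where
  "deg VA VA = Some 0" | "deg VA VB = Some 0" | "deg VA VC = Some 0"
| "deg VB VB = Some 0" | "deg VB VC = Some 0" | "deg VB VD = Some 0" | "deg VB VE = Some 0"
| "deg VC VC = Some 0" | "deg VC VE = Some 0" | "deg VC VF = Some 0"
| "deg VD VD = Some 0" | "deg VD VE = Some 0" | "deg VD VA = Some 1"
| "deg VE VE = Some 0" | "deg VE VF = Some 0" | "deg VE VA = Some 1" | "deg VE VB = Some 1"
| "deg VF VF = Some 0" | "deg VF VB = Some 1" | "deg VF VD = Some 1"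
| "deg _ _ = None"

fun vob :: "('o, 'a) octa \<Rightarrow> vertex \<Rightarrow> 'o" where
  "vob X VA = oA X" | "vob X VB = oB X" | "vob X VC = oC X"
| "vob X VD = oD X" | "vob X VE = oE X" | "vob X VF = oF X"

text \<open>The last clause provides the identities on the diagonal, so that they are edges of
  degree 0 like the others.\<close>

fun edge :: "('o, 'a, 'k) tri_cat \<Rightarrow> ('o, 'a) octa \<Rightarrow> vertex \<Rightarrow> vertex \<Rightarrow> 'a" where
  "edge T X VA VB = mf X" | "edge T X VA VC = mh X"
| "edge T X VB VC = mg X" | "edge T X VB VD = mf1 X" | "edge T X VB VE = ml X"
| "edge T X VC VE = mh1 X" | "edge T X VC VF = mg1 X"
| "edge T X VD VE = mk X" | "edge T X VD VA = mf2 X"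
| "edge T X VE VF = mk1 X" | "edge T X VE VA = mh2 X" | "edge T X VE VB = ml1 X"
| "edge T X VF VB = mg2 X" | "edge T X VF VD = mk2 X"
| "edge T X v _ = ide T (vob X v)"

text \<open>This relation is not transitive: \<open>VA\<close> and \<open>VB\<close>, as well as
  \<open>VB\<close> and \<open>VD\<close>, are related in equal degree, but \<open>VA\<close> and
  \<open>VD\<close> are not, in accordance with the vanishing of \<open>f' f\<close>.\<close>

definition pre :: "vertex \<times> int \<Rightarrow> vertex \<times> int \<Rightarrow> bool" where
  "pre p q \<longleftrightarrow> deg (fst p) (fst q) = Some (snd q - snd p)"

definition gob :: "('o, 'a, 'k) tri_cat \<Rightarrow> ('o, 'a) octa \<Rightarrow> vertex \<times> int \<Rightarrow> 'o" where
  "gob T X p = shift_ob T (snd p) (vob X (fst p))"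

text \<open>The value zero off \<open>pre\<close> makes the law
  \<open>b q r \<cdot> b p q = b p r\<close> cover vanishing composites of edges as well.\<close>

definition gmor :: "('o, 'a, 'k) tri_cat \<Rightarrow> ('o, 'a) octa \<Rightarrow> vertex \<times> int \<Rightarrow> vertex \<times> int \<Rightarrow> 'a" where
  "gmor T X p q = (if pre p q then sh T (snd p) (edge T X (fst p) (fst q)) else zer T (gob T X p) (gob T X q))"

definition up :: "vertex \<times> int \<Rightarrow> vertex \<times> int" where "up p = (fst p, snd p + 1)"

definition down :: "vertex \<times> int \<Rightarrow> vertex \<times> int" where "down p = (fst p, snd p - 1)"

lemma up_down [simp]: "up (down p) = p" "down (up p) = p" "up (v, m) = (v, m + 1)"
  "pre (up p) (up q) = pre p q" "pre (down p) (down q) = pre p q"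
  by (simp_all add: up_def down_def pre_def)

lemma pre_refl [simp]: "pre p p"
  by (cases p; cases "fst p") (auto simp: pre_def)

locale octahedron_in = triangulated_category T for T :: "('o, 'a, 'k :: field) tri_cat" (structure) +
  fixes X :: "('o, 'a) octa"
  assumes octahedron: "octahedron T X"
begin

abbreviation "P \<equiv> gob T X"
abbreviation "b \<equiv> gmor T X"

lemma dt_f: "dt (oA X) (oB X) (oD X) (mf X) (mf1 X) (mf2 X)"
  and dt_h: "dt (oA X) (oC X) (oE X) (mh X) (mh1 X) (mh2 X)"
  and dt_g: "dt (oB X) (oC X) (oF X) (mg X) (mg1 X) (mg2 X)"
  and dt_k: "dt (oD X) (oE X) (oF X) (mk X) (mk1 X) (mk2 X)"
  and edge_eqs: "mh X = mg X \<cdot> mf X" "mk2 X = shm T (mf1 X) \<cdot> mg2 X" "mf2 X = mh2 X \<cdot> mk X"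
    "mg1 X = mk1 X \<cdot> mh1 X" "ml X = mh1 X \<cdot> mg X" "ml X = mk X \<cdot> mf1 X"
    "ml1 X = shm T (mf X) \<cdot> mh2 X" "ml1 X = mg2 X \<cdot> mk1 X"
  and edge_l: "arr T (ml X)" "dm T (ml X) = oB X" "cd T (ml X) = oE X"
    "arr T (ml1 X)" "dm T (ml1 X) = oE X" "cd T (ml1 X) = sho T (oB X)"
  using octahedron unfolding octahedron_def by auto

lemmas edge_homs [simp] = dtD(1-12)[OF dt_f] dtD(1-12)[OF dt_h] dtD(1-12)[OF dt_g] dtD(1-12)[OF dt_k] edge_l

lemma vob_ob [simp]: "vob X v \<in> ob T"
  by (cases v) simp_all

lemma edge_hom:
  assumes "deg v w = Some d"
  shows "arr T (edge T X v w)" "dm T (edge T X v w) = vob X v" "cd T (edge T X v w) = shift_ob T d (vob X w)"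
  using assms by (induct v w rule: deg.induct) auto

lemma gob_ob [simp]: "P p \<in> ob T"
  by (simp add: gob_def)

lemma gmor_hom [simp]: "arr T (b p q)" "dm T (b p q) = P p" "cd T (b p q) = P q"
proof -
  have "arr T (b p q) \<and> dm T (b p q) = P p \<and> cd T (b p q) = P q"
  proof (cases "pre p q")
    case True
    have "cd T (sh T (snd p) (edge T X (fst p) (fst q))) = shift_ob T (snd p + (snd q - snd p)) (vob X (fst q))"
      unfolding shift_ob_add[OF vob_ob] using True edge_hom[of "fst p" "fst q" "snd q - snd p"]
          by (simp add: pre_def)
    then show ?thesis using True edge_hom[of "fst p" "fst q" "snd q - snd p"]
        by (simp add: pre_def gmor_def gob_def)
  qed (simp add: gmor_def)
  then show "arr T (b p q)" "dm T (b p q) = P p" "cd T (b p q) = P q" by auto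
qed

lemma gmor_not_pre: "\<not> pre p q \<Longrightarrow> b p q = zer T (P p) (P q)"
  by (simp add: gmor_def)

lemma gmor_refl [simp]: "b p p = ide T (P p)"
proof -
  have "edge T X v v = ide T (vob X v)" for v by (cases v) simp_all
  then show ?thesis by (simp add: gmor_def gob_def)
qed

lemma shm_gob [simp]: "sho T (P p) = P (up p)"
  by (simp add: gob_def up_def shift_ob_succ)

lemma shm_gmor [simp]: "shm T (b p q) = b (up p) (up q)"
proof (cases "pre p q")
  case True
  then show ?thesis using edge_hom[of "fst p" "fst q" "snd q - snd p"]
    by (simp add: gmor_def pre_def sh_succ up_def)
qed (simp add: gmor_def)

text \<open>Consecutive morphisms of the four faces compose to zero; these relations are put in the
  form in which composites are normalised below.\<close>

lemma edge_zero:
  "mf1 X \<cdot> mf X = zer T (oA X) (oD X)" "mh2 X \<cdot> (mk X \<cdot> mf1 X) = zer T (oB X) (sho T (oA X))"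
  "mh2 X \<cdot> mh1 X = zer T (oC X) (sho T (oA X))" "mg2 X \<cdot> (mk1 X \<cdot> mh1 X) = zer T (oC X) (sho T (oB X))"
  "shm T (mg X) \<cdot> mg2 X = zer T (oF X) (sho T (oC X))" "mk1 X \<cdot> mk X = zer T (oD X) (oF X)"
  "shm T (mf1 X) \<cdot> (mg2 X \<cdot> mk1 X) = zer T (oE X) (sho T (oD X))"
  "shm T (mk X) \<cdot> (shm T (mf1 X) \<cdot> mg2 X) = zer T (oF X) (sho T (oE X))"
proof -
  have "mf2 X \<cdot> mf1 X = mh2 X \<cdot> (mk X \<cdot> mf1 X)" "mg2 X \<cdot> mg1 X = mg2 X \<cdot> (mk1 X \<cdot> mh1 X)"
    "mk2 X \<cdot> mk1 X = shm T (mf1 X) \<cdot> (mg2 X \<cdot> mk1 X)" unfolding edge_eqs(2,3,4) by simp_all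
  then show "mf1 X \<cdot> mf X = zer T (oA X) (oD X)" "mh2 X \<cdot> (mk X \<cdot> mf1 X) = zer T (oB X) (sho T (oA X))"
  "mh2 X \<cdot> mh1 X = zer T (oC X) (sho T (oA X))" "mg2 X \<cdot> (mk1 X \<cdot> mh1 X) = zer T (oC X) (sho T (oB X))"
  "shm T (mg X) \<cdot> mg2 X = zer T (oF X) (sho T (oC X))" "mk1 X \<cdot> mk X = zer T (oD X) (oF X)"
  "shm T (mf1 X) \<cdot> (mg2 X \<cdot> mk1 X) = zer T (oE X) (sho T (oD X))"
  "shm T (mk X) \<cdot> (shm T (mf1 X) \<cdot> mg2 X) = zer T (oF X) (sho T (oE X))"
    using dt_comp_zero[OF dt_f] dt_comp_zero2[OF dt_f] dt_comp_zero2[OF dt_h] dt_comp_zero3[OF dt_g] dt_comp_zero2[OF dt_g]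
     dt_comp_zero[OF dt_k] dt_comp_zero2[OF dt_k] dt_comp_zero3[OF dt_k] unfolding edge_eqs(2) by auto
qed

text \<open>
  Normal forms: composites are expressed by the edges other than \<open>f''\<close>, \<open>g'\<close>, \<open>h\<close>, \<open>k''\<close>, \<open>l\<close>, \<open>l'\<close>, with the
  two commutative squares oriented as \<open>h' g = k f'\<close> and \<open>f[1] h'' = g'' k'\<close>.
\<close>

lemma edge_cmp:
  assumes "deg v w = Some d" "deg w z = Some e"
  shows "sh T d (edge T X w z) \<cdot> edge T X v w = (if deg v z = Some (d + e) then edge T X v z
    else zer T (vob X v) (shift_ob T (d + e) (vob X z)))"
proof -
  have [simp]: "shift_ob T 2 Y = sho T (sho T Y)" if "Y \<in> ob T" for Y
    using shift_ob_succ[of Y 1] that by simp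
  have sq: "mh1 X \<cdot> mg X = mk X \<cdot> mf1 X" "shm T (mf X) \<cdot> mh2 X = mg2 X \<cdot> mk1 X"
    using edge_eqs by simp_all
  have sq': "\<And>x. arr T x \<Longrightarrow> cd T x = oB X \<Longrightarrow> mh1 X \<cdot> (mg X \<cdot> x) = mk X \<cdot> (mf1 X \<cdot> x)"
    "\<And>x. arr T x \<Longrightarrow> cd T x = oE X \<Longrightarrow> shm T (mf X) \<cdot> (mh2 X \<cdot> x) = mg2 X \<cdot> (mk1 X \<cdot> x)"
    using cmp_eq[OF sq(1)] cmp_eq[OF sq(2)] by simp_all
  note sq'' = sq'(1)[of "shm T _", simplified]
  note ss = arg_cong[OF sq(1), of "shm T", simplified]
  have z': "\<And>x. arr T x \<Longrightarrow> cd T x = oA X \<Longrightarrow> mf1 X \<cdot> (mf X \<cdot> x) = zer T (dm T x) (oD X)"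
    "\<And>x. arr T x \<Longrightarrow> cd T x = oB X \<Longrightarrow> mh2 X \<cdot> (mk X \<cdot> (mf1 X \<cdot> x)) = zer T (dm T x) (sho T (oA X))"
    "\<And>x. arr T x \<Longrightarrow> cd T x = oC X \<Longrightarrow> mh2 X \<cdot> (mh1 X \<cdot> x) = zer T (dm T x) (sho T (oA X))"
    "\<And>x. arr T x \<Longrightarrow> cd T x = oC X \<Longrightarrow> mg2 X \<cdot> (mk1 X \<cdot> (mh1 X \<cdot> x)) = zer T (dm T x) (sho T (oB X))"
    "\<And>x. arr T x \<Longrightarrow> cd T x = oF X \<Longrightarrow> shm T (mg X) \<cdot> (mg2 X \<cdot> x) = zer T (dm T x) (sho T (oC X))"
    "\<And>x. arr T x \<Longrightarrow> cd T x = oD X \<Longrightarrow> mk1 X \<cdot> (mk X \<cdot> x) = zer T (dm T x) (oF X)"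
    using cmp_eq[OF edge_zero(1)] cmp_eq[OF edge_zero(2)] cmp_eq[OF edge_zero(3)] cmp_eq[OF edge_zero(4)]
      cmp_eq[OF edge_zero(5)] cmp_eq[OF edge_zero(6)] by simp_all
  have z1: "shm T (mk X) \<cdot> (shm T (mf1 X) \<cdot> (mg2 X \<cdot> mk1 X)) = zer T (oE X) (sho T (oE X))"
    "shm T (mf1 X) \<cdot> (shm T (mf X) \<cdot> x) = zer T (dm T x) (sho T (oD X))" if "arr T x" "cd T x = sho T (oA X)" for x
    using edge_zero(7) cmp_eq[OF arg_cong[OF edge_zero(1), of "shm T", simplified], of x] that by simp_all
  have z2: "shm T (mh2 X) \<cdot> (shm T (mk X) \<cdot> (shm T (mf1 X) \<cdot> mg2 X)) = zer T (oF X) (sho T (sho T (oA X)))"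
    using edge_zero(8) by simp
  note e = edge_eqs(1-4) edge_eqs(6) edge_eqs(8)
  \<comment> \<open>All composable pairs of edges are inspected. The simplification after the second
    case split discards the pairs of vertices without an edge before the third vertex is
    split.\<close>
  show ?thesis
    using assms
    by (cases v; cases w; simp; cases z; simp add: e edge_zero sq sq' ss z' z1 z2 del: edge_l)
qed

lemma gmor_cmp [simp]:
  assumes "pre p q" "pre q r"
  shows "b q r \<cdot> b p q = b p r"
proof -
  obtain v m w n z l where p: "p = (v, m)" "q = (w, n)" "r = (z, l)" by (metis surj_pair)
  define d e where "d = n - m" and "e = l - n"
  have n: "n = m + d" and l: "l = m + (d + e)" by (simp_all add: d_def e_def)
  have vw: "deg v w = Some d" "deg w z = Some e" using assms by (simp_all add: pre_def p d_def e_def)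
  have "b q r \<cdot> b p q = sh T n (edge T X w z) \<cdot> sh T m (edge T X v w)"
    using assms by (simp add: gmor_def p)
  also have "\<dots> = sh T m (sh T d (edge T X w z) \<cdot> edge T X v w)"
    using edge_hom[OF vw(1)] edge_hom[OF vw(2)] by (simp add: n sh_add)
  also have "\<dots> = b p r"
    unfolding edge_cmp[OF vw] by (auto simp: gmor_def p pre_def l gob_def shift_ob_add)
  finally show ?thesis .
qed

lemma gmor_cmp' [simp]:
  "pre p q \<Longrightarrow> pre q r \<Longrightarrow> arr T x \<Longrightarrow> cd T x = P p \<Longrightarrow> b q r \<cdot> (b p q \<cdot> x) = b p r \<cdot> x"
  using cmp_eq[OF gmor_cmp] by simp

end


context triangulated_category
begin

section \<open>Morphism spaces along a triangle\<close>

definition no_hom :: "'o \<Rightarrow> 'o \<Rightarrow> bool" where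
  "no_hom W Z \<longleftrightarrow> (\<forall>m u. arr T u \<and> dm T u = W \<and> cd T u = shift_ob T m Z \<longrightarrow> u = zer T W (shift_ob T m Z))"

text \<open>The graded space of morphisms from \<open>W\<close> to all shifts of \<open>Z\<close> is
  a line in degree \<open>n\<close> with generator \<open>x\<close>; \<open>no_hom\<close> is the
  vanishing of that space. All degrees are treated at once because connecting maps change the
  degree.\<close>

definition line_hom :: "'o \<Rightarrow> 'o \<Rightarrow> int \<Rightarrow> 'a \<Rightarrow> bool" where
  "line_hom W Z n x \<longleftrightarrow> arr T x \<and> dm T x = W \<and> cd T x = shift_ob T n Z \<and> x \<noteq> zer T W (shift_ob T n Z) \<and>
    (\<forall>m u. arr T u \<and> dm T u = W \<and> cd T u = shift_ob T m Z \<longrightarrow>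
       (if m = n then \<exists>c. u = c \<odot> x else u = zer T W (shift_ob T m Z)))"

lemma no_homD: "no_hom W Z \<Longrightarrow> arr T u \<Longrightarrow> dm T u = W \<Longrightarrow> cd T u = shift_ob T m Z \<Longrightarrow> u = zer T W (shift_ob T m Z)"
  unfolding no_hom_def by blast

lemma line_homD:
  assumes "line_hom W Z n x"
  shows "arr T x" "dm T x = W" "cd T x = shift_ob T n Z" "x \<noteq> zer T W (shift_ob T n Z)"
    "arr T u \<Longrightarrow> dm T u = W \<Longrightarrow> cd T u = shift_ob T m Z \<Longrightarrow> m \<noteq> n \<Longrightarrow> u = zer T W (shift_ob T m Z)"
    "arr T u \<Longrightarrow> dm T u = W \<Longrightarrow> cd T u = shift_ob T n Z \<Longrightarrow> \<exists>c. u = c \<odot> x"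
  using assms unfolding line_hom_def by (auto split: if_splits)

lemma line_hom_zero:
  assumes "line_hom W Z n x" "c \<odot> x = zer T W (shift_ob T n Z)" shows "c = 0"
  using line_homD(1-4)[OF assms(1)] smul_eq_zer[of x c] assms(2) by metis

text \<open>An arrow from \<open>W\<close> to a shift of \<open>Z\<close> has zero image in the
  corresponding shift of \<open>X[1]\<close>, hence it comes from \<open>Y\<close>, where there is
  nothing.\<close>

lemma no_hom_cone:
  assumes d: "dt X Y Z u v w" and "no_hom W X" "no_hom W Y"
  shows "no_hom W Z"
  unfolding no_hom_def
proof (intro allI impI, elim conjE)
  fix m z assume z: "arr T z" "dm T z = W" "cd T z = shift_ob T m Z"
  note dm = dt_sh[OF d, of m]
  note [simp] = dtD[OF d] z
  have W: "W \<in> ob T" using dm_ob[OF z(1)] z(2) by metis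
  have "(shsgn m \<odot> sh T m w) \<cdot> z = zer T W (sho T (shift_ob T m X))"
    unfolding shift_ob_succ[OF dtD(10)[OF d], symmetric] by (rule no_homD[OF assms(2)]) (simp_all add: shift_ob_sho)
  then obtain t where t: "arr T t" "dm T t = W" "cd T t = shift_ob T m Y" "sh T m v \<cdot> t = z"
    using dt_lift_ex(2)[OF dm z] by blast
  have "t = zer T W (shift_ob T m Y)" using no_homD[OF assms(3) t(1-3)] .
  then show "z = zer T W (shift_ob T m Z)" using t(4) W by simp
qed

text \<open>Composition with \<open>v\<close> is injective because \<open>W\<close> has no arrows to
  shifts of \<open>X\<close>, and surjective because it has none to shifts of \<open>X[1]\<close>;
  so it carries the generator for \<open>Y\<close> to one for \<open>Z\<close>.\<close>

lemma line_hom_cone: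
  assumes d: "dt X Y Z u v w" and X: "no_hom W X" and Y: "line_hom W Y n y"
  shows "line_hom W Z n (sh T n v \<cdot> y)"
  unfolding line_hom_def
proof (intro conjI allI impI; (elim conjE)?)
  note [simp] = dtD[OF d] line_homD(1-3)[OF Y]
  have W: "W \<in> ob T" using dm_ob[of y] by simp
  show "arr T (sh T n v \<cdot> y)" "dm T (sh T n v \<cdot> y) = W" "cd T (sh T n v \<cdot> y) = shift_ob T n Z" by simp_all
  show "sh T n v \<cdot> y \<noteq> zer T W (shift_ob T n Z)"
  proof
    assume "sh T n v \<cdot> y = zer T W (shift_ob T n Z)"
    then obtain t where t: "arr T t" "dm T t = W" "cd T t = shift_ob T n X" "sh T n u \<cdot> t = y"
      using dt_lift_ex(1)[OF dt_sh[OF d, of n] line_homD(1-3)[OF Y]] by blast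
    have "t = zer T W (shift_ob T n X)" using no_homD[OF X t(1-3)] .
    then show False using t(4) W line_homD(4)[OF Y] by simp
  qed
  fix m z assume z [simp]: "arr T z" "dm T z = W" "cd T z = shift_ob T m Z"
  have "(shsgn m \<odot> sh T m w) \<cdot> z = zer T W (sho T (shift_ob T m X))"
    unfolding shift_ob_succ[OF dtD(10)[OF d], symmetric] by (rule no_homD[OF X]) (simp_all add: shift_ob_sho)
  then obtain t where t: "arr T t" "dm T t = W" "cd T t = shift_ob T m Y" "sh T m v \<cdot> t = z"
    using dt_lift_ex(2)[OF dt_sh[OF d, of m] z] by blast
  show "if m = n then \<exists>c. z = c \<odot> (sh T n v \<cdot> y) else z = zer T W (shift_ob T m Z)"
  proof (cases "m = n")
    case True
    obtain c where "t = c \<odot> y" using line_homD(6)[OF Y t(1,2)] t(3) True by blast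
    then have "z = c \<odot> (sh T n v \<cdot> y)" using t(4) True by simp
    then show ?thesis using True by auto
  next
    case False
    have "t = zer T W (shift_ob T m Y)" using line_homD(5)[OF Y t(1-3) False] .
    then show ?thesis using False t(4) W by simp
  qed
qed

text \<open>The map \<open>u\<close> identifies the two lines. The image in \<open>X[1]\<close> of
  an arrow to \<open>Z\<close> is a multiple of \<open>x\<close> killed by \<open>u\<close>, hence
  zero; so the arrow comes from \<open>Y\<close>, where it is a multiple of \<open>u x\<close>, and
  \<open>v\<close> kills that.\<close>

lemma no_hom_cone_iso:
  assumes d: "dt X Y Z u v w" and X: "line_hom W X n x" and Y: "line_hom W Y n (sh T n u \<cdot> x)"
  shows "no_hom W Z"
  unfolding no_hom_def
proof (intro allI impI, elim conjE)
  note [simp] = dtD[OF d] line_homD(1-3)[OF X]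
  have W: "W \<in> ob T" using dm_ob[of x] by simp
  fix m z assume z [simp]: "arr T z" "dm T z = W" "cd T z = shift_ob T m Z"
  define s where "s = (shsgn m \<odot> sh T m w) \<cdot> z"
  have s: "arr T s" "dm T s = W" "cd T s = shift_ob T (m + 1) X" unfolding s_def by (simp_all add: shift_ob_sho)
  have "s = zer T W (shift_ob T (m + 1) X)"
  proof (cases "m + 1 = n")
    case True
    obtain c where c: "s = c \<odot> x"
      using line_homD(6)[OF X s(1,2)] s(3) unfolding True by blast
    have "c \<odot> (sh T n u \<cdot> x) = sh T n u \<cdot> s" unfolding c by simp
    also have "\<dots> = (shm T (sh T m u) \<cdot> (shsgn m \<odot> sh T m w)) \<cdot> z"
      unfolding True[symmetric] s_def by (simp add: sh_succ shift_ob_sho shift_ob_succ)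
    also have "\<dots> = zer T W (shift_ob T n Y)"
      unfolding dt_comp_zero3[OF dt_sh[OF d, of m]] using True W by (simp add: True[symmetric] shift_ob_succ)
    finally have "c = 0" using line_hom_zero[OF Y] by simp
    then show ?thesis using c True by simp
  next
    case False
    show ?thesis by (rule line_homD(5)[OF X s False])
  qed
  then have "(shsgn m \<odot> sh T m w) \<cdot> z = zer T W (sho T (shift_ob T m X))"
    unfolding s_def shift_ob_succ[OF dtD(10)[OF d]] .
  then obtain t where t: "arr T t" "dm T t = W" "cd T t = shift_ob T m Y" "sh T m v \<cdot> t = z"
    using dt_lift_ex(2)[OF dt_sh[OF d, of m] z] by blast
  show "z = zer T W (shift_ob T m Z)"
  proof (cases "m = n")
    case True
    obtain c where c: "t = c \<odot> (sh T n u \<cdot> x)" using line_homD(6)[OF Y t(1,2)] t(3) True by blast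
    have "z = c \<odot> ((sh T n v \<cdot> sh T n u) \<cdot> x)" using t(4) c True by simp
    then show ?thesis unfolding dt_comp_zero[OF dt_sh[OF d, of n]] using W True by simp
  next
    case False
    have "t = zer T W (shift_ob T m Y)" using line_homD(5)[OF Y t(1-3) False] .
    then show ?thesis using False t(4) W by simp
  qed
qed

text \<open>An arrow out of \<open>X[1]\<close> is the shift of an arrow out of \<open>X\<close>,
  with the degree lowered by one.\<close>

lemma no_hom_shm:
  assumes "no_hom X U" "X \<in> ob T" "U \<in> ob T" "arr T t" "dm T t = sho T X" "cd T t = shift_ob T m U"
  shows "t = zer T (sho T X) (shift_ob T m U)"
proof -
  have m: "shift_ob T m U = sho T (shift_ob T (m - 1) U)" using shift_ob_succ[of U "m - 1"] assms by simp
  obtain t' where t': "arr T t'" "dm T t' = X" "cd T t' = shift_ob T (m - 1) U" "t = shm T t'"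
    using shm_surj[OF assms(4,5)] assms(2,3,6) m by (metis shift_ob_ob)
  have "t' = zer T X (shift_ob T (m - 1) U)" using no_homD[OF assms(1) t'(1-3)] .
  then show ?thesis using t'(4) m assms(2,3) by simp
qed

lemma line_hom_shm:
  assumes "line_hom X U n x" "X \<in> ob T" "U \<in> ob T" "arr T t" "dm T t = sho T X" "cd T t = shift_ob T m U"
  shows "if m = n + 1 then \<exists>c. t = c \<odot> shm T x else t = zer T (sho T X) (shift_ob T m U)"
proof -
  have m: "shift_ob T m U = sho T (shift_ob T (m - 1) U)" using shift_ob_succ[of U "m - 1"] assms by simp
  obtain t' where t': "arr T t'" "dm T t' = X" "cd T t' = shift_ob T (m - 1) U" "t = shm T t'"
    using shm_surj[OF assms(4,5)] assms(2,3,6) m by (metis shift_ob_ob)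
  show ?thesis
  proof (cases "m = n + 1")
    case True
    then obtain c where "t' = c \<odot> x" using line_homD(6)[OF assms(1) t'(1,2)] t'(3) by auto
    then show ?thesis using t'(4) True line_homD(1)[OF assms(1)] by auto
  next
    case False
    then have "t' = zer T X (shift_ob T (m - 1) U)" using line_homD(5)[OF assms(1) t'(1-3)] by simp
    then show ?thesis using t'(4) m False assms(2,3) by simp
  qed
qed

lemma no_hom_from_cone:
  assumes d: "dt X Y Z u v w" and X: "no_hom X U" and Y: "no_hom Y U" and U: "U \<in> ob T"
  shows "no_hom Z U"
  unfolding no_hom_def
proof (intro allI impI, elim conjE)
  note [simp] = dtD[OF d] U
  fix m z assume z [simp]: "arr T z" "dm T z = Z" "cd T z = shift_ob T m U"
  have "z \<cdot> v = zer T Y (cd T z)" unfolding z(3) by (rule no_homD[OF Y]) simp_all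
  then obtain t where t: "arr T t" "dm T t = sho T X" "cd T t = shift_ob T m U" "t \<cdot> w = z"
    using dt_extend2[OF d z(1,2)] z(3) by metis
  have "t = zer T (sho T X) (shift_ob T m U)" using no_hom_shm[OF X _ U t(1-3)] by simp
  then show "z = zer T Z (shift_ob T m U)" using t(4) by simp
qed

text \<open>Restriction along \<open>v\<close> is injective, since \<open>X[1]\<close> has no arrows
  to shifts of \<open>U\<close>, and it sends \<open>y\<close> to a generator. An arrow that agrees
  with a multiple of \<open>y\<close> after restriction therefore equals it.\<close>

lemma line_hom_from_cone:
  assumes d: "dt X Y Z u v w" and X: "no_hom X U" and Y: "line_hom Y U n (y \<cdot> v)" and U: "U \<in> ob T"
    and y: "arr T y" "dm T y = Z" "cd T y = shift_ob T n U"
  shows "line_hom Z U n y"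
  unfolding line_hom_def
proof (intro conjI allI impI; (elim conjE)?)
  note [simp] = dtD[OF d] U y
  show "arr T y" "dm T y = Z" "cd T y = shift_ob T n U" by simp_all
  show "y \<noteq> zer T Z (shift_ob T n U)" using line_homD(4)[OF Y] by auto
  fix m z assume z [simp]: "arr T z" "dm T z = Z" "cd T z = shift_ob T m U"
  have zero: "z' = zer T Z (shift_ob T m U)" if z' [simp]: "arr T z'" "dm T z' = Z" "cd T z' = shift_ob T m U"
     and zv: "z' \<cdot> v = zer T Y (cd T z')" for z'
  proof -
    obtain t where t: "arr T t" "dm T t = sho T X" "cd T t = shift_ob T m U" "t \<cdot> w = z'"
      using dt_extend2[OF d z'(1,2) zv] z'(3) by metis
    have "t = zer T (sho T X) (shift_ob T m U)" using no_hom_shm[OF X _ U t(1-3)] by simp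
    then show ?thesis using t(4) by simp
  qed
  have zv: "arr T (z \<cdot> v)" "dm T (z \<cdot> v) = Y" "cd T (z \<cdot> v) = shift_ob T m U" by simp_all
  show "if m = n then \<exists>c. z = c \<odot> y else z = zer T Z (shift_ob T m U)"
  proof (cases "m = n")
    case True
    obtain c where c: "z \<cdot> v = c \<odot> (y \<cdot> v)" using line_homD(6)[OF Y zv(1,2)] zv(3) unfolding True by blast
    have "(z \<oplus> (- 1) \<odot> (c \<odot> y)) \<cdot> v = z \<cdot> v \<oplus> (- 1) \<odot> (c \<odot> (y \<cdot> v))" using True by simp
    also have "\<dots> = zer T Y (shift_ob T n U)" unfolding c using True by (simp add: smul_left)
    finally have "z \<oplus> (- 1) \<odot> (c \<odot> y) = zer T Z (shift_ob T m U)"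
      by (intro zero) (use True in \<open>simp_all del: add_cmp smul_simps2\<close>)
    then have "z = c \<odot> y" using add_neg_eq_zer[of z "c \<odot> y"] True by simp
    then show ?thesis using True by auto
  next
    case False
    show ?thesis using False zero[OF z] line_homD(5)[OF Y zv False] by simp
  qed
qed

text \<open>Mirror image of \<open>no_hom_cone_iso\<close>: the restriction to \<open>Y\<close> is a
  multiple of \<open>x\<close> that vanishes on \<open>X\<close>, hence zero, and an arrow that
  factors through \<open>X[1]\<close> extends over \<open>u[1]\<close> and is killed by
  \<open>shm T u \<cdot> w = 0\<close>.\<close>

lemma no_hom_from_cone_iso:
  assumes d: "dt X Y Z u v w" and Y: "line_hom Y U n x" and X: "line_hom X U n (x \<cdot> u)" and U: "U \<in> ob T"
  shows "no_hom Z U"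
  unfolding no_hom_def
proof (intro allI impI, elim conjE)
  note [simp] = dtD[OF d] U line_homD(1-3)[OF Y]
  fix m z assume z [simp]: "arr T z" "dm T z = Z" "cd T z = shift_ob T m U"
  have zv: "arr T (z \<cdot> v)" "dm T (z \<cdot> v) = Y" "cd T (z \<cdot> v) = shift_ob T m U" by simp_all
  have "z \<cdot> v = zer T Y (cd T z)"
  proof (cases "m = n")
    case True
    obtain c where c: "z \<cdot> v = c \<odot> x" using line_homD(6)[OF Y zv(1,2)] zv(3) unfolding True by blast
    have "c \<odot> (x \<cdot> u) = (z \<cdot> v) \<cdot> u" unfolding c by simp
    also have "\<dots> = zer T X (shift_ob T n U)" using dt_comp_zero[OF d] True by simp
    finally have "c = 0" using line_hom_zero[OF X] by simp
    then show ?thesis using c True by simp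
  next
    case False
    then show ?thesis using line_homD(5)[OF Y zv] by simp
  qed
  then obtain t where t: "arr T t" "dm T t = sho T X" "cd T t = shift_ob T m U" "t \<cdot> w = z"
    using dt_extend2[OF d z(1,2)] z(3) by metis
  have c3: "shm T u \<cdot> w = zer T Z (sho T Y)" using dt_comp_zero3[OF d] .
  have 1: "if m = n + 1 then \<exists>c. t = c \<odot> shm T (x \<cdot> u) else t = zer T (sho T X) (shift_ob T m U)"
    by (rule line_hom_shm[OF X _ U t(1-3)]) simp
  show "z = zer T Z (shift_ob T m U)"
  proof (cases "m = n + 1")
    case True
    then obtain c where "t = c \<odot> shm T (x \<cdot> u)" using 1 by auto
    then have "z = c \<odot> (shm T x \<cdot> (shm T u \<cdot> w))" using t(4) by simp
    then show ?thesis unfolding c3 using True by (simp add: shift_ob_succ)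
  next
    case False
    then show ?thesis using 1 t(4) by auto
  qed
qed

text \<open>Since \<open>Y\<close> has no arrows to shifts of \<open>U\<close>, the connecting map
  along \<open>w\<close> is bijective; it raises the degree by one.\<close>

lemma line_hom_from_cone_shift:
  assumes d: "dt X Y Z u v w" and Y: "no_hom Y U" and X: "line_hom X U n x" and U: "U \<in> ob T"
  shows "line_hom Z U (n + 1) (shm T x \<cdot> w)"
  unfolding line_hom_def
proof (intro conjI allI impI; (elim conjE)?)
  note [simp] = dtD[OF d] U line_homD(1-3)[OF X]
  show "arr T (shm T x \<cdot> w)" "dm T (shm T x \<cdot> w) = Z" "cd T (shm T x \<cdot> w) = shift_ob T (n + 1) U"
    by (simp_all add: shift_ob_succ)
  show "shm T x \<cdot> w \<noteq> zer T Z (shift_ob T (n + 1) U)"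
  proof
    assume a: "shm T x \<cdot> w = zer T Z (shift_ob T (n + 1) U)"
    have "arr T (shm T x)" "dm T (shm T x) = sho T X" "shm T x \<cdot> w = zer T Z (cd T (shm T x))"
      using a by (simp_all add: shift_ob_succ)
    then obtain s where s: "arr T s" "dm T s = sho T Y" "cd T s = cd T (shm T x)" "s \<cdot> ((- 1) \<odot> shm T u) = shm T x"
      using dt_extend2[OF dt_rot[OF d]] by metis
    have "s = zer T (sho T Y) (shift_ob T (n + 1) U)"
      using no_hom_shm[OF Y _ U s(1,2), of "n + 1"] s(3) by (simp add: shift_ob_succ)
    then have "shm T x = shm T (zer T X (shift_ob T n U))" using s(4) by (simp add: shift_ob_succ)
    then have "x = zer T X (shift_ob T n U)" using shm_inj[of x "zer T X (shift_ob T n U)"] by simp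
    then show False using line_homD(4)[OF X] by simp
  qed
  fix m z assume z [simp]: "arr T z" "dm T z = Z" "cd T z = shift_ob T m U"
  have "z \<cdot> v = zer T Y (cd T z)" unfolding z(3) by (rule no_homD[OF Y]) simp_all
  then obtain t where t: "arr T t" "dm T t = sho T X" "cd T t = shift_ob T m U" "t \<cdot> w = z"
    using dt_extend2[OF d z(1,2)] z(3) by metis
  have 1: "if m = n + 1 then \<exists>c. t = c \<odot> shm T x else t = zer T (sho T X) (shift_ob T m U)"
    by (rule line_hom_shm[OF X _ U t(1-3)]) simp
  show "if m = n + 1 then \<exists>c. z = c \<odot> (shm T x \<cdot> w) else z = zer T Z (shift_ob T m U)"
    using 1 t(4) by (auto split: if_splits)
qed

section \<open>Exceptional sequences\<close>

lemma line_hom_if_hom_line: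
  assumes "hom_line T W (shift_ob T n Z) x" "\<And>m. m \<noteq> n \<Longrightarrow> hom T W (shift_ob T m Z) = {zer T W (shift_ob T m Z)}"
  shows "line_hom W Z n x"
  unfolding line_hom_def
proof (intro conjI allI impI; (elim conjE)?)
  have x: "arr T x" "dm T x = W" "cd T x = shift_ob T n Z" and inj: "inj (\<lambda>c. c \<odot> x)" and r: "range (\<lambda>c. c \<odot> x)
      = hom T W (shift_ob T n Z)"
    using assms(1) unfolding hom_line_def bij_betw_def by auto
  show "arr T x" "dm T x = W" "cd T x = shift_ob T n Z" by fact+
  show "x \<noteq> zer T W (shift_ob T n Z)"
  proof
    assume "x = zer T W (shift_ob T n Z)"
    then have "0 \<odot> x = 1 \<odot> x" using smul_simps2(1,3)[of x] x by metis
    then show False using injD[OF inj] by (metis zero_neq_one)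
  qed
  fix m u assume u: "arr T u" "dm T u = W" "cd T u = shift_ob T m Z"
  show "if m = n then \<exists>c. u = c \<odot> x else u = zer T W (shift_ob T m Z)"
  proof (cases "m = n")
    case True
    then have "u \<in> range (\<lambda>c. c \<odot> x)" using r u by simp
    then show ?thesis using True by auto
  next
    case False
    have "u \<in> hom T W (shift_ob T m Z)" using u by simp
    then show ?thesis using assms(2)[OF False] False by (simp del: hom_iff)
  qed
qed

text \<open>The identity is a multiple of the generator, and the factor is not 0: otherwise every
  endomorphism would vanish, the generator included.\<close>

lemma line_hom_ide:
  assumes "line_hom W W 0 x"
  shows "line_hom W W 0 (ide T W)"
proof -
  note X = line_homD(1-3)[OF assms]
  have W: "W \<in> ob T" using X by auto
  obtain c where c: "ide T W = c \<odot> x" using line_homD(6)[OF assms, of "ide T W"] W by auto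
  have "c \<noteq> 0"
  proof
    assume "c = 0"
    then have "ide T W = zer T W W" using c X by simp
    then have "x = zer T W W" using cmp_ide[of x W] X W by simp
    then show False using line_homD(4)[OF assms] by simp
  qed
  then have "d \<odot> x = (d * inverse c) \<odot> ide T W" for d unfolding c using X by (simp add: mult.assoc)
  moreover have "ide T W \<noteq> zer T W W"
  proof
    assume "ide T W = zer T W W"
    then have "x = zer T W W" using cmp_ide[of x W] X W by simp
    then show False using line_homD(4)[OF assms] by simp
  qed
  ultimately show ?thesis using W line_homD(5,6)[OF assms] unfolding line_hom_def
      by (metis ide_simps shift_ob_simps(1))
qed

end

text \<open>States that the relations of the mesh category are the only ones, in every degree. Apart
  from generation by \<open>A\<close>, \<open>B\<close>, \<open>C\<close>, this is the form in which
  the exceptional sequence enters all later arguments.\<close>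

locale exceptional_octahedron = octahedron_in T X for T :: "('o, 'a, 'k :: field) tri_cat" (structure) and X +
  assumes hom_None: "deg v w = None \<Longrightarrow> no_hom (vob X v) (vob X w)"
    and hom_Some: "deg v w = Some d \<Longrightarrow> line_hom (vob X v) (vob X w) d (edge T X v w)"

context octahedron_in
begin

text \<open>The nine spaces among \<open>A\<close>, \<open>B\<close>, \<open>C\<close> determine the
  other 27 through the long exact sequences of the faces on \<open>f\<close>, \<open>h\<close> and
  \<open>g\<close>, first in the second and then in the first variable. The commutativities
  \<open>edge_eqs\<close> identify each resulting generator with an edge.\<close>

lemma exceptional_octahedronI:
  assumes AA: "line_hom (oA X) (oA X) 0 (ide T (oA X))" and BB: "line_hom (oB X) (oB X) 0 (ide T (oB X))"
    and CC: "line_hom (oC X) (oC X) 0 (ide T (oC X))" and AB: "line_hom (oA X) (oB X) 0 (mf X)"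
    and BC: "line_hom (oB X) (oC X) 0 (mg X)" and AC: "line_hom (oA X) (oC X) 0 (mh X)"
    and BA: "no_hom (oB X) (oA X)" and CA: "no_hom (oC X) (oA X)" and CB: "no_hom (oC X) (oB X)"
  shows "exceptional_octahedron T X"
proof -
  have AD: "no_hom (oA X) (oD X)" using no_hom_cone_iso[OF dt_f AA] AB by simp
  have AE: "no_hom (oA X) (oE X)" using no_hom_cone_iso[OF dt_h AA] AC by simp
  have AF: "no_hom (oA X) (oF X)" using no_hom_cone_iso[OF dt_g AB] AC by (simp add: edge_eqs)
  have BD: "line_hom (oB X) (oD X) 0 (mf1 X)" using line_hom_cone[OF dt_f BA BB] by simp
  have BE: "line_hom (oB X) (oE X) 0 (ml X)" using line_hom_cone[OF dt_h BA BC] by (simp add: edge_eqs(5))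
  have BF: "no_hom (oB X) (oF X)" using no_hom_cone_iso[OF dt_g BB] BC by simp
  have CD: "no_hom (oC X) (oD X)" using no_hom_cone[OF dt_f CA CB] .
  have CE: "line_hom (oC X) (oE X) 0 (mh1 X)" using line_hom_cone[OF dt_h CA CC] by simp
  have CF: "line_hom (oC X) (oF X) 0 (mg1 X)" using line_hom_cone[OF dt_g CB CC] by simp
  have DA: "line_hom (oD X) (oA X) 1 (mf2 X)" using line_hom_from_cone_shift[OF dt_f BA AA] by simp
  have DB: "no_hom (oD X) (oB X)" using no_hom_from_cone_iso[OF dt_f BB] AB by simp
  have DC: "no_hom (oD X) (oC X)" using no_hom_from_cone_iso[OF dt_f BC] AC by (simp add: edge_eqs)
  have DD: "line_hom (oD X) (oD X) 0 (ide T (oD X))" using line_hom_from_cone[OF dt_f AD, of 0 "ide T (oD X)"] BD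
      by simp
  have DE: "line_hom (oD X) (oE X) 0 (mk X)" using line_hom_from_cone[OF dt_f AE, of 0 "mk X"] BE
      by (simp add: edge_eqs(6))
  have DF: "no_hom (oD X) (oF X)" using no_hom_from_cone[OF dt_f AF BF] by simp
  have EA: "line_hom (oE X) (oA X) 1 (mh2 X)" using line_hom_from_cone_shift[OF dt_h CA AA] by simp
  have EB: "line_hom (oE X) (oB X) 1 (ml1 X)" using line_hom_from_cone_shift[OF dt_h CB AB]
      by (simp add: edge_eqs(7))
  have EC: "no_hom (oE X) (oC X)" using no_hom_from_cone_iso[OF dt_h CC] AC by simp
  have ED: "no_hom (oE X) (oD X)" using no_hom_from_cone[OF dt_h AD CD] by simp
  have EE: "line_hom (oE X) (oE X) 0 (ide T (oE X))" using line_hom_from_cone[OF dt_h AE, of 0 "ide T (oE X)"] CE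
      by simp
  have EF: "line_hom (oE X) (oF X) 0 (mk1 X)" using line_hom_from_cone[OF dt_h AF, of 0 "mk1 X"] CF
      by (simp add: edge_eqs(4))
  have FA: "no_hom (oF X) (oA X)" using no_hom_from_cone[OF dt_g BA CA] by simp
  have FB: "line_hom (oF X) (oB X) 1 (mg2 X)" using line_hom_from_cone_shift[OF dt_g CB BB] by simp
  have FC: "no_hom (oF X) (oC X)" using no_hom_from_cone_iso[OF dt_g CC] BC by simp
  have FD: "line_hom (oF X) (oD X) 1 (mk2 X)" using line_hom_from_cone_shift[OF dt_g CD BD]
      by (simp add: edge_eqs(2))
  have FE: "no_hom (oF X) (oE X)" using no_hom_from_cone_iso[OF dt_g CE] BE by (simp add: edge_eqs(5))
  have FF: "line_hom (oF X) (oF X) 0 (ide T (oF X))" using line_hom_from_cone[OF dt_g BF, of 0 "ide T (oF X)"] CF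
      by simp
  note all = AA AB AC AD AE AF BA BB BC BD BE BF CA CB CC CD CE CF DA DB DC DD DE DF EA EB EC ED EE EF FA FB FC FD FE FF
  show ?thesis
  proof
    fix v w d
    show "deg v w = None \<Longrightarrow> no_hom (vob X v) (vob X w)" by (cases v; cases w; simp add: all)
    show "deg v w = Some d \<Longrightarrow> line_hom (vob X v) (vob X w) d (edge T X v w)" by (cases v; cases w) (auto simp: all)
  qed
qed

end

context exceptional_octahedron
begin

lemma gob_hom:
  assumes x: "arr T x" "dm T x = P p" "cd T x = P q"
  shows "\<not> pre p q \<Longrightarrow> x = zer T (P p) (P q)" "pre p q \<Longrightarrow> \<exists>c. x = c \<odot> b p q"
proof -
  let ?V = "vob X (fst p)" and ?W = "vob X (fst q)" and ?d = "snd q - snd p"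
  have e: "shift_ob T (snd q) ?W = shift_ob T (snd p) (shift_ob T ?d ?W)"
    using shift_ob_add[of ?W "snd p" ?d] by simp
  obtain y where y: "arr T y" "dm T y = ?V" "cd T y = shift_ob T ?d ?W" "x = sh T (snd p) y"
    by (rule sh_surj[of x "snd p" ?V "shift_ob T ?d ?W"]) (use x e in \<open>simp_all add: gob_def\<close>)
  { assume n: "\<not> pre p q"
    have "y = zer T ?V (shift_ob T ?d ?W)"
    proof (cases "deg (fst p) (fst q)")
      case None then show ?thesis using no_homD[OF hom_None[OF None] y(1-3)] by blast
    next
      case (Some d)
      then have "d \<noteq> ?d" using n by (auto simp: pre_def)
      then show ?thesis using line_homD(5)[OF hom_Some[OF Some] y(1-3)] by simp
    qed
    then show "x = zer T (P p) (P q)" using y(4) e by (simp add: gob_def) }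
  { assume "pre p q"
    then have d: "deg (fst p) (fst q) = Some ?d" by (simp add: pre_def)
    obtain c where "y = c \<odot> edge T X (fst p) (fst q)" using line_homD(6)[OF hom_Some[OF d] y(1-3)] by blast
    then show "\<exists>c. x = c \<odot> b p q" using y(4) \<open>pre p q\<close> edge_hom[OF d] by (intro exI[of _ c]) (simp add: gmor_def) }
qed

lemma gmor_nonzero: assumes "pre p q" shows "b p q \<noteq> zer T (P p) (P q)"
proof
  let ?V = "vob X (fst p)" and ?W = "vob X (fst q)" and ?d = "snd q - snd p"
  assume z: "b p q = zer T (P p) (P q)"
  have d: "deg (fst p) (fst q) = Some ?d" using assms by (simp add: pre_def)
  have e: "shift_ob T (snd q) ?W = shift_ob T (snd p) (shift_ob T ?d ?W)"
    using shift_ob_add[of ?W "snd p" ?d] by simp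
  have "sh T (snd p) (edge T X (fst p) (fst q)) = sh T (snd p) (zer T ?V (shift_ob T ?d ?W))"
    using z assms e by (simp add: gmor_def gob_def)
  then have "edge T X (fst p) (fst q) = zer T ?V (shift_ob T ?d ?W)"
    by (rule sh_inj[rotated 2]) (use edge_hom[OF d] in simp_all)
  then show False using line_homD(4)[OF hom_Some[OF d]] by simp
qed

lemma gmor_smul_cancel: "pre p q \<Longrightarrow> c \<odot> b p q = d \<odot> b p q \<Longrightarrow> c = d"
proof (rule ccontr)
  assume p: "pre p q" and e: "c \<odot> b p q = d \<odot> b p q" and "c \<noteq> d"
  have "(c - d) \<odot> b p q = (c \<odot> b p q) \<oplus> ((- d) \<odot> b p q)" using smul_left[of "b p q" c "- d"] by simp
  also have "\<dots> = zer T (P p) (P q)" unfolding e by (simp add: smul_left)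
  finally have "b p q = zer T (P p) (P q)" using smul_eq_zer[of "b p q" "c - d"] \<open>c \<noteq> d\<close> by simp
  then show False using gmor_nonzero[OF p] by simp
qed

end

context triangulated_category
begin

section \<open>Good octahedra\<close>

lemma isom_shm_reflect:
  assumes "isom T (sho T X) (sho T Y) (shm T u)" "arr T u" "dm T u = X" "cd T u = Y"
  shows "isom T X Y u"
proof -
  have o: "X \<in> ob T" "Y \<in> ob T" using assms(2-4) dm_ob cd_ob by metis+
  obtain v' where v': "arr T v'" "dm T v' = sho T Y" "cd T v' = sho T X"
    "v' \<cdot> shm T u = ide T (sho T X)" "shm T u \<cdot> v' = ide T (sho T Y)"
    by (rule isomE[OF assms(1)])
  obtain v where v: "arr T v" "dm T v = Y" "cd T v = X" "v' = shm T v" using shm_surj[OF v'(1-3)] o by metis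
  have "shm T (v \<cdot> u) = shm T (ide T X)" "shm T (u \<cdot> v) = shm T (ide T Y)"
    using v' v assms(2-4) o by simp_all
  then have "v \<cdot> u = ide T X" "u \<cdot> v = ide T Y" using shm_inj v assms(2-4) o by (metis cmp_simps(1) ide_simps(1))+
  then show ?thesis using isomI[of u v X Y] v assms by simp
qed

lemma dt_shm:
  assumes "dt X Y Z u v w" shows "dt (sho T X) (sho T Y) (sho T Z) (shm T u) (shm T v) ((- 1) \<odot> shm T w)"
  using assms dt_shm_iff[of X Y Z u v w] dtD[OF assms] by (simp add: triangle_iff)

text \<open>Both rotated triangles start with \<open>v\<close>, so uniqueness of cones compares
  \<open>X[1]\<close> with \<open>X'[1]\<close>; the comparison is the shift of an
  isomorphism.\<close>

lemma dt_first_unique: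
  assumes d: "dt X Y Z u v w" and d': "dt X' Y Z u' v w'"
  obtains c where "isom T X X' c" "u' \<cdot> c = u" "w' = shm T c \<cdot> w"
proof -
  note D = dtD[OF d] dtD[OF d']
  obtain c1 where c1: "isom T (sho T X) (sho T X') c1" "c1 \<cdot> w = w'" "((- 1) \<odot> shm T u') \<cdot> c1 = (- 1) \<odot> shm T u"
    using dt_unique[OF dt_rot[OF d] dt_rot[OF d']] by metis
  note C = isomD[OF c1(1)]
  obtain c where c: "arr T c" "dm T c = X" "cd T c = X'" "c1 = shm T c" using shm_surj[OF C(1-3)] D by metis
  have "(- 1) \<odot> (- 1) \<odot> shm T (u' \<cdot> c) = (- 1) \<odot> (- 1) \<odot> shm T u" using c1(3) c D by simp
  then have "shm T (u' \<cdot> c) = shm T u" using c D by (simp del: shm_cmp)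
  then have "u' \<cdot> c = u" using shm_inj[of "u' \<cdot> c" u] c D by simp
  moreover have "isom T X X' c" using isom_shm_reflect c1(1) c by metis
  ultimately show thesis using that c1(2) c(4) by metis
qed

text \<open>
  The octahedral axiom for \<open>B \<rightarrow> C \<oplus> D \<rightarrow> C\<close> identifies the cone of the first map with \<open>Y\<close>.
\<close>

lemma dt_mesh:
  assumes bp: "biproduct T C D Q i j p q"
    and dg: "dt B C F g g1 g2" and dk: "dt D Y F k k1 k2"
    and t: "arr T t" "dm T t = B" "cd T t = D" and k2: "k2 = shm T t \<cdot> g2"
    and h: "arr T h" "dm T h = C" "cd T h = Y" "k1 \<cdot> h = g1"
    and CD: "\<And>x. arr T x \<Longrightarrow> dm T x = C \<Longrightarrow> cd T x = D \<Longrightarrow> x = zer T C D"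
  shows "dt B Q Y (i \<cdot> g \<oplus> j \<cdot> t) (h \<cdot> p \<oplus> ((- 1) \<odot> k) \<cdot> q) (g2 \<cdot> k1)"
proof -
  note [simp] = dtD[OF dg] dtD[OF dk] t h(1-3) biproductD[OF bp]
  have [simp]: "shm T p \<cdot> shm T j = zer T (sho T D) (sho T C)" "shm T q \<cdot> shm T j = ide T (sho T D)"
    "\<And>x. arr T x \<Longrightarrow> cd T x = sho T D \<Longrightarrow> shm T q \<cdot> (shm T j \<cdot> x) = x"
    "\<And>x. arr T x \<Longrightarrow> cd T x = sho T C \<Longrightarrow> shm T q \<cdot> (shm T i \<cdot> x) = zer T (dm T x) (sho T D)"
    using biproductD[OF biproduct_shm[OF bp]] by simp_all
  define u where "u = i \<cdot> g \<oplus> j \<cdot> t"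
  have u [simp]: "arr T u" "dm T u = B" "cd T u = Q" "p \<cdot> u = g" "q \<cdot> u = t" unfolding u_def by simp_all
  have uh: "u \<in> hom T B Q" by simp
  obtain Z v w where dz: "dt B Q Z u v w" using TR1_cone[OF uh] by blast
  note [simp] = dtD[OF dz]
  \<comment> \<open>The projection of the sum to \<open>C\<close> has cone \<open>D[1]\<close>, with
    zero map from \<open>C\<close>. Its composite with \<open>u\<close> is \<open>g\<close>, so the
    octahedral axiom relates the cones of \<open>u\<close>, \<open>g\<close> and this
    projection.\<close>
  have dp: "dt Q C (sho T D) p (zer T C (sho T D)) ((- 1) \<odot> shm T j)"
    using dt_rot[OF dt_split[OF biproduct_swap[OF bp]]] .
  have "dt B C F (p \<cdot> u) g1 g2" using dg by simp
  then obtain m m1 m2 l l' where o: "octahedron T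
                \<lparr>oA = B, oB = Q, oC = C, oD = Z, oE = F, oF = sho T D,
                 mf = u, mf1 = v, mf2 = w, mg = p, mg1 = zer T C (sho T D), mg2 = (- 1) \<odot> shm T j,
                 mh = p \<cdot> u, mh1 = g1, mh2 = g2, mk = m, mk1 = m1, mk2 = m2,
                 ml = l, ml1 = l'\<rparr>"
    using TR4[OF dz dp] by blast
  have dm: "dt Z F (sho T D) m m1 m2"
    and o2: "m2 = shm T v \<cdot> ((- 1) \<odot> shm T j)" "w = g2 \<cdot> m" "g1 \<cdot> p = m \<cdot> v"
      "shm T u \<cdot> g2 = ((- 1) \<odot> shm T j) \<cdot> m1"
    using o unfolding octahedron_def by (auto simp del: dtD)
  note [simp] = dtD[OF dm]
  \<comment> \<open>The second component of one commutativity of the octahedron identifies the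
    unknown \<open>m1\<close> with \<open>- k2\<close>. Hence \<open>Z\<close> and \<open>Y\<close>
    both occur as first vertex of a triangle with the same second morphism.\<close>
  have "shm T q \<cdot> (((- 1) \<odot> shm T j) \<cdot> m1) = shm T (q \<cdot> u) \<cdot> g2" unfolding o2(4)[symmetric] by (simp del: u(5))
  then have "(- 1) \<odot> (- 1) \<odot> m1 = (- 1) \<odot> k2" unfolding k2 by simp
  then have m1: "m1 = (- 1) \<odot> k2" by simp
  have d1: "dt Y F (sho T D) k1 ((- 1) \<odot> k2) (shm T k)"
    using dt_signs[OF dt_rot[OF dk], of 1 "-1" "-1"] by simp
  obtain c where c: "isom T Y Z c" "m \<cdot> c = k1" "m2 = shm T c \<cdot> shm T k"
    by (rule dt_first_unique[OF d1 dm[unfolded m1]])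
  note [simp] = isomD[OF c(1)]
  have "shm T (c \<cdot> k) = shm T ((- 1) \<odot> (v \<cdot> j))" using c(3) o2(1) by simp
  then have ck: "c \<cdot> k = (- 1) \<odot> (v \<cdot> j)" using shm_inj[of "c \<cdot> k" "(- 1) \<odot> (v \<cdot> j)"] by simp
  \<comment> \<open>The isomorphism \<open>c\<close> matches \<open>v\<close> on \<open>D\<close> by
    construction, while on \<open>C\<close> it may a priori differ from it. The defect
    \<open>y\<close> is killed by \<open>m\<close>, so it factors through the fibre \<open>D\<close>
    of \<open>m\<close>, by an arrow \<open>C -> D\<close> that vanishes according to
    \<open>CD\<close>.\<close>
  define y where "y = v \<cdot> i \<oplus> (- 1) \<odot> (c \<cdot> h)"
  have y [simp]: "arr T y" "dm T y = C" "cd T y = Z" unfolding y_def by simp_all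
  have "m \<cdot> (v \<cdot> i) = (g1 \<cdot> p) \<cdot> i" unfolding o2(3) by simp
  then have "m \<cdot> (v \<cdot> i) = g1" by simp
  moreover have "m \<cdot> (c \<cdot> h) = g1" using cmp_eq[OF c(2), of h] h(4) by simp
  ultimately have my: "m \<cdot> y = zer T C F" unfolding y_def by simp
  obtain Z' w' where w': "arr T w'" "dm T w' = Z'" "cd T w' = Z" "Z' \<in> ob T" "sho T Z' = sho T D"
      "dt Z' Z F w' m m1"
    using dt_unrot_ex[OF dm] by metis
  have "Z' = D" using sho_inj[OF w'(4) _ w'(5)] by simp
  then obtain x where x: "arr T x" "dm T x = C" "cd T x = D" "w' \<cdot> x = y"
    using dt_lift_ex(1)[OF w'(6) y(1,2,3)] my by blast
  have "y = zer T C Z" using CD[OF x(1-3)] x(4) w' \<open>Z' = D\<close> by simp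
  then have vi: "v \<cdot> i = c \<cdot> h" unfolding y_def using add_neg_eq_zer[of "v \<cdot> i" "c \<cdot> h"] by simp
  have "v \<cdot> (i \<cdot> p) = (v \<cdot> i) \<cdot> p" "v \<cdot> (j \<cdot> q) = (v \<cdot> j) \<cdot> q" by simp_all
  moreover have "(- 1) \<odot> (c \<cdot> k) = v \<cdot> j" unfolding ck by simp
  ultimately have v: "c \<cdot> (h \<cdot> p \<oplus> ((- 1) \<odot> k) \<cdot> q) = v"
    using biproduct_out[OF bp, of v] vi cmp_eq[of "(- 1) \<odot> c" k "v \<cdot> j" q] by simp
  obtain c' where c': "isom T Z Y c'" "arr T c'" "dm T c' = Z" "cd T c' = Y" "c \<cdot> c' = ide T Z" "\<And>x. arr T x
      \<Longrightarrow> cd T x = Y \<Longrightarrow> c' \<cdot> (c \<cdot> x) = x"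
    using isomE[OF c(1)] by metis
  have 1: "h \<cdot> p \<oplus> ((- 1) \<odot> k) \<cdot> q = c' \<cdot> v" using c'(6)[of "h \<cdot> p \<oplus> ((- 1) \<odot> k) \<cdot> q"] unfolding v by simp
  have "g2 \<cdot> (k1 \<cdot> c') = g2 \<cdot> ((m \<cdot> c) \<cdot> c')" unfolding c(2) ..
  also have "\<dots> = g2 \<cdot> (m \<cdot> (c \<cdot> c'))" using c'(2-4) by simp
  finally have 2: "g2 \<cdot> (k1 \<cdot> c') = w" unfolding c'(5) o2(2) by simp
  have ids: "isom T B B (ide T B)" "isom T Q Q (ide T Q)" by simp_all
  show ?thesis unfolding u_def[symmetric]
    by (rule TR1_iso[OF dz _ ids c'(1)]) (use 1 2 c'(2-4) in \<open>simp_all add: triangle_iff\<close>)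
qed

end

context exceptional_octahedron
begin

text \<open>Both triangles are instances of \<open>dt_mesh\<close>. The first uses that
  \<open>C\<close> has no arrows to \<open>D\<close>. For the second, the face on \<open>k\<close>
  is rotated, the face on \<open>f\<close> is shifted, and the vanishing concerns arrows
  \<open>F -> A[1]\<close>; the result is rotated back so that it starts with
  \<open>l\<close>.\<close>

lemma good: "good_octahedron T X"
  unfolding good_octahedron_def
proof (intro conjI octahedron)
  obtain Q i j p q where bp: "biproduct T (oC X) (oD X) Q i j p q" using ex_biproduct[of "oC X" "oD X"] by auto
  have "dt (oB X) Q (oE X) (i \<cdot> mg X \<oplus> j \<cdot> mf1 X) (mh1 X \<cdot> p \<oplus> ((- 1) \<odot> mk X) \<cdot> q) (mg2 X \<cdot> mk1 X)"
  proof (rule dt_mesh[OF bp dt_g dt_k])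
    show "mk2 X = shm T (mf1 X) \<cdot> mg2 X" "mk1 X \<cdot> mh1 X = mg1 X" using edge_eqs by auto
    show "x = zer T (oC X) (oD X)" if "arr T x" "dm T x = oC X" "cd T x = oD X" for x
      using no_homD[OF hom_None[of VC VD], of x 0] that by simp
  qed simp_all
  then show "\<exists>Q i j p q. biproduct T (oC X) (oD X) Q i j p q \<and> dt (oB X) Q (oE X) (i \<cdot> mg X \<oplus> j \<cdot> mf1 X)
     (mh1 X \<cdot> p \<oplus> neg T (mk X) \<cdot> q) (ml1 X)" unfolding neg_eq edge_eqs(8) using bp by blast
next
  obtain Q i j p q where bp: "biproduct T (oF X) (sho T (oA X)) Q i j p q" using ex_biproduct[of "oF X"
      "sho T (oA X)"] by auto
  note [simp] = biproductD[OF bp]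
  have dg: "dt (oE X) (oF X) (sho T (oD X)) (mk1 X) (mk2 X) ((- 1) \<odot> shm T (mk X))" using dt_rot[OF dt_k] .
  have "dt (sho T (oA X)) (sho T (oB X)) (sho T (oD X)) (shm T (mf X)) (shm T (mf1 X)) ((- 1) \<odot> shm T (mf2 X))"
    by (rule dt_shm[OF dt_f])
  \<comment> \<open>The sign produced by the shift is moved to the first morphism. The row in
    \<open>dt_mesh\<close> negates that morphism, so \<open>shm T (mf X)\<close> ends up with a plus
    sign.\<close>
  then have dk: "dt (sho T (oA X)) (sho T (oB X)) (sho T (oD X)) ((- 1) \<odot> shm T (mf X)) (shm T (mf1 X)) (shm T (mf2 X))"
    using dt_signs[of _ _ _ _ _ _ "-1" 1 "-1"] by force
  have "dt (oE X) Q (sho T (oB X)) (i \<cdot> mk1 X \<oplus> j \<cdot> ((- 1) \<odot> mh2 X)) (mg2 X \<cdot> p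
      \<oplus> ((- 1) \<odot> ((- 1) \<odot> shm T (mf X))) \<cdot> q)
     (((- 1) \<odot> shm T (mk X)) \<cdot> shm T (mf1 X))"
  proof (rule dt_mesh[OF bp dg dk])
    show "shm T (mf2 X) = shm T ((- 1) \<odot> mh2 X) \<cdot> ((- 1) \<odot> shm T (mk X))" using edge_eqs(3) by simp
    show "shm T (mf1 X) \<cdot> mg2 X = mk2 X" using edge_eqs by auto
    show "x = zer T (oF X) (sho T (oA X))" if "arr T x" "dm T x = oF X" "cd T x = sho T (oA X)" for x
      using no_homD[OF hom_None[of VF VA], of x 1] that by simp
  qed simp_all
  then have d: "dt (oB X) (oE X) Q (ml X) (i \<cdot> mk1 X \<oplus> j \<cdot> ((- 1) \<odot> mh2 X)) (mg2 X \<cdot> p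
      \<oplus> ((- 1) \<odot> ((- 1) \<odot> shm T (mf X))) \<cdot> q)"
    by (rule dt_unrot) (use edge_eqs(6) in simp_all)
  have e: "(- 1) \<odot> ((- 1) \<odot> shm T (mf X)) = shm T (mf X)" by simp
  show "\<exists>Q i j p q. biproduct T (oF X) (sho T (oA X)) Q i j p q \<and> dt (oB X) (oE X) Q (ml X) (i \<cdot> mk1 X
      \<oplus> j \<cdot> neg T (mh2 X))
     (mg2 X \<cdot> p \<oplus> shm T (mf X) \<cdot> q)" unfolding neg_eq using bp d[unfolded e] by blast
qed

end


section \<open>Combinatorics of the mesh category\<close>

text \<open>Nonidentity edges strictly increase the weight, so it serves as the order of elimination.\<close>

fun weight :: "vertex \<times> int \<Rightarrow> int" where
  "weight (VA, m) = 4 * m + 1" | "weight (VB, m) = 4 * m + 2" | "weight (VC, m) = 4 * m + 3"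
| "weight (VD, m) = 4 * m + 3" | "weight (VE, m) = 4 * m + 4" | "weight (VF, m) = 4 * m + 5"

text \<open>The commutative squares \<open>h' g = k f'\<close> and \<open>f[1] h'' = g'' k'\<close>.\<close>

definition mesh :: "vertex \<times> int \<Rightarrow> vertex \<times> int \<Rightarrow> vertex \<times> int \<Rightarrow> vertex \<times> int \<Rightarrow> bool" where
  "mesh m q1 q2 r \<longleftrightarrow> (\<exists>n. (m, q1, q2, r) = ((VB, n), (VC, n), (VD, n), (VE, n)) \<or>
                           (m, q1, q2, r) = ((VE, n), (VF, n), (VA, n + 1), (VB, n + 1)))"

lemma meshD:
  assumes "mesh m q1 q2 r"
  shows "pre m q1" "pre m q2" "pre q1 r" "pre q2 r" "pre m r" "\<not> pre q1 q2" "\<not> pre q2 q1" "\<not> pre r q1" "\<not> pre r q2"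
    "weight q1 < weight r" "weight q2 < weight r" "weight q2 = weight q1"
  using assms by (auto simp: mesh_def pre_def)

lemma mesh_unique:
  "mesh m q1 q2 r \<Longrightarrow> mesh m' q1' q2' r \<Longrightarrow> m' = m \<and> q1' = q1 \<and> q2' = q2"
  by (auto simp: mesh_def)

lemma pre_mesh_cases:
  assumes "mesh m q1 q2 r" "pre p r" shows "p = m \<or> p = q1 \<or> p = q2 \<or> p = r"
proof -
  obtain v n where "p = (v, n)" by (cases p)
  then show ?thesis using assms by (cases v) (auto simp: mesh_def pre_def)
qed

text \<open>Factorisation through a mesh for targets that come later in the order of elimination.
  The first part clears a component on a fork, the other two clear a component on a join.\<close>

lemma mesh_above:
  assumes "mesh m q1 q2 r"
  shows "pre m J \<Longrightarrow> weight q1 \<le> weight J \<Longrightarrow> pre q1 J \<or> pre q2 J"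
    "pre q1 J \<Longrightarrow> weight r \<le> weight J \<Longrightarrow> J \<noteq> r \<Longrightarrow> pre r J \<and> \<not> pre q2 J"
    "pre q2 J \<Longrightarrow> weight r \<le> weight J \<Longrightarrow> J \<noteq> r \<Longrightarrow> pre r J \<and> \<not> pre q1 J"
proof -
  obtain v n where J: "J = (v, n)" by (cases J)
  show "pre m J \<Longrightarrow> weight q1 \<le> weight J \<Longrightarrow> pre q1 J \<or> pre q2 J"
    "pre q1 J \<Longrightarrow> weight r \<le> weight J \<Longrightarrow> J \<noteq> r \<Longrightarrow> pre r J \<and> \<not> pre q2 J"
    "pre q2 J \<Longrightarrow> weight r \<le> weight J \<Longrightarrow> J \<noteq> r \<Longrightarrow> pre r J \<and> \<not> pre q1 J"
    using assms unfolding J by (cases v; auto simp: mesh_def pre_def)+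
qed

text \<open>Of two components into \<open>P J\<close> one can be pushed along an arrow between their
  sources, unless these sources are the middle corners of a square ending in \<open>J\<close>. This
  exception is the origin of \<open>st_both\<close>.\<close>

lemma pre_connected:
  assumes "pre p J" "pre q J"
  shows "pre p q \<or> pre q p \<or> (\<exists>m. mesh m p q J \<or> mesh m q p J)"
proof -
  obtain v m w n z l where p: "p = (v, m)" "q = (w, n)" "J = (z, l)" by (metis surj_pair)
  show ?thesis using assms unfolding p by (cases z; cases v; simp add: pre_def; cases w; auto simp: mesh_def)
qed

text \<open>A component \<open>p -> J\<close> that does not factor through the earlier target
  \<open>q\<close> of \<open>p\<close>. By \<open>branch_mesh\<close> this occurs only when
  \<open>q\<close> and \<open>J\<close> are the middle corners of a square starting at
  \<open>p\<close>; the edge \<open>p -> q\<close> is then completed to a fork.\<close>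

definition branch :: "vertex \<times> int \<Rightarrow> vertex \<times> int \<Rightarrow> vertex \<times> int \<Rightarrow> bool" where
  "branch p q J \<longleftrightarrow> pre p J \<and> pre p q \<and> \<not> pre q J \<and> weight q \<le> weight J"

lemma branch_mesh:
  assumes "branch p q J" shows "\<exists>r. mesh p q J r \<or> mesh p J q r"
proof -
  obtain v m w n z l where p: "p = (v, m)" "q = (w, n)" "J = (z, l)" by (metis surj_pair)
  show ?thesis using assms unfolding p branch_def by (cases z; cases v; simp add: pre_def; cases w; auto simp:
      mesh_def)
qed

lemma branch_unique: "branch p q J \<Longrightarrow> branch p' q' J \<Longrightarrow> p' = p \<and> q' = q"
  using branch_mesh[of p q J] branch_mesh[of p' q' J] by (auto simp: mesh_def)

lemma branch_no_mesh: "branch p q J \<Longrightarrow> mesh m q1 q2 J \<Longrightarrow> False"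
  using branch_mesh[of p q J] by (auto simp: mesh_def)

text \<open>Decides which of two components into \<open>P J\<close> clears the other. In the second
  alternative the arrow \<open>p1 -> p\<close> is annihilated by \<open>p -> q\<close>, so it can be
  used without disturbing that edge.\<close>

lemma branch_pre:
  assumes "branch p q J" "pre p1 J" shows "pre p p1 \<or> pre p1 p \<and> \<not> pre p1 q"
proof -
  obtain v m w n z l x k where p: "p = (v, m)" "q = (w, n)" "J = (z, l)" "p1 = (x, k)" by (metis surj_pair)
  have "\<exists>r. mesh p q J r \<or> mesh p J q r" using branch_mesh assms by blast
  then show ?thesis using assms(2) unfolding p by (cases x; auto simp: mesh_def pre_def)
qed

section \<open>More on biproducts\<close>

context linear_category
begin

lemma biproduct_zero: "zero_object C Z \<Longrightarrow> U \<in> ob C \<Longrightarrow> biproduct C Z U U (zer C Z U) (ide C U) (zer C U Z) (ide C U)"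
  by (rule biproductI) (auto simp: zero_object_iff)

lemma biproduct_zero_isom:
  assumes "biproduct C Z U V i j p q" "zero_object C Z" shows "isom C U V j"
proof -
  note b = biproductD[OF assms(1)]
  have "i = zer C Z V" using zero_objectD(3)[OF assms(2) b(1,5)] b by simp
  then have "j \<cdot> q = ide C V" using b(20) b(1-15) by simp
  then show ?thesis using b by (intro isomI[of j q]) auto
qed

lemma biproduct_scale:
  assumes "biproduct C U V W i j p q" "c \<noteq> 0"
  shows "biproduct C U V W i (c \<odot> j) p (inverse c \<odot> q)"
  using biproductD[OF assms(1)] assms(2) by (intro biproductI) auto

lemma biproduct_assoc:
  assumes "biproduct C A B W i1 i2 p1 p2" "biproduct C W D U k1 k2 r1 r2" "biproduct C B D Q m1 m2 n1 n2"
  shows "biproduct C A Q U (k1 \<cdot> i1) (k1 \<cdot> (i2 \<cdot> n1) \<oplus> k2 \<cdot> n2) (p1 \<cdot> r1) (m1 \<cdot> (p2 \<cdot> r1) \<oplus> m2 \<cdot> r2)"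
proof -
  note [simp] = biproductD[OF assms(1)] biproductD[OF assms(2)] biproductD[OF assms(3)]
  have "k1 \<cdot> (i1 \<cdot> (p1 \<cdot> r1)) \<oplus> k1 \<cdot> (i2 \<cdot> (p2 \<cdot> r1)) = k1 \<cdot> (i1 \<cdot> (p1 \<cdot> r1) \<oplus> i2 \<cdot> (p2 \<cdot> r1))" by simp
  also have "\<dots> = k1 \<cdot> r1" using biproduct_into[OF assms(1), of r1] by simp
  finally have e: "k1 \<cdot> (i1 \<cdot> (p1 \<cdot> r1)) \<oplus> k1 \<cdot> (i2 \<cdot> (p2 \<cdot> r1)) = k1 \<cdot> r1" .
  have "k1 \<cdot> (i1 \<cdot> (p1 \<cdot> r1)) \<oplus> (k1 \<cdot> (i2 \<cdot> (p2 \<cdot> r1)) \<oplus> k2 \<cdot> r2) = ide C U"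
    unfolding add_assoc'[symmetric, of "k1 \<cdot> (i1 \<cdot> (p1 \<cdot> r1))" "k1 \<cdot> (i2 \<cdot> (p2 \<cdot> r1))" "k2 \<cdot> r2", simplified]
    using e by (simp flip: add_assoc')
  then show ?thesis by (intro biproductI) simp_all
qed

text \<open>Exchanges the two middle summands of a sum of two sums; in \<open>reduced_join\<close>
  this brings the two remaining blocks next to each other.\<close>

lemma biproduct_interchange:
  assumes 1: "biproduct C A B U a b pa pb" and 2: "biproduct C A' B' U' a' b' pa' pb'"
      and 3: "biproduct C U U' V i i' p p'"
    and 4: "biproduct C A A' W e e' r r'" and 5: "biproduct C B B' R f f' s s'"
  shows "biproduct C W R V (i \<cdot> (a \<cdot> r) \<oplus> i' \<cdot> (a' \<cdot> r')) (i \<cdot> (b \<cdot> s) \<oplus> i' \<cdot> (b' \<cdot> s'))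
    (e \<cdot> (pa \<cdot> p) \<oplus> e' \<cdot> (pa' \<cdot> p')) (f \<cdot> (pb \<cdot> p) \<oplus> f' \<cdot> (pb' \<cdot> p'))"
proof -
  note [simp] = biproductD[OF 1] biproductD[OF 2] biproductD[OF 3] biproductD[OF 4] biproductD[OF 5]
  have "i \<cdot> (a \<cdot> (pa \<cdot> p)) \<oplus> i \<cdot> (b \<cdot> (pb \<cdot> p)) = i \<cdot> (a \<cdot> (pa \<cdot> p) \<oplus> b \<cdot> (pb \<cdot> p))" by simp
  also have "\<dots> = i \<cdot> p" using biproduct_into[OF 1, of p] by simp
  finally have e1: "i \<cdot> (a \<cdot> (pa \<cdot> p)) \<oplus> i \<cdot> (b \<cdot> (pb \<cdot> p)) = i \<cdot> p" .
  have "i' \<cdot> (a' \<cdot> (pa' \<cdot> p')) \<oplus> i' \<cdot> (b' \<cdot> (pb' \<cdot> p')) = i' \<cdot> (a' \<cdot> (pa' \<cdot> p') \<oplus> b' \<cdot> (pb' \<cdot> p'))" by simp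
  also have "\<dots> = i' \<cdot> p'" using biproduct_into[OF 2, of p'] by simp
  finally have e2: "i' \<cdot> (a' \<cdot> (pa' \<cdot> p')) \<oplus> i' \<cdot> (b' \<cdot> (pb' \<cdot> p')) = i' \<cdot> p'" .
  have "(i \<cdot> (a \<cdot> (pa \<cdot> p)) \<oplus> i' \<cdot> (a' \<cdot> (pa' \<cdot> p'))) \<oplus> (i \<cdot> (b \<cdot> (pb \<cdot> p)) \<oplus> i' \<cdot> (b' \<cdot> (pb' \<cdot> p')))
    = (i \<cdot> (a \<cdot> (pa \<cdot> p)) \<oplus> i \<cdot> (b \<cdot> (pb \<cdot> p))) \<oplus> (i' \<cdot> (a' \<cdot> (pa' \<cdot> p')) \<oplus> i' \<cdot> (b' \<cdot> (pb' \<cdot> p')))"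
    by (simp add: add_ac)
  also have "\<dots> = ide C V" unfolding e1 e2 by simp
  finally have "(i \<cdot> (a \<cdot> (pa \<cdot> p)) \<oplus> i' \<cdot> (a' \<cdot> (pa' \<cdot> p'))) \<oplus> (i \<cdot> (b \<cdot> (pb \<cdot> p)) \<oplus> i' \<cdot> (b' \<cdot> (pb' \<cdot> p')))
      = ide C V" .
  then show ?thesis by (intro biproductI) simp_all
qed

lemma diag_eq:
  assumes "biproduct C U1 U2 U i1 i2 p1 p2" "arr C u" "dm C u = U" "arr C u1" "arr C u2" "arr C j1" "arr C j2"
    "dm C u1 = U1" "dm C u2 = U2" "cd C u1 = dm C j1" "cd C u2 = dm C j2" "cd C j1 = cd C u" "cd C j2 = cd C u"
    "u \<cdot> i1 = j1 \<cdot> u1" "u \<cdot> i2 = j2 \<cdot> u2"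
  shows "u = j1 \<cdot> (u1 \<cdot> p1) \<oplus> j2 \<cdot> (u2 \<cdot> p2)"
  by (rule biproduct_eq_out[OF assms(1)]) (use assms biproductD[OF assms(1)] in simp_all)

end

section \<open>Decomposition of morphisms\<close>

context exceptional_octahedron
begin

text \<open>\<open>N\<close> bounds the weights of the summands of the target.\<close>

inductive decomposed :: "int \<Rightarrow> 'o \<Rightarrow> 'o \<Rightarrow> 'a \<Rightarrow> bool" for N where
  zero: "zero_object T Z \<Longrightarrow> zero_object T Z' \<Longrightarrow> decomposed N Z Z' (zer T Z Z')"
| src: "zero_object T Z \<Longrightarrow> decomposed N (P p) Z (zer T (P p) Z)"
| tgt: "zero_object T Z \<Longrightarrow> weight q \<le> N \<Longrightarrow> decomposed N Z (P q) (zer T Z (P q))"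
| bas: "pre p q \<Longrightarrow> weight q \<le> N \<Longrightarrow> decomposed N (P p) (P q) (b p q)"
| fork: "mesh m q1 q2 r \<Longrightarrow> weight q1 \<le> N \<Longrightarrow> biproduct T (P q1) (P q2) Q i j n1 n2 \<Longrightarrow>
     decomposed N (P m) Q (i \<cdot> b m q1 \<oplus> j \<cdot> b m q2)"
| join: "mesh m q1 q2 r \<Longrightarrow> weight r \<le> N \<Longrightarrow> biproduct T (P q1) (P q2) Q i j n1 n2 \<Longrightarrow>
     decomposed N Q (P r) (b q1 r \<cdot> n1 \<oplus> (- 1) \<odot> (b q2 r \<cdot> n2))"
| sum: "decomposed N U1 V1 u1 \<Longrightarrow> decomposed N U2 V2 u2 \<Longrightarrow> biproduct T U1 U2 U i1 i2 p1 p2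
    \<Longrightarrow> biproduct T V1 V2 V j1 j2 k1 k2 \<Longrightarrow>
     decomposed N U V (j1 \<cdot> (u1 \<cdot> p1) \<oplus> j2 \<cdot> (u2 \<cdot> p2))"

lemma decomposed_hom:
  assumes "decomposed N U V u" shows "arr T u" "dm T u = U" "cd T u = V" "U \<in> ob T" "V \<in> ob T"
proof -
  have "arr T u \<and> dm T u = U \<and> cd T u = V" using assms
  proof induct
    case (zero Z Z') then show ?case using zero_objectD(1) by simp
  next
    case (src Z p) then show ?case using zero_objectD(1) by simp
  next
    case (tgt Z q) then show ?case using zero_objectD(1) by simp
  next
    case (fork m q1 q2 r Q i j p q) show ?case using biproductD[OF fork(3)] by simp
  next
    case (join m q1 q2 r Q i j p q) show ?case using biproductD[OF join(3)] by simp
  next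
    case (sum U1 V1 u1 U2 V2 u2 U i1 i2 p1 p2 V j1 j2 q1 q2)
    show ?case using sum(2,4) biproductD[OF sum(5)] biproductD[OF sum(6)] by simp
  qed simp
  then show "arr T u" "dm T u = U" "cd T u = V" "U \<in> ob T" "V \<in> ob T" using dm_ob cd_ob by blast+
qed

lemma decomposed_mono: "decomposed N U V u \<Longrightarrow> N \<le> N' \<Longrightarrow> decomposed N' U V u"
  by (induct rule: decomposed.induct) (auto intro: decomposed.intros)

text \<open>The form in which the rule \<open>sum\<close> is applied: a given arrow is recognised as
  diagonal by its restrictions to the two summands.\<close>

lemma decomposed_diag:
  assumes "decomposed N U1 V1 u1" "decomposed N U2 V2 u2" "biproduct T U1 U2 U i1 i2 p1 p2"
      "biproduct T V1 V2 V j1 j2 q1 q2"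
    "arr T u" "dm T u = U" "cd T u = V" "u \<cdot> i1 = j1 \<cdot> u1" "u \<cdot> i2 = j2 \<cdot> u2"
  shows "decomposed N U V u"
proof -
  have "u = j1 \<cdot> (u1 \<cdot> p1) \<oplus> j2 \<cdot> (u2 \<cdot> p2)"
    by (rule diag_eq[OF assms(3)]) (use assms(5-9) decomposed_hom[OF assms(1)] decomposed_hom[OF assms(2)]
        biproductD[OF assms(4)] in simp_all)
  then show ?thesis using decomposed.sum[OF assms(1-4)] by simp
qed

text \<open>Adding a zero map between zero objects allows any isomorphisms to serve as the
  injections of the biproducts.\<close>

lemma decomposed_isom:
  assumes u: "decomposed N U V u" and a: "isom T U U' a" and c: "isom T V V' c" and u': "arr T u'" "dm T u' = U'"
      "cd T u' = V'" "u' \<cdot> a = c \<cdot> u"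
  shows "decomposed N U' V' u'"
proof -
  obtain Z where Z: "zero_object T Z" using ex_zero_object by blast
  note [simp] = zero_objectD(1)[OF Z] isomD[OF a] isomD[OF c] u'(1-3)
  obtain a' where a': "biproduct T Z U U' (zer T Z U') a (zer T U' Z) a'" using biproduct_zero_left[OF Z a] by metis
  obtain c' where c': "biproduct T Z V V' (zer T Z V') c (zer T V' Z) c'" using biproduct_zero_left[OF Z c] by metis
  show ?thesis by (rule decomposed_diag[OF decomposed.zero[OF Z Z] u a' c']) (use u'(4) in simp_all)
qed

text \<open>
  When a morphism \<open>u\<close> that is already decomposed is extended by a component \<open>x\<close> into \<open>P J\<close>, all but one
  summand \<open>a\<close> of \<open>u\<close> can be cleared from \<open>x\<close>.  These are the possible remaining pairs \<open>(a, x)\<close>.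
\<close>

inductive state :: "vertex \<times> int \<Rightarrow> 'o \<Rightarrow> 'o \<Rightarrow> 'a \<Rightarrow> 'a \<Rightarrow> bool" for J where
  st_zero: "zero_object T Z \<Longrightarrow> zero_object T Z' \<Longrightarrow> state J Z Z' (zer T Z Z') (zer T Z (P J))"
| st_src: "zero_object T Z \<Longrightarrow> pre p J \<Longrightarrow> c \<noteq> 0 \<Longrightarrow> state J (P p) Z (zer T (P p) Z) (c \<odot> b p J)"
| st_bas: "branch p q J \<Longrightarrow> c \<noteq> 0 \<Longrightarrow> state J (P p) (P q) (b p q) (c \<odot> b p J)"
| st_join: "mesh m q1 q2 J \<Longrightarrow> biproduct T (P q1) (P q2) Q i j n1 n2 \<Longrightarrow> c \<noteq> 0 \<Longrightarrow>
     state J Q (P J) (b q1 J \<cdot> n1 \<oplus> (- 1) \<odot> (b q2 J \<cdot> n2)) (c \<odot> (b q1 J \<cdot> n1))"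
| st_both: "mesh m q1 q2 J \<Longrightarrow> biproduct T (P q1) (P q2) Q i j n1 n2 \<Longrightarrow> c \<noteq> 0 \<Longrightarrow> d \<noteq> 0 \<Longrightarrow> zero_object T Z \<Longrightarrow>
     state J Q Z (zer T Q Z) (c \<odot> (b q1 J \<cdot> n1) \<oplus> d \<odot> (b q2 J \<cdot> n2))"

lemma decomposed_state: "state J U V a x \<Longrightarrow> decomposed (weight J) U V a"
proof (induct rule: state.induct)
  case (st_both m q1 q2 Q i j p q c d Z)
  note [simp] = zero_objectD(1)[OF st_both(5)] biproductD[OF st_both(2)]
  have bz: "biproduct T Z Z Z (ide T Z) (ide T Z) (ide T Z) (ide T Z)"
    using st_both(5) biproduct_zero[OF st_both(5), of Z] by (simp add: zero_object_iff)
  show ?case by (rule decomposed_diag[OF decomposed.src[OF st_both(5)]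
      decomposed.src[OF st_both(5)] st_both(2) bz]) simp_all
qed (auto intro: decomposed.intros simp: branch_def)

lemma state_hom:
  assumes "state J U V a x"
  shows "arr T a" "dm T a = U" "cd T a = V" "U \<in> ob T" "V \<in> ob T" "arr T x" "dm T x = U" "cd T x = P J"
proof -
  show "arr T a" "dm T a = U" "cd T a = V" "U \<in> ob T" "V \<in> ob T" using decomposed_hom[OF decomposed_state[OF assms]]
      by auto
  have "arr T x \<and> dm T x = U \<and> cd T x = P J" using assms
  proof cases
    case (st_zero) then show ?thesis using zero_objectD(1) by auto
  next
    case (st_join m q1 q2 i j p q c) show ?thesis unfolding st_join(3) using biproductD[OF st_join(5)] by simp
  next
    case (st_both m q1 q2 i j p q c d) show ?thesis unfolding st_both(2) using biproductD[OF st_both(4)] by simp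
  qed auto
  then show "arr T x" "dm T x = U" "cd T x = P J" by auto
qed

text \<open>
  The pair \<open>(s, t)\<close> is a morphism from \<open>a2\<close> to \<open>a1\<close>; the automorphism of \<open>a1 \<oplus> a2\<close> that it induces,
  together with \<open>y\<close>, clears \<open>x2\<close>.
\<close>

definition dominates :: "vertex \<times> int \<Rightarrow> 'o \<Rightarrow> 'o \<Rightarrow> 'a \<Rightarrow> 'a \<Rightarrow> 'o \<Rightarrow> 'o \<Rightarrow> 'a \<Rightarrow> 'a \<Rightarrow> bool" where
  "dominates J U1 V1 a1 x1 U2 V2 a2 x2 \<longleftrightarrow> (\<exists>s t y. arr T s \<and> dm T s = U2 \<and> cd T s = U1 \<and> arr T t \<and> dm T t = V2 \<and>
      cd T t = V1 \<and>
     arr T y \<and> dm T y = V2 \<and> cd T y = P J \<and> t \<cdot> a2 = a1 \<cdot> s \<and> x2 = x1 \<cdot> s \<oplus> y \<cdot> a2)"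

text \<open>The case \<open>t = 0\<close>, \<open>y = 0\<close>: the component \<open>x2\<close>
  factors through \<open>x1\<close> by an arrow that \<open>a1\<close> kills.\<close>

lemma dominatesI:
  assumes "state J U1 V1 a1 x1" "state J U2 V2 a2 x2" "arr T s" "dm T s = U2" "cd T s = U1"
     "a1 \<cdot> s = zer T U2 V1" "x2 = x1 \<cdot> s"
  shows "dominates J U1 V1 a1 x1 U2 V2 a2 x2"
  unfolding dominates_def
  by (intro exI[of _ s] exI[of _ "zer T V2 V1"] exI[of _ "zer T V2 (P J)"])
    (use assms(3-7) state_hom[OF assms(1)] state_hom[OF assms(2)] in simp)

text \<open>Of two remaining pairs one always clears the other, except for two sources at the middle
  corners of a square into \<open>J\<close>. The local facts \<open>A\<close> to \<open>H\<close>
  treat the combinations of constructors that are compatible; branches and squares with the same end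
  \<open>J\<close> exclude each other by \<open>branch_no_mesh\<close>.\<close>

lemma state_compare:
  assumes s1: "state J U1 V1 a1 x1" and s2: "state J U2 V2 a2 x2"
    and bU: "biproduct T U1 U2 U i1 i2 p1 p2" and bV: "biproduct T V1 V2 V j1 j2 k1 k2"
  shows "dominates J U1 V1 a1 x1 U2 V2 a2 x2 \<or> dominates J U2 V2 a2 x2 U1 V1 a1 x1 \<or>
     state J U V (j1 \<cdot> (a1 \<cdot> p1) \<oplus> j2 \<cdot> (a2 \<cdot> p2)) (x1 \<cdot> p1 \<oplus> x2 \<cdot> p2)"
proof -
  have A: "dominates J U V a x U' V' a' x'" if "state J U V a x" "state J U' V' a' x'" "zero_object T U'"
      for U V a x U' V' a' x'
  proof (rule dominatesI[OF that(1,2), of "zer T U' U"])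
    note [simp] = state_hom[OF that(1)] state_hom(4)[OF that(2)]
    show "arr T (zer T U' U)" "dm T (zer T U' U) = U'" "cd T (zer T U' U) = U" "a \<cdot> zer T U' U = zer T U' V"
        by simp_all
    show "x' = x \<cdot> zer T U' U" using zero_objectD(3)[OF that(3), of x'] state_hom[OF that(2)] by simp
  qed
  \<comment> \<open>The component on \<open>p'\<close> is transported along the arrow
    \<open>p' -> p\<close>, rescaled by the quotient of the two coefficients.\<close>
  have B: "dominates J (P p) V a x (P p') V' a' x'"
    if "state J (P p) V a x" "state J (P p') V' a' x'" "pre p' p" "pre p J" "a \<cdot> b p' p = zer T (P p') V"
      "x = c \<odot> b p J" "x' = d \<odot> b p' J" "c \<noteq> 0" for p V a x p' V' a' x' c d
    by (rule dominatesI[OF that(1,2), of "(d / c) \<odot> b p' p"]) (use that(3-8) state_hom[OF that(1)] in simp_all)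
  \<comment> \<open>The only combination in which both components are kept; they are recorded
    together as \<open>st_both\<close>. \<open>C'\<close> is the same with the two sources in the
    other order.\<close>
  have C: "?thesis" if e: "(U1, V1, a1, x1, U2, V2, a2, x2) = (P q1, Z1, zer T (P q1) Z1, c \<odot> b q1 J, P q2, Z2,
      zer T (P q2) Z2, d \<odot> b q2 J)"
     "mesh m q1 q2 J" "c \<noteq> 0" "d \<noteq> 0" "zero_object T Z1" "zero_object T Z2" for m q1 q2 Z1 Z2 c d
  proof -
    have Ve: "isom T V2 V j2" using biproduct_zero_isom[OF bV] e by simp
    then have V: "zero_object T V" using zero_object_isom e by blast
    note [simp] = zero_objectD(1)[OF V] zero_objectD(1)[OF e(5)] zero_objectD(1)[OF e(6)]
    have bU': "biproduct T (P q1) (P q2) U i1 i2 p1 p2" using bU e by simp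
    have "state J U V (zer T U V) (c \<odot> (b q1 J \<cdot> p1) \<oplus> d \<odot> (b q2 J \<cdot> p2))"
      by (rule st_both[OF e(2) bU' e(3,4) V])
    moreover have "j1 \<cdot> (a1 \<cdot> p1) \<oplus> j2 \<cdot> (a2 \<cdot> p2) = zer T U V" "x1 \<cdot> p1 \<oplus> x2 \<cdot> p2 = c \<odot> (b q1 J \<cdot> p1)
        \<oplus> d \<odot> (b q2 J \<cdot> p2)"
      using e biproductD[OF bU'] biproductD[OF bV] by simp_all
    ultimately show ?thesis by simp
  qed
  have C': "?thesis" if e: "(U1, V1, a1, x1, U2, V2, a2, x2) = (P q2, Z2, zer T (P q2) Z2, d \<odot> b q2 J, P q1, Z1,
      zer T (P q1) Z1, c \<odot> b q1 J)"
     "mesh m q1 q2 J" "c \<noteq> 0" "d \<noteq> 0" "zero_object T Z1" "zero_object T Z2" for m q1 q2 Z1 Z2 c d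
  proof -
    have Ve: "isom T V2 V j2" using biproduct_zero_isom[OF bV] e by simp
    then have V: "zero_object T V" using zero_object_isom e by blast
    note [simp] = zero_objectD(1)[OF V] zero_objectD(1)[OF e(5)] zero_objectD(1)[OF e(6)]
    have bU': "biproduct T (P q1) (P q2) U i2 i1 p2 p1" using biproduct_swap[OF bU] e by simp
    have "state J U V (zer T U V) (c \<odot> (b q1 J \<cdot> p2) \<oplus> d \<odot> (b q2 J \<cdot> p1))"
      by (rule st_both[OF e(2) bU' e(3,4) V])
    moreover have "j1 \<cdot> (a1 \<cdot> p1) \<oplus> j2 \<cdot> (a2 \<cdot> p2) = zer T U V" "x1 \<cdot> p1 \<oplus> x2 \<cdot> p2 = c \<odot> (b q1 J \<cdot> p2)
        \<oplus> d \<odot> (b q2 J \<cdot> p1)"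
      using e biproductD[OF bU'] biproductD[OF bV] by (simp_all add: add_com)
    ultimately show ?thesis by simp
  qed
  have D: "dominates J (P p) Z (zer T (P p) Z) (c \<odot> b p J) Q V' a' x'"
      if "state J (P p) Z (zer T (P p) Z) (c \<odot> b p J)" "state J Q V' a' x'"
     "arr T s" "dm T s = Q" "cd T s = P p" "x' = b p J \<cdot> s" "c \<noteq> 0" for p Z c Q V' a' x' s
    by (rule dominatesI[OF that(1,2),
        of "inverse c \<odot> s"]) (use that(3-7) state_hom(5)[OF that(1)] state_hom(4)[OF that(2)] in simp_all)
  have E: "dominates J (P p) Z (zer T (P p) Z) (c \<odot> b p J) Q (P J) (b q1 J \<cdot> r
      \<oplus> (- 1) \<odot> (b q2 J \<cdot> r')) (d \<odot> (b q1 J \<cdot> r)) \<or>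
       dominates J Q (P J) (b q1 J \<cdot> r
           \<oplus> (- 1) \<odot> (b q2 J \<cdot> r')) (d \<odot> (b q1 J \<cdot> r)) (P p) Z (zer T (P p) Z) (c \<odot> b p J)"
     if s: "state J (P p) Z (zer T (P p) Z) (c \<odot> b p J)" "state J Q (P J) (b q1 J \<cdot> r
         \<oplus> (- 1) \<odot> (b q2 J \<cdot> r')) (d \<odot> (b q1 J \<cdot> r))"
      and m: "mesh m q1 q2 J" and bp: "biproduct T (P q1) (P q2) Q i j r r'" and p: "pre p J" and nz: "c \<noteq> 0"
          "d \<noteq> 0"
     for p Z c d m q1 q2 r r' i j Q
  proof -
    note [simp] = biproductD[OF bp] meshD[OF m] state_hom(5)[OF s(1)]
    consider "p = m" | "p = q2" | "p = q1 \<or> p = J" using pre_mesh_cases[OF m p] by blast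
    then show ?thesis
    proof cases
      case 1
      \<comment> \<open>A source at the start of the square maps to the sum of the middle corners by
        the fork. The join kills the fork because the square commutes, and the component on the
        first corner recovers the edge to \<open>J\<close>.\<close>
      have "dominates J Q (P J) (b q1 J \<cdot> r
          \<oplus> (- 1) \<odot> (b q2 J \<cdot> r')) (d \<odot> (b q1 J \<cdot> r)) (P m) Z (zer T (P p) Z) (c \<odot> b p J)"
        by (rule dominatesI[of _ _ _ _ _ _ _ _ _ "(c / d) \<odot> (i \<cdot> b m q1
            \<oplus> j \<cdot> b m q2)"]) (use s 1 nz in \<open>simp_all add: smul_left\<close>)
      then show ?thesis using 1 by simp
    next
      case 2
      \<comment> \<open>The component of the join sits on \<open>q1\<close>, while the source is at
        \<open>q2\<close>. Adding a multiple of the join itself exchanges the two corners, which is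
        why \<open>y\<close> is nonzero here.\<close>
      have "(d \<odot> (b q2 J \<cdot> r')) \<oplus> (d \<odot> (b q1 J \<cdot> r) \<oplus> (- d) \<odot> (b q2 J \<cdot> r')) = d \<odot> (b q1 J \<cdot> r)"
        using add_left_com[of "d \<odot> (b q2 J \<cdot> r')" "d \<odot> (b q1 J \<cdot> r)" "(- d) \<odot> (b q2 J \<cdot> r')"]
            by (simp add: smul_left)
      then have "dominates J (P p) Z (zer T (P p) Z) (c \<odot> b p J) Q (P J) (b q1 J \<cdot> r
          \<oplus> (- 1) \<odot> (b q2 J \<cdot> r')) (d \<odot> (b q1 J \<cdot> r))"
        unfolding dominates_def
        by (intro exI[of _ "(d / c) \<odot> r'"] exI[of _ "zer T (P J) Z"] exI[of _ "d \<odot> ide T (P J)"]) (use 2 nz in simp)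
      then show ?thesis ..
    next
      case 3
      then show ?thesis using m nz by (intro disjI1 D[OF s, of "d \<odot> (b q1 p \<cdot> r)"]) auto
    qed
  qed
  have F: "dominates J Q Z (zer T Q Z) (c \<odot> (b q1 J \<cdot> r) \<oplus> d \<odot> (b q2 J \<cdot> r')) (P p) V' a' (e \<odot> b p J) \<or>
      dominates J (P p) V' a' (e \<odot> b p J) Q Z (zer T Q Z) (c \<odot> (b q1 J \<cdot> r) \<oplus> d \<odot> (b q2 J \<cdot> r'))"
     if s: "state J Q Z (zer T Q Z) (c \<odot> (b q1 J \<cdot> r) \<oplus> d \<odot> (b q2 J \<cdot> r'))" "state J (P p) V' a' (e \<odot> b p J)"
      and m: "mesh m q1 q2 J" and bp: "biproduct T (P q1) (P q2) Q i j r r'" and p: "pre p J" and nz: "c \<noteq> 0"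
          "d \<noteq> 0" "e \<noteq> 0"
      and a': "a' = zer T (P p) V'" for Q Z c d q1 q2 r r' p V' a' e m i j
  proof -
    note [simp] = biproductD[OF bp] meshD[OF m] state_hom(5)[OF s(1)] state_hom(5)[OF s(2)]
    consider "p = m \<or> p = q1" | "p = q2" | "p = J" using pre_mesh_cases[OF m p] by blast
    then show ?thesis
    proof cases
      case 1
      then have [simp]: "pre p q1" by auto
      show ?thesis by (rule disjI1, rule dominatesI[OF s, of "(e / c) \<odot> (i \<cdot> b p q1)"]) (use nz in simp_all)
    next
      case 2
      show ?thesis by (rule disjI1, rule dominatesI[OF s, of "(e / d) \<odot> j"]) (use nz 2 in simp_all)
    next
      case 3
      show ?thesis by (rule disjI2, rule dominatesI[OF s(2,1), of "(c / e) \<odot> (b q1 J \<cdot> r)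
          \<oplus> (d / e) \<odot> (b q2 J \<cdot> r')"]) (use nz 3 a' in simp_all)
    qed
  qed
  \<comment> \<open>Two joins over the same square are identified by their corners; the same
    multiple of this identification is used on the sources and on the targets.\<close>
  have G: "dominates J Q (P J) (b q1 J \<cdot> r \<oplus> (- 1) \<odot> (b q2 J \<cdot> r')) (c \<odot> (b q1 J \<cdot> r)) Q' (P J) (b q1 J \<cdot> l
      \<oplus> (- 1) \<odot> (b q2 J \<cdot> l')) (d \<odot> (b q1 J \<cdot> l))"
    if m: "mesh m q1 q2 J" and bp: "biproduct T (P q1) (P q2) Q i j r r'"
        and bp': "biproduct T (P q1) (P q2) Q' i' j' l l'" and nz: "c \<noteq> 0"
    for Q Q' m q1 q2 r r' l l' i j i' j' c d
  proof -
    note [simp] = biproductD[OF bp] biproductD[OF bp']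
    show ?thesis unfolding dominates_def
      by (intro exI[of _ "(d / c) \<odot> (i \<cdot> l \<oplus> j \<cdot> l')"] exI[of _ "(d / c) \<odot> ide T (P J)"]
          exI[of _ "zer T (P J) (P J)"]) (use nz in simp)
  qed
  have H: "dominates J Q Z (zer T Q Z) (c \<odot> (b q1 J \<cdot> r) \<oplus> d \<odot> (b q2 J \<cdot> r')) Q' V' a' (c' \<odot> (b q1 J \<cdot> l)
      \<oplus> d' \<odot> (b q2 J \<cdot> l'))"
    if s: "state J Q Z (zer T Q Z) (c \<odot> (b q1 J \<cdot> r) \<oplus> d \<odot> (b q2 J \<cdot> r'))" "state J Q' V' a' (c' \<odot> (b q1 J \<cdot> l)
        \<oplus> d' \<odot> (b q2 J \<cdot> l'))"
      and m: "mesh m q1 q2 J" and bp: "biproduct T (P q1) (P q2) Q i j r r'"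
          and bp': "biproduct T (P q1) (P q2) Q' i' j' l l'" and nz: "c \<noteq> 0" "d \<noteq> 0"
    for Q Q' m q1 q2 r r' l l' i j i' j' c d c' d' Z V' a'
  proof -
    note [simp] = biproductD[OF bp] biproductD[OF bp'] state_hom(5)[OF s(1)]
    show ?thesis by (rule dominatesI[OF s, of "(c' / c) \<odot> (i \<cdot> l) \<oplus> (d' / d) \<odot> (j \<cdot> l')"]) (use nz in simp_all)
  qed
  \<comment> \<open>Puts the component of a join into the shape expected by \<open>H\<close>, with
    coefficient 0 on the second corner.\<close>
  have z: "d' = 0 \<Longrightarrow> c' \<odot> (b q1 J \<cdot> l) \<oplus> d' \<odot> (b q2 J \<cdot> l') = c' \<odot> (b q1 J \<cdot> l)"
    if "biproduct T (P q1) (P q2) Q' i' j' l l'" for c' d' q1 q2 l l' Q' i' j'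
    using biproductD[OF that] by simp
  show ?thesis using s1
  proof cases
    case st_zero
    then show ?thesis using A[OF s2 s1] by simp
  next
    case 1: (st_src p c)
    show ?thesis using s2
    proof cases
      case st_zero
      then show ?thesis using A[OF s1 s2] by simp
    next
      case 2: (st_src p' c')
      consider "pre p p'" | "pre p' p" | m where "mesh m p p' J" | m where "mesh m p' p J"
        using pre_connected[OF 1(5) 2(5)] by blast
      then show ?thesis
      proof cases
        case _: 1
        then show ?thesis using B[OF s2[unfolded 2] s1[unfolded 1], of c' c] 1 2 zero_objectD(1) by simp
      next
        case _: 2
        then show ?thesis using B[OF s1[unfolded 1] s2[unfolded 2], of c c'] 1 2 zero_objectD(1) by simp
      next
        case (3 m)
        show ?thesis by (rule C[OF _ 3 1(6) 2(6) 1(4) 2(4)]) (use 1 2 in simp)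
      next
        case (4 m)
        show ?thesis by (rule C'[OF _ 4 2(6) 1(6) 2(4) 1(4)]) (use 1 2 in simp)
      qed
    next
      case 2: (st_bas p' q c')
      consider "pre p' p" | "pre p p'" "\<not> pre p q" using branch_pre[OF 2(5) 1(5)] by blast
      then show ?thesis
      proof cases
        case _: 1
        then show ?thesis using B[OF s1[unfolded 1] s2[unfolded 2], of c c'] 1 2 zero_objectD(1) by simp
      next
        case 3: 2
        have "dominates J U2 V2 a2 x2 U1 V1 a1 x1" unfolding 1 2
          by (rule B[OF s2[unfolded 2] s1[unfolded 1] 3(1) _ _ refl refl 2(6)]) (use 2(5) 3 in \<open>auto simp:
              branch_def gmor_not_pre\<close>)
        then show ?thesis by simp
      qed
    next
      case 2: (st_join m q1 q2 i j r r' d)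
      show ?thesis unfolding 1 2 using E[OF s1[unfolded 1] s2[unfolded 2] 2(4,5) 1(5,6) 2(6)] by blast
    next
      case 2: (st_both m q1 q2 i j r r' d e)
      show ?thesis unfolding 1 2 using F[OF s2[unfolded 2] s1[unfolded 1] 2(3,4) 1(5) 2(5,6) 1(6)] by blast
    qed
  next
    case 1: (st_bas p q c)
    show ?thesis using s2
    proof cases
      case st_zero
      then show ?thesis using A[OF s1 s2] by simp
    next
      case 2: (st_src p' c')
      consider "pre p p'" | "pre p' p" "\<not> pre p' q" using branch_pre[OF 1(5) 2(5)] by blast
      then show ?thesis
      proof cases
        case _: 1
        then show ?thesis using B[OF s2[unfolded 2] s1[unfolded 1], of c' c] 1 2 zero_objectD(1) by simp
      next
        case 3: 2
        have "dominates J U1 V1 a1 x1 U2 V2 a2 x2" unfolding 1 2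
          by (rule B[OF s1[unfolded 1] s2[unfolded 2] 3(1) _ _ refl refl 1(6)]) (use 1(5) 3 in \<open>auto simp:
              branch_def gmor_not_pre\<close>)
        then show ?thesis by simp
      qed
    next
      case 2: (st_bas p' q' c')
      then have e: "p' = p" "q' = q" using branch_unique 1 by blast+
      have "dominates J U1 V1 a1 x1 U2 V2 a2 x2" unfolding 1 2 e dominates_def
        by (intro exI[of _ "(c' / c) \<odot> ide T (P p)"] exI[of _ "(c' / c) \<odot> ide T (P q)"]
            exI[of _ "zer T (P q) (P J)"]) (use 1 in simp)
      then show ?thesis ..
    next
      case 2: (st_join m q1 q2 i j r r' d)
      then show ?thesis using branch_no_mesh 1 by blast
    next
      case 2: (st_both m q1 q2 i j r r' d e)
      then show ?thesis using branch_no_mesh 1 by blast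
    qed
  next
    case 1: (st_join m q1 q2 i j r r' c)
    show ?thesis using s2
    proof cases
      case st_zero
      then show ?thesis using A[OF s1 s2] by simp
    next
      case 2: (st_src p' c')
      show ?thesis unfolding 1 2 using E[OF s2[unfolded 2] s1[unfolded 1] 1(4,5) 2(5,6) 1(6)] by blast
    next
      case 2: (st_bas p' q' c')
      then show ?thesis using branch_no_mesh 1 by blast
    next
      case 2: (st_join m' q1' q2' i' j' l l' d)
      have e: "q1' = q1" "q2' = q2" using mesh_unique 1(4) 2(4) by blast+
      show ?thesis unfolding 1 2 e by (rule disjI1, rule G[OF 1(4,5) 2(5)[unfolded e] 1(6)])
    next
      case 2: (st_both m' q1' q2' i' j' l l' d d')
      have e: "q1' = q1" "q2' = q2" using mesh_unique 1(4) 2(3) by blast+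
      have "dominates J U2 V2 a2 x2 U1 V1 a1 x1" unfolding 1 2 e
        using H[OF s2[unfolded 2 e] _ 1(4) 2(4)[unfolded e] 1(5) 2(5,6), where c'=c and d'=0] s1[unfolded 1]
            z[OF 1(5)] by metis
      then show ?thesis by simp
    qed
  next
    case 1: (st_both m q1 q2 i j r r' c d)
    show ?thesis using s2
    proof cases
      case st_zero
      then show ?thesis using A[OF s1 s2] by simp
    next
      case 2: (st_src p' c')
      show ?thesis unfolding 1 2 using F[OF s1[unfolded 1] s2[unfolded 2] 1(3,4) 2(5) 1(5,6) 2(6)] by blast
    next
      case 2: (st_bas p' q' c')
      then show ?thesis using branch_no_mesh 1 by blast
    next
      case 2: (st_join m' q1' q2' i' j' l l' c')
      have e: "q1' = q1" "q2' = q2" using mesh_unique 1(3) 2(4) by blast+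
      have "dominates J U1 V1 a1 x1 U2 V2 a2 x2" unfolding 1 2 e
        using H[OF s1[unfolded 1] _ 1(3,4) 2(5)[unfolded e] 1(5,6), where c'=c' and d'=0] s2[unfolded 2 e]
            z[OF 2(5)[unfolded e]] by metis
      then show ?thesis by simp
    next
      case 2: (st_both m' q1' q2' i' j' l l' c' d')
      have e: "q1' = q1" "q2' = q2" using mesh_unique 1(3) 2(3) by blast+
      have "dominates J U1 V1 a1 x1 U2 V2 a2 x2" unfolding 1 2 e
        by (rule H[OF s1[unfolded 1] s2[unfolded 2 e] 1(3,4) 2(4)[unfolded e] 1(5,6)])
      then show ?thesis by simp
    qed
  qed
qed

end


section \<open>Clearing a new component against a decomposed morphism\<close>

context exceptional_octahedron
begin

text \<open>After a change of direct sum decompositions of source and target, and up to the multiple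
  \<open>y \<cdot> u\<close> that row operations remove, \<open>x\<close> lives on a single block
  \<open>a\<close> of \<open>u\<close>, and the pair is one of those listed by
  \<open>state\<close>.\<close>

definition reduced :: "vertex \<times> int \<Rightarrow> 'o \<Rightarrow> 'o \<Rightarrow> 'a \<Rightarrow> 'a \<Rightarrow> bool" where
  "reduced J U V u x \<longleftrightarrow> (\<exists>Ua Va a xa U' V' u' i1 i2 p1 p2 j1 j2 k1 k2 y.
     state J Ua Va a xa \<and> decomposed (weight J) U' V' u' \<and> biproduct T Ua U' U i1 i2 p1 p2 \<and>
         biproduct T Va V' V j1 j2 k1 k2 \<and>
     arr T u \<and> dm T u = U \<and> cd T u = V \<and> u \<cdot> i1 = j1 \<cdot> a \<and> u \<cdot> i2 = j2 \<cdot> u' \<and>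
     arr T y \<and> dm T y = V \<and> cd T y = P J \<and> x = xa \<cdot> p1 \<oplus> y \<cdot> u)"

lemma reducedI:
  assumes "state J Ua Va a xa" "decomposed (weight J) U' V' u'" "biproduct T Ua U' U i1 i2 p1 p2"
      "biproduct T Va V' V j1 j2 k1 k2"
     "arr T u" "dm T u = U" "cd T u = V" "u \<cdot> i1 = j1 \<cdot> a" "u \<cdot> i2 = j2 \<cdot> u'"
     "arr T y" "dm T y = V" "cd T y = P J" "x = xa \<cdot> p1 \<oplus> y \<cdot> u"
  shows "reduced J U V u x"
  unfolding reduced_def using assms by blast

lemma reduced_zero:
  assumes u: "decomposed (weight J) U V u" and y: "arr T y" "dm T y = V" "cd T y = P J"
  shows "reduced J U V u (y \<cdot> u)"
proof -
  obtain Z where Z: "zero_object T Z" using ex_zero_object by blast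
  note [simp] = zero_objectD(1)[OF Z] decomposed_hom[OF u] y
  show ?thesis
    by (rule reducedI[OF st_zero[OF Z Z] u biproduct_zero[OF Z] biproduct_zero[OF Z], where y=y]) simp_all
qed

lemma reduced_state:
  assumes s: "state J U V a xa" and y: "arr T y" "dm T y = V" "cd T y = P J"
  shows "reduced J U V a (xa \<oplus> y \<cdot> a)"
proof -
  obtain Z where Z: "zero_object T Z" using ex_zero_object by blast
  note [simp] = zero_objectD(1)[OF Z] state_hom[OF s] y
  show ?thesis
    by (rule reducedI[OF s decomposed.zero[OF Z Z] biproduct_swap[OF biproduct_zero[OF Z]]
        biproduct_swap[OF biproduct_zero[OF Z]], where y=y]) simp_all
qed

text \<open>The shears by \<open>s\<close> and \<open>t\<close> keep the morphism diagonal because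
  \<open>t \<cdot> a2 = a1 \<cdot> s\<close>. In the new decomposition the second component is only
  \<open>y \<cdot> a2\<close>, a multiple of the morphism.\<close>

lemma reduced_dominates:
  assumes s1: "state J U1 V1 a1 x1" and s2: "state J U2 V2 a2 x2" and d: "dominates J U1 V1 a1 x1 U2 V2 a2 x2"
    and bU: "biproduct T U1 U2 U i1 i2 p1 p2" and bV: "biproduct T V1 V2 V j1 j2 k1 k2"
  shows "reduced J U V (j1 \<cdot> (a1 \<cdot> p1) \<oplus> j2 \<cdot> (a2 \<cdot> p2)) (x1 \<cdot> p1 \<oplus> x2 \<cdot> p2)"
proof -
  obtain s t y where st: "arr T s" "dm T s = U2" "cd T s = U1" "arr T t" "dm T t = V2" "cd T t = V1"
     "arr T y" "dm T y = V2" "cd T y = P J" and e: "t \<cdot> a2 = a1 \<cdot> s" "x2 = x1 \<cdot> s \<oplus> y \<cdot> a2"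
    using d unfolding dominates_def by blast
  note [simp] = state_hom[OF s1] state_hom[OF s2] biproductD[OF bU] biproductD[OF bV] st
  show ?thesis
  proof (rule reducedI[OF s1 decomposed_state[OF s2] biproduct_shear[OF bU st(1-3)] biproduct_shear[OF bV st(4-6)],
      where y="y \<cdot> k2"])
    show "(j1 \<cdot> (a1 \<cdot> p1) \<oplus> j2 \<cdot> (a2 \<cdot> p2)) \<cdot> (i2 \<oplus> (- 1) \<odot> (i1 \<cdot> s)) = (j2 \<oplus> (- 1) \<odot> (j1 \<cdot> t)) \<cdot> a2"
      by (simp add: e(1) add_com)
    show "x1 \<cdot> p1 \<oplus> x2 \<cdot> p2 = x1 \<cdot> (p1 \<oplus> s \<cdot> p2) \<oplus> (y \<cdot> k2) \<cdot> (j1 \<cdot> (a1 \<cdot> p1) \<oplus> j2 \<cdot> (a2 \<cdot> p2))"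
      by (simp add: e(2))
  qed simp_all
qed

text \<open>A summand on which \<open>x\<close> is already a multiple of \<open>u\<close> joins the
  decomposed rest; the multiples on both parts add up to one on the whole target.\<close>

lemma reduced_sum:
  assumes r: "reduced J U1 V1 u1 x1" and u2: "decomposed (weight J) U2 V2 u2"
    and bU: "biproduct T U1 U2 U i1 i2 p1 p2" and bV: "biproduct T V1 V2 V j1 j2 k1 k2"
    and u: "arr T u" "dm T u = U" "cd T u = V" "u \<cdot> i1 = j1 \<cdot> u1" "u \<cdot> i2 = j2 \<cdot> u2"
    and y: "arr T y" "dm T y = V" "cd T y = P J"
  shows "reduced J U V u (x1 \<cdot> p1 \<oplus> y \<cdot> u)"
proof -
  obtain Ua Va a xa U' V' u' a1 a2 b1 b2 c1 c2 d1 d2 y1 where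
     s: "state J Ua Va a xa" and u': "decomposed (weight J) U' V' u'" and bp: "biproduct T Ua U' U1 a1 a2 b1 b2"
         and bp': "biproduct T Va V' V1 c1 c2 d1 d2" and
     u1: "arr T u1" "dm T u1 = U1" "cd T u1 = V1" "u1 \<cdot> a1 = c1 \<cdot> a" "u1 \<cdot> a2 = c2 \<cdot> u'"
     and y1: "arr T y1" "dm T y1 = V1" "cd T y1 = P J" and x1: "x1 = xa \<cdot> b1 \<oplus> y1 \<cdot> u1"
    using r unfolding reduced_def by blast
  obtain R e1 e2 f1 f2 where R: "biproduct T U' U2 R e1 e2 f1 f2" using ex_biproduct decomposed_hom(4) u' u2
      by metis
  obtain R' g1 g2 h1 h2 where R': "biproduct T V' V2 R' g1 g2 h1 h2" using ex_biproduct decomposed_hom(5) u' u2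
      by metis
  note [simp] = biproductD[OF bp] biproductD[OF bp'] biproductD[OF R] biproductD[OF R'] biproductD[OF bU]
      biproductD[OF bV]
    u(1-3) y u1(1-3) y1 state_hom[OF s] decomposed_hom[OF u'] decomposed_hom[OF u2]
  have ue: "u = j1 \<cdot> (u1 \<cdot> p1) \<oplus> j2 \<cdot> (u2 \<cdot> p2)" by (rule diag_eq[OF bU]) (simp_all add: u)
  have k1u: "k1 \<cdot> u = u1 \<cdot> p1" unfolding ue by simp
  have ui: "u \<cdot> (i1 \<cdot> x) = j1 \<cdot> (u1 \<cdot> x)" if "arr T x" "cd T x = U1" for x using cmp_eq[OF u(4), of x] that by simp
  have ui2: "u \<cdot> (i2 \<cdot> x) = j2 \<cdot> (u2 \<cdot> x)" if "arr T x" "cd T x = U2" for x using cmp_eq[OF u(5), of x] that by simp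
  have ua: "u1 \<cdot> (a2 \<cdot> x) = c2 \<cdot> (u' \<cdot> x)" if "arr T x" "cd T x = U'" for x using cmp_eq[OF u1(5), of x] that
      by simp
  show ?thesis
  proof (rule reducedI[OF s decomposed.sum[OF u' u2 R R'] biproduct_assoc[OF bp bU R] biproduct_assoc[OF bp' bV R'],
      where y="y \<oplus> y1 \<cdot> k1"])
    show "u \<cdot> (i1 \<cdot> a1) = (j1 \<cdot> c1) \<cdot> a" using u1(4) by (simp add: ui)
    show "u \<cdot> (i1 \<cdot> (a2 \<cdot> f1) \<oplus> i2 \<cdot> f2) = (j1 \<cdot> (c2 \<cdot> h1) \<oplus> j2 \<cdot> h2) \<cdot> (g1 \<cdot> (u' \<cdot> f1) \<oplus> g2 \<cdot> (u2 \<cdot> f2))"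
      by (simp add: ui ui2 ua)
    show "x1 \<cdot> p1 \<oplus> y \<cdot> u = xa \<cdot> (b1 \<cdot> p1) \<oplus> (y \<oplus> y1 \<cdot> k1) \<cdot> u" unfolding x1 by (simp add: k1u add_ac)
  qed simp_all
qed

text \<open>The two remaining blocks are gathered into one summand and compared by
  \<open>state_compare\<close>, while the decomposed rests form the other summand.\<close>

lemma reduced_join:
  assumes r1: "reduced J U1 V1 u1 x1" and r2: "reduced J U2 V2 u2 x2"
    and bU: "biproduct T U1 U2 U i1 i2 p1 p2" and bV: "biproduct T V1 V2 V j1 j2 k1 k2"
  shows "reduced J U V (j1 \<cdot> (u1 \<cdot> p1) \<oplus> j2 \<cdot> (u2 \<cdot> p2)) (x1 \<cdot> p1 \<oplus> x2 \<cdot> p2)"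
proof -
  obtain Ua Va a xa U' V' u' a1 a2 b1 b2 c1 c2 d1 d2 y1 where
     s1: "state J Ua Va a xa" and u': "decomposed (weight J) U' V' u'" and bp1: "biproduct T Ua U' U1 a1 a2 b1 b2"
         and bp1': "biproduct T Va V' V1 c1 c2 d1 d2" and
     u1: "arr T u1" "dm T u1 = U1" "cd T u1 = V1" "u1 \<cdot> a1 = c1 \<cdot> a" "u1 \<cdot> a2 = c2 \<cdot> u'"
     and y1: "arr T y1" "dm T y1 = V1" "cd T y1 = P J" and x1: "x1 = xa \<cdot> b1 \<oplus> y1 \<cdot> u1"
    using r1 unfolding reduced_def by blast
  obtain Ub Vb a' xb U'' V'' u'' a1' a2' b1' b2' c1' c2' d1' d2' y2 where
     s2: "state J Ub Vb a' xb" and u'': "decomposed (weight J) U'' V'' u''"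
         and bp2: "biproduct T Ub U'' U2 a1' a2' b1' b2'" and bp2': "biproduct T Vb V'' V2 c1' c2' d1' d2'" and
     u2: "arr T u2" "dm T u2 = U2" "cd T u2 = V2" "u2 \<cdot> a1' = c1' \<cdot> a'" "u2 \<cdot> a2' = c2' \<cdot> u''"
     and y2: "arr T y2" "dm T y2 = V2" "cd T y2 = P J" and x2: "x2 = xb \<cdot> b1' \<oplus> y2 \<cdot> u2"
    using r2 unfolding reduced_def by blast
  obtain W e1 e2 f1 f2 where W: "biproduct T Ua Ub W e1 e2 f1 f2" using ex_biproduct state_hom(4) s1 s2 by metis
  obtain W' e1' e2' f1' f2' where W': "biproduct T Va Vb W' e1' e2' f1' f2'" using ex_biproduct state_hom(5) s1 s2
      by metis
  obtain R g1 g2 h1 h2 where R: "biproduct T U' U'' R g1 g2 h1 h2" using ex_biproduct decomposed_hom(4) u' u''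
      by metis
  obtain R' g1' g2' h1' h2' where R': "biproduct T V' V'' R' g1' g2' h1' h2'"
      using ex_biproduct decomposed_hom(5) u' u'' by metis
  note [simp] = biproductD[OF bp1] biproductD[OF bp1'] biproductD[OF bp2] biproductD[OF bp2'] biproductD[OF bU]
      biproductD[OF bV]
    biproductD[OF W] biproductD[OF W'] biproductD[OF R] biproductD[OF R'] u1(1-3) u2(1-3) y1 y2
    state_hom[OF s1] state_hom[OF s2] decomposed_hom[OF u'] decomposed_hom[OF u'']
  have ua: "u1 \<cdot> (a1 \<cdot> x) = c1 \<cdot> (a \<cdot> x)" if "arr T x" "cd T x = Ua" for x using cmp_eq[OF u1(4), of x] that by simp
  have ua2: "u1 \<cdot> (a2 \<cdot> x) = c2 \<cdot> (u' \<cdot> x)" if "arr T x" "cd T x = U'" for x using cmp_eq[OF u1(5), of x] that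
      by simp
  have ub: "u2 \<cdot> (a1' \<cdot> x) = c1' \<cdot> (a' \<cdot> x)" if "arr T x" "cd T x = Ub" for x using cmp_eq[OF u2(4), of x] that
      by simp
  have ub2: "u2 \<cdot> (a2' \<cdot> x) = c2' \<cdot> (u'' \<cdot> x)" if "arr T x" "cd T x = U''" for x using cmp_eq[OF u2(5), of x] that
      by simp
  let ?u = "j1 \<cdot> (u1 \<cdot> p1) \<oplus> j2 \<cdot> (u2 \<cdot> p2)"
  let ?w = "e1' \<cdot> (a \<cdot> f1) \<oplus> e2' \<cdot> (a' \<cdot> f2)" and ?x = "xa \<cdot> f1 \<oplus> xb \<cdot> f2"
  let ?w' = "e2' \<cdot> (a' \<cdot> f2) \<oplus> e1' \<cdot> (a \<cdot> f1)" and ?x' = "xb \<cdot> f2 \<oplus> xa \<cdot> f1"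
  have wx: "?w' = ?w" "?x' = ?x" by (simp_all add: add_com)
  have w: "reduced J W W' ?w ?x"
    using state_compare[OF s1 s2 W W']
  proof (elim disjE)
    assume "dominates J Ua Va a xa Ub Vb a' xb"
    then show ?thesis by (rule reduced_dominates[OF s1 s2 _ W W'])
  next
    assume "dominates J Ub Vb a' xb Ua Va a xa"
    then show ?thesis unfolding wx[symmetric] by (rule reduced_dominates[OF s2 s1 _ biproduct_swap[OF W]
        biproduct_swap[OF W']])
  next
    assume "state J W W' ?w ?x"
    from reduced_state[OF this, of "zer T W' (P J)"] show ?thesis by simp
  qed
  have "reduced J U V ?u (?x \<cdot> (e1 \<cdot> (b1 \<cdot> p1) \<oplus> e2 \<cdot> (b1' \<cdot> p2)) \<oplus> (y1 \<cdot> k1 \<oplus> y2 \<cdot> k2) \<cdot> ?u)"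
    by (rule reduced_sum[OF w decomposed.sum[OF u' u'' R R'] biproduct_interchange[OF bp1 bp2 bU W R]
        biproduct_interchange[OF bp1' bp2' bV W' R']])
      (simp_all add: ua ua2 ub ub2)
  moreover have "?x \<cdot> (e1 \<cdot> (b1 \<cdot> p1) \<oplus> e2 \<cdot> (b1' \<cdot> p2)) \<oplus> (y1 \<cdot> k1 \<oplus> y2 \<cdot> k2) \<cdot> ?u = x1 \<cdot> p1 \<oplus> x2 \<cdot> p2"
    unfolding x1 x2 by (simp add: add_ac)
  ultimately show ?thesis by simp
qed

text \<open>Induction on the decomposition. Since no summand of the target exceeds the weight of
  \<open>J\<close>, a component on an edge, fork or join factors through its target except in the
  situations that \<open>state\<close> records.\<close>

lemma reduced_decomposed:
  assumes "decomposed (weight J) U V u" "arr T x" "dm T x = U" "cd T x = P J"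
  shows "reduced J U V u x"
  using assms
proof (induct arbitrary: x rule: decomposed.induct)
  case (zero Z Z')
  have "x = zer T Z' (P J) \<cdot> zer T Z Z'"
    using zero_objectD(3)[OF zero(1), of x] zero zero_objectD(1)[OF zero(1)] zero_objectD(1)[OF zero(2)] by simp
  then show ?case using reduced_zero[OF decomposed.zero[OF zero(1,2)],
      of "zer T Z' (P J)"] zero_objectD(1)[OF zero(2)] by simp
next
  case (src Z p)
  note [simp] = zero_objectD(1)[OF src(1)]
  note red0 = reduced_zero[OF decomposed.src[OF src(1)], of "zer T Z (P J)" J p]
  show ?case
  proof (cases "pre p J")
    case True
    obtain c where c: "x = c \<odot> b p J" using gob_hom(2)[OF src(2-4) True] by blast
    show ?thesis
    proof (cases "c = 0")
      case True then show ?thesis using red0 c by simp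
    next
      case False
      show ?thesis using reduced_state[OF st_src[OF src(1) True False], of "zer T Z (P J)"] c by simp
    qed
  next
    case False
    then show ?thesis using red0 gob_hom(1)[OF src(2-4) False] by simp
  qed
next
  case (tgt Z q)
  note [simp] = zero_objectD(1)[OF tgt(1)]
  have "x = zer T (P q) (P J) \<cdot> zer T Z (P q)" using zero_objectD(3)[OF tgt(1), of x] tgt by simp
  then show ?case using reduced_zero[OF decomposed.tgt[OF tgt(1,2)], of "zer T (P q) (P J)"] by simp
next
  case (bas p q)
  note red0 = reduced_zero[where J=J, OF decomposed.bas[OF bas(1,2)]]
  show ?case
  proof (cases "pre p J")
    case True
    obtain c where c: "x = c \<odot> b p J" using gob_hom(2)[OF bas(3-5) True] by blast
    show ?thesis
    proof (cases "pre q J")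
      case True
      show ?thesis using red0[of "c \<odot> b q J"] c bas(1) True by simp
    next
      case n: False
      show ?thesis
      proof (cases "c = 0")
        case 0: True show ?thesis using red0[of "zer T (P q) (P J)"] c 0 by simp
      next
        case False
        have "branch p q J" using True bas(1,2) n by (simp add: branch_def)
        then show ?thesis using reduced_state[OF st_bas[OF _ False], of p q J "zer T (P q) (P J)"] c by simp
      qed
    qed
  next
    case False
    then show ?thesis using red0[of "zer T (P q) (P J)"] gob_hom(1)[OF bas(3-5) False] by simp
  qed
next
  case (fork m q1 q2 r Q i j n1 n2)
  note [simp] = biproductD[OF fork(3)] meshD[OF fork(1)]
  note red0 = reduced_zero[where J=J, OF decomposed.fork[OF fork(1-3)]]
  show ?case
  proof (cases "pre m J")
    case True
    obtain c where c: "x = c \<odot> b m J" using gob_hom(2)[OF fork(4-6) True] by blast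
    consider "pre q1 J" | "pre q2 J" using mesh_above(1)[OF fork(1) True fork(2)] by blast
    then show ?thesis
    proof cases
      case 1 show ?thesis using red0[of "c \<odot> (b q1 J \<cdot> n1)"] c 1 by simp
    next
      case 2 show ?thesis using red0[of "c \<odot> (b q2 J \<cdot> n2)"] c 2 by simp
    qed
  next
    case False
    then show ?thesis using red0[of "zer T Q (P J)"] gob_hom(1)[OF fork(4-6) False] by simp
  qed
next
  case (join m q1 q2 r Q i j n1 n2)
  note [simp] = biproductD[OF join(3)] meshD[OF join(1)] join(4-6)
  note red0 = reduced_zero[where J=J, OF decomposed.join[OF join(1-3)]]
  have x: "x = (x \<cdot> i) \<cdot> n1 \<oplus> (x \<cdot> j) \<cdot> n2" using biproduct_out[OF join(3), of x] by simp
  note h1 = gob_hom[of "x \<cdot> i" q1 J] and h2 = gob_hom[of "x \<cdot> j" q2 J]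
  show ?case
  proof (cases "J = r")
    case True
    obtain c d where c: "x \<cdot> i = c \<odot> b q1 J" and d: "x \<cdot> j = d \<odot> b q2 J" using h1(2) h2(2) True by auto
    have x': "x = c \<odot> (b q1 J \<cdot> n1) \<oplus> d \<odot> (b q2 J \<cdot> n2)" by (subst x, unfold c d) simp
    \<comment> \<open>The join has coefficients 1 and -1, so a row \<open>(c, d)\<close> is a
      multiple of it when \<open>c + d = 0\<close>. Otherwise adding \<open>d\<close> times the join
      leaves \<open>c + d\<close> on the first corner alone.\<close>
    show ?thesis
    proof (cases "c + d = 0")
      case cd: True
      then have "d = - c" by (simp add: eq_neg_iff_add_eq_0 add.commute)
      then show ?thesis using red0[of "c \<odot> ide T (P J)"] x' True by simp
    next
      case False
      have m: "mesh m q1 q2 J" using join(1) True by simp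
      have "(c + d) \<odot> (b q1 J \<cdot> n1) \<oplus> ((- d) \<odot> (b q1 J \<cdot> n1) \<oplus> d \<odot> (b q2 J \<cdot> n2)) = x"
        unfolding x' by (simp add: smul_left2)
      then show ?thesis using reduced_state[OF st_join[OF m join(3) False], of "(- d) \<odot> ide T (P J)"] True by simp
    qed
  next
    case False
    consider (1) "pre q1 J" | (2) "pre q2 J" | (3) "\<not> pre q1 J" "\<not> pre q2 J" by blast
    then show ?thesis
    proof cases
      case 1
      note 1 [simp] = 1 mesh_above(2)[OF join(1) 1 join(2) False]
      obtain c where c: "x \<cdot> i = c \<odot> b q1 J" using h1(2) by auto
      have d: "x \<cdot> j = zer T (P q2) (P J)" using h2(1) by simp
      have "x = c \<odot> (b q1 J \<cdot> n1)" by (subst x, unfold c d) simp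
      then show ?thesis using red0[of "c \<odot> b r J"] by (simp add: gmor_not_pre)
    next
      case 2
      note 2 [simp] = 2 mesh_above(3)[OF join(1) 2 join(2) False]
      obtain d where d: "x \<cdot> j = d \<odot> b q2 J" using h2(2) by auto
      have c: "x \<cdot> i = zer T (P q1) (P J)" using h1(1) by simp
      have "x = d \<odot> (b q2 J \<cdot> n2)" by (subst x, unfold c d) simp
      then show ?thesis using red0[of "(- d) \<odot> b r J"] by (simp add: gmor_not_pre)
    next
      case 3
      have cd: "x \<cdot> i = zer T (P q1) (P J)" "x \<cdot> j = zer T (P q2) (P J)" using h1(1) h2(1) 3 by auto
      have "x = zer T Q (P J)" by (subst x, unfold cd) simp
      then show ?thesis using red0[of "zer T (P r) (P J)"] by simp
    qed
  qed
next
  case (sum U1 V1 u1 U2 V2 u2 U i1 i2 p1 p2 V j1 j2 k1 k2)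
  note [simp] = biproductD[OF sum(5)] sum(7-9)
  have "reduced J U1 V1 u1 (x \<cdot> i1)" "reduced J U2 V2 u2 (x \<cdot> i2)" using sum(2,4) by simp_all
  from reduced_join[OF this sum(5,6)] show ?case using biproduct_out[OF sum(5), of x] by simp
qed

text \<open>Each remaining pair, read as one arrow into the enlarged target, is again a normal form:
  \<open>st_zero\<close> gives a zero map from a zero object, \<open>st_src\<close> an edge,
  \<open>st_bas\<close> a fork, \<open>st_join\<close> a sum of two edges and \<open>st_both\<close>
  a join.\<close>

lemma decomposed_state_extend:
  assumes s: "state J U V a x" and bp: "biproduct T V (P J) W i j p q"
  shows "decomposed (weight J) U W (i \<cdot> a \<oplus> j \<cdot> x)"
  using s
proof cases
  case (st_zero)
  note [simp] = zero_objectD(1)[OF st_zero(3)] zero_objectD(1)[OF st_zero(4)] biproductD[OF bp]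
  have j: "isom T (P J) W j" using biproduct_zero_isom[OF bp] st_zero by simp
  show ?thesis by (rule decomposed_isom[OF decomposed.tgt[OF st_zero(3) order_refl] isom_ide j]) (use st_zero(1,2) in simp_all)
next
  case (st_src p' c)
  note [simp] = zero_objectD(1)[OF st_src(4)] biproductD[OF bp]
  have j: "isom T (P J) W j" using biproduct_zero_isom[OF bp] st_src by simp
  show ?thesis unfolding st_src(1)
    by (rule decomposed_isom[OF decomposed.bas[OF st_src(5) order_refl] isom_smul[OF isom_ide,
        of _ "inverse c"] j]) (use st_src in simp_all)
next
  case (st_bas p' q' c)
  note [simp] = biproductD[OF bp[unfolded st_bas(2)]]
  have "biproduct T (P q') (P J) W i (c \<odot> j) p (inverse c \<odot> q)" using biproduct_scale[OF bp st_bas(6)] st_bas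
      by simp
  note b1 = this biproduct_swap[OF this]
  obtain r where "mesh p' q' J r \<or> mesh p' J q' r" using branch_mesh[OF st_bas(5)] by blast
  then show ?thesis
  proof
    assume m: "mesh p' q' J r"
    show ?thesis using decomposed.fork[OF m _ b1(1), of "weight J"] meshD(12)[OF m] st_bas by simp
  next
    assume m: "mesh p' J q' r"
    show ?thesis using decomposed.fork[OF m _ b1(2), of "weight J"] st_bas by (simp add: add_com)
  qed
next
  case (st_join m q1 q2 i' j' n1 n2 c)
  have bp': "biproduct T (P J) (P J) W i j p q" using bp st_join by simp
  note [simp] = biproductD[OF bp'] biproductD[OF st_join(5)]
  \<comment> \<open>The coefficient matrix has rows \<open>(1, -1)\<close> and
    \<open>(c, 0)\<close>. Its columns form a basis because \<open>c\<close> is not 0, and taking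
    them as the injections into \<open>W\<close> makes the arrow diagonal.\<close>
  have b2: "biproduct T (P J) (P J) W (i \<oplus> c \<odot> j) ((- 1) \<odot> i) (inverse c \<odot> q) ((- 1) \<odot> p \<oplus> inverse c \<odot> q)"
  proof (rule biproductI)
    show "(i \<oplus> c \<odot> j) \<cdot> (inverse c \<odot> q) \<oplus> ((- 1) \<odot> i) \<cdot> ((- 1) \<odot> p \<oplus> inverse c \<odot> q) = ide T W"
      using st_join(6) add_left_com[of "j \<cdot> q" "i \<cdot> p" "- inverse c \<odot> (i \<cdot> q)"]
          add_left_com[of "inverse c \<odot> (i \<cdot> q)" "i \<cdot> p" "j \<cdot> q \<oplus> - inverse c \<odot> (i \<cdot> q)"]
       add_left_com[of "inverse c \<odot> (i \<cdot> q)" "j \<cdot> q" "- inverse c \<odot> (i \<cdot> q)"] by (simp add: smul_left)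
  qed (use st_join(6) in \<open>simp_all add: smul_left\<close>)
  have "decomposed (weight J) U W ((i \<oplus> c \<odot> j) \<cdot> (b q1 J \<cdot> n1) \<oplus> ((- 1) \<odot> i) \<cdot> (b q2 J \<cdot> n2))"
    by (rule decomposed.sum[OF decomposed.bas decomposed.bas st_join(5) b2]) (use meshD[OF st_join(4)] in simp_all)
  then show ?thesis using st_join(2,3) add_com[of "c \<odot> (j \<cdot> (b q1 J \<cdot> n1))" "- 1 \<odot> (i \<cdot> (b q2 J \<cdot> n2))"] by simp
next
  case (st_both m q1 q2 i' j' n1 n2 c d)
  note [simp] = zero_objectD(1)[OF st_both(7)] biproductD[OF bp] biproductD[OF st_both(4)]
  have j: "isom T (P J) W j" using biproduct_zero_isom[OF bp] st_both by simp
  \<comment> \<open>Rescaling the two corners by \<open>c\<close> and \<open>- d\<close> turns the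
    row \<open>(c, d)\<close> into the row \<open>(1, -1)\<close> of a join.\<close>
  have b2: "biproduct T (P q1) (P q2) U (inverse c \<odot> i') (inverse (- d) \<odot> j') (c \<odot> n1) ((- d) \<odot> n2)"
    using biproduct_swap[OF biproduct_scale[OF biproduct_swap[OF biproduct_scale[OF st_both(4),
        of "inverse (- d)"]], of "inverse c"]] st_both(5,6) by simp
  show ?thesis
    by (rule decomposed_isom[OF decomposed.join[OF st_both(3) order_refl b2] isom_ide j]) (use st_both(1,2) in simp_all)
qed

text \<open>One step of the elimination: \<open>reduced_decomposed\<close> isolates the block that
  meets the new component, \<open>decomposed_state_extend\<close> treats this block together with
  \<open>P J\<close>, and the rest is added as a diagonal summand.\<close>

lemma decomposed_extend:
  assumes u: "decomposed (weight J) U V u" and x: "arr T x" "dm T x = U" "cd T x = P J"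
      and bp: "biproduct T V (P J) W j j' q q'"
  shows "decomposed (weight J) U W (j \<cdot> u \<oplus> j' \<cdot> x)"
proof -
  obtain Ua Va a xa U' V' u' i1 i2 p1 p2 j1 j2 k1 k2 y where
     s: "state J Ua Va a xa" and u': "decomposed (weight J) U' V' u'" and bU: "biproduct T Ua U' U i1 i2 p1 p2"
         and bV: "biproduct T Va V' V j1 j2 k1 k2" and
     ui: "u \<cdot> i1 = j1 \<cdot> a" "u \<cdot> i2 = j2 \<cdot> u'" and y: "arr T y" "dm T y = V" "cd T y = P J"
         and xe: "x = xa \<cdot> p1 \<oplus> y \<cdot> u"
    using reduced_decomposed[OF u x] unfolding reduced_def by blast
  obtain Wv k k' l l' where Wv: "biproduct T Va (P J) Wv k k' l l'" using ex_biproduct[OF state_hom(5)[OF s],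
      of "P J"] by auto
  note [simp] = biproductD[OF bU] biproductD[OF bV] biproductD[OF bp] biproductD[OF Wv] state_hom[OF s]
      decomposed_hom[OF u'] decomposed_hom[OF u] y x
  \<comment> \<open>The term \<open>y \<cdot> u\<close> of \<open>x\<close> is absorbed by shearing
    \<open>W\<close>: the embedding of \<open>V\<close> becomes \<open>j + j' y\<close>.\<close>
  have "biproduct T (P J) V W j' (j \<oplus> (- 1) \<odot> (j' \<cdot> ((- 1) \<odot> y))) (q' \<oplus> ((- 1) \<odot> y) \<cdot> q) q"
    by (rule biproduct_shear[OF biproduct_swap[OF bp]]) simp_all
  then have b1: "biproduct T (P J) V W j' (j \<oplus> j' \<cdot> y) (q' \<oplus> (- 1) \<odot> (y \<cdot> q)) q" by simp
  note b2 = biproduct_swap[OF biproduct_assoc[OF biproduct_swap[OF bV] biproduct_swap[OF b1] Wv]]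
  have ui': "u \<cdot> (i1 \<cdot> z) = j1 \<cdot> (a \<cdot> z)" if "arr T z" "cd T z = Ua" for z using cmp_eq[OF ui(1), of z] that by simp
  have ui2: "u \<cdot> (i2 \<cdot> z) = j2 \<cdot> (u' \<cdot> z)" if "arr T z" "cd T z = U'" for z using cmp_eq[OF ui(2), of z] that
      by simp
  show ?thesis
    by (rule decomposed_diag[OF decomposed_state_extend[OF s Wv] u' bU b2]) (simp_all add: xe ui ui' ui2 add_ac)
qed

end


section \<open>Direct sums of the objects of an octahedron\<close>

context octahedron_in
begin

inductive lsum :: "(vertex \<times> int) list \<Rightarrow> 'o \<Rightarrow> bool" where
  lsum_Nil: "zero_object T Z \<Longrightarrow> lsum [] Z"
| lsum_Cons: "lsum ps U \<Longrightarrow> biproduct T (P p) U V i j r s \<Longrightarrow> lsum (p # ps) V"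

definition decomposable :: "'o \<Rightarrow> bool" where "decomposable U \<longleftrightarrow> (\<exists>ps. lsum ps U)"

lemma lsum_ob: "lsum ps U \<Longrightarrow> U \<in> ob T"
  by (induct rule: lsum.induct) (auto dest: zero_objectD(1) biproductD(15))

lemma lsum_isom:
  assumes "lsum ps U" "isom T U V u" shows "lsum ps V"
  using assms
proof (cases rule: lsum.cases)
  case lsum_Nil
  then show ?thesis using zero_object_isom assms(2) by (metis lsum.lsum_Nil)
next
  case (lsum_Cons ps W p i j r s)
  then show ?thesis using biproduct_isom[OF lsum_Cons(3) assms(2)] lsum.lsum_Cons by metis
qed

lemma lsum_sh: "lsum ps U \<Longrightarrow> lsum (map (\<lambda>p. (fst p, m + snd p)) ps) (shift_ob T m U)"
proof (induct rule: lsum.induct)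
  case (lsum_Nil Z)
  then show ?case using zero_object_sh by (simp add: lsum.lsum_Nil)
next
  case (lsum_Cons ps U p V i j r s)
  have "shift_ob T m (P p) = P (fst p, m + snd p)" by (simp add: gob_def shift_ob_add)
  then show ?case using lsum.lsum_Cons[OF lsum_Cons(2)] biproduct_sh[OF lsum_Cons(3), of m] by force
qed

text \<open>Insertion sort on direct sum decompositions, by exchanging neighbouring summands.
  Weights decrease along the list, so the head, which the induction in
  \<open>decomposed_lsum\<close> adds last, is the heaviest.\<close>

lemma lsum_insort:
  assumes "lsum ps U" "sorted_wrt (\<lambda>p q. weight q \<le> weight p) ps" "biproduct T (P p) U V i j r s"
  shows "\<exists>qs. lsum qs V \<and> sorted_wrt (\<lambda>p q. weight q \<le> weight p) qs \<and> set qs \<subseteq> insert p (set ps)"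
  using assms
proof (induct arbitrary: V i j r s rule: lsum.induct)
  case (lsum_Nil Z)
  then show ?case using lsum.lsum_Cons[OF lsum.lsum_Nil[OF lsum_Nil(1)]] by (intro exI[of _ "[p]"]) auto
next
  case (lsum_Cons ps U' q U i' j' r' s')
  show ?case
  proof (cases "weight q \<le> weight p")
    case True
    then have "sorted_wrt (\<lambda>p q. weight q \<le> weight p) (p # q # ps)" using lsum_Cons(4) by auto
    then show ?thesis using lsum.lsum_Cons[OF lsum.lsum_Cons[OF lsum_Cons(1,3)] lsum_Cons(5)]
      by (intro exI[of _ "p # q # ps"]) auto
  next
    case False
    obtain W k l t u where W: "biproduct T (P p) U' W k l t u" using ex_biproduct[of "P p" U']
        lsum_ob[OF lsum_Cons(1)] by auto
    obtain qs where qs: "lsum qs W" "sorted_wrt (\<lambda>p q. weight q \<le> weight p) qs" "set qs \<subseteq> insert p (set ps)"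
      using lsum_Cons(2)[OF _ W] lsum_Cons(4) by auto
    have "lsum (q # qs) V"
      by (rule lsum.lsum_Cons[OF qs(1) biproduct_assoc[OF lsum_Cons(3) biproduct_swap[OF lsum_Cons(5)]
          biproduct_swap[OF W]]])
    moreover have "sorted_wrt (\<lambda>p q. weight q \<le> weight p) (q # qs)" using qs lsum_Cons(4) False by auto
    ultimately show ?thesis using qs(3) by (intro exI[of _ "q # qs"]) auto
  qed
qed

lemma lsum_sorted: "lsum ps U \<Longrightarrow> \<exists>qs. lsum qs U \<and> sorted_wrt (\<lambda>p q. weight q \<le> weight p) qs"
proof (induct rule: lsum.induct)
  case (lsum_Nil Z)
  then show ?case using lsum.lsum_Nil by (intro exI[of _ "[]"]) auto
next
  case (lsum_Cons ps U p V i j r s)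
  then show ?case using lsum_insort by blast
qed

lemma lsum_append: "lsum ps U \<Longrightarrow> lsum qs V \<Longrightarrow> biproduct T U V W i j r s \<Longrightarrow> lsum (ps @ qs) W"
proof (induct arbitrary: W i j r s rule: lsum.induct)
  case (lsum_Nil Z)
  then show ?case using lsum_isom[OF lsum_Nil(2) biproduct_zero_isom[OF lsum_Nil(3,1)]] by simp
next
  case (lsum_Cons ps U' p U i' j' r' s')
  obtain Q k l t u where Q: "biproduct T U' V Q k l t u" using ex_biproduct lsum_ob lsum_Cons(1,4) by metis
  show ?case using lsum.lsum_Cons[OF lsum_Cons(2)[OF lsum_Cons(4) Q] biproduct_assoc[OF lsum_Cons(3,5) Q]] by simp
qed

lemma decomposable_ob: "decomposable U \<Longrightarrow> U \<in> ob T"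
  unfolding decomposable_def using lsum_ob by blast

lemma decomposable_isom: "decomposable U \<Longrightarrow> isom T U V u \<Longrightarrow> decomposable V"
  unfolding decomposable_def using lsum_isom by blast

lemma decomposable_sh: "decomposable U \<Longrightarrow> decomposable (shift_ob T m U)"
  unfolding decomposable_def using lsum_sh by blast

lemma decomposable_shm: "decomposable U \<Longrightarrow> decomposable (sho T U)"
  using decomposable_sh[of U 1] by simp

lemma decomposable_unshm: "decomposable (sho T U) \<Longrightarrow> U \<in> ob T \<Longrightarrow> decomposable U"
  using decomposable_sh[of "sho T U" "- 1"] shift_ob_sho[of U "- 1"] by simp

lemma decomposable_zero: "zero_object T Z \<Longrightarrow> decomposable Z"
  unfolding decomposable_def using lsum_Nil by blast

lemma decomposable_gob: "decomposable (P p)"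
proof -
  obtain Z where Z: "zero_object T Z" using ex_zero_object by blast
  have "lsum [p] (P p)" by (rule lsum_Cons[OF lsum_Nil[OF Z] biproduct_swap[OF biproduct_zero[OF Z]]]) simp
  then show ?thesis unfolding decomposable_def by blast
qed

lemma decomposable_biproduct: "decomposable U \<Longrightarrow> decomposable V \<Longrightarrow> biproduct T U V W i j r s \<Longrightarrow> decomposable W"
  unfolding decomposable_def using lsum_append by blast

lemma decomposable_induct [consumes 1, case_names zero gob sum]:
  assumes "decomposable U" and z: "\<And>Z. zero_object T Z \<Longrightarrow> Q Z" and g: "\<And>p. Q (P p)"
    and s: "\<And>U V W i j r s. Q U \<Longrightarrow> Q V \<Longrightarrow> biproduct T U V W i j r s \<Longrightarrow> Q W"
  shows "Q U"
proof -
  obtain ps where "lsum ps U" using assms(1) unfolding decomposable_def by blast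
  then show ?thesis by (induct rule: lsum.induct) (use z g s in blast)+
qed

end

context exceptional_octahedron
begin

text \<open>The target is built up summand by summand. The tail is decomposed with the weight of the
  head as bound, which is the bound that \<open>decomposed_extend\<close> asks for when the
  component into the head is added.\<close>

lemma decomposed_lsum:
  assumes "lsum qs V" "sorted_wrt (\<lambda>p q. weight q \<le> weight p) qs" "\<forall>q\<in>set qs. weight q \<le> N"
    "lsum ps U" "arr T u" "dm T u = U" "cd T u = V"
  shows "decomposed N U V u"
  using assms
proof (induct arbitrary: N u rule: lsum.induct)
  case (lsum_Nil Z)
  note Z = lsum_Nil(1)
  have "decomposed N U Z (zer T U Z)" using lsum_Nil(4)
  proof (induct rule: lsum.induct)
    case (lsum_Nil Z') then show ?case using decomposed.zero[OF lsum_Nil Z] by simp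
  next
    case (lsum_Cons ps U' p U'' i j r s)
    note [simp] = biproductD[OF lsum_Cons(3)] zero_objectD(1)[OF Z]
    show ?case by (rule decomposed_diag[OF decomposed.src[OF Z] lsum_Cons(2) lsum_Cons(3)
        biproduct_zero[OF Z]]) simp_all
  qed
  then show ?case using zero_objectD(2)[OF Z, of u] lsum_Nil by simp
next
  case (lsum_Cons qs V' q V i j r s)
  note [simp] = biproductD[OF lsum_Cons(3)] lsum_Cons(7-9)
  have "decomposed (weight q) U V' (s \<cdot> u)" by (rule lsum_Cons(2)) (use lsum_Cons(4,6) in auto)
  from decomposed_extend[OF this _ _ _ biproduct_swap[OF lsum_Cons(3)], of "r \<cdot> u"]
  have "decomposed (weight q) U V (j \<cdot> (s \<cdot> u) \<oplus> i \<cdot> (r \<cdot> u))" by simp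
  then have "decomposed (weight q) U V u" using biproduct_into[OF biproduct_swap[OF lsum_Cons(3)], of u] by simp
  then show ?case by (rule decomposed_mono) (use lsum_Cons(5) in simp)
qed

lemma decomposable_decomposed:
  assumes "decomposable U" "decomposable V" "arr T u" "dm T u = U" "cd T u = V"
  shows "\<exists>N. decomposed N U V u"
proof -
  obtain ps where ps: "lsum ps U" using assms(1) unfolding decomposable_def by blast
  obtain qs where qs: "lsum qs V" "sorted_wrt (\<lambda>p q. weight q \<le> weight p) qs" using lsum_sorted assms(2)
      unfolding decomposable_def by blast
  \<comment> \<open>For the empty list the bound holds vacuously.\<close>
  have "\<forall>q\<in>set qs. weight q \<le> Max (weight ` set qs)" by simp
  then show ?thesis using decomposed_lsum[OF qs _ ps assms(3-5)] by blast
qed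

end

section \<open>Distinguished triangles on decomposable objects\<close>

text \<open>
  The two instances are the triangles all of whose objects are sums of shifts of the octahedron, and the
  triangles that a functor preserves.
\<close>

locale triangle_class = exceptional_octahedron T X for T :: "('o, 'a, 'k :: field) tri_cat" (structure) and X +
  fixes \<W> :: "'o \<Rightarrow> 'o \<Rightarrow> 'o \<Rightarrow> 'a \<Rightarrow> 'a \<Rightarrow> 'a \<Rightarrow> bool"
  assumes W_dt: "\<W> U V W u v w \<Longrightarrow> dt U V W u v w"
    and W_isom: "\<W> U V W u v w \<Longrightarrow> dt U' V' W' u' v' w' \<Longrightarrow> isom T U U' a \<Longrightarrow> isom T V V' c \<Longrightarrow> isom T W W' e
       \<Longrightarrow> u' \<cdot> a = c \<cdot> u \<Longrightarrow> v' \<cdot> c = e \<cdot> v \<Longrightarrow> w' \<cdot> e = shm T a \<cdot> w \<Longrightarrow> \<W> U' V' W' u' v' w'"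
    and W_rot: "\<W> U V W u v w \<Longrightarrow> \<W> V W (sho T U) v w ((- 1) \<odot> shm T u)"
    and W_unrot: "dt U V W u v w \<Longrightarrow> \<W> V W (sho T U) v w ((- 1) \<odot> shm T u) \<Longrightarrow> \<W> U V W u v w"
    and W_sum: "\<W> U1 V1 W1 u1 v1 w1 \<Longrightarrow> \<W> U2 V2 W2 u2 v2 w2 \<Longrightarrow> biproduct T U1 U2 U i1 i2 p1 p2
       \<Longrightarrow> biproduct T V1 V2 V j1 j2 q1 q2 \<Longrightarrow> biproduct T W1 W2 W k1 k2 r1 r2
       \<Longrightarrow> \<W> U V W (j1 \<cdot> (u1 \<cdot> p1) \<oplus> j2 \<cdot> (u2 \<cdot> p2)) (k1 \<cdot> (v1 \<cdot> q1) \<oplus> k2 \<cdot> (v2 \<cdot> q2))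
             (shm T i1 \<cdot> (w1 \<cdot> r1) \<oplus> shm T i2 \<cdot> (w2 \<cdot> r2))"
    and W_zero: "zero_object T Z \<Longrightarrow> \<W> Z Z Z (zer T Z Z) (zer T Z Z) (zer T Z (sho T Z))"
    and W_ide: "zero_object T Z \<Longrightarrow> \<W> (P p) (P p) Z (ide T (P p)) (zer T (P p) Z) (zer T Z (sho T (P p)))"
    and W_f: "\<W> (oA X) (oB X) (oD X) (mf X) (mf1 X) (mf2 X)"
    and W_h: "\<W> (oA X) (oC X) (oE X) (mh X) (mh1 X) (mh2 X)"
    and W_g: "\<W> (oB X) (oC X) (oF X) (mg X) (mg1 X) (mg2 X)"
    and W_k: "\<W> (oD X) (oE X) (oF X) (mk X) (mk1 X) (mk2 X)"
    and W_mesh1: "\<exists>Q i j p q. biproduct T (oC X) (oD X) Q i j p q \<and>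
       \<W> (oB X) Q (oE X) (i \<cdot> mg X \<oplus> j \<cdot> mf1 X) (mh1 X \<cdot> p \<oplus> (- 1) \<odot> (mk X \<cdot> q)) (ml1 X)"
    and W_mesh2: "\<exists>Q i j p q. biproduct T (oF X) (sho T (oA X)) Q i j p q \<and>
       \<W> (oB X) (oE X) Q (ml X) (i \<cdot> mk1 X \<oplus> (- 1) \<odot> (j \<cdot> mh2 X)) (mg2 X \<cdot> p \<oplus> shm T (mf X) \<cdot> q)"
begin

text \<open>Membership of a triangle in the class depends only on its first morphism, by
  \<open>W_all\<close>, and only up to isomorphism, by \<open>has_cone_isom\<close>. The class can
  therefore be studied on morphisms.\<close>

definition has_cone :: "'o \<Rightarrow> 'o \<Rightarrow> 'a \<Rightarrow> bool" where
  "has_cone U V u \<longleftrightarrow> (\<exists>W v w. \<W> U V W u v w)"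

lemma has_coneI: "\<W> U V W u v w \<Longrightarrow> has_cone U V u" unfolding has_cone_def by blast

lemma has_cone_isom:
  assumes h: "has_cone U V u" and a: "isom T U U' a" and c: "isom T V V' c"
    and u': "arr T u'" "dm T u' = U'" "cd T u' = V'" "u' \<cdot> a = c \<cdot> u"
  shows "has_cone U' V' u'"
proof -
  obtain W v w where w: "\<W> U V W u v w" using h unfolding has_cone_def by blast
  note d = W_dt[OF w]
  have "u' \<in> hom T U' V'" using u' by simp
  then obtain W' v' w' where d': "dt U' V' W' u' v' w'" using TR1_cone by blast
  obtain e where "isom T W W' e" "v' \<cdot> c = e \<cdot> v" "w' \<cdot> e = shm T a \<cdot> w"
    using dt_iso_extend[OF d d' a c u'(4)] by metis
  then show ?thesis using W_isom[OF w d' a c _ u'(4)] has_coneI by blast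
qed

lemma W_all:
  assumes "has_cone U V u" "dt U V W u v w" shows "\<W> U V W u v w"
proof -
  obtain W' v' w' where w: "\<W> U V W' u v' w'" using assms(1) unfolding has_cone_def by blast
  obtain e where "isom T W' W e" "e \<cdot> v' = v" "w \<cdot> e = w'" using dt_unique[OF W_dt[OF w] assms(2)] by metis
  note E = this
  note [simp] = dtD[OF assms(2)] dtD[OF W_dt[OF w]]
  show ?thesis by (rule W_isom[OF w assms(2) isom_ide isom_ide E(1)]) (use E in simp_all)
qed

lemma W_signs:
  assumes w: "\<W> U V W u v w" and abc: "x * y * z = 1" shows "\<W> U V W (x \<odot> u) (y \<odot> v) (z \<odot> w)"
proof -
  note d = W_dt[OF w]
  note [simp] = dtD[OF d]
  have nz: "x \<noteq> 0" "y \<noteq> 0" "z * (x * y) = 1" using abc by (auto simp: mult_ac)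
  show ?thesis
    by (rule W_isom[OF w dt_signs[OF d abc] isom_ide isom_smul[OF isom_ide nz(1)] isom_smul[OF isom_ide,
        of _ "x * y"]])
      (use nz in \<open>simp_all add: mult.commute\<close>)
qed

lemma has_cone_shm:
  assumes "has_cone U V u" shows "has_cone (sho T U) (sho T V) (shm T u)"
proof -
  obtain W v w where w: "\<W> U V W u v w" using assms unfolding has_cone_def by blast
  from W_signs[OF W_rot[OF W_rot[OF W_rot[OF w]]], of "-1" "-1" 1] show ?thesis
    using dtD[OF W_dt[OF w]] by (auto intro: has_coneI)
qed

text \<open>By \<open>W_all\<close> the shifted triangle belongs to the class. Two signs turn it
  into the threefold rotation of a triangle on \<open>u\<close>, which is then rotated back one step
  at a time.\<close>

lemma has_cone_unshm:
  assumes "has_cone (sho T U) (sho T V) (shm T u)" and u: "arr T u" "dm T u = U" "cd T u = V"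
  shows "has_cone U V u"
proof -
  have "u \<in> hom T U V" using u by simp
  then obtain W v w where d: "dt U V W u v w" using TR1_cone by blast
  note [simp] = dtD[OF d]
  have "\<W> (sho T U) (sho T V) (sho T W) (shm T u) (shm T v) ((- 1) \<odot> shm T w)" by (rule W_all[OF assms(1)
      dt_shm[OF d]])
  from W_signs[OF this, of "-1" "-1" 1]
  have "\<W> (sho T U) (sho T V) (sho T W) ((- 1) \<odot> shm T u) ((- 1) \<odot> shm T v) ((- 1) \<odot> shm T w)" by simp
  then have "\<W> W (sho T U) (sho T V) w ((- 1) \<odot> shm T u) ((- 1) \<odot> shm T v)"
      by (rule W_unrot[OF dt_rot[OF dt_rot[OF d]]])
  then have "\<W> V W (sho T U) v w ((- 1) \<odot> shm T u)" by (rule W_unrot[OF dt_rot[OF d]])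
  then have "\<W> U V W u v w" by (rule W_unrot[OF d])
  then show ?thesis by (rule has_coneI)
qed

lemma has_cone_sh:
  assumes "has_cone U V u" and u: "arr T u" "dm T u = U" "cd T u = V"
  shows "has_cone (shift_ob T m U) (shift_ob T m V) (sh T m u)"
proof -
  have [simp]: "U \<in> ob T" "V \<in> ob T" using u dm_ob cd_ob by blast+
  show ?thesis
  proof (induct m rule: int_induct[of _ 0])
    case base show ?case using assms by simp
  next
    case (step1 i) show ?case using has_cone_shm[OF step1(2)] u by (simp add: sh_succ shift_ob_succ)
  next
    case (step2 i)
    show ?case by (rule has_cone_unshm) (use step2(2) u in \<open>simp_all add: sh_succ[symmetric]
        shift_ob_succ[symmetric]\<close>)
  qed
qed

text \<open>Every nonidentity edge except \<open>l\<close> and \<open>l'\<close> is a morphism of a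
  face. The arrow \<open>l'\<close> closes the first additional triangle and \<open>l\<close> opens
  the second, so goodness is used here.\<close>

lemma has_cone_edge:
  assumes "deg v w = Some d" shows "has_cone (vob X v) (shift_ob T d (vob X w)) (edge T X v w)"
proof (cases "v = w")
  case True
  obtain Z where Z: "zero_object T Z" using ex_zero_object by blast
  have d: "d = 0" and e: "edge T X v v = ide T (vob X v)" using assms True by (cases v; simp)+
  show ?thesis using W_ide[OF Z, of "(v, 0)"] True d e by (auto simp: gob_def intro: has_coneI)
next
  case False
  obtain Q i j p q where m1: "\<W> (oB X) Q (oE X) (i \<cdot> mg X \<oplus> j \<cdot> mf1 X) (mh1 X \<cdot> p \<oplus> (- 1) \<odot> (mk X \<cdot> q)) (ml1 X)"
    using W_mesh1 by blast
  obtain Q' i' j' p' q' where m2: "\<W> (oB X) (oE X) Q' (ml X) (i' \<cdot> mk1 X \<oplus> (- 1) \<odot> (j' \<cdot> mh2 X)) (mg2 X \<cdot> p'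
      \<oplus> shm T (mf X) \<cdot> q')"
    using W_mesh2 by blast
  note h = has_coneI[OF W_f] has_coneI[OF W_rot[OF W_f]] has_coneI[OF W_rot[OF W_rot[OF W_f]]]
    has_coneI[OF W_h] has_coneI[OF W_rot[OF W_h]] has_coneI[OF W_rot[OF W_rot[OF W_h]]]
    has_coneI[OF W_g] has_coneI[OF W_rot[OF W_g]] has_coneI[OF W_rot[OF W_rot[OF W_g]]]
    has_coneI[OF W_k] has_coneI[OF W_rot[OF W_k]] has_coneI[OF W_rot[OF W_rot[OF W_k]]]
    has_coneI[OF W_rot[OF W_rot[OF m1]]] has_coneI[OF m2]
  show ?thesis using assms False h by (cases v; cases w) auto
qed

lemma has_cone_gmor:
  assumes "pre p q" shows "has_cone (P p) (P q) (b p q)"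
proof -
  have d: "deg (fst p) (fst q) = Some (snd q - snd p)" using assms by (simp add: pre_def)
  have "shift_ob T (snd p) (shift_ob T (snd q - snd p) (vob X (fst q))) = P q"
    using shift_ob_add[of "vob X (fst q)" "snd p" "snd q - snd p"] by (simp add: gob_def)
  then show ?thesis using has_cone_sh[OF has_cone_edge[OF d] edge_hom[OF d], of "snd p"] assms
      by (simp add: gob_def gmor_def)
qed

lemma has_cone_fork_aux:
  assumes h: "has_cone U Q (i \<cdot> x \<oplus> j \<cdot> y)" and b: "biproduct T V W Q i j p q"
      and b': "biproduct T V W Q' i' j' p' q'"
    and x: "arr T x" "dm T x = U" "cd T x = V" and y: "arr T y" "dm T y = U" "cd T y = W"
  shows "has_cone U Q' (i' \<cdot> x \<oplus> j' \<cdot> y)"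
proof -
  note [simp] = biproductD[OF b] biproductD[OF b'] x y
  have [simp]: "U \<in> ob T" using dm_ob[OF x(1)] x(2) by metis
  show ?thesis by (rule has_cone_isom[OF h isom_ide biproduct_unique[OF b b']]) simp_all
qed

lemma has_cone_join_aux:
  assumes h: "has_cone Q U (x \<cdot> p \<oplus> y \<cdot> q)" and b: "biproduct T V W Q i j p q"
      and b': "biproduct T V W Q' i' j' p' q'"
    and x: "arr T x" "dm T x = V" "cd T x = U" and y: "arr T y" "dm T y = W" "cd T y = U"
  shows "has_cone Q' U (x \<cdot> p' \<oplus> y \<cdot> q')"
proof -
  note [simp] = biproductD[OF b] biproductD[OF b'] x y
  have [simp]: "U \<in> ob T" using cd_ob[OF x(1)] x(3) by metis
  show ?thesis by (rule has_cone_isom[OF h biproduct_unique[OF b b'] isom_ide]) simp_all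
qed

lemma mesh_sh:
  assumes "mesh m q1 q2 r"
  shows "m = (VB, n) \<and> q1 = (VC, n) \<and> q2 = (VD, n) \<and> r = (VE, n) \<Longrightarrow>
     P m = shift_ob T n (oB X) \<and> P q1 = shift_ob T n (oC X) \<and> P q2 = shift_ob T n (oD X) \<and>
         P r = shift_ob T n (oE X) \<and>
     b m q1 = sh T n (mg X) \<and> b m q2 = sh T n (mf1 X) \<and> b q1 r = sh T n (mh1 X) \<and> b q2 r = sh T n (mk X)"
    "m = (VE, n) \<and> q1 = (VF, n) \<and> q2 = (VA, n + 1) \<and> r = (VB, n + 1) \<Longrightarrow>
     P m = shift_ob T n (oE X) \<and> P q1 = shift_ob T n (oF X) \<and> P q2 = shift_ob T n (sho T (oA X)) \<and>
         P r = shift_ob T n (sho T (oB X)) \<and>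
     b m q1 = sh T n (mk1 X) \<and> b m q2 = sh T n (mh2 X) \<and> b q1 r = sh T n (mg2 X) \<and> b q2 r = sh T n (shm T (mf X))"
  using assms by (auto simp: gob_def gmor_def pre_def shift_ob_sho sh_shm)

text \<open>For the first square, fork and join are the first two morphisms of the first additional
  triangle; for the other square they are the last two morphisms of the second one. There a sign is
  moved by replacing one injection and the matching projection by their negatives.\<close>

lemma has_cone_mesh:
  assumes m: "mesh m q1 q2 r" and bp: "biproduct T (P q1) (P q2) Q i j p q"
  shows "has_cone (P m) Q (i \<cdot> b m q1 \<oplus> j \<cdot> b m q2)" "has_cone Q (P r) (b q1 r \<cdot> p \<oplus> (- 1) \<odot> (b q2 r \<cdot> q))"
proof -
  obtain n where "m = (VB, n) \<and> q1 = (VC, n) \<and> q2 = (VD, n) \<and> r = (VE, n) \<or>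
     m = (VE, n) \<and> q1 = (VF, n) \<and> q2 = (VA, n + 1) \<and> r = (VB, n + 1)" using m unfolding mesh_def by auto
  then have "has_cone (P m) Q (i \<cdot> b m q1 \<oplus> j \<cdot> b m q2) \<and> has_cone Q (P r) (b q1 r \<cdot> p \<oplus> (- 1) \<odot> (b q2 r \<cdot> q))"
  proof
    assume e: "m = (VB, n) \<and> q1 = (VC, n) \<and> q2 = (VD, n) \<and> r = (VE, n)"
    note E = mesh_sh(1)[OF m e]
    obtain Q' i' j' p' q' where b': "biproduct T (oC X) (oD X) Q' i' j' p' q'" and
      w: "\<W> (oB X) Q' (oE X) (i' \<cdot> mg X \<oplus> j' \<cdot> mf1 X) (mh1 X \<cdot> p' \<oplus> (- 1) \<odot> (mk X \<cdot> q')) (ml1 X)" using W_mesh1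
          by blast
    note [simp] = biproductD[OF b']
    have "has_cone (shift_ob T n (oB X)) (shift_ob T n Q') (sh T n (i' \<cdot> mg X \<oplus> j' \<cdot> mf1 X))"
      by (rule has_cone_sh[OF has_coneI[OF w]]) simp_all
    then have 1: "has_cone (P m) (shift_ob T n Q') (sh T n i' \<cdot> b m q1 \<oplus> sh T n j' \<cdot> b m q2)" using E by simp
    have "has_cone (shift_ob T n Q') (shift_ob T n (oE X)) (sh T n (mh1 X \<cdot> p' \<oplus> (- 1) \<odot> (mk X \<cdot> q')))"
      by (rule has_cone_sh[OF has_coneI[OF W_rot[OF w]]]) simp_all
    then have 2: "has_cone (shift_ob T n Q') (P r) (b q1 r \<cdot> sh T n p' \<oplus> ((- 1) \<odot> b q2 r) \<cdot> sh T n q')" using E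
        by simp
    have b1: "biproduct T (P q1) (P q2) (shift_ob T n Q') (sh T n i') (sh T n j') (sh T n p') (sh T n q')"
      using biproduct_sh[OF b', of n] E by simp
    show ?thesis using has_cone_fork_aux[OF 1 b1 bp] has_cone_join_aux[OF 2 b1 bp] biproductD[OF bp] by simp
  next
    assume e: "m = (VE, n) \<and> q1 = (VF, n) \<and> q2 = (VA, n + 1) \<and> r = (VB, n + 1)"
    note E = mesh_sh(2)[OF m e]
    obtain Q' i' j' p' q' where b': "biproduct T (oF X) (sho T (oA X)) Q' i' j' p' q'" and
      w: "\<W> (oB X) (oE X) Q' (ml X) (i' \<cdot> mk1 X \<oplus> (- 1) \<odot> (j' \<cdot> mh2 X)) (mg2 X \<cdot> p' \<oplus> shm T (mf X) \<cdot> q')"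
          using W_mesh2 by blast
    note [simp] = biproductD[OF b']
    have "has_cone (shift_ob T n (oE X)) (shift_ob T n Q') (sh T n (i' \<cdot> mk1 X \<oplus> (- 1) \<odot> (j' \<cdot> mh2 X)))"
      by (rule has_cone_sh[OF has_coneI[OF W_rot[OF w]]]) simp_all
    then have 1: "has_cone (P m) (shift_ob T n Q') (sh T n i' \<cdot> b m q1 \<oplus> sh T n ((- 1) \<odot> j') \<cdot> b m q2)" using E
        by simp
    have "has_cone (shift_ob T n Q') (shift_ob T n (sho T (oB X))) (sh T n (mg2 X \<cdot> p' \<oplus> shm T (mf X) \<cdot> q'))"
      by (rule has_cone_sh[OF has_coneI[OF W_rot[OF W_rot[OF w]]]]) simp_all
    then have 2: "has_cone (shift_ob T n Q') (P r) (b q1 r \<cdot> sh T n p' \<oplus> ((- 1) \<odot> b q2 r) \<cdot> sh T n ((- 1) \<odot> q'))"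
        using E by simp
    have b1: "biproduct T (P q1) (P q2) (shift_ob T n Q') (sh T n i') (sh T n ((- 1) \<odot> j')) (sh T n p') (sh T n ((- 1) \<odot> q'))"
      using biproduct_sh[OF biproduct_scale[OF b', of "-1"], of n] E by simp
    show ?thesis using has_cone_fork_aux[OF 1 b1 bp] has_cone_join_aux[OF 2 b1 bp] biproductD[OF bp] by simp
  qed
  then show "has_cone (P m) Q (i \<cdot> b m q1 \<oplus> j \<cdot> b m q2)" "has_cone Q (P r) (b q1 r \<cdot> p \<oplus> (- 1) \<odot> (b q2 r \<cdot> q))"
      by blast+
qed

lemma has_cone_decomposed: "decomposed N U V u \<Longrightarrow> has_cone U V u"
proof (induct rule: decomposed.induct)
  case (zero Z Z')
  show ?case by (rule has_cone_isom[OF has_coneI[OF W_zero[OF zero(1)]] isom_ide isom_zero[OF zero]])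
     (use zero_objectD(1)[OF zero(1)] zero_objectD(1)[OF zero(2)] in simp_all)
next
  case (src Z p) show ?case using has_coneI[OF W_rot[OF W_ide[OF src]]] .
next
  case (tgt Z q)
  note Z1 = zero_object_shm[OF tgt(1)]
  note [simp] = zero_objectD(1)[OF tgt(1)]
  have "\<W> Z (P q) (P q) (zer T Z (P q)) (ide T (P q)) (zer T (P q) (sho T Z))"
    by (rule W_unrot[OF dt_zero_source[OF tgt(1) gob_ob]]) (use W_ide[OF Z1, of q] in simp)
  then show ?case by (rule has_coneI)
next
  case (bas p q) then show ?case using has_cone_gmor by blast
next
  case (fork m q1 q2 r Q i j n1 n2) show ?case using has_cone_mesh(1)[OF fork(1,3)] .
next
  case (join m q1 q2 r Q i j n1 n2) show ?case using has_cone_mesh(2)[OF join(1,3)] .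
next
  case (sum U1 V1 u1 U2 V2 u2 U i1 i2 p1 p2 V j1 j2 q1 q2)
  obtain W1 v1 w1 where 1: "\<W> U1 V1 W1 u1 v1 w1" using sum(2) unfolding has_cone_def by blast
  obtain W2 v2 w2 where 2: "\<W> U2 V2 W2 u2 v2 w2" using sum(4) unfolding has_cone_def by blast
  obtain W k1 k2 r1 r2 where "biproduct T W1 W2 W k1 k2 r1 r2"
      using ex_biproduct dtD(12)[OF W_dt[OF 1]] dtD(12)[OF W_dt[OF 2]] by metis
  from W_sum[OF 1 2 sum(5,6) this] show ?case by (rule has_coneI)
qed

theorem W_decomposable:
  assumes "decomposable U" "decomposable V" "dt U V W u v w" shows "\<W> U V W u v w"
  using decomposable_decomposed[OF assms(1,2)] has_cone_decomposed W_all[OF _ assms(3)] dtD[OF assms(3)] by metis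

end

section \<open>Decomposable objects are closed under cones\<close>

context exceptional_octahedron
begin

lemma mesh1: "\<exists>Q i j p q. biproduct T (oC X) (oD X) Q i j p q \<and>
       dt (oB X) Q (oE X) (i \<cdot> mg X \<oplus> j \<cdot> mf1 X) (mh1 X \<cdot> p \<oplus> (- 1) \<odot> (mk X \<cdot> q)) (ml1 X)"
proof -
  obtain Q i j p q where b: "biproduct T (oC X) (oD X) Q i j p q" and
    d: "dt (oB X) Q (oE X) (i \<cdot> mg X \<oplus> j \<cdot> mf1 X) (mh1 X \<cdot> p \<oplus> neg T (mk X) \<cdot> q) (ml1 X)"
    using good unfolding good_octahedron_def by blast
  have "neg T (mk X) \<cdot> q = (- 1) \<odot> (mk X \<cdot> q)" using biproductD[OF b] by simp
  then show ?thesis using b d by metis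
qed

lemma mesh2: "\<exists>Q i j p q. biproduct T (oF X) (sho T (oA X)) Q i j p q \<and>
       dt (oB X) (oE X) Q (ml X) (i \<cdot> mk1 X \<oplus> (- 1) \<odot> (j \<cdot> mh2 X)) (mg2 X \<cdot> p \<oplus> shm T (mf X) \<cdot> q)"
proof -
  obtain Q i j p q where b: "biproduct T (oF X) (sho T (oA X)) Q i j p q" and
    d: "dt (oB X) (oE X) Q (ml X) (i \<cdot> mk1 X \<oplus> j \<cdot> neg T (mh2 X)) (mg2 X \<cdot> p \<oplus> shm T (mf X) \<cdot> q)"
    using good unfolding good_octahedron_def by blast
  have "j \<cdot> neg T (mh2 X) = (- 1) \<odot> (j \<cdot> mh2 X)" using biproductD[OF b] by simp
  then show ?thesis using b d by metis
qed

lemma decomposable_vob: "decomposable (vob X v)"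
  using decomposable_gob[of "(v, 0)"] by (simp add: gob_def)

text \<open>For this class \<open>W_decomposable\<close> says that a cone of a morphism between
  decomposable objects is decomposable. All generating triangles qualify because their vertices are
  built from the six objects.\<close>

lemma decomposable_triangles:
  "triangle_class T X (\<lambda>U V W u v w. dt U V W u v w \<and> decomposable U \<and> decomposable V \<and> decomposable W)"
proof (unfold_locales, goal_cases)
  case (2 U V W u v w U' V' W' u' v' w' a c e)
  then show ?case using decomposable_isom by blast
next
  case (3 U V W u v w)
  then show ?case using dt_rot decomposable_shm by blast
next
  case (4 U V W u v w)
  then show ?case using decomposable_unshm dtD(10)[OF 4(1)] by blast
next
  case (5 U1 V1 W1 u1 v1 w1 U2 V2 W2 u2 v2 w2 U i1 i2 p1 p2 V j1 j2 q1 q2 W k1 k2 r1 r2)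
  then show ?case using dt_sum[OF _ _ 5(3-5)] decomposable_biproduct[OF _ _ 5(3)]
     decomposable_biproduct[OF _ _ 5(4)] decomposable_biproduct[OF _ _ 5(5)] by blast
next
  case (6 Z)
  show ?case using dt_id[OF 6 zero_objectD(1)[OF 6]] decomposable_zero[OF 6] 6 by (simp add: zero_object_iff)
next
  case (7 Z p)
  show ?case using dt_id[OF 7 gob_ob] decomposable_zero[OF 7] decomposable_gob by blast
next
  case 8 show ?case using dt_f decomposable_vob[of VA] decomposable_vob[of VB] decomposable_vob[of VD] by simp
next
  case 9 show ?case using dt_h decomposable_vob[of VA] decomposable_vob[of VC] decomposable_vob[of VE] by simp
next
  case 10 show ?case using dt_g decomposable_vob[of VB] decomposable_vob[of VC] decomposable_vob[of VF] by simp
next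
  case 11 show ?case using dt_k decomposable_vob[of VD] decomposable_vob[of VE] decomposable_vob[of VF] by simp
next
  case 12
  have "decomposable (oB X)" "decomposable (oE X)" "decomposable (oC X)" "decomposable (oD X)"
    using decomposable_vob[of VB] decomposable_vob[of VE] decomposable_vob[of VC] decomposable_vob[of VD]
        by simp_all
  then show ?case using mesh1 decomposable_biproduct by blast
next
  case 13
  have "decomposable (oB X)" "decomposable (oE X)" "decomposable (oF X)" "decomposable (sho T (oA X))"
    using decomposable_vob[of VB] decomposable_vob[of VE] decomposable_vob[of VF]
        decomposable_shm[OF decomposable_vob[of VA]] by simp_all
  then show ?case using mesh2 decomposable_biproduct by blast
qed blast

lemma decomposable_cone:
  assumes "decomposable U" "decomposable V" "dt U V W u v w" shows "decomposable W"
  using triangle_class.W_decomposable[OF decomposable_triangles assms] by blast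

text \<open>The decomposable objects form a triangulated subcategory that contains \<open>A\<close>,
  \<open>B\<close> and \<open>C\<close>, and the triangulated envelope is the least one.\<close>

lemma decomposable_all:
  assumes "ob T = tri_envelope T {oA X, oB X, oC X}" "U \<in> ob T" shows "decomposable U"
proof -
  obtain Z where Z: "zero_object T Z" using ex_zero_object by blast
  have "tri_subcat T {U. decomposable U}" unfolding tri_subcat_def
  proof (intro conjI allI ballI impI)
    show "{U. decomposable U} \<subseteq> ob T" using decomposable_ob by blast
    show "\<exists>Z\<in>{U. decomposable U}. zero_object T Z" using Z decomposable_zero by blast
    show "\<And>U V u. U \<in> {U. decomposable U} \<Longrightarrow> isom T U V u \<Longrightarrow> V \<in> {U. decomposable U}" using decomposable_isom by blast
    show "\<And>U m. U \<in> {U. decomposable U} \<Longrightarrow> shift_ob T m U \<in> {U. decomposable U}" using decomposable_sh by blast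
    show "\<And>U V W u v w. dt U V W u v w \<Longrightarrow> U \<in> {U. decomposable U} \<Longrightarrow> V \<in> {U. decomposable U}
        \<Longrightarrow> W \<in> {U. decomposable U}"
      using decomposable_cone by blast
  qed
  moreover have "{oA X, oB X, oC X} \<subseteq> {U. decomposable U}" using decomposable_vob[of VA] decomposable_vob[of VB]
      decomposable_vob[of VC] by simp
  ultimately show ?thesis using assms unfolding tri_envelope_def by blast
qed

end


section \<open>Functors compatible with the shift\<close>

text \<open>An exact functor up to the preservation of triangles. The Kan extension is first
  constructed as such a functor, and \<open>preserves\<close> measures how far it is exact.\<close>

locale graded_functor = S: triangulated_category S + T: triangulated_category T
  for S :: "('o, 'a, 'k :: field) tri_cat" and T :: "('p, 'b, 'k) tri_cat" +
  fixes F :: "('o, 'a, 'p, 'b) ex_fun"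
  assumes linear: "linear_functor S T (fob F) (fmor F)"
    and fal_isom: "U \<in> ob S \<Longrightarrow> isom T (fob F (sho S U)) (sho T (fob F U)) (fal F U)"
    and fal_nat: "arr S u \<Longrightarrow> fal F (cd S u) \<cdot>\<^bsub>T\<^esub> fmor F (shm S u) = shm T (fmor F u) \<cdot>\<^bsub>T\<^esub> fal F (dm S u)"
begin

lemma fob_ob [simp]: "U \<in> ob S \<Longrightarrow> fob F U \<in> ob T"
  and fmor_ide [simp]: "U \<in> ob S \<Longrightarrow> fmor F (ide S U) = ide T (fob F U)"
  using linear unfolding linear_functor_def by blast+

lemma fmor_hom [simp]:
  assumes "arr S u" shows "arr T (fmor F u)" "dm T (fmor F u) = fob F (dm S u)" "cd T (fmor F u) = fob F (cd S u)"
proof -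
  have "\<And>X Y u. u \<in> hom S X Y \<Longrightarrow> fmor F u \<in> hom T (fob F X) (fob F Y)" using linear unfolding linear_functor_def
      by blast
  from this[of u "dm S u" "cd S u"] show "arr T (fmor F u)" "dm T (fmor F u) = fob F (dm S u)" "cd T (fmor F u)
      = fob F (cd S u)"
    using assms by auto
qed

lemma fmor_cmp [simp]: assumes "arr S u" "arr S v" "cd S u = dm S v" shows "fmor F (v \<cdot>\<^bsub>S\<^esub> u)
    = fmor F v \<cdot>\<^bsub>T\<^esub> fmor F u"
proof -
  have "\<And>X Y Z u v. u \<in> hom S X Y \<Longrightarrow> v \<in> hom S Y Z \<Longrightarrow> fmor F (v \<cdot>\<^bsub>S\<^esub> u) = fmor F v \<cdot>\<^bsub>T\<^esub> fmor F u"
    using linear unfolding linear_functor_def by blast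
  from this[of u "dm S u" "cd S u" v "cd S v"] show ?thesis using assms by simp
qed

lemma fmor_add [simp]:
  assumes "arr S u" "arr S v" "dm S u = dm S v" "cd S u = cd S v" shows "fmor F (u \<oplus>\<^bsub>S\<^esub> v) = fmor F u \<oplus>\<^bsub>T\<^esub> fmor F v"
proof -
  have "\<And>X Y u v. u \<in> hom S X Y \<Longrightarrow> v \<in> hom S X Y \<Longrightarrow> fmor F (u \<oplus>\<^bsub>S\<^esub> v) = fmor F u \<oplus>\<^bsub>T\<^esub> fmor F v"
    using linear unfolding linear_functor_def by blast
  from this[of u "dm S u" "cd S u" v] show ?thesis using assms by simp
qed

lemma fmor_smul [simp]: assumes "arr S u" shows "fmor F (c \<odot>\<^bsub>S\<^esub> u) = c \<odot>\<^bsub>T\<^esub> fmor F u"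
proof -
  have "\<And>X Y u. u \<in> hom S X Y \<Longrightarrow> fmor F (c \<odot>\<^bsub>S\<^esub> u) = c \<odot>\<^bsub>T\<^esub> fmor F u"
    using linear unfolding linear_functor_def by blast
  from this[of u "dm S u" "cd S u"] show ?thesis using assms by simp
qed

lemma fmor_zer [simp]: "U \<in> ob S \<Longrightarrow> V \<in> ob S \<Longrightarrow> fmor F (zer S U V) = zer T (fob F U) (fob F V)"
  using fmor_smul[of "zer S U V" 0] by (simp del: fmor_smul)

lemma fal_hom [simp]: "U \<in> ob S \<Longrightarrow> arr T (fal F U)" "U \<in> ob S \<Longrightarrow> dm T (fal F U) = fob F (sho S U)"
   "U \<in> ob S \<Longrightarrow> cd T (fal F U) = sho T (fob F U)"
  using T.isomD[OF fal_isom] by simp_all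

lemma fal_shm: "arr S u \<Longrightarrow> dm S u = U \<Longrightarrow> cd S u = V \<Longrightarrow> fal F V \<cdot>\<^bsub>T\<^esub> fmor F (shm S u) = shm T (fmor F u) \<cdot>\<^bsub>T\<^esub> fal F U"
  using fal_nat by blast

lemma fal_shm': "arr S u \<Longrightarrow> dm S u = U \<Longrightarrow> cd S u = V \<Longrightarrow> arr T x \<Longrightarrow> cd T x = fob F (sho S U) \<Longrightarrow>
    fal F V \<cdot>\<^bsub>T\<^esub> (fmor F (shm S u) \<cdot>\<^bsub>T\<^esub> x) = shm T (fmor F u) \<cdot>\<^bsub>T\<^esub> (fal F U \<cdot>\<^bsub>T\<^esub> x)"
  using T.cmp_eq[OF fal_shm, of u U V x] S.dm_ob[of u] S.cd_ob[of u] by auto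

lemma fmor_isom: assumes "isom S U V u" shows "isom T (fob F U) (fob F V) (fmor F u)"
proof -
  obtain v where v: "arr S v" "dm S v = V" "cd S v = U" "v \<cdot>\<^bsub>S\<^esub> u = ide S U" "u \<cdot>\<^bsub>S\<^esub> v = ide S V"
    by (rule S.isomE[OF assms])
  note [simp] = S.isomD[OF assms] v(1-3)
  have "fmor F (v \<cdot>\<^bsub>S\<^esub> u) = ide T (fob F U)" "fmor F (u \<cdot>\<^bsub>S\<^esub> v) = ide T (fob F V)" unfolding v by simp_all
  then show ?thesis by (intro T.isomI[of _ "fmor F v"]) simp_all
qed

lemma fmor_biproduct:
  assumes "biproduct S U V W i j p q"
  shows "biproduct T (fob F U) (fob F V) (fob F W) (fmor F i) (fmor F j) (fmor F p) (fmor F q)"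
  using S.biproductD[OF assms] by (intro T.biproductI) (simp_all flip: fmor_cmp fmor_add)

lemma fob_zero: "zero_object S Z \<Longrightarrow> zero_object T (fob F Z)"
  using fmor_ide[of Z] unfolding S.zero_object_iff T.zero_object_iff by (auto simp del: fmor_ide)

definition preserves :: "'o \<Rightarrow> 'o \<Rightarrow> 'o \<Rightarrow> 'a \<Rightarrow> 'a \<Rightarrow> 'a \<Rightarrow> bool" where
  "preserves U V W u v w \<longleftrightarrow> S.dt U V W u v w \<and>
      T.dt (fob F U) (fob F V) (fob F W) (fmor F u) (fmor F v) (fal F U \<cdot>\<^bsub>T\<^esub> fmor F w)"

lemma preserves_isom:
  assumes p: "preserves U V W u v w" and d: "S.dt U' V' W' u' v' w'" and a: "isom S U U' a" and c: "isom S V V' c"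
      and e: "isom S W W' e"
    and eq: "u' \<cdot>\<^bsub>S\<^esub> a = c \<cdot>\<^bsub>S\<^esub> u" "v' \<cdot>\<^bsub>S\<^esub> c = e \<cdot>\<^bsub>S\<^esub> v" "w' \<cdot>\<^bsub>S\<^esub> e = shm S a \<cdot>\<^bsub>S\<^esub> w"
  shows "preserves U' V' W' u' v' w'"
proof -
  have ds: "S.dt U V W u v w" and dt:
      "T.dt (fob F U) (fob F V) (fob F W) (fmor F u) (fmor F v) (fal F U \<cdot>\<^bsub>T\<^esub> fmor F w)"
    using p unfolding preserves_def by blast+
  note [simp] = S.dtD[OF ds] S.dtD[OF d] S.isomD[OF a] S.isomD[OF c] S.isomD[OF e]
  have "fmor F u' \<cdot>\<^bsub>T\<^esub> fmor F a = fmor F c \<cdot>\<^bsub>T\<^esub> fmor F u" "fmor F v' \<cdot>\<^bsub>T\<^esub> fmor F c = fmor F e \<cdot>\<^bsub>T\<^esub> fmor F v"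
    "fmor F w' \<cdot>\<^bsub>T\<^esub> fmor F e = fmor F (shm S a) \<cdot>\<^bsub>T\<^esub> fmor F w"
    using arg_cong[OF eq(1), of "fmor F"] arg_cong[OF eq(2), of "fmor F"] arg_cong[OF eq(3), of "fmor F"]
        by simp_all
  then have "T.dt (fob F U') (fob F V') (fob F W') (fmor F u') (fmor F v') (fal F U' \<cdot>\<^bsub>T\<^esub> fmor F w')"
    by (intro T.TR1_iso[OF dt _ fmor_isom[OF a] fmor_isom[OF c] fmor_isom[OF e]]) (simp_all add:
        T.triangle_iff fal_shm' [where U=U])
  then show ?thesis using d unfolding preserves_def by blast
qed

text \<open>Rotating the image triangle yields \<open>sho T (fob F U)\<close>, while the image of
  the rotation contains \<open>fob F (sho S U)\<close>. The inverse of the comparison isomorphism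
  mediates, and its naturality matches the last morphisms.\<close>

lemma preserves_rot:
  assumes p: "preserves U V W u v w" shows "preserves V W (sho S U) v w ((- 1) \<odot>\<^bsub>S\<^esub> shm S u)"
proof -
  have ds: "S.dt U V W u v w" and dt:
      "T.dt (fob F U) (fob F V) (fob F W) (fmor F u) (fmor F v) (fal F U \<cdot>\<^bsub>T\<^esub> fmor F w)"
    using p unfolding preserves_def by blast+
  note [simp] = S.dtD[OF ds]
  have fi: "isom T (fob F (sho S U)) (sho T (fob F U)) (fal F U)" by (rule fal_isom) simp
  obtain c where c: "isom T (sho T (fob F U)) (fob F (sho S U)) c" "arr T c" "dm T c = sho T (fob F U)"
      "cd T c = fob F (sho S U)"
     "fal F U \<cdot>\<^bsub>T\<^esub> c = ide T (sho T (fob F U))" "\<And>x. arr T x \<Longrightarrow> cd T x = fob F (sho S U) \<Longrightarrow> c \<cdot>\<^bsub>T\<^esub> (fal F U \<cdot>\<^bsub>T\<^esub> x)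
         = x"
    by (rule T.isomE[OF fi], rule that)
  note [simp] = c(2-6)
  have ids: "isom T (fob F V) (fob F V) (ide T (fob F V))" "isom T (fob F W) (fob F W) (ide T (fob F W))"
      by simp_all
  have "T.dt (fob F V) (fob F W) (fob F (sho S U)) (fmor F v) (fmor F w) (fal F V \<cdot>\<^bsub>T\<^esub> fmor F ((- 1) \<odot>\<^bsub>S\<^esub> shm S u))"
    by (rule T.TR1_iso[OF T.dt_rot[OF dt] _ ids c(1)]) (simp_all add: T.triangle_iff fal_shm'[where U=U])
  then show ?thesis using S.dt_rot[OF ds] unfolding preserves_def by blast
qed

lemma preserves_unrot:
  assumes ds: "S.dt U V W u v w" and p: "preserves V W (sho S U) v w ((- 1) \<odot>\<^bsub>S\<^esub> shm S u)"
      shows "preserves U V W u v w"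
proof -
  have dt: "T.dt (fob F V) (fob F W) (fob F (sho S U)) (fmor F v) (fmor F w) (fal F V \<cdot>\<^bsub>T\<^esub> fmor F ((- 1) \<odot>\<^bsub>S\<^esub> shm S u))"
    using p unfolding preserves_def by blast
  note [simp] = S.dtD[OF ds]
  have ids: "isom T (fob F V) (fob F V) (ide T (fob F V))" "isom T (fob F W) (fob F W) (ide T (fob F W))"
      by simp_all
  have "T.dt (fob F V) (fob F W) (sho T (fob F U)) (fmor F v) (fal F U \<cdot>\<^bsub>T\<^esub> fmor F w) ((- 1) \<odot>\<^bsub>T\<^esub> shm T (fmor F u))"
    by (rule T.TR1_iso[OF dt _ ids fal_isom]) (simp_all add: T.triangle_iff fal_shm[where U=U])
  then have "T.dt (fob F U) (fob F V) (fob F W) (fmor F u) (fmor F v) (fal F U \<cdot>\<^bsub>T\<^esub> fmor F w)"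
    by (rule T.dt_unrot) simp_all
  then show ?thesis using ds unfolding preserves_def by blast
qed

lemma preserves_sum:
  assumes 1: "preserves U1 V1 W1 u1 v1 w1" and 2: "preserves U2 V2 W2 u2 v2 w2"
      and bU: "biproduct S U1 U2 U i1 i2 p1 p2"
    and bV: "biproduct S V1 V2 V j1 j2 q1 q2" and bW: "biproduct S W1 W2 W k1 k2 r1 r2"
  shows "preserves U V W (j1 \<cdot>\<^bsub>S\<^esub> (u1 \<cdot>\<^bsub>S\<^esub> p1) \<oplus>\<^bsub>S\<^esub> j2 \<cdot>\<^bsub>S\<^esub> (u2 \<cdot>\<^bsub>S\<^esub> p2)) (k1 \<cdot>\<^bsub>S\<^esub> (v1 \<cdot>\<^bsub>S\<^esub> q1)
      \<oplus>\<^bsub>S\<^esub> k2 \<cdot>\<^bsub>S\<^esub> (v2 \<cdot>\<^bsub>S\<^esub> q2))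
     (shm S i1 \<cdot>\<^bsub>S\<^esub> (w1 \<cdot>\<^bsub>S\<^esub> r1) \<oplus>\<^bsub>S\<^esub> shm S i2 \<cdot>\<^bsub>S\<^esub> (w2 \<cdot>\<^bsub>S\<^esub> r2))"
proof -
  have s: "S.dt U1 V1 W1 u1 v1 w1" "S.dt U2 V2 W2 u2 v2 w2"
    and t: "T.dt (fob F U1) (fob F V1) (fob F W1) (fmor F u1) (fmor F v1) (fal F U1 \<cdot>\<^bsub>T\<^esub> fmor F w1)"
      "T.dt (fob F U2) (fob F V2) (fob F W2) (fmor F u2) (fmor F v2) (fal F U2 \<cdot>\<^bsub>T\<^esub> fmor F w2)"
    using 1 2 unfolding preserves_def by blast+
  note [simp] = S.dtD[OF s(1)] S.dtD[OF s(2)] S.biproductD[OF bU] S.biproductD[OF bV] S.biproductD[OF bW]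
  show ?thesis unfolding preserves_def
  proof
    show "S.dt U V W (j1 \<cdot>\<^bsub>S\<^esub> (u1 \<cdot>\<^bsub>S\<^esub> p1) \<oplus>\<^bsub>S\<^esub> j2 \<cdot>\<^bsub>S\<^esub> (u2 \<cdot>\<^bsub>S\<^esub> p2)) (k1 \<cdot>\<^bsub>S\<^esub> (v1 \<cdot>\<^bsub>S\<^esub> q1)
        \<oplus>\<^bsub>S\<^esub> k2 \<cdot>\<^bsub>S\<^esub> (v2 \<cdot>\<^bsub>S\<^esub> q2))
       (shm S i1 \<cdot>\<^bsub>S\<^esub> (w1 \<cdot>\<^bsub>S\<^esub> r1) \<oplus>\<^bsub>S\<^esub> shm S i2 \<cdot>\<^bsub>S\<^esub> (w2 \<cdot>\<^bsub>S\<^esub> r2))" by (rule S.dt_sum[OF s bU bV bW])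
    show "T.dt (fob F U) (fob F V) (fob F W) (fmor F (j1 \<cdot>\<^bsub>S\<^esub> (u1 \<cdot>\<^bsub>S\<^esub> p1) \<oplus>\<^bsub>S\<^esub> j2 \<cdot>\<^bsub>S\<^esub> (u2 \<cdot>\<^bsub>S\<^esub> p2)))
      (fmor F (k1 \<cdot>\<^bsub>S\<^esub> (v1 \<cdot>\<^bsub>S\<^esub> q1) \<oplus>\<^bsub>S\<^esub> k2 \<cdot>\<^bsub>S\<^esub> (v2 \<cdot>\<^bsub>S\<^esub> q2)))
      (fal F U \<cdot>\<^bsub>T\<^esub> fmor F (shm S i1 \<cdot>\<^bsub>S\<^esub> (w1 \<cdot>\<^bsub>S\<^esub> r1) \<oplus>\<^bsub>S\<^esub> shm S i2 \<cdot>\<^bsub>S\<^esub> (w2 \<cdot>\<^bsub>S\<^esub> r2)))"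
      using T.dt_sum[OF t fmor_biproduct[OF bU] fmor_biproduct[OF bV] fmor_biproduct[OF bW]]
      by (simp add: fal_shm'[where U=U1] fal_shm'[where U=U2])
  qed
qed

lemma preserves_ide:
  assumes "zero_object S Z" "U \<in> ob S" shows "preserves U U Z (ide S U) (zer S U Z) (zer S Z (sho S U))"
  using S.dt_id[OF assms] T.dt_id[OF fob_zero[OF assms(1)] fob_ob[OF assms(2)]] assms S.zero_objectD(1)[OF assms(1)]
  unfolding preserves_def by simp

lemma map_octa_edge:
  assumes "octahedron S X" "deg v w = Some d"
  shows "edge T (map_octa T F X) v w = (if d
      = 0 then fmor F (edge S X v w) else fal F (vob X w) \<cdot>\<^bsub>T\<^esub> fmor F (edge S X v w))"
proof -
  interpret X: octahedron_in S X using assms(1) by unfold_locales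
  show ?thesis using assms(2) by (cases v; cases w) (auto simp: map_octa_def)
qed

lemma map_octa_vob [simp]: "vob (map_octa T F X) v = fob F (vob X v)"
  by (cases v) (auto simp: map_octa_def)

end

section \<open>Left Kan extension\<close>

locale octahedron_pair = S: exceptional_octahedron S X + T: octahedron_in T Y
  for S :: "('o, 'a, 'k :: field) tri_cat" and X and T :: "('p, 'b, 'k) tri_cat" and Y
begin

abbreviation "G \<equiv> gob T Y"
abbreviation "g \<equiv> gmor T Y"

text \<open>
  A cocone is a linear natural transformation from \<open>hom S (S.P -) U\<close> to \<open>hom T (G -) Z\<close>; the universal
  ones represent the value at \<open>U\<close> of the left Kan extension of \<open>G\<close> along \<open>S.P\<close>.
\<close>

definition cocone :: "'o \<Rightarrow> 'p \<Rightarrow> (vertex \<times> int \<Rightarrow> 'a \<Rightarrow> 'b) \<Rightarrow> bool" where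
  "cocone U Z \<Phi> \<longleftrightarrow> U \<in> ob S \<and> Z \<in> ob T \<and>
     (\<forall>p x. arr S x \<and> dm S x = S.P p \<and> cd S x = U \<longrightarrow> arr T (\<Phi> p x) \<and> dm T (\<Phi> p x) = G p \<and> cd T (\<Phi> p x) = Z) \<and>
     (\<forall>p x y. arr S x \<and> dm S x = S.P p \<and> cd S x = U \<and> arr S y \<and> dm S y = S.P p \<and> cd S y = U \<longrightarrow> \<Phi> p (x \<oplus>\<^bsub>S\<^esub> y) = \<Phi> p x
         \<oplus>\<^bsub>T\<^esub> \<Phi> p y) \<and>
     (\<forall>p x c. arr S x \<and> dm S x = S.P p \<and> cd S x = U \<longrightarrow> \<Phi> p (c \<odot>\<^bsub>S\<^esub> x) = c \<odot>\<^bsub>T\<^esub> \<Phi> p x) \<and>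
     (\<forall>p q x. pre p q \<and> arr S x \<and> dm S x = S.P q \<and> cd S x = U \<longrightarrow> \<Phi> p (x \<cdot>\<^bsub>S\<^esub> S.b p q) = \<Phi> q x \<cdot>\<^bsub>T\<^esub> g p q)"

definition kan :: "'o \<Rightarrow> 'p \<Rightarrow> (vertex \<times> int \<Rightarrow> 'a \<Rightarrow> 'b) \<Rightarrow> bool" where
  "kan U Z \<Phi> \<longleftrightarrow> cocone U Z \<Phi> \<and>
     (\<forall>W \<Psi>. cocone U W \<Psi> \<longrightarrow> (\<exists>z. arr T z \<and> dm T z = Z \<and> cd T z = W \<and>
        (\<forall>p x. arr S x \<and> dm S x = S.P p \<and> cd S x = U \<longrightarrow> \<Psi> p x = z \<cdot>\<^bsub>T\<^esub> \<Phi> p x))) \<and>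
     (\<forall>z z'. arr T z \<and> dm T z = Z \<and> arr T z' \<and> dm T z' = Z \<and> cd T z = cd T z' \<and>
        (\<forall>p x. arr S x \<and> dm S x = S.P p \<and> cd S x = U \<longrightarrow> z \<cdot>\<^bsub>T\<^esub> \<Phi> p x = z' \<cdot>\<^bsub>T\<^esub> \<Phi> p x) \<longrightarrow> z = z')"

lemma cocone_D:
  assumes "cocone U Z \<Phi>"
  shows "U \<in> ob S" "Z \<in> ob T"
    "arr S x \<Longrightarrow> dm S x = S.P p \<Longrightarrow> cd S x = U \<Longrightarrow> arr T (\<Phi> p x)"
    "arr S x \<Longrightarrow> dm S x = S.P p \<Longrightarrow> cd S x = U \<Longrightarrow> dm T (\<Phi> p x) = G p"
    "arr S x \<Longrightarrow> dm S x = S.P p \<Longrightarrow> cd S x = U \<Longrightarrow> cd T (\<Phi> p x) = Z"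
    "arr S x \<Longrightarrow> dm S x = S.P p \<Longrightarrow> cd S x = U \<Longrightarrow> arr S y \<Longrightarrow> dm S y = S.P p \<Longrightarrow> cd S y = U
        \<Longrightarrow> \<Phi> p (x \<oplus>\<^bsub>S\<^esub> y) = \<Phi> p x \<oplus>\<^bsub>T\<^esub> \<Phi> p y"
    "arr S x \<Longrightarrow> dm S x = S.P p \<Longrightarrow> cd S x = U \<Longrightarrow> \<Phi> p (c \<odot>\<^bsub>S\<^esub> x) = c \<odot>\<^bsub>T\<^esub> \<Phi> p x"
    "pre p q \<Longrightarrow> arr S x \<Longrightarrow> dm S x = S.P q \<Longrightarrow> cd S x = U \<Longrightarrow> \<Phi> p (x \<cdot>\<^bsub>S\<^esub> S.b p q) = \<Phi> q x \<cdot>\<^bsub>T\<^esub> g p q"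
  using assms unfolding cocone_def by blast+

lemma cocone_zer:
  assumes "cocone U Z \<Phi>" shows "\<Phi> p (zer S (S.P p) U) = zer T (G p) Z"
  using cocone_D(7)[OF assms, of "zer S (S.P p) U" p 0] cocone_D(1)[OF assms] cocone_D(3-5)[OF assms,
      of "zer S (S.P p) U" p] by simp

lemma cocone_cmp:
  assumes "cocone V Z \<Phi>" "arr S u" "dm S u = U" "cd S u = V" shows "cocone U Z (\<lambda>p x. \<Phi> p (u \<cdot>\<^bsub>S\<^esub> x))"
proof -
  note [simp] = cocone_D[OF assms(1)] assms(2-4)
  have [simp]: "U \<in> ob S" using S.dm_ob[OF assms(2)] assms(3) by metis
  have "\<Phi> p (u \<cdot>\<^bsub>S\<^esub> (x \<cdot>\<^bsub>S\<^esub> S.b p q)) = \<Phi> q (u \<cdot>\<^bsub>S\<^esub> x) \<cdot>\<^bsub>T\<^esub> g p q"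
    if "pre p q" "arr S x" "dm S x = S.P q" "cd S x = U" for p q x
    using cocone_D(8)[OF assms(1) that(1), of "u \<cdot>\<^bsub>S\<^esub> x"] that by simp
  then show ?thesis unfolding cocone_def by simp
qed


lemma kanD:
  assumes "kan U Z \<Phi>"
  shows "cocone U Z \<Phi>"
    "cocone U W \<Psi> \<Longrightarrow> \<exists>z. arr T z \<and> dm T z = Z \<and> cd T z = W \<and> (\<forall>p x. arr S x \<and> dm S x = S.P p \<and>
        cd S x = U \<longrightarrow> \<Psi> p x = z \<cdot>\<^bsub>T\<^esub> \<Phi> p x)"
    "arr T z \<Longrightarrow> dm T z = Z \<Longrightarrow> arr T z' \<Longrightarrow> dm T z' = Z \<Longrightarrow> cd T z = cd T z' \<Longrightarrow>
       (\<And>p x. arr S x \<Longrightarrow> dm S x = S.P p \<Longrightarrow> cd S x = U \<Longrightarrow> z \<cdot>\<^bsub>T\<^esub> \<Phi> p x = z' \<cdot>\<^bsub>T\<^esub> \<Phi> p x) \<Longrightarrow> z = z'"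
  using assms unfolding kan_def by blast+

lemma kan_isom:
  assumes k: "kan U Z \<Phi>" and k': "kan U Z' \<Phi>'"
  obtains z where "isom T Z Z' z" "\<And>p x. arr S x \<Longrightarrow> dm S x = S.P p \<Longrightarrow> cd S x = U \<Longrightarrow> \<Phi>' p x = z \<cdot>\<^bsub>T\<^esub> \<Phi> p x"
proof -
  note c = cocone_D[OF kanD(1)[OF k]] and c' = cocone_D[OF kanD(1)[OF k']]
  obtain z where z: "arr T z" "dm T z = Z" "cd T z = Z'" "\<And>p x. arr S x \<Longrightarrow> dm S x = S.P p \<Longrightarrow> cd S x = U
      \<Longrightarrow> \<Phi>' p x = z \<cdot>\<^bsub>T\<^esub> \<Phi> p x"
    using kanD(2)[OF k kanD(1)[OF k']] by blast
  obtain z' where z': "arr T z'" "dm T z' = Z'" "cd T z' = Z" "\<And>p x. arr S x \<Longrightarrow> dm S x = S.P p \<Longrightarrow> cd S x = U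
      \<Longrightarrow> \<Phi> p x = z' \<cdot>\<^bsub>T\<^esub> \<Phi>' p x"
    using kanD(2)[OF k' kanD(1)[OF k]] by blast
  note [simp] = c(1-5) c'(2-5) z(1-3) z'(1-3)
  have "z' \<cdot>\<^bsub>T\<^esub> z = ide T Z"
    by (rule kanD(3)[OF k]) (simp_all add: z(4)[symmetric] z'(4)[symmetric])
  moreover have "z \<cdot>\<^bsub>T\<^esub> z' = ide T Z'"
    by (rule kanD(3)[OF k']) (simp_all add: z(4)[symmetric] z'(4)[symmetric])
  ultimately have "isom T Z Z' z" by (intro T.isomI[of z z']) simp_all
  then show thesis using that z(4) by blast
qed

lemma kan_zero:
  assumes U: "zero_object S U" and Z: "zero_object T Z" and c: "cocone U Z \<Phi>" shows "kan U Z \<Phi>"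
  unfolding kan_def
proof (intro conjI allI impI c)
  fix W \<Psi> assume \<Psi>: "cocone U W \<Psi>"
  note [simp] = S.zero_objectD(1)[OF U] T.zero_objectD(1)[OF Z] cocone_D(1-5)[OF \<Psi>] cocone_D(1-5)[OF c]
  have "\<Psi> p x = zer T Z W \<cdot>\<^bsub>T\<^esub> \<Phi> p x" if "arr S x" "dm S x = S.P p" "cd S x = U" for p x
    using S.zero_objectD(2)[OF U, of x] cocone_zer[OF \<Psi>, of p] that by simp
  then show "\<exists>z. arr T z \<and> dm T z = Z \<and> cd T z = W \<and> (\<forall>p x. arr S x \<and> dm S x = S.P p \<and>
      cd S x = U \<longrightarrow> \<Psi> p x = z \<cdot>\<^bsub>T\<^esub> \<Phi> p x)"
    by (intro exI[of _ "zer T Z W"]) simp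
next
  fix z z' assume "arr T z \<and> dm T z = Z \<and> arr T z' \<and> dm T z' = Z \<and> cd T z = cd T z' \<and>
        (\<forall>p x. arr S x \<and> dm S x = S.P p \<and> cd S x = U \<longrightarrow> z \<cdot>\<^bsub>T\<^esub> \<Phi> p x = z' \<cdot>\<^bsub>T\<^esub> \<Phi> p x)"
  then show "z = z'" using T.zero_objectD(3)[OF Z] by metis
qed

text \<open>The Yoneda argument: arrows into \<open>S.P q\<close> from the diagram are multiples of
  the \<open>S.b p q\<close>, so naturality and linearity determine a cocone by its value at the
  identity.\<close>

lemma kan_gob:
  assumes c: "cocone (S.P q) Z \<Phi>" and i: "isom T (G q) Z (\<Phi> q (ide S (S.P q)))" shows "kan (S.P q) Z \<Phi>"
  unfolding kan_def
proof (intro conjI allI impI c)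
  have gen: "\<Psi> p x = c \<odot>\<^bsub>T\<^esub> (\<Psi> q (ide S (S.P q)) \<cdot>\<^bsub>T\<^esub> g p q)"
    if \<Psi>: "cocone (S.P q) W \<Psi>" and "pre p q" "x = c \<odot>\<^bsub>S\<^esub> S.b p q" for W \<Psi> p x c
    using cocone_D(7)[OF \<Psi>, of "S.b p q" p c] cocone_D(8)[OF \<Psi> that(2), of "ide S (S.P q)"] that(3) by simp
  fix W \<Psi> assume \<Psi>: "cocone (S.P q) W \<Psi>"
  let ?t = "\<Phi> q (ide S (S.P q))" and ?s = "\<Psi> q (ide S (S.P q))"
  note [simp] = cocone_D(1-5)[OF \<Psi>] cocone_D(1-5)[OF c]
  obtain t where t: "arr T t" "dm T t = Z" "cd T t = G q" "\<And>x. arr T x \<Longrightarrow> cd T x = G q \<Longrightarrow> t \<cdot>\<^bsub>T\<^esub> (?t \<cdot>\<^bsub>T\<^esub> x) = x"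
    using T.isomE[OF i] by metis
  note [simp] = t
  have "\<Psi> p x = (?s \<cdot>\<^bsub>T\<^esub> t) \<cdot>\<^bsub>T\<^esub> \<Phi> p x" if x: "arr S x" "dm S x = S.P p" "cd S x = S.P q" for p x
  proof (cases "pre p q")
    case True
    obtain c' where c': "x = c' \<odot>\<^bsub>S\<^esub> S.b p q" using S.gob_hom(2)[OF x True] by blast
    show ?thesis using gen[OF \<Psi> True c'] gen[OF c True c'] by simp
  next
    case False
    then show ?thesis using S.gob_hom(1)[OF x False] cocone_zer[OF \<Psi>, of p] cocone_zer[OF c, of p] by simp
  qed
  moreover have "arr T (?s \<cdot>\<^bsub>T\<^esub> t)" "dm T (?s \<cdot>\<^bsub>T\<^esub> t) = Z" "cd T (?s \<cdot>\<^bsub>T\<^esub> t) = W" by simp_all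
  ultimately show "\<exists>z. arr T z \<and> dm T z = Z \<and> cd T z = W \<and> (\<forall>p x. arr S x \<and> dm S x = S.P p \<and> cd S x = S.P q \<longrightarrow> \<Psi> p x
      = z \<cdot>\<^bsub>T\<^esub> \<Phi> p x)"
    by blast
next
  fix z z' assume z: "arr T z \<and> dm T z = Z \<and> arr T z' \<and> dm T z' = Z \<and> cd T z = cd T z' \<and>
        (\<forall>p x. arr S x \<and> dm S x = S.P p \<and> cd S x = S.P q \<longrightarrow> z \<cdot>\<^bsub>T\<^esub> \<Phi> p x = z' \<cdot>\<^bsub>T\<^esub> \<Phi> p x)"
  have "arr S (ide S (S.P q)) \<and> dm S (ide S (S.P q)) = S.P q \<and> cd S (ide S (S.P q)) = S.P q" by simp
  then have "z \<cdot>\<^bsub>T\<^esub> \<Phi> q (ide S (S.P q)) = z' \<cdot>\<^bsub>T\<^esub> \<Phi> q (ide S (S.P q))" using z by blast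
  then show "z = z'" using T.isom_cancel_right[OF i] z by blast
qed

text \<open>A cocone at \<open>U\<close> restricts to cocones at the two summands, and their
  factorisations are reassembled with the projections of \<open>Z\<close>.\<close>

lemma kan_sum:
  assumes c: "cocone U Z \<Phi>" and k1: "kan U1 Z1 \<Phi>1" and k2: "kan U2 Z2 \<Phi>2"
    and bU: "biproduct S U1 U2 U i j r s" and bZ: "biproduct T Z1 Z2 Z i' j' r' s'"
    and e1: "\<And>p x. arr S x \<Longrightarrow> dm S x = S.P p \<Longrightarrow> cd S x = U1 \<Longrightarrow> \<Phi> p (i \<cdot>\<^bsub>S\<^esub> x) = i' \<cdot>\<^bsub>T\<^esub> \<Phi>1 p x"
    and e2: "\<And>p x. arr S x \<Longrightarrow> dm S x = S.P p \<Longrightarrow> cd S x = U2 \<Longrightarrow> \<Phi> p (j \<cdot>\<^bsub>S\<^esub> x) = j' \<cdot>\<^bsub>T\<^esub> \<Phi>2 p x"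
  shows "kan U Z \<Phi>"
  unfolding kan_def
proof (intro conjI allI impI c)
  note [simp] = cocone_D(1-5)[OF c] cocone_D(1-5)[OF kanD(1)[OF k1]] cocone_D(1-5)[OF kanD(1)[OF k2]]
    S.biproductD[OF bU] T.biproductD[OF bZ]
  have dec: "\<Psi> p x = \<Psi> p (i \<cdot>\<^bsub>S\<^esub> (r \<cdot>\<^bsub>S\<^esub> x)) \<oplus>\<^bsub>T\<^esub> \<Psi> p (j \<cdot>\<^bsub>S\<^esub> (s \<cdot>\<^bsub>S\<^esub> x))"
    if "cocone U W \<Psi>" "arr S x" "dm S x = S.P p" "cd S x = U" for W \<Psi> p x
    using cocone_D(6)[OF that(1), of "i \<cdot>\<^bsub>S\<^esub> (r \<cdot>\<^bsub>S\<^esub> x)" p "j \<cdot>\<^bsub>S\<^esub> (s \<cdot>\<^bsub>S\<^esub> x)"] S.biproduct_into[OF bU,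
        of x] that(2-4) by simp
  fix W \<Psi> assume \<Psi>: "cocone U W \<Psi>"
  note [simp] = cocone_D(2)[OF \<Psi>]
  have \<Psi>1: "cocone U1 W (\<lambda>p x. \<Psi> p (i \<cdot>\<^bsub>S\<^esub> x))" by (rule cocone_cmp[OF \<Psi>]) simp_all
  have \<Psi>2: "cocone U2 W (\<lambda>p x. \<Psi> p (j \<cdot>\<^bsub>S\<^esub> x))" by (rule cocone_cmp[OF \<Psi>]) simp_all
  obtain z1 where z1: "arr T z1" "dm T z1 = Z1" "cd T z1 = W" "\<And>p x. arr S x \<Longrightarrow> dm S x = S.P p \<Longrightarrow> cd S x = U1
      \<Longrightarrow> \<Psi> p (i \<cdot>\<^bsub>S\<^esub> x) = z1 \<cdot>\<^bsub>T\<^esub> \<Phi>1 p x"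
    using kanD(2)[OF k1 \<Psi>1] by blast
  obtain z2 where z2: "arr T z2" "dm T z2 = Z2" "cd T z2 = W" "\<And>p x. arr S x \<Longrightarrow> dm S x = S.P p \<Longrightarrow> cd S x = U2
      \<Longrightarrow> \<Psi> p (j \<cdot>\<^bsub>S\<^esub> x) = z2 \<cdot>\<^bsub>T\<^esub> \<Phi>2 p x"
    using kanD(2)[OF k2 \<Psi>2] by blast
  note [simp] = z1(1-3) z2(1-3)
  have "\<Psi> p x = (z1 \<cdot>\<^bsub>T\<^esub> r' \<oplus>\<^bsub>T\<^esub> z2 \<cdot>\<^bsub>T\<^esub> s') \<cdot>\<^bsub>T\<^esub> \<Phi> p x" if x: "arr S x" "dm S x = S.P p" "cd S x = U" for p x
    unfolding dec[OF \<Psi> x] dec[OF c x] using x by (simp add: e1 e2 z1(4) z2(4))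
  then show "\<exists>z. arr T z \<and> dm T z = Z \<and> cd T z = W \<and> (\<forall>p x. arr S x \<and> dm S x = S.P p \<and>
      cd S x = U \<longrightarrow> \<Psi> p x = z \<cdot>\<^bsub>T\<^esub> \<Phi> p x)"
    by (intro exI[of _ "z1 \<cdot>\<^bsub>T\<^esub> r' \<oplus>\<^bsub>T\<^esub> z2 \<cdot>\<^bsub>T\<^esub> s'"]) simp
next
  note [simp] = cocone_D(1-5)[OF c] cocone_D(1-5)[OF kanD(1)[OF k1]] cocone_D(1-5)[OF kanD(1)[OF k2]]
    S.biproductD[OF bU] T.biproductD[OF bZ]
  fix z z' assume "arr T z \<and> dm T z = Z \<and> arr T z' \<and> dm T z' = Z \<and> cd T z = cd T z' \<and>
        (\<forall>p x. arr S x \<and> dm S x = S.P p \<and> cd S x = U \<longrightarrow> z \<cdot>\<^bsub>T\<^esub> \<Phi> p x = z' \<cdot>\<^bsub>T\<^esub> \<Phi> p x)"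
  then have z [simp]: "arr T z" "dm T z = Z" "arr T z'" "dm T z' = Z" "cd T z = cd T z'"
    and ze: "\<And>p x. arr S x \<Longrightarrow> dm S x = S.P p \<Longrightarrow> cd S x = U \<Longrightarrow> z \<cdot>\<^bsub>T\<^esub> \<Phi> p x = z' \<cdot>\<^bsub>T\<^esub> \<Phi> p x" by auto
  have "z \<cdot>\<^bsub>T\<^esub> i' = z' \<cdot>\<^bsub>T\<^esub> i'"
  proof (rule kanD(3)[OF k1])
    fix p x assume x: "arr S x" "dm S x = S.P p" "cd S x = U1"
    show "(z \<cdot>\<^bsub>T\<^esub> i') \<cdot>\<^bsub>T\<^esub> \<Phi>1 p x = (z' \<cdot>\<^bsub>T\<^esub> i') \<cdot>\<^bsub>T\<^esub> \<Phi>1 p x" using ze[of "i \<cdot>\<^bsub>S\<^esub> x" p] x by (simp add: e1)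
  qed simp_all
  moreover have "z \<cdot>\<^bsub>T\<^esub> j' = z' \<cdot>\<^bsub>T\<^esub> j'"
  proof (rule kanD(3)[OF k2])
    fix p x assume x: "arr S x" "dm S x = S.P p" "cd S x = U2"
    show "(z \<cdot>\<^bsub>T\<^esub> j') \<cdot>\<^bsub>T\<^esub> \<Phi>2 p x = (z' \<cdot>\<^bsub>T\<^esub> j') \<cdot>\<^bsub>T\<^esub> \<Phi>2 p x" using ze[of "j \<cdot>\<^bsub>S\<^esub> x" p] x by (simp add: e2)
  qed simp_all
  ultimately show "z = z'" using T.biproduct_eq_out[OF bZ z(1,2,3,4)] by blast
qed

text \<open>The coefficient of an arrow with respect to \<open>S.b p q\<close>, well defined by
  \<open>gmor_smul_cancel\<close>, is transferred to \<open>g p q\<close>. Naturality holds because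
  composites of edges that vanish in \<open>S\<close> by the combinatorics of \<open>pre\<close>
  vanish in \<open>T\<close> for the same reason.\<close>

lemma cocone_gob_ex:
  obtains \<Phi> where "cocone (S.P q) (G q) \<Phi>" "\<Phi> q (ide S (S.P q)) = ide T (G q)"
proof -
  define coef where "coef p x = (THE c. x = c \<odot>\<^bsub>S\<^esub> S.b p q)" for p x
  define \<Phi> where "\<Phi> p x = (if pre p q then coef p x \<odot>\<^bsub>T\<^esub> g p q else zer T (G p) (G q))" for p x
  have coef: "coef p (c \<odot>\<^bsub>S\<^esub> S.b p q) = c" if "pre p q" for p c
    unfolding coef_def using S.gmor_smul_cancel[OF that] by (intro the_equality) auto
  have \<Phi>: "\<Phi> p (c \<odot>\<^bsub>S\<^esub> S.b p q) = c \<odot>\<^bsub>T\<^esub> g p q" if "pre p q" for p c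
    unfolding \<Phi>_def using that coef by simp
  have \<Phi>b: "\<Phi> p (S.b p q) = g p q" if "pre p q" for p using \<Phi>[OF that, of 1] by simp
  have \<Phi>0: "\<Phi> p (zer S (S.P p) (S.P q)) = zer T (G p) (G q)" for p
    using \<Phi>[of p 0] by (cases "pre p q") (simp_all add: \<Phi>_def)
  have ex: "\<exists>c. x = c \<odot>\<^bsub>S\<^esub> S.b p q" if "pre p q" "arr S x" "dm S x = S.P p" "cd S x = S.P q" for p x
    using S.gob_hom(2)[OF that(2-4,1)] .
  have z: "x = zer S (S.P p) (S.P q)" if "\<not> pre p q" "arr S x" "dm S x = S.P p" "cd S x = S.P q" for p x
    using S.gob_hom(1)[OF that(2-4,1)] .
  have "cocone (S.P q) (G q) \<Phi>" unfolding cocone_def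
  proof (intro conjI allI impI; (elim conjE)?)
    fix p x assume x: "arr S x" "dm S x = S.P p" "cd S x = S.P q"
    show "arr T (\<Phi> p x)" "dm T (\<Phi> p x) = G p" "cd T (\<Phi> p x) = G q" by (simp_all add: \<Phi>_def)
    fix c show "\<Phi> p (c \<odot>\<^bsub>S\<^esub> x) = c \<odot>\<^bsub>T\<^esub> \<Phi> p x"
    proof (cases "pre p q")
      case True
      then obtain d where "x = d \<odot>\<^bsub>S\<^esub> S.b p q" using ex x by blast
      then show ?thesis using True by (simp add: \<Phi>)
    next
      case False
      then show ?thesis by (simp add: \<Phi>_def)
    qed
  next
    fix p x y assume x: "arr S x" "dm S x = S.P p" "cd S x = S.P q" and y: "arr S y" "dm S y = S.P p"
        "cd S y = S.P q"
    show "\<Phi> p (x \<oplus>\<^bsub>S\<^esub> y) = \<Phi> p x \<oplus>\<^bsub>T\<^esub> \<Phi> p y"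
    proof (cases "pre p q")
      case True
      obtain d where d: "x = d \<odot>\<^bsub>S\<^esub> S.b p q" using ex x True by blast
      obtain e where e: "y = e \<odot>\<^bsub>S\<^esub> S.b p q" using ex y True by blast
      show ?thesis unfolding d e using True by (simp add: \<Phi> S.smul_left T.smul_left)
    next
      case False
      then show ?thesis by (simp add: \<Phi>_def)
    qed
  next
    fix p r x assume r: "pre p r" and x: "arr S x" "dm S x = S.P r" "cd S x = S.P q"
    show "\<Phi> p (x \<cdot>\<^bsub>S\<^esub> S.b p r) = \<Phi> r x \<cdot>\<^bsub>T\<^esub> g p r"
    proof (cases "pre r q")
      case True
      then obtain d where d: "x = d \<odot>\<^bsub>S\<^esub> S.b r q" using ex x by blast
      show ?thesis unfolding d using r True by (cases "pre p q") (simp_all add: \<Phi> \<Phi>0 S.gmor_not_pre T.gmor_not_pre)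
    next
      case False
      then have x0: "x = zer S (S.P r) (S.P q)" using z x by blast
      show ?thesis unfolding x0 by (simp add: \<Phi>0)
    qed
  qed simp_all
  then show thesis using that[of \<Phi>] \<Phi>b[of q] by simp
qed

lemma kan_ex: "S.decomposable U \<Longrightarrow> \<exists>Z \<Phi>. kan U Z \<Phi>"
proof (induct rule: S.decomposable_induct)
  case (zero U)
  obtain Z where Z: "zero_object T Z" using T.ex_zero_object by blast
  have "cocone U Z (\<lambda>p x. zer T (G p) Z)" unfolding cocone_def
      using S.zero_objectD(1)[OF zero] T.zero_objectD(1)[OF Z] by simp
  then show ?case using kan_zero[OF zero Z] by blast
next
  case (gob p)
  obtain \<Phi> where \<Phi>: "cocone (S.P p) (G p) \<Phi>" "\<Phi> p (ide S (S.P p)) = ide T (G p)" by (rule cocone_gob_ex)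
  have "kan (S.P p) (G p) \<Phi>" by (rule kan_gob[OF \<Phi>(1)]) (simp add: \<Phi>(2))
  then show ?case by blast
next
  case (sum U1 U2 U i j r s)
  obtain Z1 \<Phi>1 where k1: "kan U1 Z1 \<Phi>1" using sum(1) by blast
  obtain Z2 \<Phi>2 where k2: "kan U2 Z2 \<Phi>2" using sum(2) by blast
  obtain Z i' j' r' s' where bZ: "biproduct T Z1 Z2 Z i' j' r' s'"
    using T.ex_biproduct cocone_D(2)[OF kanD(1)[OF k1]] cocone_D(2)[OF kanD(1)[OF k2]] by metis
  note [simp] = cocone_D[OF kanD(1)[OF k1]] cocone_D[OF kanD(1)[OF k2]] S.biproductD[OF sum(3)] T.biproductD[OF bZ]
     cocone_zer[OF kanD(1)[OF k1]] cocone_zer[OF kanD(1)[OF k2]]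
  have n1: "\<Phi>1 p (r \<cdot>\<^bsub>S\<^esub> (x \<cdot>\<^bsub>S\<^esub> S.b p q)) = \<Phi>1 q (r \<cdot>\<^bsub>S\<^esub> x) \<cdot>\<^bsub>T\<^esub> g p q"
    if "pre p q" "arr S x" "dm S x = S.P q" "cd S x = U" for p q x
    using cocone_D(8)[OF kanD(1)[OF k1] that(1), of "r \<cdot>\<^bsub>S\<^esub> x"] that by simp
  have n2: "\<Phi>2 p (s \<cdot>\<^bsub>S\<^esub> (x \<cdot>\<^bsub>S\<^esub> S.b p q)) = \<Phi>2 q (s \<cdot>\<^bsub>S\<^esub> x) \<cdot>\<^bsub>T\<^esub> g p q"
    if "pre p q" "arr S x" "dm S x = S.P q" "cd S x = U" for p q x
    using cocone_D(8)[OF kanD(1)[OF k2] that(1), of "s \<cdot>\<^bsub>S\<^esub> x"] that by simp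
  have "cocone U Z (\<lambda>p x. i' \<cdot>\<^bsub>T\<^esub> \<Phi>1 p (r \<cdot>\<^bsub>S\<^esub> x) \<oplus>\<^bsub>T\<^esub> j' \<cdot>\<^bsub>T\<^esub> \<Phi>2 p (s \<cdot>\<^bsub>S\<^esub> x))"
    unfolding cocone_def by (simp add: n1 n2 T.add_ac)
  then have "kan U Z (\<lambda>p x. i' \<cdot>\<^bsub>T\<^esub> \<Phi>1 p (r \<cdot>\<^bsub>S\<^esub> x) \<oplus>\<^bsub>T\<^esub> j' \<cdot>\<^bsub>T\<^esub> \<Phi>2 p (s \<cdot>\<^bsub>S\<^esub> x))"
    by (rule kan_sum[OF _ k1 k2 sum(3) bZ]) simp_all
  then show ?case by blast
qed

lemma unsh:
  assumes "arr S x" "dm S x = S.P p" "cd S x = sho S U" "U \<in> ob S"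
  shows "arr S (sh S (- 1) x)" "dm S (sh S (- 1) x) = S.P (down p)" "cd S (sh S (- 1) x) = U" "shm S (sh S (- 1) x)
      = x"
proof -
  have "shift_ob S (- 1) (S.P p) = S.P (down p)"
    using S.shift_ob_add[of "vob X (fst p)" "- 1" "snd p"] by (simp add: gob_def down_def)
  then show "arr S (sh S (- 1) x)" "dm S (sh S (- 1) x) = S.P (down p)" "cd S (sh S (- 1) x) = U"
      "shm S (sh S (- 1) x) = x"
    using assms S.shift_ob_sho[of U "- 1"] S.sh_add[of x 1 "- 1"] by simp_all
qed

text \<open>Both diagrams commute strictly with the shift when the index moves by \<open>up\<close>,
  so shifting turns cocones at \<open>U\<close> into cocones at \<open>U[1]\<close> and back, and
  with them the universal property. The comparison isomorphism of the functor arises from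
  this.\<close>

lemma kan_shift:
  assumes k: "kan U Z \<Phi>"
  shows "kan (sho S U) (sho T Z) (\<lambda>p x. shm T (\<Phi> (down p) (sh S (- 1) x)))" (is "kan _ _ ?\<Phi>")
proof -
  note c = kanD(1)[OF k]
  note [simp] = cocone_D[OF c]
  have T1: "shift_ob T (- 1) (sho T W) = W" if "W \<in> ob T" for W using T.shift_ob_sho[OF that, of "- 1"] by simp
  have bd: "sh S (- 1) (S.b p q) = S.b (down p) (down q)" for p q
    using S.sh_pred_unique[of "S.b p q" "S.b (down p) (down q)" 0] by simp
  have ob: "sho T (G (down p)) = G p" for p by simp
  have Pd: "shift_ob S (- 1) (S.P p) = S.P (down p)" for p
    using S.shift_ob_add[of "vob X (fst p)" "- 1" "snd p"] by (simp add: gob_def down_def)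
  have Ud: "shift_ob S (- 1) (sho S U) = U" using S.shift_ob_sho[of U "- 1"] by simp
  have nat: "\<Phi> (down p) (sh S (- 1) x \<cdot>\<^bsub>S\<^esub> S.b (down p) (down q))
      = \<Phi> (down q) (sh S (- 1) x) \<cdot>\<^bsub>T\<^esub> g (down p) (down q)"
    if "pre p q" "arr S x" "dm S x = S.P q" "cd S x = sho S U" for p q x
    using cocone_D(8)[OF c _ unsh(1-3)[OF that(2-4)], of "down p"] that by simp
  have cs: "cocone (sho S U) (sho T Z) ?\<Phi>"
    unfolding cocone_def by (simp add: nat Pd Ud bd del: split_paired_All)
  show ?thesis unfolding kan_def
  proof (intro conjI allI impI cs)
    fix W' \<Psi> assume \<Psi>: "cocone (sho S U) W' \<Psi>"
    obtain W where W: "W \<in> ob T" "W' = sho T W" using T.sho_surj cocone_D(2)[OF \<Psi>] by metis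
    note [simp] = W cocone_D[OF \<Psi>]
    define \<Psi>' where "\<Psi>' p x = sh T (- 1) (\<Psi> (up p) (shm S x))" for p x
    have Gd: "shift_ob T (- 1) (G (up p)) = G p" for p using T1[of "G p"] by simp
    have gd: "sh T (- 1) (g (up p) (up q)) = g p q" for p q
      using T.sh_pred_unique[of "g (up p) (up q)" "g p q" 0] by simp
    have nat': "\<Psi> (up p) (shm S x \<cdot>\<^bsub>S\<^esub> S.b (up p) (up q)) = \<Psi> (up q) (shm S x) \<cdot>\<^bsub>T\<^esub> g (up p) (up q)"
      if "pre p q" "arr S x" "dm S x = S.P q" "cd S x = U" for p q x
      using cocone_D(8)[OF \<Psi>, of "up p" "up q" "shm S x"] that by simp
    have "cocone U W \<Psi>'" unfolding cocone_def \<Psi>'_def using T1[OF W(1)] by (simp add: Gd gd nat')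
    then obtain z where z: "arr T z" "dm T z = Z" "cd T z = W"
      "\<And>p x. arr S x \<Longrightarrow> dm S x = S.P p \<Longrightarrow> cd S x = U \<Longrightarrow> \<Psi>' p x = z \<cdot>\<^bsub>T\<^esub> \<Phi> p x"
      using kanD(2)[OF k] by blast
    have "\<Psi> p x = shm T z \<cdot>\<^bsub>T\<^esub> ?\<Phi> p x" if x: "arr S x" "dm S x = S.P p" "cd S x = sho S U" for p x
    proof -
      note y = unsh[OF x cocone_D(1)[OF c]]
      have "shm T (\<Psi>' (down p) (sh S (- 1) x)) = shm T z \<cdot>\<^bsub>T\<^esub> ?\<Phi> p x" using z(4)[OF y(1-3)] y z(1-3) by simp
      moreover have "shm T (\<Psi>' (down p) (sh S (- 1) x)) = \<Psi> p x"
        unfolding \<Psi>'_def using y(4) x T.sh_add[of "\<Psi> p x" 1 "- 1"] by simp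
      ultimately show ?thesis by simp
    qed
    then show "\<exists>z. arr T z \<and> dm T z = sho T Z \<and> cd T z = W' \<and> (\<forall>p x. arr S x \<and> dm S x = S.P p \<and>
        cd S x = sho S U \<longrightarrow> \<Psi> p x = z \<cdot>\<^bsub>T\<^esub> ?\<Phi> p x)"
      using z(1-3) by (intro exI[of _ "shm T z"]) simp
  next
    fix z z' assume "arr T z \<and> dm T z = sho T Z \<and> arr T z' \<and> dm T z' = sho T Z \<and> cd T z = cd T z' \<and>
        (\<forall>p x. arr S x \<and> dm S x = S.P p \<and> cd S x = sho S U \<longrightarrow> z \<cdot>\<^bsub>T\<^esub> ?\<Phi> p x = z' \<cdot>\<^bsub>T\<^esub> ?\<Phi> p x)"
    then have z: "arr T z" "dm T z = sho T Z" "arr T z'" "dm T z' = sho T Z" "cd T z = cd T z'" and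
      ze: "\<And>p x. arr S x \<Longrightarrow> dm S x = S.P p \<Longrightarrow> cd S x = sho S U \<Longrightarrow> z \<cdot>\<^bsub>T\<^esub> ?\<Phi> p x = z' \<cdot>\<^bsub>T\<^esub> ?\<Phi> p x" by blast+
    obtain W where W: "W \<in> ob T" "cd T z = sho T W" using T.sho_surj[of "cd T z"] T.cd_ob[OF z(1)] by metis
    obtain y where y: "arr T y" "dm T y = Z" "cd T y = W" "z = shm T y" using T.shm_surj[OF z(1,2) W(2)] W by auto
    obtain y' where y': "arr T y'" "dm T y' = Z" "cd T y' = W" "z' = shm T y'"
        using T.shm_surj[OF z(3,4)] W z(5) cocone_D(2)[OF c] by metis
    have "y = y'"
    proof (rule kanD(3)[OF k y(1,2) y'(1,2)])
      show "cd T y = cd T y'" using y y' by simp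
      fix p x assume x: "arr S x" "dm S x = S.P p" "cd S x = U"
      have "sh S (- 1) (shm S x) = x" using S.sh_shm[OF x(1), of "- 1"] by simp
      then have "shm T (y \<cdot>\<^bsub>T\<^esub> \<Phi> p x) = shm T (y' \<cdot>\<^bsub>T\<^esub> \<Phi> p x)" using ze[of "shm S x" "up p"] x y y' by simp
      then show "y \<cdot>\<^bsub>T\<^esub> \<Phi> p x = y' \<cdot>\<^bsub>T\<^esub> \<Phi> p x" using T.shm_inj x y y' by simp
    qed
    then show "z = z'" using y y' by simp
  qed
qed

end


section \<open>Isomorphisms of octahedra\<close>

context triangulated_category
begin

text \<open>The squares of \<open>octa_iso\<close> in one condition indexed by pairs of vertices, so
  that inverting and composing isomorphisms requires no case distinction.\<close>

definition edge_iso :: "('o, 'a) octa \<Rightarrow> ('o, 'a) octa \<Rightarrow> (vertex \<Rightarrow> 'a) \<Rightarrow> bool" where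
  "edge_iso Y Y' e \<longleftrightarrow> (\<forall>v. isom T (vob Y v) (vob Y' v) (e v)) \<and>
     (\<forall>v w d. deg v w = Some d \<longrightarrow> edge T Y' v w \<cdot> e v = sh T d (e w) \<cdot> edge T Y v w)"

lemma octa_iso_if_edge_iso:
  assumes "edge_iso Y Y' e" shows "octa_iso T Y Y'"
proof -
  have i: "isom T (vob Y v) (vob Y' v) (e v)" for v using assms unfolding edge_iso_def by blast
  have E: "edge T Y' v w \<cdot> e v = sh T d (e w) \<cdot> edge T Y v w" if "deg v w = Some d" for v w d
    using assms that unfolding edge_iso_def by blast
  have d0: "edge T Y' v w \<cdot> e v = e w \<cdot> edge T Y v w" if "deg v w = Some 0" for v w
    using E[OF that] by simp
  have d1: "edge T Y' v w \<cdot> e v = shm T (e w) \<cdot> edge T Y v w" if "deg v w = Some 1" for v w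
    using E[OF that] by simp
  note I = i[of VA, simplified] i[of VB, simplified] i[of VC, simplified] i[of VD, simplified] i[of VE, simplified]
      i[of VF, simplified]
    d0[of VA VB, simplified] d0[of VB VD, simplified] d1[of VD VA, simplified] d0[of VB VC, simplified] d0[of VC VF,
        simplified]
    d1[of VF VB, simplified] d0[of VA VC, simplified] d0[of VC VE, simplified] d1[of VE VA, simplified] d0[of VD VE,
        simplified]
    d0[of VE VF, simplified] d1[of VF VD, simplified] d0[of VB VE, simplified] d1[of VE VB, simplified]
  show ?thesis unfolding octa_iso_def
    by (intro exI[of _ "e VA"] exI[of _ "e VB"] exI[of _ "e VC"] exI[of _ "e VD"] exI[of _ "e VE"]
        exI[of _ "e VF"] conjI I)
qed

lemma edge_iso_if_octa_iso:
  assumes "octa_iso T Y Y'" obtains e where "edge_iso Y Y' e"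
proof -
  obtain a b c d e r where o: "isom T (oA Y) (oA Y') a" "isom T (oB Y) (oB Y') b" "isom T (oC Y) (oC Y') c"
     "isom T (oD Y) (oD Y') d" "isom T (oE Y) (oE Y') e" "isom T (oF Y) (oF Y') r"
     "mf Y' \<cdot> a = b \<cdot> mf Y" "mf1 Y' \<cdot> b = d \<cdot> mf1 Y" "mf2 Y' \<cdot> d = shm T a \<cdot> mf2 Y"
     "mg Y' \<cdot> b = c \<cdot> mg Y" "mg1 Y' \<cdot> c = r \<cdot> mg1 Y" "mg2 Y' \<cdot> r = shm T b \<cdot> mg2 Y"
     "mh Y' \<cdot> a = c \<cdot> mh Y" "mh1 Y' \<cdot> c = e \<cdot> mh1 Y" "mh2 Y' \<cdot> e = shm T a \<cdot> mh2 Y"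
     "mk Y' \<cdot> d = e \<cdot> mk Y" "mk1 Y' \<cdot> e = r \<cdot> mk1 Y" "mk2 Y' \<cdot> r = shm T d \<cdot> mk2 Y"
     "ml Y' \<cdot> b = e \<cdot> ml Y" "ml1 Y' \<cdot> e = shm T b \<cdot> ml1 Y"
    using assms unfolding octa_iso_def by blast
  define \<epsilon> where "\<epsilon> v = (case v of VA \<Rightarrow> a | VB \<Rightarrow> b | VC \<Rightarrow> c | VD \<Rightarrow> d | VE \<Rightarrow> e | VF \<Rightarrow> r)" for v
  note [simp] = isomD[OF o(1)] isomD[OF o(2)] isomD[OF o(3)] isomD[OF o(4)] isomD[OF o(5)] isomD[OF o(6)]
  have "isom T (vob Y v) (vob Y' v) (\<epsilon> v)" for v using o(1-6) by (cases v) (simp_all add: \<epsilon>_def)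
  moreover have "edge T Y' v w \<cdot> \<epsilon> v = sh T m (\<epsilon> w) \<cdot> edge T Y v w" if "deg v w = Some m" for v w m
    using that o(7-) by (cases v; cases w) (auto simp: \<epsilon>_def)
  ultimately show thesis using that unfolding edge_iso_def by blast
qed

lemma octa_iso_refl: assumes "octahedron T Y" shows "octa_iso T Y Y"
proof -
  interpret Y: octahedron_in T Y using assms by unfold_locales
  show ?thesis by (rule octa_iso_if_edge_iso[of _ _ "\<lambda>v. ide T (vob Y v)"]) (simp add: edge_iso_def Y.edge_hom)
qed

lemma octa_iso_sym: assumes "octahedron T Y" "octahedron T Y'" "octa_iso T Y Y'" shows "octa_iso T Y' Y"
proof -
  interpret Y: octahedron_in T Y using assms by unfold_locales
  interpret Y': octahedron_in T Y' using assms by unfold_locales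
  obtain e where e: "edge_iso Y Y' e" using edge_iso_if_octa_iso assms(3) by blast
  then have i: "isom T (vob Y v) (vob Y' v) (e v)" for v unfolding edge_iso_def by blast
  have "\<exists>f. isom T (vob Y' v) (vob Y v) f \<and> f \<cdot> e v = ide T (vob Y v) \<and> e v \<cdot> f = ide T (vob Y' v)" for v
    using isomE[OF i[of v]] by metis
  then obtain f where f: "\<And>v. isom T (vob Y' v) (vob Y v) (f v)" "\<And>v. f v \<cdot> e v = ide T (vob Y v)" "\<And>v. e v \<cdot> f v
      = ide T (vob Y' v)"
    by metis
  note [simp] = isomD[OF i] isomD[OF f(1)]
  have "edge T Y v w \<cdot> f v = sh T d (f w) \<cdot> edge T Y' v w" if d: "deg v w = Some d" for v w d
  proof -
    note [simp] = Y.edge_hom[OF d] Y'.edge_hom[OF d]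
    have ed: "edge T Y' v w \<cdot> e v = sh T d (e w) \<cdot> edge T Y v w" using e d unfolding edge_iso_def by blast
    have "sh T d (f w) \<cdot> edge T Y' v w = sh T d (f w) \<cdot> ((edge T Y' v w \<cdot> e v) \<cdot> f v)" using f(3) by simp
    also have "\<dots> = (sh T d (f w) \<cdot> sh T d (e w)) \<cdot> (edge T Y v w \<cdot> f v)" unfolding ed by simp
    also have "sh T d (f w) \<cdot> sh T d (e w) = sh T d (f w \<cdot> e w)" by simp
    finally show ?thesis unfolding f(2) by simp
  qed
  then show ?thesis using f(1) by (intro octa_iso_if_edge_iso[of _ _ f]) (simp add: edge_iso_def)
qed

lemma octa_iso_trans:
  assumes "octahedron T Y" "octahedron T Y'" "octahedron T Y''" "octa_iso T Y Y'" "octa_iso T Y' Y''"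
      shows "octa_iso T Y Y''"
proof -
  interpret Y: octahedron_in T Y using assms by unfold_locales
  interpret Y': octahedron_in T Y' using assms by unfold_locales
  interpret Y'': octahedron_in T Y'' using assms by unfold_locales
  obtain e where e: "edge_iso Y Y' e" using edge_iso_if_octa_iso assms(4) by blast
  then have i: "isom T (vob Y v) (vob Y' v) (e v)" for v unfolding edge_iso_def by blast
  obtain f where f: "edge_iso Y' Y'' f" using edge_iso_if_octa_iso assms(5) by blast
  then have j: "isom T (vob Y' v) (vob Y'' v) (f v)" for v unfolding edge_iso_def by blast
  note [simp] = isomD[OF i] isomD[OF j]
  have "edge T Y'' v w \<cdot> (f v \<cdot> e v) = sh T d (f w \<cdot> e w) \<cdot> edge T Y v w" if d: "deg v w = Some d" for v w d
  proof -
    note [simp] = Y.edge_hom[OF d] Y'.edge_hom[OF d] Y''.edge_hom[OF d]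
    have ed: "edge T Y' v w \<cdot> e v = sh T d (e w) \<cdot> edge T Y v w" "edge T Y'' v w \<cdot> f v
        = sh T d (f w) \<cdot> edge T Y' v w"
      using e f d unfolding edge_iso_def by blast+
    have "edge T Y'' v w \<cdot> (f v \<cdot> e v) = (edge T Y'' v w \<cdot> f v) \<cdot> e v" by simp
    also have "\<dots> = sh T d (f w) \<cdot> (edge T Y' v w \<cdot> e v)" unfolding ed(2) by simp
    finally show ?thesis unfolding ed(1) by simp
  qed
  then show ?thesis using isom_cmp[OF i j] by (intro octa_iso_if_edge_iso[of _ _ "\<lambda>v. f v \<cdot> e v"]) (simp add:
      edge_iso_def)
qed

lemma good_octahedronD: "good_octahedron T Y \<Longrightarrow> octahedron T Y"
  by (simp add: good_octahedron_def)

lemma equiv_good_octa_rel: "equiv {Y. good_octahedron T Y} (good_octa_rel T)"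
proof (rule equivI)
  show "good_octa_rel T \<subseteq> {Y. good_octahedron T Y} \<times> {Y. good_octahedron T Y}" by (auto simp: good_octa_rel_def)
  show "refl_on {Y. good_octahedron T Y} (good_octa_rel T)"
    using octa_iso_refl good_octahedronD by (auto simp: refl_on_def good_octa_rel_def)
  show "sym (good_octa_rel T)"
    using octa_iso_sym good_octahedronD by (auto simp: sym_on_def good_octa_rel_def)
  show "trans (good_octa_rel T)"
  proof (rule transI)
    fix Y Y' Y'' assume a: "(Y, Y') \<in> good_octa_rel T" "(Y', Y'') \<in> good_octa_rel T"
    then have "octahedron T Y" "octahedron T Y'" "octahedron T Y''" using good_octahedronD
        unfolding good_octa_rel_def by blast+
    then show "(Y, Y'') \<in> good_octa_rel T" using octa_iso_trans[of Y Y' Y''] a unfolding good_octa_rel_def by blast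
  qed
qed

lemma octa_iso_gob:
  assumes "octahedron T Y" "octahedron T Y'" "octa_iso T Y Y'"
  obtains \<epsilon> where "\<And>p. isom T (gob T Y p) (gob T Y' p) (\<epsilon> p)" "\<And>p. \<epsilon> (up p) = shm T (\<epsilon> p)"
    "\<And>p q. pre p q \<Longrightarrow> gmor T Y' p q \<cdot> \<epsilon> p = \<epsilon> q \<cdot> gmor T Y p q"
proof -
  interpret Y: octahedron_in T Y using assms by unfold_locales
  interpret Y': octahedron_in T Y' using assms by unfold_locales
  obtain e where e: "edge_iso Y Y' e" using edge_iso_if_octa_iso assms(3) by blast
  then have i: "isom T (vob Y v) (vob Y' v) (e v)" for v unfolding edge_iso_def by blast
  note [simp] = isomD[OF i]
  show thesis
  proof (rule that[of "\<lambda>p. sh T (snd p) (e (fst p))"])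
    show "isom T (gob T Y p) (gob T Y' p) (sh T (snd p) (e (fst p)))" for p unfolding gob_def
        by (rule isom_sh[OF i])
    show "sh T (snd (up p)) (e (fst (up p))) = shm T (sh T (snd p) (e (fst p)))" for p by (simp add: up_def sh_succ)
    fix p q assume pq: "pre p q"
    then have d: "deg (fst p) (fst q) = Some (snd q - snd p)" by (simp add: pre_def)
    note [simp] = Y.edge_hom[OF d] Y'.edge_hom[OF d]
    have "edge T Y' (fst p) (fst q) \<cdot> e (fst p) = sh T (snd q - snd p) (e (fst q)) \<cdot> edge T Y (fst p) (fst q)"
      using e d unfolding edge_iso_def by blast
    then have "sh T (snd p) (edge T Y' (fst p) (fst q) \<cdot> e (fst p))
        = sh T (snd p) (sh T (snd q - snd p) (e (fst q)) \<cdot> edge T Y (fst p) (fst q))"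
      by simp
    moreover have "sh T (snd p) (sh T (snd q - snd p) (e (fst q))) = sh T (snd q) (e (fst q))"
      using sh_add[of "e (fst q)" "snd p" "snd q - snd p"] by simp
    ultimately show "gmor T Y' p q \<cdot> sh T (snd p) (e (fst p)) = sh T (snd q) (e (fst q)) \<cdot> gmor T Y p q"
      using pq by (simp add: gmor_def)
  qed
qed

end

section \<open>Exact functors and octahedra\<close>

locale ex_functor = graded_functor S T F for S :: "('o, 'a, 'k :: field) tri_cat" and T :: "('p, 'b, 'k) tri_cat"
    and F +
  assumes dt_preserves: "S.dt U V W u v w \<Longrightarrow> preserves U V W u v w"

lemma ex_functor_iff:
  assumes "triangulated_category S" "triangulated_category T"
  shows "exact_functor S T F \<longleftrightarrow> ex_functor S T F"
proof -
  interpret S: triangulated_category S by fact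
  interpret T: triangulated_category T by fact
  show ?thesis
  proof
    assume e: "exact_functor S T F"
    interpret F: graded_functor S T F
      by unfold_locales (use e in \<open>auto simp: exact_functor_def\<close>)
    show "ex_functor S T F" by unfold_locales (use e in \<open>auto simp: exact_functor_def F.preserves_def\<close>)
  next
    assume "ex_functor S T F"
    then interpret F: ex_functor S T F .
    show "exact_functor S T F" unfolding exact_functor_def
      using F.linear F.fal_isom F.fal_nat F.dt_preserves unfolding F.preserves_def by auto
  qed
qed

context ex_functor
begin

lemma map_octa_octahedron:
  assumes "octahedron S X" shows "octahedron T (map_octa T F X)"
proof -
  interpret X: octahedron_in S X using assms by unfold_locales
  note e = X.edge_eqs
  note t = dt_preserves[OF X.dt_f] dt_preserves[OF X.dt_h] dt_preserves[OF X.dt_g] dt_preserves[OF X.dt_k]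
  have "ml X = mk X \<cdot>\<^bsub>S\<^esub> mf1 X" "ml1 X = shm S (mf X) \<cdot>\<^bsub>S\<^esub> mh2 X" using e by auto
  then have "fmor F (ml X) = fmor F (mk X) \<cdot>\<^bsub>T\<^esub> fmor F (mf1 X)"
    "fal F (oB X) \<cdot>\<^bsub>T\<^esub> fmor F (ml1 X) = shm T (fmor F (mf X)) \<cdot>\<^bsub>T\<^esub> (fal F (oA X) \<cdot>\<^bsub>T\<^esub> fmor F (mh2 X))"
    by (simp_all add: fal_shm'[where U="oA X"])
  moreover have "fmor F (mh X) = fmor F (mg X) \<cdot>\<^bsub>T\<^esub> fmor F (mf X)"
    "fal F (oD X) \<cdot>\<^bsub>T\<^esub> fmor F (mk2 X) = shm T (fmor F (mf1 X)) \<cdot>\<^bsub>T\<^esub> (fal F (oB X) \<cdot>\<^bsub>T\<^esub> fmor F (mg2 X))"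
    "fal F (oA X) \<cdot>\<^bsub>T\<^esub> fmor F (mf2 X) = (fal F (oA X) \<cdot>\<^bsub>T\<^esub> fmor F (mh2 X)) \<cdot>\<^bsub>T\<^esub> fmor F (mk X)"
    "fmor F (mg1 X) = fmor F (mk1 X) \<cdot>\<^bsub>T\<^esub> fmor F (mh1 X)"
    "fmor F (ml X) = fmor F (mh1 X) \<cdot>\<^bsub>T\<^esub> fmor F (mg X)"
    "fal F (oB X) \<cdot>\<^bsub>T\<^esub> fmor F (ml1 X) = (fal F (oB X) \<cdot>\<^bsub>T\<^esub> fmor F (mg2 X)) \<cdot>\<^bsub>T\<^esub> fmor F (mk1 X)"
    unfolding e(1-5,8) by (simp_all add: fal_shm'[where U="oB X"])
  moreover have "fmor F (ml X) \<in> hom T (fob F (oB X)) (fob F (oE X))"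
      "fal F (oB X) \<cdot>\<^bsub>T\<^esub> fmor F (ml1 X) \<in> hom T (fob F (oE X)) (sho T (fob F (oB X)))"
    by simp_all
  ultimately show ?thesis using t unfolding octahedron_def preserves_def by (simp add: map_octa_def)
qed

lemma map_octa_good:
  assumes "good_octahedron S X" shows "good_octahedron T (map_octa T F X)"
proof -
  interpret X: octahedron_in S X using assms by unfold_locales (simp add: good_octahedron_def)
  obtain Q i j p q where b1: "biproduct S (oF X) (sho S (oA X)) Q i j p q" and
    d1: "S.dt (oB X) (oE X) Q (ml X) (i \<cdot>\<^bsub>S\<^esub> mk1 X \<oplus>\<^bsub>S\<^esub> j \<cdot>\<^bsub>S\<^esub> neg S (mh2 X)) (mg2 X \<cdot>\<^bsub>S\<^esub> p
        \<oplus>\<^bsub>S\<^esub> shm S (mf X) \<cdot>\<^bsub>S\<^esub> q)"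
    using assms unfolding good_octahedron_def by blast
  obtain Q' i' j' p' q' where b2: "biproduct S (oC X) (oD X) Q' i' j' p' q'" and
    d2: "S.dt (oB X) Q' (oE X) (i' \<cdot>\<^bsub>S\<^esub> mg X \<oplus>\<^bsub>S\<^esub> j' \<cdot>\<^bsub>S\<^esub> mf1 X) (mh1 X \<cdot>\<^bsub>S\<^esub> p' \<oplus>\<^bsub>S\<^esub> neg S (mk X) \<cdot>\<^bsub>S\<^esub> q') (ml1 X)"
    using assms unfolding good_octahedron_def by blast
  have fi: "isom T (fob F (sho S (oA X))) (sho T (fob F (oA X))) (fal F (oA X))" by (rule fal_isom) simp
  obtain c where c: "arr T c" "dm T c = sho T (fob F (oA X))" "cd T c = fob F (sho S (oA X))" "c \<cdot>\<^bsub>T\<^esub> fal F (oA X)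
      = ide T (fob F (sho S (oA X)))"
     "fal F (oA X) \<cdot>\<^bsub>T\<^esub> c = ide T (sho T (fob F (oA X)))"
     "\<And>x. arr T x \<Longrightarrow> cd T x = fob F (sho S (oA X)) \<Longrightarrow> c \<cdot>\<^bsub>T\<^esub> (fal F (oA X) \<cdot>\<^bsub>T\<^esub> x) = x"
    by (rule T.isomE[OF fi], rule that)
  note fb = fmor_biproduct[OF b1]
  note [simp] = S.biproductD[OF b1] S.biproductD[OF b2] T.biproductD[OF fb] c
  \<comment> \<open>The image of the biproduct has \<open>fob F (sho S (oA X))\<close> as second
    summand, whereas goodness in \<open>T\<close> asks for \<open>sho T (fob F (oA X))\<close>; the
    comparison isomorphism replaces one by the other.\<close>
  have bf: "biproduct T (fob F (oF X)) (sho T (fob F (oA X))) (fob F Q) (fmor F i) (fmor F j \<cdot>\<^bsub>T\<^esub> c) (fmor F p) (fal F (oA X) \<cdot>\<^bsub>T\<^esub> fmor F q)"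
    by (rule T.biproductI) simp_all
  have t1: "T.dt (fob F (oB X)) (fob F (oE X)) (fob F Q) (fmor F (ml X)) (fmor F i \<cdot>\<^bsub>T\<^esub> fmor F (mk1 X)
      \<oplus>\<^bsub>T\<^esub> (fmor F j \<cdot>\<^bsub>T\<^esub> c) \<cdot>\<^bsub>T\<^esub> neg T (fal F (oA X) \<cdot>\<^bsub>T\<^esub> fmor F (mh2 X)))
     ((fal F (oB X) \<cdot>\<^bsub>T\<^esub> fmor F (mg2 X)) \<cdot>\<^bsub>T\<^esub> fmor F p
         \<oplus>\<^bsub>T\<^esub> shm T (fmor F (mf X)) \<cdot>\<^bsub>T\<^esub> (fal F (oA X) \<cdot>\<^bsub>T\<^esub> fmor F q))"
    using dt_preserves[OF d1] unfolding preserves_def by (simp add: fal_shm'[where U="oA X"])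
  have t2: "T.dt (fob F (oB X)) (fob F Q') (fob F (oE X)) (fmor F i' \<cdot>\<^bsub>T\<^esub> fmor F (mg X)
      \<oplus>\<^bsub>T\<^esub> fmor F j' \<cdot>\<^bsub>T\<^esub> fmor F (mf1 X))
     (fmor F (mh1 X) \<cdot>\<^bsub>T\<^esub> fmor F p' \<oplus>\<^bsub>T\<^esub> neg T (fmor F (mk X)) \<cdot>\<^bsub>T\<^esub> fmor F q') (fal F (oB X) \<cdot>\<^bsub>T\<^esub> fmor F (ml1 X))"
    using dt_preserves[OF d2] unfolding preserves_def by simp
  show ?thesis unfolding good_octahedron_def
    using map_octa_octahedron[OF X.octahedron] bf t1 fmor_biproduct[OF b2] t2
        by (simp only: map_octa_def octa.simps) blast
qed

end

text \<open>An identification of the diagram of \<open>Y\<close> with the image under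
  \<open>F\<close> of the diagram of \<open>X\<close>, compatible with the shift. Exactness of
  \<open>F\<close> is not assumed here; it is deduced from the goodness of \<open>Y\<close>.\<close>

locale comparison = graded_functor S T F + octahedron_pair S X T Y
  for S :: "('o, 'a, 'k :: field) tri_cat" and T :: "('p, 'b, 'k) tri_cat" and F and X and Y +
  fixes e :: "vertex \<times> int \<Rightarrow> 'b"
  assumes e_isom: "isom T (G p) (fob F (S.P p)) (e p)"
    and e_nat: "pre p q \<Longrightarrow> fmor F (S.b p q) \<cdot>\<^bsub>T\<^esub> e p = e q \<cdot>\<^bsub>T\<^esub> g p q"
    and e_shift: "fal F (S.P p) \<cdot>\<^bsub>T\<^esub> e (up p) = shm T (e p)"
begin

lemma e_hom [simp]: "arr T (e p)" "dm T (e p) = G p" "cd T (e p) = fob F (S.P p)"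
  using T.isomD[OF e_isom] by simp_all

text \<open>An additive functor respects zero objects and direct sums, and at \<open>S.P p\<close>
  the Yoneda argument applies. So \<open>F\<close> itself is the Kan extension of \<open>Y\<close>,
  which makes it unique.\<close>

lemma kan_fob: "S.decomposable U \<Longrightarrow> kan U (fob F U) (\<lambda>p x. fmor F x \<cdot>\<^bsub>T\<^esub> e p)"
proof -
  have c: "cocone U (fob F U) (\<lambda>p x. fmor F x \<cdot>\<^bsub>T\<^esub> e p)" if "U \<in> ob S" for U
    unfolding cocone_def using that e_nat by simp
  show "S.decomposable U \<Longrightarrow> ?thesis"
  proof (induct rule: S.decomposable_induct)
    case (zero U) then show ?case using kan_zero fob_zero c S.zero_objectD(1) by blast
  next
    case (gob p)
    show ?case by (rule kan_gob[OF c]) (use e_isom in simp_all)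
  next
    case (sum U V W i j r s)
    note [simp] = S.biproductD[OF sum(3)]
    show ?case by (rule kan_sum[OF c sum(1,2,3) fmor_biproduct[OF sum(3)]]) simp_all
  qed
qed

lemma gob_simps [simp]: "gob R Z (v, 0) = vob Z v" "gob R Z (v, 1) = sho R (vob Z v)"
  by (simp_all add: gob_def)

lemma e0_hom: "arr T (e (v, 0))" "dm T (e (v, 0)) = vob Y v" "cd T (e (v, 0)) = fob F (vob X v)"
  by simp_all

lemma edge_e:
  assumes "deg v w = Some d"
  shows "d = 0 \<Longrightarrow> fmor F (edge S X v w) \<cdot>\<^bsub>T\<^esub> e (v, 0) = e (w, 0) \<cdot>\<^bsub>T\<^esub> edge T Y v w"
    "fmor F (edge S X v w) \<cdot>\<^bsub>T\<^esub> e (v, 0) = e (w, d) \<cdot>\<^bsub>T\<^esub> edge T Y v w"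
    "d = 1 \<Longrightarrow> fal F (vob X w) \<cdot>\<^bsub>T\<^esub> (fmor F (edge S X v w) \<cdot>\<^bsub>T\<^esub> e (v, 0)) = shm T (e (w, 0)) \<cdot>\<^bsub>T\<^esub> edge T Y v w"
proof -
  have p: "pre (v, 0) (w, d)" using assms by (simp add: pre_def)
  show 1: "fmor F (edge S X v w) \<cdot>\<^bsub>T\<^esub> e (v, 0) = e (w, d) \<cdot>\<^bsub>T\<^esub> edge T Y v w" using e_nat[OF p] p
      by (simp add: gmor_def)
  then show "d = 0 \<Longrightarrow> fmor F (edge S X v w) \<cdot>\<^bsub>T\<^esub> e (v, 0) = e (w, 0) \<cdot>\<^bsub>T\<^esub> edge T Y v w" by simp
  assume d: "d = 1"
  note [simp] = S.edge_hom[OF assms] T.edge_hom[OF assms]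
  have s: "fal F (vob X w) \<cdot>\<^bsub>T\<^esub> e (w, 1) = shm T (e (w, 0))" using e_shift[of "(w, 0)"] by (simp add: gob_def)
  have "fal F (vob X w) \<cdot>\<^bsub>T\<^esub> (e (w, 1) \<cdot>\<^bsub>T\<^esub> edge T Y v w) = shm T (e (w, 0)) \<cdot>\<^bsub>T\<^esub> edge T Y v w"
    by (rule T.cmp_eq[OF s]) (simp_all add: d)
  then show "fal F (vob X w) \<cdot>\<^bsub>T\<^esub> (fmor F (edge S X v w) \<cdot>\<^bsub>T\<^esub> e (v, 0)) = shm T (e (w, 0)) \<cdot>\<^bsub>T\<^esub> edge T Y v w"
      using 1 d by simp
qed

lemma e0_isom: "isom T (vob Y v) (fob F (vob X v)) (e (v, 0))"
  using e_isom[of "(v, 0)"] by (simp add: gob_def)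

lemma deg_cases: "deg v w = Some d \<Longrightarrow> d = 0 \<or> d = 1"
  by (cases v; cases w) auto

lemma octa_iso_map: "octa_iso T Y (map_octa T F X)"
proof (rule T.octa_iso_if_edge_iso[of _ _ "\<lambda>v. e (v, 0)"])
  have "edge T (map_octa T F X) v w \<cdot>\<^bsub>T\<^esub> e (v, 0) = sh T d (e (w, 0)) \<cdot>\<^bsub>T\<^esub> edge T Y v w" if "deg v w = Some d"
      for v w d
    using deg_cases[OF that] edge_e[OF that] S.edge_hom[OF that] by (auto simp: map_octa_edge[OF S.octahedron that])
  then show "T.edge_iso Y (map_octa T F X) (\<lambda>v. e (v, 0))" unfolding T.edge_iso_def using e0_isom by simp
qed

text \<open>The isomorphisms \<open>e (v, 0)\<close> at the three vertices carry the face of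
  \<open>Y\<close> to the image of the face of \<open>X\<close>.\<close>

lemma preserves_face:
  assumes "deg v w = Some 0" "deg w z = Some 0" "deg z v = Some 1"
    and "S.dt (vob X v) (vob X w) (vob X z) (edge S X v w) (edge S X w z) (edge S X z v)"
    and t: "T.dt (vob Y v) (vob Y w) (vob Y z) (edge T Y v w) (edge T Y w z) (edge T Y z v)"
  shows "preserves (vob X v) (vob X w) (vob X z) (edge S X v w) (edge S X w z) (edge S X z v)"
proof -
  note [simp] = S.edge_hom[OF assms(1)] S.edge_hom[OF assms(2)] S.edge_hom[OF assms(3)]
  show ?thesis unfolding preserves_def
    by (intro conjI assms(4) T.TR1_iso[OF t _ e0_isom e0_isom e0_isom])
      (simp_all add: T.triangle_iff edge_e(1)[OF assms(1)] edge_e(1)[OF assms(2)] edge_e(3)[OF assms(3)])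
qed

text \<open>The preserved triangles form a \<open>triangle_class\<close>. The faces are carried over
  by \<open>e\<close>; the two additional triangles are distinguished for \<open>Y\<close> by
  goodness and are carried over by \<open>e\<close> and the uniqueness of biproducts.\<close>

lemma preserves_decomposable:
  assumes good: "good_octahedron T Y"
    and UV: "S.decomposable U" "S.decomposable V" "S.dt U V W u v w"
  shows "preserves U V W u v w"
proof -
  note eqs = edge_e(1)[of VA VB 0] edge_e(1)[of VB VC 0] edge_e(1)[of VB VD 0] edge_e(1)[of VC VE 0] edge_e(1)[of VD VE 0]
    edge_e(1)[of VE VF 0] edge_e(1)[of VB VE 0] edge_e(2)[of VE VA 1] edge_e(3)[of VE VB 1] edge_e(3)[of VF VB 1]
  note eqs = eqs[simplified]
  have eq': "\<And>x. arr T x \<Longrightarrow> cd T x = vob Y v \<Longrightarrow> fmor F (edge S X v w) \<cdot>\<^bsub>T\<^esub> (e (v, 0) \<cdot>\<^bsub>T\<^esub> x) = e (w,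
      0) \<cdot>\<^bsub>T\<^esub> (edge T Y v w \<cdot>\<^bsub>T\<^esub> x)"
    if d: "deg v w = Some 0" for v w
    using T.cmp_eq[OF edge_e(1)[OF d refl]] S.edge_hom[OF d] T.edge_hom[OF d] by simp
  have m1: "\<exists>Q i j p q. biproduct S (oC X) (oD X) Q i j p q \<and>
       preserves (oB X) Q (oE X) (i \<cdot>\<^bsub>S\<^esub> mg X \<oplus>\<^bsub>S\<^esub> j \<cdot>\<^bsub>S\<^esub> mf1 X) (mh1 X \<cdot>\<^bsub>S\<^esub> p
           \<oplus>\<^bsub>S\<^esub> (- 1) \<odot>\<^bsub>S\<^esub> (mk X \<cdot>\<^bsub>S\<^esub> q)) (ml1 X)"
  proof -
    obtain Q i j p q where b: "biproduct S (oC X) (oD X) Q i j p q" and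
      d: "S.dt (oB X) Q (oE X) (i \<cdot>\<^bsub>S\<^esub> mg X \<oplus>\<^bsub>S\<^esub> j \<cdot>\<^bsub>S\<^esub> mf1 X) (mh1 X \<cdot>\<^bsub>S\<^esub> p \<oplus>\<^bsub>S\<^esub> (- 1) \<odot>\<^bsub>S\<^esub> (mk X \<cdot>\<^bsub>S\<^esub> q)) (ml1 X)"
      using S.mesh1 by blast
    obtain Q' i' j' p' q' where b': "biproduct T (oC Y) (oD Y) Q' i' j' p' q'" and
      d': "T.dt (oB Y) Q' (oE Y) (i' \<cdot>\<^bsub>T\<^esub> mg Y \<oplus>\<^bsub>T\<^esub> j' \<cdot>\<^bsub>T\<^esub> mf1 Y) (mh1 Y \<cdot>\<^bsub>T\<^esub> p'
          \<oplus>\<^bsub>T\<^esub> neg T (mk Y) \<cdot>\<^bsub>T\<^esub> q') (ml1 Y)"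
      using good unfolding good_octahedron_def by blast
    note bF = fmor_biproduct[OF b]
    obtain r s where bs: "biproduct T (oC Y) (oD Y) (fob F Q) (fmor F i \<cdot>\<^bsub>T\<^esub> e (VC, 0)) (fmor F j \<cdot>\<^bsub>T\<^esub> e (VD,
        0)) (r \<cdot>\<^bsub>T\<^esub> fmor F p) (s \<cdot>\<^bsub>T\<^esub> fmor F q)"
      using T.biproduct_isom_summands[OF bF e0_isom[of VC, simplified] e0_isom[of VD, simplified]] by metis
    note [simp] = S.biproductD[OF b] T.biproductD[OF b'] T.biproductD[OF bF] e0_hom[of VB, simplified] e0_hom[of VC,
        simplified] e0_hom[of VD, simplified] e0_hom[of VE, simplified]
    have "T.dt (fob F (oB X)) (fob F Q) (fob F (oE X)) (fmor F (i \<cdot>\<^bsub>S\<^esub> mg X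
        \<oplus>\<^bsub>S\<^esub> j \<cdot>\<^bsub>S\<^esub> mf1 X)) (fmor F (mh1 X \<cdot>\<^bsub>S\<^esub> p \<oplus>\<^bsub>S\<^esub> (- 1) \<odot>\<^bsub>S\<^esub> (mk X \<cdot>\<^bsub>S\<^esub> q)))
       (fal F (oB X) \<cdot>\<^bsub>T\<^esub> fmor F (ml1 X))"
      by (rule T.TR1_iso[OF d' _ e0_isom[of VB, simplified] T.biproduct_unique[OF b' bs] e0_isom[of VE,
          simplified]])
        (simp_all add: T.triangle_iff eqs eq'[of VC VE, simplified] eq'[of VD VE, simplified])
    then show ?thesis using b d unfolding preserves_def by blast
  qed
  have m2: "\<exists>Q i j p q. biproduct S (oF X) (sho S (oA X)) Q i j p q \<and>
       preserves (oB X) (oE X) Q (ml X) (i \<cdot>\<^bsub>S\<^esub> mk1 X \<oplus>\<^bsub>S\<^esub> (- 1) \<odot>\<^bsub>S\<^esub> (j \<cdot>\<^bsub>S\<^esub> mh2 X)) (mg2 X \<cdot>\<^bsub>S\<^esub> p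
           \<oplus>\<^bsub>S\<^esub> shm S (mf X) \<cdot>\<^bsub>S\<^esub> q)"
  proof -
    obtain Q i j p q where b: "biproduct S (oF X) (sho S (oA X)) Q i j p q" and
      d: "S.dt (oB X) (oE X) Q (ml X) (i \<cdot>\<^bsub>S\<^esub> mk1 X \<oplus>\<^bsub>S\<^esub> (- 1) \<odot>\<^bsub>S\<^esub> (j \<cdot>\<^bsub>S\<^esub> mh2 X)) (mg2 X \<cdot>\<^bsub>S\<^esub> p
          \<oplus>\<^bsub>S\<^esub> shm S (mf X) \<cdot>\<^bsub>S\<^esub> q)"
      using S.mesh2 by blast
    obtain Q' i' j' p' q' where b': "biproduct T (oF Y) (sho T (oA Y)) Q' i' j' p' q'" and
      d': "T.dt (oB Y) (oE Y) Q' (ml Y) (i' \<cdot>\<^bsub>T\<^esub> mk1 Y \<oplus>\<^bsub>T\<^esub> j' \<cdot>\<^bsub>T\<^esub> neg T (mh2 Y)) (mg2 Y \<cdot>\<^bsub>T\<^esub> p'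
          \<oplus>\<^bsub>T\<^esub> shm T (mf Y) \<cdot>\<^bsub>T\<^esub> q')"
      using good unfolding good_octahedron_def by blast
    note bF = fmor_biproduct[OF b]
    have i1: "isom T (sho T (oA Y)) (fob F (sho S (oA X))) (e (VA, 1))" using e_isom[of "(VA, 1)"]
        by (simp add: gob_def)
    obtain r s where bs: "biproduct T (oF Y) (sho T (oA Y)) (fob F Q) (fmor F i \<cdot>\<^bsub>T\<^esub> e (VF,
        0)) (fmor F j \<cdot>\<^bsub>T\<^esub> e (VA, 1)) (r \<cdot>\<^bsub>T\<^esub> fmor F p) (s \<cdot>\<^bsub>T\<^esub> fmor F q)"
      using T.biproduct_isom_summands[OF bF e0_isom[of VF, simplified] i1] by metis
    note [simp] = S.biproductD[OF b] T.biproductD[OF b'] T.biproductD[OF bF] e0_hom[of VA, simplified] e0_hom[of VB,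
        simplified] e0_hom[of VE, simplified] e0_hom[of VF, simplified]
       T.isomD[OF i1]
    have fs: "fal F (oA X) \<cdot>\<^bsub>T\<^esub> e (VA, 1) = shm T (e (VA, 0))" using e_shift[of "(VA, 0)"] by (simp add: gob_def)
    have 1: "fal F (oB X) \<cdot>\<^bsub>T\<^esub> (fmor F (mg2 X) \<cdot>\<^bsub>T\<^esub> (e (VF, 0) \<cdot>\<^bsub>T\<^esub> p')) = shm T (e (VB, 0)) \<cdot>\<^bsub>T\<^esub> (mg2 Y \<cdot>\<^bsub>T\<^esub> p')"
      using T.cmp_eq[OF eqs(10), of p'] by simp
    have "shm T (fmor F (mf X)) \<cdot>\<^bsub>T\<^esub> (fal F (oA X) \<cdot>\<^bsub>T\<^esub> e (VA, 1)) = shm T (e (VB, 0)) \<cdot>\<^bsub>T\<^esub> shm T (mf Y)"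
      unfolding fs using arg_cong[OF eqs(1), of "shm T"] by simp
    from T.cmp_eq[OF this, of q'] have 2: "fal F (oB X) \<cdot>\<^bsub>T\<^esub> (fmor F (shm S (mf X)) \<cdot>\<^bsub>T\<^esub> (e (VA, 1) \<cdot>\<^bsub>T\<^esub> q'))
        = shm T (e (VB, 0)) \<cdot>\<^bsub>T\<^esub> (shm T (mf Y) \<cdot>\<^bsub>T\<^esub> q')"
      by (simp add: fal_shm'[where U="oA X"])
    have "T.dt (fob F (oB X)) (fob F (oE X)) (fob F Q) (fmor F (ml X)) (fmor F (i \<cdot>\<^bsub>S\<^esub> mk1 X
        \<oplus>\<^bsub>S\<^esub> (- 1) \<odot>\<^bsub>S\<^esub> (j \<cdot>\<^bsub>S\<^esub> mh2 X)))
       (fal F (oB X) \<cdot>\<^bsub>T\<^esub> fmor F (mg2 X \<cdot>\<^bsub>S\<^esub> p \<oplus>\<^bsub>S\<^esub> shm S (mf X) \<cdot>\<^bsub>S\<^esub> q))"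
      by (rule T.TR1_iso[OF d' _ e0_isom[of VB, simplified] e0_isom[of VE, simplified]
          T.biproduct_unique[OF b' bs]])
        (simp_all add: T.triangle_iff eqs 1 2)
    then show ?thesis using b d unfolding preserves_def by blast
  qed
  have f: "preserves (oA X) (oB X) (oD X) (mf X) (mf1 X) (mf2 X)"
      "preserves (oA X) (oC X) (oE X) (mh X) (mh1 X) (mh2 X)"
     "preserves (oB X) (oC X) (oF X) (mg X) (mg1 X) (mg2 X)" "preserves (oD X) (oE X) (oF X) (mk X) (mk1 X) (mk2 X)"
    using preserves_face[of VA VB VD] preserves_face[of VA VC VE] preserves_face[of VB VC VF]
        preserves_face[of VD VE VF]
      S.dt_f S.dt_h S.dt_g S.dt_k T.dt_f T.dt_h T.dt_g T.dt_k by simp_all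
  interpret triangle_class S X preserves
  proof (unfold_locales, goal_cases)
    case 1 then show ?case unfolding preserves_def by blast
  next
    case 2 then show ?case by (rule preserves_isom)
  next
    case 3 then show ?case by (rule preserves_rot)
  next
    case 4 then show ?case by (rule preserves_unrot)
  next
    case 5 then show ?case by (rule preserves_sum)
  next
    case (6 Z) then show ?case using preserves_ide[OF 6 S.zero_objectD(1)[OF 6]] by (simp add: S.zero_object_iff)
  next
    case (7 Z p) show ?case by (rule preserves_ide[OF 7]) simp
  qed (use f m1 m2 in blast)+
  show ?thesis using W_decomposable[OF UV] .
qed

end


section \<open>The functor attached to an octahedron\<close>

context octahedron_pair
begin

text \<open>Universal cocones are chosen at all objects at once. The rest is forced: linearity,
  functoriality and naturality are equations between arrows out of universal objects and may be
  tested on the cocones.\<close>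

lemma ex_comparison:
  assumes full: "\<And>U. U \<in> ob S \<Longrightarrow> S.decomposable U"
  shows "\<exists>F e. comparison S T F X Y e"
proof -
  have "\<forall>U. \<exists>Z \<Phi>. U \<in> ob S \<longrightarrow> kan U Z \<Phi>" using kan_ex full by blast
  then obtain Z K where K: "\<And>U. U \<in> ob S \<Longrightarrow> kan U (Z U) (K U)" by metis
  note c = kanD(1)[OF K]
  note [simp] = cocone_D(2-7)[OF c]
  \<comment> \<open>The arrow classified by the universal cocone at \<open>cd S u\<close>, composed
    with \<open>u\<close>. It is unique by \<open>kanD(3)\<close>, so the choice operator introduces
    no ambiguity.\<close>
  define Fm where "Fm u = (SOME z. arr T z \<and> dm T z = Z (dm S u) \<and> cd T z = Z (cd S u) \<and>
     (\<forall>p x. arr S x \<and> dm S x = S.P p \<and> cd S x = dm S u \<longrightarrow> K (cd S u) p (u \<cdot>\<^bsub>S\<^esub> x) = z \<cdot>\<^bsub>T\<^esub> K (dm S u) p x))" for u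
  have "arr T (Fm u) \<and> dm T (Fm u) = Z (dm S u) \<and> cd T (Fm u) = Z (cd S u) \<and>
     (\<forall>p x. arr S x \<and> dm S x = S.P p \<and> cd S x = dm S u \<longrightarrow> K (cd S u) p (u \<cdot>\<^bsub>S\<^esub> x) = Fm u \<cdot>\<^bsub>T\<^esub> K (dm S u) p x)"
    if u: "arr S u" for u
    unfolding Fm_def by (rule someI_ex, rule kanD(2)[OF K cocone_cmp[OF c]]) (use u in simp_all)
  then have Fm [simp]: "arr S u \<Longrightarrow> arr T (Fm u)" "arr S u \<Longrightarrow> dm T (Fm u) = Z (dm S u)" "arr S u
      \<Longrightarrow> cd T (Fm u) = Z (cd S u)"
    and FmK: "\<And>p x. arr S u \<Longrightarrow> arr S x \<Longrightarrow> dm S x = S.P p \<Longrightarrow> cd S x = dm S u \<Longrightarrow> Fm u \<cdot>\<^bsub>T\<^esub> K (dm S u) p x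
        = K (cd S u) p (u \<cdot>\<^bsub>S\<^esub> x)" for u
    by metis+
  have FmK' [simp]: "Fm u \<cdot>\<^bsub>T\<^esub> K V p x = K (cd S u) p (u \<cdot>\<^bsub>S\<^esub> x)" if "arr S u" "dm S u = V" "arr S x"
      "dm S x = S.P p" "cd S x = V" for u V p x
    using FmK that by blast
  \<comment> \<open>The objects \<open>Z (sho S U)\<close> and \<open>sho T (Z U)\<close> both carry
    a universal cocone at \<open>sho S U\<close>, the second one by \<open>kan_shift\<close>; this
    is the isomorphism between them.\<close>
  define al where "al U = (SOME z. isom T (Z (sho S U)) (sho T (Z U)) z \<and>
     (\<forall>p x. arr S x \<and> dm S x = S.P p \<and> cd S x = sho S U \<longrightarrow> shm T (K U (down p) (sh S (- 1) x))
         = z \<cdot>\<^bsub>T\<^esub> K (sho S U) p x))" for U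
  have "isom T (Z (sho S U)) (sho T (Z U)) (al U) \<and>
     (\<forall>p x. arr S x \<and> dm S x = S.P p \<and> cd S x = sho S U \<longrightarrow> shm T (K U (down p) (sh S (- 1) x))
         = al U \<cdot>\<^bsub>T\<^esub> K (sho S U) p x)"
    if U: "U \<in> ob S" for U
  proof -
    obtain z where "isom T (Z (sho S U)) (sho T (Z U)) z"
      "\<And>p x. arr S x \<Longrightarrow> dm S x = S.P p \<Longrightarrow> cd S x = sho S U \<Longrightarrow> shm T (K U (down p) (sh S (- 1) x))
          = z \<cdot>\<^bsub>T\<^esub> K (sho S U) p x"
      using kan_isom[OF K[OF S.sho_ob[OF U]] kan_shift[OF K[OF U]]] by metis
    then show ?thesis unfolding al_def by (intro someI_ex[where P="\<lambda>z. isom T (Z (sho S U)) (sho T (Z U)) z \<and>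
     (\<forall>p x. arr S x \<and> dm S x = S.P p \<and> cd S x = sho S U \<longrightarrow> shm T (K U (down p) (sh S (- 1) x))
         = z \<cdot>\<^bsub>T\<^esub> K (sho S U) p x)"] exI[of _ z]) blast
  qed
  then have al: "U \<in> ob S \<Longrightarrow> isom T (Z (sho S U)) (sho T (Z U)) (al U)"
    and alK: "\<And>p x. U \<in> ob S \<Longrightarrow> arr S x \<Longrightarrow> dm S x = S.P p \<Longrightarrow> cd S x = sho S U \<Longrightarrow> al U \<cdot>\<^bsub>T\<^esub> K (sho S U) p x
        = shm T (K U (down p) (sh S (- 1) x))" for U
    by metis+
  note [simp] = alK T.isomD(1-3)[OF al]
  let ?F = "\<lparr>fob = Z, fmor = Fm, fal = al\<rparr>"
  interpret F: graded_functor S T ?F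
  proof
    show "linear_functor S T (fob ?F) (fmor ?F)" unfolding linear_functor_def
    proof (intro conjI ballI allI impI)
      fix U assume U: "U \<in> ob S"
      show "fob ?F U \<in> ob T" using U by simp
      have "Fm (ide S U) = ide T (Z U)" by (rule kanD(3)[OF K[OF U]]) (use U in simp_all)
      then show "fmor ?F (ide S U) = ide T (fob ?F U)" by simp
    next
      fix U V u assume "u \<in> hom S U V"
      then show "fmor ?F u \<in> hom T (fob ?F U) (fob ?F V)" by auto
    next
      fix U V W u v assume "u \<in> hom S U V" "v \<in> hom S V W"
      then have [simp]: "arr S u" "dm S u = U" "cd S u = V" "arr S v" "dm S v = V" "cd S v = W" by simp_all
      have U: "U \<in> ob S" using S.dm_ob[of u] by simp
      have [simp]: "V \<in> ob S" "W \<in> ob S" using S.cd_ob[of u] S.cd_ob[of v] by simp_all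
      have "Fm (v \<cdot>\<^bsub>S\<^esub> u) = Fm v \<cdot>\<^bsub>T\<^esub> Fm u" by (rule kanD(3)[OF K[OF U]]) (use U in simp_all)
      then show "fmor ?F (v \<cdot>\<^bsub>S\<^esub> u) = fmor ?F v \<cdot>\<^bsub>T\<^esub> fmor ?F u" by simp
    next
      fix U V u v assume "u \<in> hom S U V" "v \<in> hom S U V"
      then have [simp]: "arr S u" "dm S u = U" "cd S u = V" "arr S v" "dm S v = U" "cd S v = V" by simp_all
      have U: "U \<in> ob S" using S.dm_ob[of u] by simp
      have [simp]: "V \<in> ob S" using S.cd_ob[of u] by simp
      have "Fm (u \<oplus>\<^bsub>S\<^esub> v) = Fm u \<oplus>\<^bsub>T\<^esub> Fm v" by (rule kanD(3)[OF K[OF U]]) (use U in simp_all)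
      then show "fmor ?F (u \<oplus>\<^bsub>S\<^esub> v) = fmor ?F u \<oplus>\<^bsub>T\<^esub> fmor ?F v" by simp
    next
      fix U V u c assume "u \<in> hom S U V"
      then have [simp]: "arr S u" "dm S u = U" "cd S u = V" by simp_all
      have U: "U \<in> ob S" using S.dm_ob[of u] by simp
      have [simp]: "V \<in> ob S" using S.cd_ob[of u] by simp
      have "Fm (c \<odot>\<^bsub>S\<^esub> u) = c \<odot>\<^bsub>T\<^esub> Fm u" by (rule kanD(3)[OF K[OF U]]) (use U in simp_all)
      then show "fmor ?F (c \<odot>\<^bsub>S\<^esub> u) = c \<odot>\<^bsub>T\<^esub> fmor ?F u" by simp
    qed
    show "U \<in> ob S \<Longrightarrow> isom T (fob ?F (sho S U)) (sho T (fob ?F U)) (fal ?F U)" for U using al by simp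
    fix u assume [simp]: "arr S u"
    have "al (cd S u) \<cdot>\<^bsub>T\<^esub> Fm (shm S u) = shm T (Fm u) \<cdot>\<^bsub>T\<^esub> al (dm S u)"
    proof (rule kanD(3)[OF K[of "sho S (dm S u)"]])
      fix p x assume x [simp]: "arr S x" "dm S x = S.P p" "cd S x = sho S (dm S u)"
      note y = unsh[OF x S.dm_ob]
      have [simp]: "shift_ob S (- 1) (S.P p) = S.P (down p)" "shift_ob S (- 1) (sho S (dm S u)) = dm S u"
        using y(2,3) by simp_all
      have "sh S (- 1) (shm S u \<cdot>\<^bsub>S\<^esub> x) = u \<cdot>\<^bsub>S\<^esub> sh S (- 1) x" using S.sh_shm[of u "- 1"] by simp
      then have "(al (cd S u) \<cdot>\<^bsub>T\<^esub> Fm (shm S u)) \<cdot>\<^bsub>T\<^esub> K (sho S (dm S u)) p x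
          = shm T (K (cd S u) (down p) (u \<cdot>\<^bsub>S\<^esub> sh S (- 1) x))" by simp
      also have "\<dots> = shm T (Fm u \<cdot>\<^bsub>T\<^esub> K (dm S u) (down p) (sh S (- 1) x))" by (subst FmK) simp_all
      finally show "(al (cd S u) \<cdot>\<^bsub>T\<^esub> Fm (shm S u)) \<cdot>\<^bsub>T\<^esub> K (sho S (dm S u)) p x
          = (shm T (Fm u) \<cdot>\<^bsub>T\<^esub> al (dm S u)) \<cdot>\<^bsub>T\<^esub> K (sho S (dm S u)) p x"
        by (simp del: FmK')
    qed simp_all
    then show "fal ?F (cd S u) \<cdot>\<^bsub>T\<^esub> fmor ?F (shm S u) = shm T (fmor ?F u) \<cdot>\<^bsub>T\<^esub> fal ?F (dm S u)" by simp
  qed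
  \<comment> \<open>The identification sends the identity of \<open>S.P p\<close> through the chosen
    universal cocone. Comparison with the explicit cocone of \<open>cocone_gob_ex\<close> shows that
    its value is invertible.\<close>
  have "comparison S T ?F X Y (\<lambda>p. K (S.P p) p (ide S (S.P p)))"
  proof
    fix p
    obtain \<Phi> where \<Phi>: "cocone (S.P p) (G p) \<Phi>" "\<Phi> p (ide S (S.P p)) = ide T (G p)" by (rule cocone_gob_ex)
    have k: "kan (S.P p) (G p) \<Phi>" by (rule kan_gob[OF \<Phi>(1)]) (simp add: \<Phi>(2))
    obtain z where z: "isom T (G p) (Z (S.P p)) z" "\<And>q x. arr S x \<Longrightarrow> dm S x = S.P q \<Longrightarrow> cd S x = S.P p
        \<Longrightarrow> K (S.P p) q x = z \<cdot>\<^bsub>T\<^esub> \<Phi> q x"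
      using kan_isom[OF k K[of "S.P p"]] by (metis S.gob_ob)
    have "K (S.P p) p (ide S (S.P p)) = z" using z(2)[of "ide S (S.P p)" p] \<Phi>(2) T.isomD[OF z(1)] by simp
    then show "isom T (G p) (fob ?F (S.P p)) (K (S.P p) p (ide S (S.P p)))" using z(1) by simp
    have "sh S (- 1) (ide S (S.P (up p))) = ide S (S.P p)" using S.sh_pred_unique[of "ide S (S.P (up p))"
        "ide S (S.P p)" 0] by simp
    then show "fal ?F (S.P p) \<cdot>\<^bsub>T\<^esub> K (S.P (up p)) (up p) (ide S (S.P (up p))) = shm T (K (S.P p) p (ide S (S.P p)))"
      using alK[of "S.P p" "ide S (S.P (up p))" "up p"] by simp
  next
    fix p q assume "pre p q"
    then show "fmor ?F (S.b p q) \<cdot>\<^bsub>T\<^esub> K (S.P p) p (ide S (S.P p)) = K (S.P q) q (ide S (S.P q)) \<cdot>\<^bsub>T\<^esub> g p q"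
      using cocone_D(8)[OF c[of "S.P q"], of p q "ide S (S.P q)"] by simp
  qed
  then show ?thesis by blast
qed

end

section \<open>Comparison data of an exact functor\<close>

context ex_functor
begin

text \<open>The functor commutes with one shift only up to \<open>fal\<close>. Iterating this in
  both directions gives coherent isomorphisms for all integers, normalised to be the identity in
  degree 0 as required for \<open>e_shift\<close>.\<close>

lemma shift_isoms:
  assumes U: "U \<in> ob S"
  obtains \<epsilon> where "\<And>m. isom T (shift_ob T m (fob F U)) (fob F (shift_ob S m U)) (\<epsilon> m)" "\<epsilon> 0 = ide T (fob F U)"
    "\<And>m. fal F (shift_ob S m U) \<cdot>\<^bsub>T\<^esub> \<epsilon> (m + 1) = shm T (\<epsilon> m)"
proof -
  have "\<forall>V. \<exists>c. V \<in> ob S \<longrightarrow> isom T (sho T (fob F V)) (fob F (sho S V)) c \<and> fal F V \<cdot>\<^bsub>T\<^esub> c = ide T (sho T (fob F V))"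
    using T.isomE[OF fal_isom] by metis
  then obtain inv where inv: "\<And>V. V \<in> ob S \<Longrightarrow> isom T (sho T (fob F V)) (fob F (sho S V)) (inv V)"
     "\<And>V. V \<in> ob S \<Longrightarrow> fal F V \<cdot>\<^bsub>T\<^esub> inv V = ide T (sho T (fob F V))" by metis
  \<comment> \<open>Going up, the comparison isomorphism has to be inverted; going down, it is
    composed on the left and the result is shifted back.\<close>
  define pos where "pos = rec_nat (ide T (fob F U)) (\<lambda>n x. inv (shift_ob S (int n) U) \<cdot>\<^bsub>T\<^esub> shm T x)"
  define neg where "neg = rec_nat (ide T (fob F U)) (\<lambda>n x. sh T (- 1) (fal F (shift_ob S (- int n - 1) U) \<cdot>\<^bsub>T\<^esub> x))"
  have pos_simps: "pos 0 = ide T (fob F U)" "pos (Suc n) = inv (shift_ob S (int n) U) \<cdot>\<^bsub>T\<^esub> shm T (pos n)" for n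
    by (simp_all add: pos_def)
  have neg_simps: "neg 0 = ide T (fob F U)" "neg (Suc n)
      = sh T (- 1) (fal F (shift_ob S (- int n - 1) U) \<cdot>\<^bsub>T\<^esub> neg n)" for n
    by (simp_all add: neg_def)
  have p: "isom T (shift_ob T (int n) (fob F U)) (fob F (shift_ob S (int n) U)) (pos n)" for n
  proof (induct n)
    case 0 show ?case using U by (simp add: pos_simps)
  next
    case (Suc n)
    have e: "shift_ob T (int (Suc n)) (fob F U) = sho T (shift_ob T (int n) (fob F U))"
       "shift_ob S (int (Suc n)) U = sho S (shift_ob S (int n) U)"
      using T.shift_ob_succ[of "fob F U" "int n"] S.shift_ob_succ[OF U, of "int n"] U by (simp_all add: add.commute)
    show ?case unfolding e pos_simps(2) by (rule T.isom_cmp[OF T.isom_shm[OF Suc] inv(1)]) (use U in simp)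
  qed
  have ns: "shift_ob S (- int n) U = sho S (shift_ob S (- int n - 1) U)" for n using S.shift_ob_succ[OF U,
      of "- int n - 1"] by simp
  have nt: "shift_ob T (- 1) (sho T W) = W" if "W \<in> ob T" for W using T.shift_ob_sho[OF that, of "- 1"] by simp
  have n: "isom T (shift_ob T (- int n) (fob F U)) (fob F (shift_ob S (- int n) U)) (neg n)" for n
  proof (induct n)
    case 0 show ?case using U by (simp add: neg_simps)
  next
    case (Suc n)
    have "isom T (fob F (shift_ob S (- int n) U)) (sho T (fob F (shift_ob S (- int n - 1) U))) (fal F (shift_ob S (- int n - 1) U))"
      unfolding ns by (rule fal_isom) (use U in simp)
    from T.isom_sh[OF T.isom_cmp[OF Suc this], of "- 1"]
    have "isom T (shift_ob T (- 1) (shift_ob T (- int n) (fob F U))) (fob F (shift_ob S (- int n - 1) U)) (neg (Suc n))"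
      using U by (simp add: neg_simps(2) nt)
    moreover have "shift_ob T (- 1) (shift_ob T (- int n) (fob F U)) = shift_ob T (- int (Suc n)) (fob F U)"
      using T.shift_ob_add[of "fob F U" "- 1" "- int n"] U by simp
    moreover have "- int n - 1 = - int (Suc n)" by simp
    ultimately show ?case by metis
  qed
  define \<epsilon> where "\<epsilon> m = (if 0 \<le> m then pos (nat m) else neg (nat (- m)))" for m
  show thesis
  proof (rule that[of \<epsilon>])
    show "isom T (shift_ob T m (fob F U)) (fob F (shift_ob S m U)) (\<epsilon> m)" for m
      using p[of "nat m"] n[of "nat (- m)"] by (auto simp: \<epsilon>_def)
    show "\<epsilon> 0 = ide T (fob F U)" by (simp add: \<epsilon>_def pos_simps)
    show "fal F (shift_ob S m U) \<cdot>\<^bsub>T\<^esub> \<epsilon> (m + 1) = shm T (\<epsilon> m)" for m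
    proof (cases "0 \<le> m")
      case True
      then have e: "nat (m + 1) = Suc (nat m)" by simp
      note [simp] = T.isomD[OF p] T.isomD[OF inv(1)] inv(2)
      have [simp]: "sho T (shift_ob T (int (nat m)) (fob F U)) = shift_ob T (m + 1) (fob F U)"
          using True T.shift_ob_succ[of "fob F U" m] U by simp
      show ?thesis unfolding \<epsilon>_def e pos_simps(2)
        using True U T.cmp_eq[OF inv(2)[of "shift_ob S m U"],
            of "shm T (pos (nat m))"] T.isomD(1-3)[OF p[of "nat m"]] by simp
    next
      case False
      \<comment> \<open>With \<open>k = - m - 1\<close> the claim relates \<open>neg k\<close>, in
        degree \<open>m + 1\<close>, to \<open>neg (Suc k)\<close>, in degree
        \<open>m\<close>.\<close>
      then obtain k where m: "m = - int k - 1"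
          by (metis add.commute diff_conv_add_uminus int_cases minus_add_distrib negative_zless of_nat_0_le_iff of_nat_Suc)
      have e: "\<epsilon> (m + 1) = neg k" "\<epsilon> m = neg (Suc k)" using m by (cases "k = 0"; simp add:
          \<epsilon>_def pos_simps neg_simps nat_add_distrib)+
      note a = T.isomD(1-3)[OF n[of k]]
      have [simp]: "sho S (shift_ob S (- int k - 1) U) = shift_ob S (- int k) U" using ns[of k] by simp
      have q: "shm T (sh T (- 1) x) = x" if "arr T x" for x using T.sh_add[OF that, of 1 "- 1"] by simp
      show ?thesis unfolding e unfolding m neg_simps(2) by (rule q[symmetric]) (use a U in simp)
    qed
  qed
qed

text \<open>Naturality on shifted edges is equivalent in neighbouring degrees, so it reduces to
  unshifted edges. There it holds because \<open>map_octa\<close> already composes the edges of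
  degree 1 with the comparison isomorphism.\<close>

lemma comparison_map:
  assumes "exceptional_octahedron S X"
  shows "\<exists>e. comparison S T F X (map_octa T F X) e"
proof -
  interpret X: exceptional_octahedron S X by fact
  interpret Y: octahedron_in T "map_octa T F X" by unfold_locales (rule map_octa_octahedron[OF X.octahedron])
  let ?Y = "map_octa T F X"
  have "\<forall>v. \<exists>\<epsilon>. (\<forall>m. isom T (shift_ob T m (fob F (vob X v))) (fob F (shift_ob S m (vob X v))) (\<epsilon> m)) \<and>
      \<epsilon> 0 = ide T (fob F (vob X v)) \<and>
    (\<forall>m. fal F (shift_ob S m (vob X v)) \<cdot>\<^bsub>T\<^esub> \<epsilon> (m + 1) = shm T (\<epsilon> m))"
    using shift_isoms[OF X.vob_ob] by metis
  then obtain \<epsilon> where i: "\<And>v m. isom T (shift_ob T m (fob F (vob X v))) (fob F (shift_ob S m (vob X v))) (\<epsilon> v m)"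
    and \<epsilon>0: "\<And>v. \<epsilon> v 0 = ide T (fob F (vob X v))"
    and s: "\<And>v m. fal F (shift_ob S m (vob X v)) \<cdot>\<^bsub>T\<^esub> \<epsilon> v (m + 1) = shm T (\<epsilon> v m)"
    by metis
  note [simp] = T.isomD(1-3)[OF i]
  have nat: "fmor F (sh S m (edge S X v w)) \<cdot>\<^bsub>T\<^esub> \<epsilon> v m = \<epsilon> w (m + d) \<cdot>\<^bsub>T\<^esub> sh T m (edge T ?Y v w)" (is "?N m")
      if d: "deg v w = Some d" for v w d m
  proof -
    note [simp] = X.edge_hom[OF d] Y.edge_hom[OF d]
    have dd: "d = 0 \<or> d = 1" using d by (cases v; cases w) auto
    \<comment> \<open>By \<open>L\<close> and \<open>R\<close>, composing both sides in degree
      \<open>m + 1\<close> with an isomorphism gives the shifts of both sides in degree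
      \<open>m\<close>. An equivalence is needed because the induction runs over all
      integers.\<close>
    have step: "?N (m + 1) \<longleftrightarrow> ?N m" for m
    proof -
      let ?s = "sh S m (edge S X v w)" and ?t = "sh T m (edge T ?Y v w)"
      have [simp]: "sho S (shift_ob S m V) = shift_ob S (m + 1) V" "shift_ob S m (shift_ob S d V)
          = shift_ob S (m + d) V" if "V \<in> ob S" for V m d
        using S.shift_ob_succ[OF that] S.shift_ob_add[OF that] by metis+
      have [simp]: "sho T (shift_ob T m V) = shift_ob T (m + 1) V" "shift_ob T m (shift_ob T d V)
          = shift_ob T (m + d) V" if "V \<in> ob T" for V m d
        using T.shift_ob_succ[OF that] T.shift_ob_add[OF that] by metis+
      have md: "m + 1 + d = m + d + 1" by simp
      have f: "isom T (fob F (shift_ob S (m + d + 1) (vob X w))) (sho T (fob F (shift_ob S (m + d) (vob X w)))) (fal F (shift_ob S (m + d) (vob X w)))"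
        using fal_isom[of "shift_ob S (m + d) (vob X w)"] by simp
      let ?a = "fal F (shift_ob S (m + d) (vob X w))"
      have L: "?a \<cdot>\<^bsub>T\<^esub> (fmor F (shm S ?s) \<cdot>\<^bsub>T\<^esub> \<epsilon> v (m + 1)) = shm T (fmor F ?s \<cdot>\<^bsub>T\<^esub> \<epsilon> v m)"
        using s[of m v] by (simp add: fal_shm'[where U="shift_ob S m (vob X v)"])
      have R: "?a \<cdot>\<^bsub>T\<^esub> (\<epsilon> w (m + d + 1) \<cdot>\<^bsub>T\<^esub> shm T ?t) = shm T (\<epsilon> w (m + d) \<cdot>\<^bsub>T\<^esub> ?t)"
        using T.cmp_eq[OF s[of "m + d" w], of "shm T ?t"] by (simp add: md)
      have "?N (m + 1) \<longleftrightarrow> fmor F (shm S ?s) \<cdot>\<^bsub>T\<^esub> \<epsilon> v (m + 1) = \<epsilon> w (m + d + 1) \<cdot>\<^bsub>T\<^esub> shm T ?t"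
        by (simp add: S.sh_succ T.sh_succ md)
      also have "\<dots> \<longleftrightarrow> shm T (fmor F ?s \<cdot>\<^bsub>T\<^esub> \<epsilon> v m) = shm T (\<epsilon> w (m + d) \<cdot>\<^bsub>T\<^esub> ?t)"
        unfolding L[symmetric] R[symmetric]
        using T.isom_cancel_left[OF f, of "fmor F (shm S ?s) \<cdot>\<^bsub>T\<^esub> \<epsilon> v (m + 1)" "\<epsilon> w (m + d + 1) \<cdot>\<^bsub>T\<^esub> shm T ?t"]
            by (auto simp: md simp del: T.assoc)
      also have "\<dots> \<longleftrightarrow> ?N m" using T.shm_inj[of "fmor F ?s \<cdot>\<^bsub>T\<^esub> \<epsilon> v m" "\<epsilon> w (m + d) \<cdot>\<^bsub>T\<^esub> ?t"]
          by (auto simp del: T.shm_cmp)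
      finally show ?thesis .
    qed
    show "?N m"
    proof (induct m rule: int_induct[of _ 0])
      case base
      show ?case using dd
      proof
        assume d0: "d = 0"
        then show ?thesis using X.edge_hom[OF d] by (simp add: \<epsilon>0 map_octa_edge[OF X.octahedron d])
      next
        assume d1: "d = 1"
        let ?a = "fal F (vob X w)"
        \<comment> \<open>In degree 0 the coherence \<open>s\<close> says that
          \<open>\<epsilon> w 1\<close> is a right inverse of the comparison isomorphism, hence its
          inverse.\<close>
        have a: "?a \<cdot>\<^bsub>T\<^esub> \<epsilon> w 1 = ide T (sho T (fob F (vob X w)))" using s[of 0 w] by (simp add: \<epsilon>0)
        have i1: "arr T (\<epsilon> w 1)" "dm T (\<epsilon> w 1) = sho T (fob F (vob X w))" "cd T (\<epsilon> w 1) = fob F (sho S (vob X w))"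
          using T.isomD(1-3)[OF i[of 1 w]] by simp_all
        have "?a \<cdot>\<^bsub>T\<^esub> (\<epsilon> w 1 \<cdot>\<^bsub>T\<^esub> ?a) = ?a \<cdot>\<^bsub>T\<^esub> ide T (fob F (sho S (vob X w)))" using T.cmp_eq[OF a, of ?a] i1
            by simp
        then have "\<epsilon> w 1 \<cdot>\<^bsub>T\<^esub> ?a = ide T (fob F (sho S (vob X w)))"
          using T.isom_cancel_left[OF fal_isom[OF X.vob_ob[of w]], of "\<epsilon> w 1 \<cdot>\<^bsub>T\<^esub> ?a"
              "ide T (fob F (sho S (vob X w)))"] i1 by (simp del: T.cmp_ide_right)
        from T.cmp_eq[OF this, of "fmor F (edge S X v w)"]
        have "\<epsilon> w 1 \<cdot>\<^bsub>T\<^esub> (?a \<cdot>\<^bsub>T\<^esub> fmor F (edge S X v w)) = fmor F (edge S X v w)" using i1 X.edge_hom[OF d] d1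
            by simp
        then show ?thesis using d1 X.edge_hom[OF d] by (simp add: \<epsilon>0 map_octa_edge[OF X.octahedron d])
      qed
    next
      case (step1 i) then show ?case using step by blast
    next
      case (step2 i) then show ?case using step[of "i - 1"] by simp
    qed
  qed
  have "comparison S T F X ?Y (\<lambda>p. \<epsilon> (fst p) (snd p))"
  proof
    fix p
    show "isom T (Y.P p) (fob F (X.P p)) (\<epsilon> (fst p) (snd p))" using i by (simp add: gob_def)
    show "fal F (X.P p) \<cdot>\<^bsub>T\<^esub> \<epsilon> (fst (up p)) (snd (up p)) = shm T (\<epsilon> (fst p) (snd p))" using s
        by (simp add: gob_def up_def)
  next
    fix p q assume pq: "pre p q"
    then have d: "deg (fst p) (fst q) = Some (snd q - snd p)" by (simp add: pre_def)
    show "fmor F (X.b p q) \<cdot>\<^bsub>T\<^esub> \<epsilon> (fst p) (snd p) = \<epsilon> (fst q) (snd q) \<cdot>\<^bsub>T\<^esub> Y.b p q"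
      using nat[OF d, of "snd p"] pq by (simp add: gmor_def)
  qed
  then show ?thesis by blast
qed

end

section \<open>Transport and uniqueness of comparison data\<close>

lemma comparison_transfer:
  assumes "comparison S T F X Y e" "octahedron T Y'" "octa_iso T Y' Y"
  shows "\<exists>e'. comparison S T F X Y' e'"
proof -
  interpret C: comparison S T F X Y e by fact
  interpret Y': octahedron_in T Y' using assms(2) by unfold_locales
  obtain \<epsilon> where \<epsilon>: "\<And>p. isom T (Y'.P p) (C.G p) (\<epsilon> p)" "\<And>p. \<epsilon> (up p) = shm T (\<epsilon> p)"
    "\<And>p q. pre p q \<Longrightarrow> C.g p q \<cdot>\<^bsub>T\<^esub> \<epsilon> p = \<epsilon> q \<cdot>\<^bsub>T\<^esub> Y'.b p q"
    using C.T.octa_iso_gob[OF assms(2) C.T.octahedron assms(3)] by metis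
  note [simp] = C.T.isomD(1-3)[OF \<epsilon>(1)]
  have "comparison S T F X Y' (\<lambda>p. e p \<cdot>\<^bsub>T\<^esub> \<epsilon> p)"
  proof
    fix p
    show "isom T (Y'.P p) (fob F (C.S.P p)) (e p \<cdot>\<^bsub>T\<^esub> \<epsilon> p)" by (rule C.T.isom_cmp[OF \<epsilon>(1) C.e_isom])
    have "fal F (C.S.P p) \<cdot>\<^bsub>T\<^esub> (e (up p) \<cdot>\<^bsub>T\<^esub> \<epsilon> (up p)) = shm T (e p) \<cdot>\<^bsub>T\<^esub> \<epsilon> (up p)"
      by (rule C.T.cmp_eq[OF C.e_shift]) simp_all
    then show "fal F (C.S.P p) \<cdot>\<^bsub>T\<^esub> (e (up p) \<cdot>\<^bsub>T\<^esub> \<epsilon> (up p)) = shm T (e p \<cdot>\<^bsub>T\<^esub> \<epsilon> p)" by (simp add: \<epsilon>(2))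
  next
    fix p q assume pq: "pre p q"
    have "fmor F (C.S.b p q) \<cdot>\<^bsub>T\<^esub> (e p \<cdot>\<^bsub>T\<^esub> \<epsilon> p) = (e q \<cdot>\<^bsub>T\<^esub> C.g p q) \<cdot>\<^bsub>T\<^esub> \<epsilon> p"
      by (rule C.T.cmp_eq[OF C.e_nat[OF pq]]) simp_all
    also have "\<dots> = e q \<cdot>\<^bsub>T\<^esub> (\<epsilon> q \<cdot>\<^bsub>T\<^esub> Y'.b p q)" unfolding \<epsilon>(3)[OF pq, symmetric] by simp
    finally show "fmor F (C.S.b p q) \<cdot>\<^bsub>T\<^esub> (e p \<cdot>\<^bsub>T\<^esub> \<epsilon> p) = (e q \<cdot>\<^bsub>T\<^esub> \<epsilon> q) \<cdot>\<^bsub>T\<^esub> Y'.b p q" by simp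
  qed
  then show ?thesis by blast
qed

text \<open>Both functors are Kan extensions of the same diagram by \<open>kan_fob\<close>. This
  provides \<open>\<gamma>\<close>, and its naturality and compatibility with the shift are
  equations that may be tested on universal cocones.\<close>

lemma comparison_unique:
  assumes "comparison S T F X Y e" "comparison S T F' X Y e'"
    and full: "\<And>U. U \<in> ob S \<Longrightarrow> octahedron_in.decomposable S X U"
  shows "exact_functor_iso S T F F'"
proof -
  interpret C: comparison S T F X Y e by fact
  interpret C': comparison S T F' X Y e' by fact
  have "\<forall>U. \<exists>z. U \<in> ob S \<longrightarrow> isom T (fob F U) (fob F' U) z \<and>
    (\<forall>p x. arr S x \<and> dm S x = C.S.P p \<and> cd S x = U \<longrightarrow> fmor F' x \<cdot>\<^bsub>T\<^esub> e' p = z \<cdot>\<^bsub>T\<^esub> (fmor F x \<cdot>\<^bsub>T\<^esub> e p))"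
    using C.kan_isom[OF C.kan_fob[OF full] C'.kan_fob[OF full]] by metis
  then obtain \<gamma> where i: "\<And>U. U \<in> ob S \<Longrightarrow> isom T (fob F U) (fob F' U) (\<gamma> U)" and
    \<gamma>: "\<And>U p x. U \<in> ob S \<Longrightarrow> arr S x \<Longrightarrow> dm S x = C.S.P p \<Longrightarrow> cd S x = U \<Longrightarrow> \<gamma> U \<cdot>\<^bsub>T\<^esub> (fmor F x \<cdot>\<^bsub>T\<^esub> e p)
        = fmor F' x \<cdot>\<^bsub>T\<^esub> e' p"
    by metis
  note [simp] = C.T.isomD(1-3)[OF i] \<gamma>
  have nat: "\<gamma> V \<cdot>\<^bsub>T\<^esub> fmor F u = fmor F' u \<cdot>\<^bsub>T\<^esub> \<gamma> U" if u [simp]: "arr S u" "dm S u = U" "cd S u = V" for u U V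
  proof -
    have [simp]: "U \<in> ob S" "V \<in> ob S" using C.S.dm_ob[OF u(1)] C.S.cd_ob[OF u(1)] by simp_all
    show ?thesis
    proof (rule C.kanD(3)[OF C.kan_fob[OF full]])
      fix p x assume x [simp]: "arr S x" "dm S x = C.S.P p" "cd S x = U"
      have "\<gamma> V \<cdot>\<^bsub>T\<^esub> (fmor F (u \<cdot>\<^bsub>S\<^esub> x) \<cdot>\<^bsub>T\<^esub> e p) = fmor F' (u \<cdot>\<^bsub>S\<^esub> x) \<cdot>\<^bsub>T\<^esub> e' p" by (rule \<gamma>) simp_all
      then show "(\<gamma> V \<cdot>\<^bsub>T\<^esub> fmor F u) \<cdot>\<^bsub>T\<^esub> (fmor F x \<cdot>\<^bsub>T\<^esub> e p) = (fmor F' u \<cdot>\<^bsub>T\<^esub> \<gamma> U) \<cdot>\<^bsub>T\<^esub> (fmor F x \<cdot>\<^bsub>T\<^esub> e p)"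
          by simp
    qed simp_all
  qed
  have sh: "fal F' U \<cdot>\<^bsub>T\<^esub> \<gamma> (sho S U) = shm T (\<gamma> U) \<cdot>\<^bsub>T\<^esub> fal F U" if U [simp]: "U \<in> ob S" for U
  proof (rule C.kanD(3)[OF C.kan_fob[OF full[of "sho S U"]]])
    fix p x assume x [simp]: "arr S x" "dm S x = C.S.P p" "cd S x = sho S U"
    define y where "y = sh S (- 1) x"
    have y [simp]: "arr S y" "dm S y = C.S.P (down p)" "cd S y = U" and xy: "x = shm S y" using C.unsh[OF x U]
        by (simp_all add: y_def)
    have s: "fal F (C.S.P (down p)) \<cdot>\<^bsub>T\<^esub> e p = shm T (e (down p))" "fal F' (C.S.P (down p)) \<cdot>\<^bsub>T\<^esub> e' p
        = shm T (e' (down p))"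
      using C.e_shift[of "down p"] C'.e_shift[of "down p"] by simp_all
    have "fal F' U \<cdot>\<^bsub>T\<^esub> (\<gamma> (sho S U) \<cdot>\<^bsub>T\<^esub> (fmor F x \<cdot>\<^bsub>T\<^esub> e p)) = shm T (fmor F' y \<cdot>\<^bsub>T\<^esub> e' (down p))"
      by (simp add: xy C'.fal_shm'[where U="C.S.P (down p)"] s)
    also have "\<dots> = shm T (\<gamma> U \<cdot>\<^bsub>T\<^esub> (fmor F y \<cdot>\<^bsub>T\<^esub> e (down p)))" by (subst \<gamma>) simp_all
    also have "\<dots> = shm T (\<gamma> U) \<cdot>\<^bsub>T\<^esub> (fal F U \<cdot>\<^bsub>T\<^esub> (fmor F x \<cdot>\<^bsub>T\<^esub> e p))"
      by (simp add: xy C.fal_shm'[where U="C.S.P (down p)"] s del: \<gamma>)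
    finally show "(fal F' U \<cdot>\<^bsub>T\<^esub> \<gamma> (sho S U)) \<cdot>\<^bsub>T\<^esub> (fmor F x \<cdot>\<^bsub>T\<^esub> e p)
        = (shm T (\<gamma> U) \<cdot>\<^bsub>T\<^esub> fal F U) \<cdot>\<^bsub>T\<^esub> (fmor F x \<cdot>\<^bsub>T\<^esub> e p)"
      by (simp del: \<gamma>)
  qed simp_all
  show ?thesis unfolding exact_functor_iso_def using i nat sh by (intro exI[of _ \<gamma>]) simp
qed

lemma ex_functor_octa_iso:
  assumes "ex_functor S T F" "ex_functor S T F'" "octahedron S X" "exact_functor_iso S T F F'"
  shows "octa_iso T (map_octa T F X) (map_octa T F' X)"
proof -
  interpret F: ex_functor S T F by fact
  interpret F': ex_functor S T F' by fact
  interpret X: octahedron_in S X using assms(3) by unfold_locales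
  obtain \<gamma> where i: "\<And>U. U \<in> ob S \<Longrightarrow> isom T (fob F U) (fob F' U) (\<gamma> U)"
    and nat: "\<And>U V u. u \<in> hom S U V \<Longrightarrow> \<gamma> V \<cdot>\<^bsub>T\<^esub> fmor F u = fmor F' u \<cdot>\<^bsub>T\<^esub> \<gamma> U"
    and sh: "\<And>U. U \<in> ob S \<Longrightarrow> fal F' U \<cdot>\<^bsub>T\<^esub> \<gamma> (sho S U) = shm T (\<gamma> U) \<cdot>\<^bsub>T\<^esub> fal F U"
    using assms(4) unfolding exact_functor_iso_def by blast
  note [simp] = F.T.isomD(1-3)[OF i]
  have "edge T (map_octa T F' X) v w \<cdot>\<^bsub>T\<^esub> \<gamma> (vob X v) = sh T d (\<gamma> (vob X w)) \<cdot>\<^bsub>T\<^esub> edge T (map_octa T F X) v w"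
    if d: "deg v w = Some d" for v w d
  proof -
    have "d = 0 \<or> d = 1" using d by (cases v; cases w) auto
    then show ?thesis
    proof
      assume d0: "d = 0"
      then show ?thesis using X.edge_hom[OF d] nat[of "edge S X v w" "vob X v" "vob X w"]
        by (simp add: F.map_octa_edge[OF assms(3) d] F'.map_octa_edge[OF assms(3) d])
    next
      assume d1: "d = 1"
      note [simp] = X.edge_hom[OF d, unfolded d1]
      have n: "fmor F' (edge S X v w) \<cdot>\<^bsub>T\<^esub> \<gamma> (vob X v) = \<gamma> (sho S (vob X w)) \<cdot>\<^bsub>T\<^esub> fmor F (edge S X v w)"
        using nat[of "edge S X v w" "vob X v" "sho S (vob X w)"] by simp
      have "fal F' (vob X w) \<cdot>\<^bsub>T\<^esub> (\<gamma> (sho S (vob X w)) \<cdot>\<^bsub>T\<^esub> fmor F (edge S X v w))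
          = (shm T (\<gamma> (vob X w)) \<cdot>\<^bsub>T\<^esub> fal F (vob X w)) \<cdot>\<^bsub>T\<^esub> fmor F (edge S X v w)"
        by (rule F.T.cmp_eq[OF sh]) simp_all
      then show ?thesis using n d1 by (simp add: F.map_octa_edge[OF assms(3) d] F'.map_octa_edge[OF assms(3) d])
    qed
  qed
  then have "F.T.edge_iso (map_octa T F X) (map_octa T F' X) (\<lambda>v. \<gamma> (vob X v))"
    unfolding F.T.edge_iso_def using i by simp
  then show ?thesis by (rule F.T.octa_iso_if_edge_iso)
qed

section \<open>Isomorphism classes and the bijection\<close>

lemma equiv_exact_functor_iso:
  assumes "triangulated_category S" "triangulated_category T"
  shows "equiv {F. exact_functor S T F} {(F, F'). exact_functor S T F \<and> exact_functor S T F' \<and>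
      exact_functor_iso S T F F'}"
proof (rule equivI)
  interpret S: triangulated_category S by fact
  interpret T: triangulated_category T by fact
  let ?R = "{(F, F'). exact_functor S T F \<and> exact_functor S T F' \<and> exact_functor_iso S T F F'}"
  show "?R \<subseteq> {F. exact_functor S T F} \<times> {F. exact_functor S T F}" by auto
  have refl: "exact_functor_iso S T F F" if "exact_functor S T F" for F
  proof -
    interpret F: ex_functor S T F using that ex_functor_iff[OF assms] by blast
    show ?thesis unfolding exact_functor_iso_def
      by (intro exI[of _ "\<lambda>U. ide T (fob F U)"]) simp
  qed
  show "refl_on {F. exact_functor S T F} ?R" using refl by (auto simp: refl_on_def)
  have sym: "exact_functor_iso S T F' F" if e1: "exact_functor S T F" and e2: "exact_functor S T F'"
      and e3: "exact_functor_iso S T F F'" for F F'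
  proof -
    interpret F: ex_functor S T F using e1 ex_functor_iff[OF assms] by blast
    interpret F': ex_functor S T F' using e2 ex_functor_iff[OF assms] by blast
    obtain \<gamma> where i: "\<And>U. U \<in> ob S \<Longrightarrow> isom T (fob F U) (fob F' U) (\<gamma> U)"
      and nat: "\<And>U V u. u \<in> hom S U V \<Longrightarrow> \<gamma> V \<cdot>\<^bsub>T\<^esub> fmor F u = fmor F' u \<cdot>\<^bsub>T\<^esub> \<gamma> U"
      and sh: "\<And>U. U \<in> ob S \<Longrightarrow> fal F' U \<cdot>\<^bsub>T\<^esub> \<gamma> (sho S U) = shm T (\<gamma> U) \<cdot>\<^bsub>T\<^esub> fal F U"
      using e3 unfolding exact_functor_iso_def by blast
    have "\<forall>U. \<exists>c. U \<in> ob S \<longrightarrow> isom T (fob F' U) (fob F U) c \<and> c \<cdot>\<^bsub>T\<^esub> \<gamma> U = ide T (fob F U) \<and>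
        \<gamma> U \<cdot>\<^bsub>T\<^esub> c = ide T (fob F' U)"
      using T.isomE[OF i] by metis
    then obtain \<delta> where j: "\<And>U. U \<in> ob S \<Longrightarrow> isom T (fob F' U) (fob F U) (\<delta> U)"
      and \<delta>: "\<And>U. U \<in> ob S \<Longrightarrow> \<delta> U \<cdot>\<^bsub>T\<^esub> \<gamma> U = ide T (fob F U)" "\<And>U. U \<in> ob S \<Longrightarrow> \<gamma> U \<cdot>\<^bsub>T\<^esub> \<delta> U = ide T (fob F' U)"
          by metis
    note [simp] = T.isomD(1-3)[OF i] T.isomD(1-3)[OF j] \<delta>
    have \<delta>': "\<delta> U \<cdot>\<^bsub>T\<^esub> (\<gamma> U \<cdot>\<^bsub>T\<^esub> x) = x" if "U \<in> ob S" "arr T x" "cd T x = fob F U" for U x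
      using T.cmp_eq[OF \<delta>(1)] that by simp
    have n: "\<delta> V \<cdot>\<^bsub>T\<^esub> fmor F' u = fmor F u \<cdot>\<^bsub>T\<^esub> \<delta> U" if u: "u \<in> hom S U V" for u U V
    proof -
      have [simp]: "arr S u" "dm S u = U" "cd S u = V" "U \<in> ob S" "V \<in> ob S" using u S.dm_ob[of u] S.cd_ob[of u]
          by auto
      have "\<delta> V \<cdot>\<^bsub>T\<^esub> fmor F' u = \<delta> V \<cdot>\<^bsub>T\<^esub> ((fmor F' u \<cdot>\<^bsub>T\<^esub> \<gamma> U) \<cdot>\<^bsub>T\<^esub> \<delta> U)" by simp
      also have "\<dots> = fmor F u \<cdot>\<^bsub>T\<^esub> \<delta> U" unfolding nat[OF u, symmetric] by (simp add: \<delta>')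
      finally show ?thesis .
    qed
    have s: "fal F U \<cdot>\<^bsub>T\<^esub> \<delta> (sho S U) = shm T (\<delta> U) \<cdot>\<^bsub>T\<^esub> fal F' U" if U [simp]: "U \<in> ob S" for U
    proof -
      have "shm T (\<delta> U) \<cdot>\<^bsub>T\<^esub> fal F' U = shm T (\<delta> U) \<cdot>\<^bsub>T\<^esub> ((fal F' U \<cdot>\<^bsub>T\<^esub> \<gamma> (sho S U)) \<cdot>\<^bsub>T\<^esub> \<delta> (sho S U))" by simp
      also have "\<dots> = (shm T (\<delta> U) \<cdot>\<^bsub>T\<^esub> shm T (\<gamma> U)) \<cdot>\<^bsub>T\<^esub> (fal F U \<cdot>\<^bsub>T\<^esub> \<delta> (sho S U))" unfolding sh[OF U] by simp
      also have "shm T (\<delta> U) \<cdot>\<^bsub>T\<^esub> shm T (\<gamma> U) = shm T (\<delta> U \<cdot>\<^bsub>T\<^esub> \<gamma> U)" by (simp del: \<delta>)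
      finally show ?thesis by simp
    qed
    show ?thesis unfolding exact_functor_iso_def using j n s by blast
  qed
  show "sym ?R" using sym by (auto simp: sym_def)
  have trans: "exact_functor_iso S T F F''" if e1: "exact_functor S T F" and e2: "exact_functor S T F'"
      and e3: "exact_functor S T F''"
    and e4: "exact_functor_iso S T F F'" and e5: "exact_functor_iso S T F' F''" for F F' F''
  proof -
    interpret F: ex_functor S T F using e1 ex_functor_iff[OF assms] by blast
    interpret F': ex_functor S T F' using e2 ex_functor_iff[OF assms] by blast
    interpret F'': ex_functor S T F'' using e3 ex_functor_iff[OF assms] by blast
    obtain \<gamma> where i: "\<And>U. U \<in> ob S \<Longrightarrow> isom T (fob F U) (fob F' U) (\<gamma> U)"
      and nat: "\<And>U V u. u \<in> hom S U V \<Longrightarrow> \<gamma> V \<cdot>\<^bsub>T\<^esub> fmor F u = fmor F' u \<cdot>\<^bsub>T\<^esub> \<gamma> U"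
      and sh: "\<And>U. U \<in> ob S \<Longrightarrow> fal F' U \<cdot>\<^bsub>T\<^esub> \<gamma> (sho S U) = shm T (\<gamma> U) \<cdot>\<^bsub>T\<^esub> fal F U"
      using e4 unfolding exact_functor_iso_def by blast
    obtain \<delta> where j: "\<And>U. U \<in> ob S \<Longrightarrow> isom T (fob F' U) (fob F'' U) (\<delta> U)"
      and nat': "\<And>U V u. u \<in> hom S U V \<Longrightarrow> \<delta> V \<cdot>\<^bsub>T\<^esub> fmor F' u = fmor F'' u \<cdot>\<^bsub>T\<^esub> \<delta> U"
      and sh': "\<And>U. U \<in> ob S \<Longrightarrow> fal F'' U \<cdot>\<^bsub>T\<^esub> \<delta> (sho S U) = shm T (\<delta> U) \<cdot>\<^bsub>T\<^esub> fal F' U"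
      using e5 unfolding exact_functor_iso_def by blast
    note [simp] = T.isomD(1-3)[OF i] T.isomD(1-3)[OF j]
    have n: "(\<delta> V \<cdot>\<^bsub>T\<^esub> \<gamma> V) \<cdot>\<^bsub>T\<^esub> fmor F u = fmor F'' u \<cdot>\<^bsub>T\<^esub> (\<delta> U \<cdot>\<^bsub>T\<^esub> \<gamma> U)" if u: "u \<in> hom S U V" for u U V
    proof -
      have [simp]: "arr S u" "dm S u = U" "cd S u = V" "U \<in> ob S" "V \<in> ob S" using u S.dm_ob[of u] S.cd_ob[of u]
          by auto
      have "(\<delta> V \<cdot>\<^bsub>T\<^esub> \<gamma> V) \<cdot>\<^bsub>T\<^esub> fmor F u = \<delta> V \<cdot>\<^bsub>T\<^esub> (fmor F' u \<cdot>\<^bsub>T\<^esub> \<gamma> U)" unfolding nat[OF u, symmetric] by simp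
      also have "\<dots> = (\<delta> V \<cdot>\<^bsub>T\<^esub> fmor F' u) \<cdot>\<^bsub>T\<^esub> \<gamma> U" by simp
      finally show ?thesis unfolding nat'[OF u] by simp
    qed
    have s: "fal F'' U \<cdot>\<^bsub>T\<^esub> (\<delta> (sho S U) \<cdot>\<^bsub>T\<^esub> \<gamma> (sho S U)) = shm T (\<delta> U \<cdot>\<^bsub>T\<^esub> \<gamma> U) \<cdot>\<^bsub>T\<^esub> fal F U"
        if U [simp]: "U \<in> ob S" for U
    proof -
      have "fal F'' U \<cdot>\<^bsub>T\<^esub> (\<delta> (sho S U) \<cdot>\<^bsub>T\<^esub> \<gamma> (sho S U)) = (fal F'' U \<cdot>\<^bsub>T\<^esub> \<delta> (sho S U)) \<cdot>\<^bsub>T\<^esub> \<gamma> (sho S U)" by simp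
      also have "\<dots> = shm T (\<delta> U) \<cdot>\<^bsub>T\<^esub> (fal F' U \<cdot>\<^bsub>T\<^esub> \<gamma> (sho S U))" unfolding sh'[OF U] by simp
      finally show ?thesis unfolding sh[OF U] by simp
    qed
    show ?thesis unfolding exact_functor_iso_def using T.isom_cmp[OF i j] n s
        by (intro exI[of _ "\<lambda>U. \<delta> U \<cdot>\<^bsub>T\<^esub> \<gamma> U"]) blast
  qed
  show "trans ?R" by (rule transI) (use trans in blast)
qed

text \<open>Injectivity is the uniqueness of a functor with comparison data, applied over one common
  octahedron. Surjectivity is the Kan extension, whose exactness follows from the goodness of
  \<open>Y\<close> because all objects of \<open>S\<close> are decomposable.\<close>

lemma eval_octa_bij:
  assumes S: "triangulated_category S" and T: "triangulated_category T" and X: "exceptional_octahedron S X"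
    and full: "\<And>U. U \<in> ob S \<Longrightarrow> octahedron_in.decomposable S X U"
  shows "bij_betw (eval_octa T X) (Ht S T) (good_octa_classes T)"
proof -
  interpret S: triangulated_category S by fact
  interpret T: triangulated_category T by fact
  interpret X: exceptional_octahedron S X by fact
  let ?R = "{(F, F'). exact_functor S T F \<and> exact_functor S T F' \<and> exact_functor_iso S T F F'}"
  note eR = equiv_exact_functor_iso[OF S T] and eO = T.equiv_good_octa_rel
  have good: "good_octahedron T (map_octa T F X)" if "exact_functor S T F" for F
    using ex_functor.map_octa_good[OF _ X.good] that ex_functor_iff[OF S T] by blast
  have iso: "octa_iso T (map_octa T F X) (map_octa T F' X)" if "(F, F') \<in> ?R" for F F'
    using ex_functor_octa_iso[OF _ _ X.octahedron] that ex_functor_iff[OF S T] by blast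
  \<comment> \<open>The union that defines \<open>eval_octa\<close> runs over equal classes, since
    isomorphic functors have isomorphic values at \<open>X\<close>.\<close>
  have eval: "eval_octa T X (?R `` {F}) = good_octa_rel T `` {map_octa T F X}" if F: "exact_functor S T F" for F
  proof -
    have "good_octa_rel T `` {map_octa T F' X} = good_octa_rel T `` {map_octa T F X}" if "F' \<in> ?R `` {F}" for F'
    proof -
      have "(map_octa T F X, map_octa T F' X) \<in> good_octa_rel T" using that iso[of F F'] good
          unfolding good_octa_rel_def by blast
      then show ?thesis using equiv_class_eq[OF eO] by blast
    qed
    moreover have "F \<in> ?R `` {F}" using equiv_class_self[OF eR] F by blast
    ultimately show ?thesis unfolding eval_octa_def by blast
  qed
  show ?thesis unfolding bij_betw_def
  proof
    show "inj_on (eval_octa T X) (Ht S T)"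
    proof (rule inj_onI)
      fix \<F> \<F>' assume "\<F> \<in> Ht S T" "\<F>' \<in> Ht S T" and e: "eval_octa T X \<F> = eval_octa T X \<F>'"
      then obtain F F' where F: "exact_functor S T F" "\<F> = ?R `` {F}" and F': "exact_functor S T F'"
          "\<F>' = ?R `` {F'}"
        unfolding Ht_def by (elim quotientE) blast
      interpret F: ex_functor S T F using F(1) ex_functor_iff[OF S T] by blast
      interpret F': ex_functor S T F' using F'(1) ex_functor_iff[OF S T] by blast
      have "(map_octa T F X, map_octa T F' X) \<in> good_octa_rel T"
        using e eval[OF F(1)] eval[OF F'(1)] eq_equiv_class[OF _ eO] good[OF F'(1)] unfolding F(2) F'(2) by simp
      then have o: "octa_iso T (map_octa T F X) (map_octa T F' X)" unfolding good_octa_rel_def by blast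
      \<comment> \<open>Both functors are compared with the octahedron that \<open>F\<close>
        produces from \<open>X\<close>; for \<open>F'\<close> the comparison data are moved along
        the isomorphism of octahedra.\<close>
      obtain e where "comparison S T F X (map_octa T F X) e" using F.comparison_map[OF X] by blast
      moreover obtain e' where "comparison S T F' X (map_octa T F X) e'"
        using F'.comparison_map[OF X] comparison_transfer F.map_octa_octahedron[OF X.octahedron] o by metis
      ultimately have "exact_functor_iso S T F F'" by (rule comparison_unique[OF _ _ full])
      then have "(F, F') \<in> ?R" using F F' by blast
      then show "\<F> = \<F>'" unfolding F(2) F'(2) using equiv_class_eq[OF eR] by blast
    qed
    show "eval_octa T X ` Ht S T = good_octa_classes T"
    proof
      show "eval_octa T X ` Ht S T \<subseteq> good_octa_classes T"
      proof
        fix \<C> assume "\<C> \<in> eval_octa T X ` Ht S T"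
        then obtain F where "exact_functor S T F" "\<C> = eval_octa T X (?R `` {F})" unfolding Ht_def
            by (elim imageE quotientE) blast
        then show "\<C> \<in> good_octa_classes T" using eval good unfolding good_octa_classes_def by (simp add: quotientI)
      qed
      show "good_octa_classes T \<subseteq> eval_octa T X ` Ht S T"
      proof
        fix \<C> assume "\<C> \<in> good_octa_classes T"
        then obtain Y where Y: "good_octahedron T Y" "\<C> = good_octa_rel T `` {Y}" unfolding good_octa_classes_def
            by (elim quotientE) blast
        interpret XY: octahedron_pair S X T Y by unfold_locales (rule T.good_octahedronD[OF Y(1)])
        obtain F e where "comparison S T F X Y e" using XY.ex_comparison[OF full] by blast
        then interpret C: comparison S T F X Y e .
        have "ex_functor S T F"
          by unfold_locales (meson C.preserves_decomposable[OF Y(1) full full] S.dtD(10,11))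
        then have F: "exact_functor S T F" using ex_functor_iff[OF S T] by blast
        have "(Y, map_octa T F X) \<in> good_octa_rel T" using C.octa_iso_map good[OF F] Y(1)
            unfolding good_octa_rel_def by blast
        then have "\<C> = eval_octa T X (?R `` {F})" unfolding Y(2) eval[OF F] using equiv_class_eq[OF eO] by blast
        moreover have "?R `` {F} \<in> Ht S T" unfolding Ht_def by (rule quotientI) (use F in simp)
        ultimately show "\<C> \<in> eval_octa T X ` Ht S T" by blast
      qed
    qed
  qed
qed

text \<open>Naturality is expressed by giving the bijection as evaluation at an octahedron. Its
  remaining vertices are cones and thus determined only up to isomorphism, whence the quantification
  over \<open>X\<close>. Existence holds because every octahedron that \<open>TR4\<close> builds on
  \<open>f\<close> and \<open>g\<close> is good.\<close>

theorem corollary3p3: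
  fixes S :: "('o, 'a, 'k :: field) tri_cat"
    and T :: "('p, 'b, 'k) tri_cat"
    and A B C :: 'o and f g h :: 'a
  assumes "triangulated_category S"
    and "full_strong_exceptional S [A, B, C]"
    and "hom_line S A B f"
    and "hom_line S B C g"
    and "hom_line S A C h"
    and "h = g \<cdot>\<^bsub>S\<^esub> f"
    and "h \<noteq> zer S A C"
    and "triangulated_category T"
  shows "(\<exists>X. good_octahedron S X \<and>
            oA X = A \<and> oB X = B \<and> oC X = C \<and> mf X = f \<and> mg X = g \<and> mh X = h) \<and>
         (\<forall>X. good_octahedron S X \<and>
            oA X = A \<and> oB X = B \<and> oC X = C \<and> mf X = f \<and> mg X = g \<and> mh X = h \<longrightarrow>
            bij_betw (eval_octa T X) (Ht S T) (good_octa_classes T))"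
proof -
  interpret S: triangulated_category S by fact
  define E where "E = (!) [A, B, C]"
  have E: "E 0 = A" "E 1 = B" "E (Suc 0) = B" "E 2 = C" unfolding E_def by simp_all
  have len: "length [A, B, C] = 3" by simp
  note ex = assms(2)[unfolded full_strong_exceptional_def len, folded E_def]
  have en: "\<exists>u. hom_line S (E i) (E i) u" if "i < 3" for i
    using ex that by blast
  have van: "hom S (E i) (shift_ob S m (E j)) = {zer S (E i) (shift_ob S m (E j))}"
    if "i < 3" "j < 3" "m \<noteq> 0 \<or> j < i" for i j m
    using ex that by (metis not_less)
  have env: "ob S = tri_envelope S {A, B, C}" using assms(2) unfolding full_strong_exceptional_def by simp
  have lh: "S.line_hom (E i) (E j) 0 u" if u: "hom_line S (E i) (E j) u" and ij: "i < 3" "j < 3" for i j u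
  proof (rule S.line_hom_if_hom_line)
    show "hom_line S (E i) (shift_ob S 0 (E j)) u" using u by (simp add: shift_ob_def)
    show "hom S (E i) (shift_ob S m (E j)) = {zer S (E i) (shift_ob S m (E j))}" if "m \<noteq> 0" for m
      using van[OF ij] that by blast
  qed
  have nh: "S.no_hom (E i) (E j)" if ij: "i < 3" "j < i" for i j
  proof -
    have "u = zer S (E i) (shift_ob S m (E j))" if "arr S u" "dm S u = E i" "cd S u = shift_ob S m (E j)" for m u
    proof -
      have "u \<in> hom S (E i) (shift_ob S m (E j))" using that by simp
      moreover have "j < 3" using ij by simp
      ultimately show ?thesis using van[of i j m] ij by blast
    qed
    then show ?thesis unfolding S.no_hom_def by blast
  qed
  have id: "S.line_hom (E i) (E i) 0 (ide S (E i))" if "i < 3" for i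
    using en[OF that] lh[OF _ that that] S.line_hom_ide by blast
  have exc: "exceptional_octahedron S X"
    if "octahedron S X" "oA X = A" "oB X = B" "oC X = C" "mf X = f" "mg X = g" "mh X = h" for X
  proof -
    interpret X: octahedron_in S X using that(1) by unfold_locales
    show ?thesis
      by (rule X.exceptional_octahedronI; unfold that(2-7))
        (use id[of 0] id[of 1] id[of 2] lh[of 0 1 f] lh[of 1 2 g] lh[of 0 2 h] nh[of 1 0] nh[of 2 0]
            nh[of 2 1] assms(3-5) in \<open>simp_all add: E\<close>)
  qed
  have fg: "f \<in> hom S A B" "g \<in> hom S B C" "g \<cdot>\<^bsub>S\<^esub> f \<in> hom S A C" using assms(3-6) unfolding hom_line_def by blast+
  obtain D f' f'' where d1: "dist_triangle S A B D f f' f''" using S.TR1_cone[OF fg(1)] by blast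
  obtain F g' g'' where d2: "dist_triangle S B C F g g' g''" using S.TR1_cone[OF fg(2)] by blast
  obtain E h' h'' where d3: "dist_triangle S A C E (g \<cdot>\<^bsub>S\<^esub> f) h' h''" using S.TR1_cone[OF fg(3)] by blast
  obtain X where X: "octahedron S X" "oA X = A" "oB X = B" "oC X = C" "mf X = f" "mg X = g" "mh X = h"
    using S.TR4[OF d1 d2 d3] assms(6) by (metis octa.select_convs(1-3,7,10,13))
  have "good_octahedron S X" using exceptional_octahedron.good[OF exc[OF X]] .
  moreover have "bij_betw (eval_octa T X) (Ht S T) (good_octa_classes T)"
    if "good_octahedron S X" "oA X = A" "oB X = B" "oC X = C" "mf X = f" "mg X = g" "mh X = h" for X
  proof -
    have e: "exceptional_octahedron S X" using exc[OF S.good_octahedronD[OF that(1)] that(2-7)] .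
    show ?thesis
      by (rule eval_octa_bij[OF assms(1,8) e exceptional_octahedron.decomposable_all[OF e]]) (use env that in simp_all)
  qed
  ultimately show ?thesis using X by blast
qed

end
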